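(* Let $n=2m+1\ge5$ be odd and $P=P_n$ as in the context. Each character $\chi$ of $P$ can be written uniquely as $\chi={}^1\chi+{}^0\chi+{}^+\chi+{}^-\chi$, where ${}^\varepsilon\chi$ is the sum of the constituents of $\chi$ of Type $\varepsilon\in\{1,0,+,-\}$, and each ${}^\varepsilon\chi$ is of the form ${}^\varepsilon\psi_{\vartheta^\varepsilon}$ for some (not necessarily irreducible, possibly zero) character $\vartheta^\varepsilon$. For odd $q$ set $$M:=\begin{bmatrix}1&q^{2m-2}-1&\frac{q^{m-1}}2(q^{m-1}+1)(q-1)&\frac{q^{m-1}}2(q^{m-1}-1)(q-1)\\1&-1&\frac{q^{m-1}}2(q-1)&-\frac{q^{m-1}}2(q-1)\\1&q^{m-1}-1&-q^{m-1}&0\\1&-(q^{m-1}+1)&0&q^{m-1}\end{bmatrix}$$ and for even $q$ set $$M:=\begin{bmatrix}1&q^{2m-2}-1&\frac{q^{m-1}}2(q^{m-1}+1)(q-1)&\frac{q^{m-1}}2(q^{m-1}-1)(q-1)\\1&-1&\frac{q^{m-1}}2(q-1)&-\frac{q^{m-1}}2(q-1)\\1&q^{2m-2}-1&-\frac{q^{m-1}}2(q^{m-1}+1)&-\frac{q^{m-1}}2(q^{m-1}-1)\\1&-1&-\frac{q^{m-1}}2&\frac{q^{m-1}}2\end{bmatrix}.$$ Then $\det(M)=q^{4m-2}\ne0$ for odd $q$, $\det(M)=\frac12q^{5m-3}\ne0$ for even $q$, and for all $q$ $$\begin{bmatrix}\vartheta^1(1)\\\vartheta^0(1)\\\vartheta^+(1)\\\vartheta^-(1)\end{bmatrix}=M^{-1}\begin{bmatrix}\chi(1)\\\chi(\mathbf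 z_0)\\\chi(\mathbf z_1)\\\chi(\mathbf z_2)\end{bmatrix}.$$
   Context: **Groups.** $q$ is a prime power. For odd $k=2l+1$, vectors in $\mathbb F_q^k$ are $\mathbf v=[v_l,\dots,v_1,v_0,v_1',\dots,v_l']^{\mathrm{tr}}$ with standard basis $e_l,\dots,e_0,\dots,e_l'$; $Q_k(\mathbf v)=v_0^2+\sum_{j=1}^l v_jv_j'$ and $J_k'$ is the Gram matrix of its polar form $Q_k(\mathbf v+\mathbf v')-Q_k(\mathbf v)-Q_k(\mathbf v')$. Fix $\nu\in\mathbb F_q$ with $X^2+X+\nu$ irreducible over $\mathbb{F}_q$. For $\mathbf w=[w_l,\dots,w_1,w_1',\dots,w_l']^{\mathrm{tr}}\in\mathbb F_q^{2l}$ put $Q_{2l}^+(\mathbf w)=\sum_{j=1}^l w_jw_j'$, $Q_{2l}^-(\mathbf w)=w_1^2+w_1w_1'+\nu w_1'^2+\sum_{j=2}^l w_jw_j'$. $\mathrm{GO}_{2l}^\pm(q)$ is the isometry group of $Q_{2l}^\pm$; $\mathrm{SO}_k(q)$ is the group of isometries of $Q_k$ of determinant 1. For odd $n=2m+1\ge3$, $\mathbf x\in\mathrm{SO}_{n-2}(q)$, $a\in\mathbb F_q^\times$, $\mathbf v\in\mathbb F_q^{n-2}$ let $$\mathbf s_n(\mathbf x,a)=\begin{bmatrix}a&&\\&\mathbf x&\\&&a^{-1}\end{bmatrix},\quad\mathbf u_n(\mathbf v)=\begin{bmatrix}1&-\mathbf v^{\mathrm{tr}}J'_{n-2}&-Q_{n-2}(\mathbf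 v)\\&I_{n-2}&\mathbf v\\&&1\end{bmatrix}.$$ $P_n=U_n\rtimes L_n$ is the stabilizer of $\langle e_m\rangle$ in $\mathrm{SO}_n(q)$, $U_n=\{\mathbf u_n(\mathbf v)\}$, $L_n=\{\mathbf s_n(\mathbf x,a)\}$. **Characters of $P_n$, $n\ge5$.** Fix a non-trivial irreducible character $\xi$ of $(\mathbb F_q,+)$. Let $Q_k'(\mathbf v)=v_0^2+v_1^2+v_1v_1'+\nu v_1'^2+\sum_{j=2}^lv_jv_j'$ ($k=2l+1\ge 3$), and fix $\nu'\in\mathbb F_q^\times$, $\mathbf b_3'\in\mathrm{GL}_3(q)$, independent of $k$, such that $\mathbf b_k=\mathrm{diag}(\nu'I_{l-1},\mathbf b_3',I_{l-1})$ satisfies $Q_k'(\mathbf b_k\mathbf v)=\nu'Q_k(\mathbf v)$ for all $\mathbf v$. Put $\lambda^0(\mathbf u_n(\mathbf v))=\xi(v_{m-1}')$, $\lambda^+(\mathbf u_n(\mathbf v))=\xi(v_0)$, $\lambda^-(\mathbf u_n(\mathbf v))=\xi((\mathbf b_{n-2}\mathbf v)_0)$ (subscript 0: middle coordinate). Their inertia groups in $P_n$ are $I^0=U_n\tilde P_{n-2}$, $I^\pm=U_nL_n^\pm$ with $\tilde P_{n-2}=\{\mathbf s_n(\mathbf x,a)\mid\mathbf x\in P_{n-2},\ \mathbf xe_{m-1}=ae_{m-1}\}$, $$L_n^+=\Big\{\mathbf s_n\Big(\begin{bmatrix}A&.&B\\.&a&.\\C&.&D\end{bmatrix},a\Big)\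 \Big|\ \begin{bmatrix}A&B\\C&D\end{bmatrix}\in\mathrm{GO}_{n-3}^+(q),\ a=\det\begin{bmatrix}A&B\\C&D\end{bmatrix}\Big\},$$ $$L_n^-=\Big\{\mathbf s_n\Big(\mathbf b_{n-2}^{-1}\begin{bmatrix}A&.&B\\.&a&.\\C&.&D\end{bmatrix}\mathbf b_{n-2},a\Big)\ \Big|\ \begin{bmatrix}A&B\\C&D\end{bmatrix}\in\mathrm{GO}_{n-3}^-(q),\ a=\det\begin{bmatrix}A&B\\C&D\end{bmatrix}\Big\}.$$ Let $\hat\lambda^\varepsilon$ be the extension of $\lambda^\varepsilon$ to $I^\varepsilon$ that is trivial on $\tilde P_{n-2}$, resp. $L_n^\pm$. The irreducible characters of $P_n$ are ($\uparrow$ denoting induction): Type $1$ (those with $U_n$ in the kernel): ${}^1\psi_\sigma=\mathrm{Infl}_{L_n}^{P_n}\sigma$, $\sigma\in\mathrm{Irr}(L_n)$; Type $0$ (those covering $\lambda^0$): ${}^0\psi_\mu=(\hat\lambda^0\cdot\mathrm{Infl}_{\tilde P_{n-2}}^{I^0}\tilde\mu)\uparrow_{I^0}^{P_n}$, $\mu\in\mathrm{Irr}(P_{n-2})$, where $\tilde\mu(\mathbf s_n(\mathbf x,a))=\mu(\mathbf x)$; Type $\pm$ (those covering $\lambda^\pm$): ${}^\pm\psi_\vartheta=(\hat\lambda^\pm\cdot\mathrm{Infl}_{L_n^\pm}^{I^\pm}\vartheta)\uparrow_{I^\pm}^{P_n}$, $\vartheta\in\mathrm{Irr}(L_n^\pm)$.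 The notation is extended additively to arbitrary characters. **Unipotent elements.** $\mathbf z_0=\mathbf u_n(e_{m-1})$, $\mathbf z_1=\mathbf u_n(e_0)$, $\mathbf z_2=\mathbf u_n(e_{m-1}+\nu''e_{m-1}')$, where $e_{m-1},\dots,e_0,\dots,e_{m-1}'$ is the standard basis of $\mathbb F_q^{n-2}$ and $\nu''\in\mathbb F_q^\times$ is a fixed non-square if $q$ is odd and $\nu''=1$ if $q$ is even. *)

theory Defs
  imports
    "Jordan_Normal_Form.VS_Connect"
    "Jordan_Normal_Form.Gauss_Jordan_Elimination"
    "HOL-Library.Cardinality"
    "HOL-Algebra.Coset"
    "HOL-Computational_Algebra.Polynomial_Factorial"
begin

section \<open>Complex characters of finite groups\<close>

definition GL :: "nat \<Rightarrow> 'a::field mat monoid" where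
  "GL d = units_of (ring_mat TYPE('a) d ())"

definition mat_trace :: "'a::comm_monoid_add mat \<Rightarrow> 'a" where
  "mat_trace A = (\<Sum>i<dim_row A. A $$ (i, i))"

definition representation :: "'g monoid \<Rightarrow> nat \<Rightarrow> ('g \<Rightarrow> complex mat) \<Rightarrow> bool" where
  "representation G d \<rho> \<longleftrightarrow> \<rho> \<in> hom G (GL d)"

definition irreducible_rep :: "'g monoid \<Rightarrow> nat \<Rightarrow> ('g \<Rightarrow> complex mat) \<Rightarrow> bool" where
  "irreducible_rep G d \<rho> \<longleftrightarrow> representation G d \<rho> \<and> d \<noteq> 0 \<and>
     (\<forall>W. VectorSpace.subspace class_ring W (module_vec TYPE(complex) d) \<longrightarrow>
          (\<forall>g\<in>carrier G. \<forall>w\<in>W. \<rho> g *\<^sub>v w \<in> W) \<longrightarrow>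
          W = {0\<^sub>v d} \<or> W = carrier_vec d)"

text \<open>A character is stored as a function on the whole ambient type that vanishes outside the
  group, so that equality of characters is equality of functions.  Degree \<open>d = 0\<close> is allowed:
  it affords the zero character.\<close>

definition afforded :: "'g monoid \<Rightarrow> ('g \<Rightarrow> complex mat) \<Rightarrow> 'g \<Rightarrow> complex" where
  "afforded G \<rho> g = (if g \<in> carrier G then mat_trace (\<rho> g) else 0)"

definition is_character :: "'g monoid \<Rightarrow> ('g \<Rightarrow> complex) \<Rightarrow> bool" where
  "is_character G \<chi> \<longleftrightarrow> (\<exists>d \<rho>. representation G d \<rho> \<and> \<chi> = afforded G \<rho>)"

definition Irr :: "'g monoid \<Rightarrow> ('g \<Rightarrow> complex) set" where
  "Irr G = {\<chi>. \<exists>d \<rho>. irreducible_rep G d \<rho> \<and> \<chi> = afforded G \<rho>}"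

definition char_inner :: "'g set \<Rightarrow> ('g \<Rightarrow> complex) \<Rightarrow> ('g \<Rightarrow> complex) \<Rightarrow> complex" where
  "char_inner H \<phi> \<psi> = (\<Sum>g\<in>H. \<phi> g * cnj (\<psi> g)) / of_nat (card H)"

definition constituents :: "'g monoid \<Rightarrow> ('g \<Rightarrow> complex) \<Rightarrow> ('g \<Rightarrow> complex) set" where
  "constituents G \<chi> = {\<psi> \<in> Irr G. char_inner (carrier G) \<chi> \<psi> \<noteq> 0}"

text \<open>The sum, with multiplicities, of the constituents of \<open>\<chi>\<close> lying in \<open>T\<close>.\<close>

definition constituent_sum ::
    "'g monoid \<Rightarrow> ('g \<Rightarrow> complex) set \<Rightarrow> ('g \<Rightarrow> complex) \<Rightarrow> 'g \<Rightarrow> complex" where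
  "constituent_sum G T \<chi> g =
     (\<Sum>\<psi>\<in>constituents G \<chi> \<inter> T. char_inner (carrier G) \<chi> \<psi> * \<psi> g)"

definition induced :: "'g monoid \<Rightarrow> 'g set \<Rightarrow> ('g \<Rightarrow> complex) \<Rightarrow> 'g \<Rightarrow> complex" where
  "induced G H \<phi> g = (if g \<in> carrier G then
     (\<Sum>x\<in>carrier G. if inv\<^bsub>G\<^esub> x \<otimes>\<^bsub>G\<^esub> g \<otimes>\<^bsub>G\<^esub> x \<in> H
                    then \<phi> (inv\<^bsub>G\<^esub> x \<otimes>\<^bsub>G\<^esub> g \<otimes>\<^bsub>G\<^esub> x) else 0) / of_nat (card H)
     else 0)"

text \<open>For a semidirect product \<open>U K\<close> inside \<open>G\<close> with \<open>U\<close> normal: \<open>inflated\<close> is inflation along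
  \<open>U K \<rightarrow> K\<close>, and \<open>extended\<close> is the extension of a linear character of \<open>U\<close> to \<open>U K\<close> that is trivial
  on \<open>K\<close>.\<close>

definition inflated :: "'g monoid \<Rightarrow> 'g set \<Rightarrow> 'g set \<Rightarrow> ('g \<Rightarrow> complex) \<Rightarrow> 'g \<Rightarrow> complex" where
  "inflated G U K \<sigma> g = (if g \<in> U <#>\<^bsub>G\<^esub> K
     then \<sigma> (THE k. k \<in> K \<and> (\<exists>u\<in>U. g = u \<otimes>\<^bsub>G\<^esub> k)) else 0)"

definition extended :: "'g monoid \<Rightarrow> 'g set \<Rightarrow> 'g set \<Rightarrow> ('g \<Rightarrow> complex) \<Rightarrow> 'g \<Rightarrow> complex" where
  "extended G U K \<kappa> g = (if g \<in> U <#>\<^bsub>G\<^esub> K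
     then \<kappa> (THE u. u \<in> U \<and> (\<exists>k\<in>K. g = u \<otimes>\<^bsub>G\<^esub> k)) else 0)"

definition additive_group :: "'a::monoid_add monoid" where
  "additive_group = \<lparr>carrier = UNIV, mult = (+), one = 0\<rparr>"

section \<open>Quadratic forms and orthogonal groups\<close>

text \<open>Odd-dimensional objects are indexed by the rank \<open>l\<close>, the dimension being \<open>2 * l + 1\<close>.
  Positions count from \<open>0\<close>: in dimension \<open>2 * l + 1\<close> the coordinates \<open>v\<^sub>j, v\<^sub>0, v'\<^sub>j\<close> sit at
  positions \<open>l - j\<close>, \<open>l\<close>, \<open>l + j\<close>; in dimension \<open>2 * l\<close> the coordinates \<open>w\<^sub>j, w'\<^sub>j\<close> sit at
  \<open>l - j\<close> and \<open>l + j - 1\<close>.\<close>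

definition Q_odd :: "nat \<Rightarrow> 'a::field vec \<Rightarrow> 'a" where
  "Q_odd l v = (v $ l)\<^sup>2 + (\<Sum>j=1..l. v $ (l - j) * v $ (l + j))"

definition Q_odd' :: "'a::field \<Rightarrow> nat \<Rightarrow> 'a vec \<Rightarrow> 'a" where
  "Q_odd' \<nu> l v = (v $ l)\<^sup>2 + (v $ (l - 1))\<^sup>2 + v $ (l - 1) * v $ (l + 1) + \<nu> * (v $ (l + 1))\<^sup>2
     + (\<Sum>j=2..l. v $ (l - j) * v $ (l + j))"

definition Q_plus :: "nat \<Rightarrow> 'a::field vec \<Rightarrow> 'a" where
  "Q_plus l w = (\<Sum>j=1..l. w $ (l - j) * w $ (l + j - 1))"

definition Q_minus :: "'a::field \<Rightarrow> nat \<Rightarrow> 'a vec \<Rightarrow> 'a" where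
  "Q_minus \<nu> l w = (w $ (l - 1))\<^sup>2 + w $ (l - 1) * w $ l + \<nu> * (w $ l)\<^sup>2
     + (\<Sum>j=2..l. w $ (l - j) * w $ (l + j - 1))"

definition polar_form :: "nat \<Rightarrow> 'a::field vec \<Rightarrow> 'a vec \<Rightarrow> 'a" where
  "polar_form l v w = Q_odd l (v + w) - Q_odd l v - Q_odd l w"

definition gram_J :: "nat \<Rightarrow> 'a::field mat" where
  "gram_J l = mat (2 * l + 1) (2 * l + 1)
     (\<lambda>(i, j). polar_form l (unit_vec (2 * l + 1) i) (unit_vec (2 * l + 1) j))"

definition SO_odd :: "nat \<Rightarrow> 'a::field mat set" where
  "SO_odd l = {g \<in> carrier (GL (2 * l + 1)).
     (\<forall>v\<in>carrier_vec (2 * l + 1). Q_odd l (g *\<^sub>v v) = Q_odd l v) \<and> det g = 1}"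

definition GO_plus :: "nat \<Rightarrow> 'a::field mat set" where
  "GO_plus l = {g \<in> carrier (GL (2 * l)). \<forall>w\<in>carrier_vec (2 * l). Q_plus l (g *\<^sub>v w) = Q_plus l w}"

definition GO_minus :: "'a::field \<Rightarrow> nat \<Rightarrow> 'a mat set" where
  "GO_minus \<nu> l =
     {g \<in> carrier (GL (2 * l)). \<forall>w\<in>carrier_vec (2 * l). Q_minus \<nu> l (g *\<^sub>v w) = Q_minus \<nu> l w}"

text \<open>For \<open>n = 2 * m + 1\<close>, \<open>s_mat x a\<close> is \<open>s\<^sub>n(x, a)\<close> and \<open>u_mat m v\<close> is \<open>u\<^sub>n(v)\<close>, with \<open>v\<close> of
  dimension \<open>n - 2 = 2 * (m - 1) + 1\<close>.\<close>

definition s_mat :: "'a::field mat \<Rightarrow> 'a \<Rightarrow> 'a mat" where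
  "s_mat x a = diag_block_mat [mat 1 1 (\<lambda>_. a), x, mat 1 1 (\<lambda>_. inverse a)]"

definition u_mat :: "nat \<Rightarrow> 'a::field vec \<Rightarrow> 'a mat" where
  "u_mat m v = mat (2 * m + 1) (2 * m + 1) (\<lambda>(i, j).
     if i = j then 1
     else if i = 0 \<and> j = 2 * m then - Q_odd (m - 1) v
     else if i = 0 then - (v \<bullet> col (gram_J (m - 1)) (j - 1))
     else if j = 2 * m then v $ (i - 1)
     else 0)"

definition U_grp :: "nat \<Rightarrow> 'a::field mat set" where
  "U_grp m = u_mat m ` carrier_vec (2 * (m - 1) + 1)"

definition L_grp :: "nat \<Rightarrow> 'a::field mat set" where
  "L_grp m = {s_mat x a | x a. x \<in> SO_odd (m - 1) \<and> a \<noteq> 0}"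

definition P_set :: "nat \<Rightarrow> 'a::field mat set" where
  "P_set m = {g \<in> SO_odd m. \<exists>c. g *\<^sub>v unit_vec (2 * m + 1) 0 = c \<cdot>\<^sub>v unit_vec (2 * m + 1) 0}"

definition mat_group :: "nat \<Rightarrow> 'a::field mat set \<Rightarrow> 'a mat monoid" where
  "mat_group d H = (GL d)\<lparr>carrier := H\<rparr>"

definition P_grp :: "nat \<Rightarrow> 'a::field mat monoid" where
  "P_grp m = mat_group (2 * m + 1) (P_set m)"

section \<open>The characters of the parabolic subgroup\<close>

definition b_mat :: "'a::field \<Rightarrow> 'a mat \<Rightarrow> nat \<Rightarrow> 'a mat" where
  "b_mat \<nu>' b3 l = diag_block_mat [\<nu>' \<cdot>\<^sub>m 1\<^sub>m (l - 1), b3, 1\<^sub>m (l - 1)]"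

text \<open>The matrix with rows \<open>[A, 0, B]\<close>, \<open>[0, a, 0]\<close>, \<open>[C, 0, D]\<close>, where \<open>g\<close> has the \<open>l \<times> l\<close>
  blocks \<open>A, B, C, D\<close>.\<close>

definition insert_middle :: "nat \<Rightarrow> 'a::field mat \<Rightarrow> 'a \<Rightarrow> 'a mat" where
  "insert_middle l g a = mat (2 * l + 1) (2 * l + 1) (\<lambda>(i, j).
     if i = l \<and> j = l then a
     else if i = l \<or> j = l then 0
     else g $$ (delete_index l i, delete_index l j))"

definition P_tilde :: "nat \<Rightarrow> 'a::field mat set" where
  "P_tilde m = {s_mat x a | x a. a \<noteq> 0 \<and> x \<in> P_set (m - 1) \<and>
     x *\<^sub>v unit_vec (2 * (m - 1) + 1) 0 = a \<cdot>\<^sub>v unit_vec (2 * (m - 1) + 1) 0}"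

definition L_plus :: "nat \<Rightarrow> 'a::field mat set" where
  "L_plus m = {s_mat (insert_middle (m - 1) g (det g)) (det g) | g. g \<in> GO_plus (m - 1)}"

definition L_minus :: "'a::field \<Rightarrow> 'a \<Rightarrow> 'a mat \<Rightarrow> nat \<Rightarrow> 'a mat set" where
  "L_minus \<nu> \<nu>' b3 m =
     {s_mat (inv\<^bsub>GL (2 * (m - 1) + 1)\<^esub> (b_mat \<nu>' b3 (m - 1)) * insert_middle (m - 1) g (det g)
               * b_mat \<nu>' b3 (m - 1)) (det g)
      | g. g \<in> GO_minus \<nu> (m - 1)}"

datatype char_type = Type1 | Type0 | TypePlus | TypeMinus

text \<open>The linear character \<open>u\<^sub>n(v) \<mapsto> \<xi> (f v)\<close> of \<open>U\<^sub>n\<close>, and the functional \<open>f\<close> of each type.\<close>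

definition U_char :: "nat \<Rightarrow> ('a::field \<Rightarrow> complex) \<Rightarrow> ('a vec \<Rightarrow> 'a) \<Rightarrow> 'a mat \<Rightarrow> complex" where
  "U_char m \<xi> f g = (if g \<in> U_grp m
     then \<xi> (f (THE v. v \<in> carrier_vec (2 * (m - 1) + 1) \<and> g = u_mat m v)) else 0)"

definition lambda_zero :: "nat \<Rightarrow> ('a::field \<Rightarrow> complex) \<Rightarrow> 'a mat \<Rightarrow> complex" where
  "lambda_zero m \<xi> = U_char m \<xi> (\<lambda>v. v $ (2 * (m - 1)))"

definition lambda_plus :: "nat \<Rightarrow> ('a::field \<Rightarrow> complex) \<Rightarrow> 'a mat \<Rightarrow> complex" where
  "lambda_plus m \<xi> = U_char m \<xi> (\<lambda>v. v $ (m - 1))"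

definition lambda_minus ::
    "'a::field \<Rightarrow> 'a mat \<Rightarrow> nat \<Rightarrow> ('a \<Rightarrow> complex) \<Rightarrow> 'a mat \<Rightarrow> complex" where
  "lambda_minus \<nu>' b3 m \<xi> = U_char m \<xi> (\<lambda>v. (b_mat \<nu>' b3 (m - 1) *\<^sub>v v) $ (m - 1))"

text \<open>Type \<open>1\<close>: \<open>U\<^sub>n\<close> is in the kernel; the other types: the character covers the respective
  \<open>\<lambda>\<close>, that is, its restriction to \<open>U\<^sub>n\<close> has \<open>\<lambda>\<close> as a constituent.\<close>

fun type_set ::
    "'a::field \<Rightarrow> 'a mat \<Rightarrow> nat \<Rightarrow> ('a \<Rightarrow> complex) \<Rightarrow> char_type \<Rightarrow> ('a mat \<Rightarrow> complex) set" where
  "type_set \<nu>' b3 m \<xi> Type1 = {\<psi> \<in> Irr (P_grp m). \<forall>u\<in>U_grp m. \<psi> u = \<psi> \<one>\<^bsub>P_grp m\<^esub>}"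
| "type_set \<nu>' b3 m \<xi> Type0 =
     {\<psi> \<in> Irr (P_grp m). char_inner (U_grp m) \<psi> (lambda_zero m \<xi>) \<noteq> 0}"
| "type_set \<nu>' b3 m \<xi> TypePlus =
     {\<psi> \<in> Irr (P_grp m). char_inner (U_grp m) \<psi> (lambda_plus m \<xi>) \<noteq> 0}"
| "type_set \<nu>' b3 m \<xi> TypeMinus =
     {\<psi> \<in> Irr (P_grp m). char_inner (U_grp m) \<psi> (lambda_minus \<nu>' b3 m \<xi>) \<noteq> 0}"

text \<open>The group whose characters label the characters of each type.\<close>

fun label_grp :: "'a::field \<Rightarrow> 'a \<Rightarrow> 'a mat \<Rightarrow> nat \<Rightarrow> char_type \<Rightarrow> 'a mat monoid" where
  "label_grp \<nu> \<nu>' b3 m Type1 = mat_group (2 * m + 1) (L_grp m)"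
| "label_grp \<nu> \<nu>' b3 m Type0 = P_grp (m - 1)"
| "label_grp \<nu> \<nu>' b3 m TypePlus = mat_group (2 * m + 1) (L_plus m)"
| "label_grp \<nu> \<nu>' b3 m TypeMinus = mat_group (2 * m + 1) (L_minus \<nu> \<nu>' b3 m)"

text \<open>The middle block of \<open>s\<^sub>n(x, a)\<close> is \<open>x\<close>, so this is \<open>s\<^sub>n(x, a) \<mapsto> \<mu> x\<close>.\<close>

definition mu_tilde :: "nat \<Rightarrow> ('a::field mat \<Rightarrow> complex) \<Rightarrow> 'a mat \<Rightarrow> complex" where
  "mu_tilde m \<mu> g = (if g \<in> P_tilde m
     then \<mu> (mat (2 * (m - 1) + 1) (2 * (m - 1) + 1) (\<lambda>(i, j). g $$ (i + 1, j + 1))) else 0)"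

text \<open>Induction to \<open>P\<^sub>n\<close> of the product of the trivial extension of \<open>\<kappa>\<close> with the inflation of
  \<open>\<theta>\<close>, from \<open>U\<^sub>n K\<close>.\<close>

definition induce_from ::
    "nat \<Rightarrow> 'a::field mat set \<Rightarrow> ('a mat \<Rightarrow> complex) \<Rightarrow> ('a mat \<Rightarrow> complex) \<Rightarrow> 'a mat \<Rightarrow> complex" where
  "induce_from m K \<kappa> \<theta> = induced (P_grp m) (U_grp m <#>\<^bsub>P_grp m\<^esub> K)
     (\<lambda>g. extended (P_grp m) (U_grp m) K \<kappa> g * inflated (P_grp m) (U_grp m) K \<theta> g)"

text \<open>The formulas are additive in \<open>\<theta>\<close>, so applying them to an arbitrary character of the label
  group gives the additive extension of the labelling of irreducible characters.\<close>

fun psi :: "'a::field \<Rightarrow> 'a \<Rightarrow> 'a mat \<Rightarrow> nat \<Rightarrow> ('a \<Rightarrow> complex) \<Rightarrow> char_type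
    \<Rightarrow> ('a mat \<Rightarrow> complex) \<Rightarrow> 'a mat \<Rightarrow> complex" where
  "psi \<nu> \<nu>' b3 m \<xi> Type1 \<theta> = inflated (P_grp m) (U_grp m) (L_grp m) \<theta>"
| "psi \<nu> \<nu>' b3 m \<xi> Type0 \<theta> = induce_from m (P_tilde m) (lambda_zero m \<xi>) (mu_tilde m \<theta>)"
| "psi \<nu> \<nu>' b3 m \<xi> TypePlus \<theta> = induce_from m (L_plus m) (lambda_plus m \<xi>) \<theta>"
| "psi \<nu> \<nu>' b3 m \<xi> TypeMinus \<theta> =
     induce_from m (L_minus \<nu> \<nu>' b3 m) (lambda_minus \<nu>' b3 m \<xi>) \<theta>"

section \<open>Unipotent elements and the matrix of values\<close>

definition z_zero :: "nat \<Rightarrow> 'a::field mat" where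
  "z_zero m = u_mat m (unit_vec (2 * (m - 1) + 1) 0)"

definition z_one :: "nat \<Rightarrow> 'a::field mat" where
  "z_one m = u_mat m (unit_vec (2 * (m - 1) + 1) (m - 1))"

definition z_two :: "'a::field \<Rightarrow> nat \<Rightarrow> 'a mat" where
  "z_two \<nu>'' m = u_mat m (unit_vec (2 * (m - 1) + 1) 0
     + \<nu>'' \<cdot>\<^sub>v unit_vec (2 * (m - 1) + 1) (2 * (m - 1)))"

definition M_odd :: "complex \<Rightarrow> nat \<Rightarrow> complex mat" where
  "M_odd q m = mat_of_rows_list 4
    [[1, q ^ (2 * m - 2) - 1, q ^ (m - 1) / 2 * (q ^ (m - 1) + 1) * (q - 1),
                              q ^ (m - 1) / 2 * (q ^ (m - 1) - 1) * (q - 1)],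
     [1, - 1, q ^ (m - 1) / 2 * (q - 1), - (q ^ (m - 1) / 2 * (q - 1))],
     [1, q ^ (m - 1) - 1, - (q ^ (m - 1)), 0],
     [1, - (q ^ (m - 1) + 1), 0, q ^ (m - 1)]]"

definition M_even :: "complex \<Rightarrow> nat \<Rightarrow> complex mat" where
  "M_even q m = mat_of_rows_list 4
    [[1, q ^ (2 * m - 2) - 1, q ^ (m - 1) / 2 * (q ^ (m - 1) + 1) * (q - 1),
                              q ^ (m - 1) / 2 * (q ^ (m - 1) - 1) * (q - 1)],
     [1, - 1, q ^ (m - 1) / 2 * (q - 1), - (q ^ (m - 1) / 2 * (q - 1))],
     [1, q ^ (2 * m - 2) - 1, - (q ^ (m - 1) / 2 * (q ^ (m - 1) + 1)),
                              - (q ^ (m - 1) / 2 * (q ^ (m - 1) - 1))],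
     [1, - 1, - (q ^ (m - 1) / 2), q ^ (m - 1) / 2]]"

definition value_matrix :: "nat \<Rightarrow> nat \<Rightarrow> complex mat" where
  "value_matrix q m = (if odd q then M_odd (of_nat q) m else M_even (of_nat q) m)"

end

theory Submission
  imports Defs "HOL-Computational_Algebra.Fundamental_Theorem_Algebra" "Jordan_Normal_Form.Char_Poly"
begin

text \<open>
  Clifford theory over the abelian normal subgroup \<open>U\<close> of \<open>P\<close>: the characters of \<open>U\<close> are
  \<open>u(v) \<mapsto> \<xi> (c \<bullet> v)\<close>, and conjugation by \<open>s(x, a)\<close> acts on the functionals \<open>c\<close> through \<open>a\<close> and \<open>x\<close>.
  Uniformly in the characteristic, the orbit of a nonzero functional is determined by the number of roots
  \<open>t\<close> of \<open>t\<^sup>2 + c\<^sub>0 t = \<Sum>\<^sub>j c\<^sub>j c'\<^sub>j\<close>: one root for type \<open>0\<close>, two for type \<open>+\<close>, none for type \<open>-\<close>.  Orbits are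
  joined by reducing functionals to a normal form and separated by counting the singular vectors in their kernels.
  If the constituents of \<open>\<chi>\<close> all lie over one orbit, let \<open>e\<close> be the idempotent of \<open>\<complex>[U]\<close> belonging to a member
  of the orbit; its inertia complement \<open>K\<close> acts on the image of \<open>e\<close> with character \<open>\<theta>(k) = tr (\<rho>(k) e)\<close>, and \<open>\<chi>\<close>
  is induced from \<open>\<theta>\<close>, without any irreducibility assumption.  Its value at \<open>u \<in> U\<close> is \<open>\<theta>(1)\<close> times the sum of
  the orbit at \<open>u\<close>, so the columns of the matrix are orbit sums.  These are read off from the sums over all functionals
  weighted by \<open>1\<close>, by the number of roots, and by having exactly one root.
\<close>

section \<open>Matrix sums and idempotents\<close>

text \<open>The quadratic that decides the type has a simple origin. In odd characteristic the polar
  form identifies a functional with a vector w, and 4 Q(w) is the discriminant of that quadratic: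
  one root means Q(w) = 0, two roots or none that Q(w) is a nonzero square or a nonsquare. In
  characteristic 2 the polar form has a radical, and functionals with nonzero middle coordinate come
  from no vector; the quadratic survives, with Artin-Schreier theory in place of squares. Hence all
  arguments are made with functionals. The price is that the number of roots is not visibly
  invariant under isometries. It is checked for a few explicit ones, enough for reduction to normal
  forms without an extension theorem of Witt type; full invariance comes from the singular count,
  which is invariant by definition. The zero functional also has one root but is an orbit of its
  own, type 1: hence the -1 in each entry of the second column of the matrix. All constituents of
  one type are treated together, so the four degrees are the only unknowns in the values on
  \<open>U\<close>.\<close>

definition msum :: "nat \<Rightarrow> nat \<Rightarrow> ('i \<Rightarrow> 'a::comm_monoid_add mat) \<Rightarrow> 'i set \<Rightarrow> 'a mat" where
  "msum n m f A = mat n m (\<lambda>ij. \<Sum>x\<in>A. f x $$ ij)"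

lemma msum_carrier [simp]: "msum n m f A \<in> carrier_mat n m"
  and msum_dim [simp]: "dim_row (msum n m f A) = n" "dim_col (msum n m f A) = m"
  by (auto simp: msum_def)

lemma msum_index [simp]: "i < n \<Longrightarrow> j < m \<Longrightarrow> msum n m f A $$ (i, j) = (\<Sum>x\<in>A. f x $$ (i, j))"
  by (simp add: msum_def)

lemma mult_mat_index:
  assumes "A \<in> carrier_mat n m" "B \<in> carrier_mat m p" "i < n" "j < p"
  shows "(A * B) $$ (i, j) = (\<Sum>k<m. A $$ (i, k) * B $$ (k, j))"
  using assms by (auto simp: scalar_prod_def atLeast0LessThan)

lemma mult_vec_index:
  assumes "A \<in> carrier_mat n m" "v \<in> carrier_vec m" "i < n"
  shows "(A *\<^sub>v v) $ i = (\<Sum>k<m. A $$ (i, k) * v $ k)"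
  using assms by (auto simp: scalar_prod_def atLeast0LessThan)

lemma eq_mat_by_action:
  fixes A :: "'a::semiring_1 mat"
  assumes A: "A \<in> carrier_mat n m" and B: "B \<in> carrier_mat n m"
    and eq: "\<And>v. v \<in> carrier_vec m \<Longrightarrow> A *\<^sub>v v = B *\<^sub>v v"
  shows "A = B"
proof (rule eq_matI)
  fix i j assume "i < dim_row B" "j < dim_col B"
  then have ij: "i < n" "j < m" using B by auto
  have "A $$ (i, j) = (A *\<^sub>v unit_vec m j) $ i" if "A \<in> carrier_mat n m" for A :: "'a mat"
    unfolding mult_vec_index[OF that unit_vec_carrier ij(1)] using ij
    by (simp add: unit_vec_def if_distrib[of "\<lambda>z. _ * z"] sum.delta cong: if_cong)
  then show "A $$ (i, j) = B $$ (i, j)" using A B eq[of "unit_vec m j"] by simp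
qed (use A B in auto)

lemma mult_msum:
  fixes f :: "'i \<Rightarrow> 'a::semiring_0 mat"
  assumes B: "B \<in> carrier_mat p n" and f: "\<And>x. x \<in> A \<Longrightarrow> f x \<in> carrier_mat n m"
  shows "B * msum n m f A = msum p m (\<lambda>x. B * f x) A"
proof (rule eq_matI)
  fix i j assume "i < dim_row (msum p m (\<lambda>x. B * f x) A)" "j < dim_col (msum p m (\<lambda>x. B * f x) A)"
  then have ij: "i < p" "j < m" by auto
  have "(B * msum n m f A) $$ (i, j) = (\<Sum>k<n. \<Sum>x\<in>A. B $$ (i, k) * f x $$ (k, j))"
    by (simp only: mult_mat_index[OF B msum_carrier ij]) (simp add: ij sum_distrib_left)
  also have "\<dots> = (\<Sum>x\<in>A. \<Sum>k<n. B $$ (i, k) * f x $$ (k, j))" by (rule sum.swap)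
  also have "\<dots> = (\<Sum>x\<in>A. (B * f x) $$ (i, j))"
    by (intro sum.cong refl) (simp only: mult_mat_index[OF B f ij])
  finally show "(B * msum n m f A) $$ (i, j) = msum p m (\<lambda>x. B * f x) A $$ (i, j)" using ij by simp
qed (use B in auto)

lemma msum_mult:
  fixes f :: "'i \<Rightarrow> 'a::semiring_0 mat"
  assumes B: "B \<in> carrier_mat m p" and f: "\<And>x. x \<in> A \<Longrightarrow> f x \<in> carrier_mat n m"
  shows "msum n m f A * B = msum n p (\<lambda>x. f x * B) A"
proof (rule eq_matI)
  fix i j assume "i < dim_row (msum n p (\<lambda>x. f x * B) A)" "j < dim_col (msum n p (\<lambda>x. f x * B) A)"
  then have ij: "i < n" "j < p" by auto
  have "(msum n m f A * B) $$ (i, j) = (\<Sum>k<m. \<Sum>x\<in>A. f x $$ (i, k) * B $$ (k, j))"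
    by (simp only: mult_mat_index[OF msum_carrier B ij]) (simp add: ij sum_distrib_right)
  also have "\<dots> = (\<Sum>x\<in>A. \<Sum>k<m. f x $$ (i, k) * B $$ (k, j))" by (rule sum.swap)
  also have "\<dots> = (\<Sum>x\<in>A. (f x * B) $$ (i, j))"
    by (intro sum.cong refl) (simp only: mult_mat_index[OF f B ij])
  finally show "(msum n m f A * B) $$ (i, j) = msum n p (\<lambda>x. f x * B) A $$ (i, j)" using ij by simp
qed (use B in auto)

lemma msum_cong: "A = B \<Longrightarrow> (\<And>x. x \<in> B \<Longrightarrow> f x = g x) \<Longrightarrow> msum n m f A = msum n m g B"
  by (auto simp: msum_def intro!: eq_matI sum.cong)

lemma msum_reindex: "bij_betw h A B \<Longrightarrow> msum n m f B = msum n m (\<lambda>x. f (h x)) A"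
  by (auto simp: msum_def sum.reindex_bij_betw[symmetric] intro!: eq_matI)

lemma msum_swap: "msum n m (\<lambda>x. msum n m (f x) B) A = msum n m (\<lambda>y. msum n m (\<lambda>x. f x y) A) B"
  by (rule eq_matI) (auto intro: sum.swap)

lemma smult_msum:
  fixes f :: "'i \<Rightarrow> 'a::semiring_0 mat"
  assumes "\<And>x. x \<in> A \<Longrightarrow> f x \<in> carrier_mat n m"
  shows "c \<cdot>\<^sub>m msum n m f A = msum n m (\<lambda>x. c \<cdot>\<^sub>m f x) A"
  by (intro eq_matI) (auto simp: sum_distrib_left carrier_matD[OF assms] intro!: sum.cong)

lemma msum_smult_const:
  fixes M :: "'a::semiring_0 mat"
  assumes "M \<in> carrier_mat n m"
  shows "msum n m (\<lambda>x. c x \<cdot>\<^sub>m M) A = (\<Sum>x\<in>A. c x) \<cdot>\<^sub>m M"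
  using assms by (intro eq_matI) (auto simp: sum_distrib_right)

lemma msum_delta:
  fixes M :: "'a::semiring_1 mat"
  assumes "finite A" "a \<in> A" "f a \<in> carrier_mat n m"
    "\<And>x. x \<in> A \<Longrightarrow> x \<noteq> a \<Longrightarrow> f x = 0\<^sub>m n m"
  shows "msum n m f A = f a"
proof (rule eq_matI)
  fix i j assume "i < dim_row (f a)" "j < dim_col (f a)"
  then have ij: "i < n" "j < m" using assms by auto
  have "(\<Sum>x\<in>A. f x $$ (i, j)) = (\<Sum>x\<in>A. if x = a then f a $$ (i, j) else 0)"
    using assms ij by (intro sum.cong) auto
  then show "msum n m f A $$ (i, j) = f a $$ (i, j)" using ij assms by simp
qed (use assms in auto)

lemma msum_insert:
  assumes "finite A" "a \<notin> A" "f a \<in> carrier_mat n m"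
  shows "msum n m f (insert a A) = f a + msum n m f A"
  using assms by (intro eq_matI) auto

lemma msum_empty: "msum n m f {} = 0\<^sub>m n m"
  by (intro eq_matI) auto

lemma mat_trace_mult_comm:
  fixes A :: "'a::comm_semiring_0 mat"
  assumes A: "A \<in> carrier_mat n m" and B: "B \<in> carrier_mat m n"
  shows "mat_trace (A * B) = mat_trace (B * A)"
proof -
  have "mat_trace (A * B) = (\<Sum>i<n. \<Sum>k<m. A $$ (i, k) * B $$ (k, i))"
    using A unfolding mat_trace_def
    by (auto intro!: sum.cong simp only: mult_mat_index[OF A B] index_mult_mat(2) carrier_matD lessThan_iff)
  also have "\<dots> = (\<Sum>k<m. \<Sum>i<n. B $$ (k, i) * A $$ (i, k))"
    by (subst sum.swap) (simp add: mult.commute)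
  also have "\<dots> = mat_trace (B * A)"
    using B unfolding mat_trace_def
    by (auto intro!: sum.cong simp only: mult_mat_index[OF B A] index_mult_mat(2) carrier_matD lessThan_iff)
  finally show ?thesis .
qed

lemma mat_trace_msum: "(\<And>x. x \<in> A \<Longrightarrow> f x \<in> carrier_mat n n) \<Longrightarrow> mat_trace (msum n n f A) = (\<Sum>x\<in>A. mat_trace (f x))"
  by (simp add: mat_trace_def) (subst sum.swap, auto intro!: sum.cong)

lemma mat_trace_smult [simp]: "A \<in> carrier_mat n n \<Longrightarrow> mat_trace (c \<cdot>\<^sub>m A) = c * mat_trace (A :: 'a::semiring_0 mat)"
  by (auto simp: mat_trace_def sum_distrib_left intro!: sum.cong)

lemma mat_trace_one [simp]: "mat_trace (1\<^sub>m n :: 'a::semiring_1 mat) = of_nat n"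
  by (simp add: mat_trace_def)

lemma mat_trace_zero [simp]: "mat_trace (0\<^sub>m n n) = 0"
  by (simp add: mat_trace_def)

lemma mat_trace_add: "A \<in> carrier_mat n n \<Longrightarrow> B \<in> carrier_mat n n \<Longrightarrow> mat_trace (A + B) = mat_trace A + mat_trace B"
  by (auto simp: mat_trace_def sum.distrib)

lemma mat_trace_diff:
  "A \<in> carrier_mat n n \<Longrightarrow> B \<in> carrier_mat n n \<Longrightarrow> mat_trace (A - B :: 'a::ring_1 mat) = mat_trace A - mat_trace B"
  by (auto simp: mat_trace_def sum_subtractf)

(* An inner dimension that is minimal among all factorizations makes both factors of full rank. *)
lemma idempotent_factorization:
  fixes E :: "'a::field mat"
  assumes E: "E \<in> carrier_mat d d" and EE: "E * E = E"
  obtains r A B where "A \<in> carrier_mat r d" "B \<in> carrier_mat d r" "B * A = E" "A * B = 1\<^sub>m r"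
proof -
  \<comment> \<open>An arbitrary finite index set instead of \<open>{..<r}\<close> makes it easy to
    drop one summand; the renumbering is done once, at the end.\<close>
  define P where "P r \<longleftrightarrow> (\<exists>(b :: nat \<Rightarrow> nat \<Rightarrow> 'a) a (K :: nat set). finite K \<and> card K = r \<and>
    (\<forall>i<d. \<forall>j<d. E $$ (i, j) = (\<Sum>k\<in>K. b i k * a k j)))" for r
  have "P d" unfolding P_def
    by (rule exI[of _ "\<lambda>i k. E $$ (i, k)"], rule exI[of _ "\<lambda>k j. if k = j then 1 else 0"], rule exI[of _ "{..<d}"])
       (simp add: if_distrib[of "\<lambda>z. _ * z"] sum.delta cong: if_cong)
  define r where "r = (LEAST r. P r)"
  have Pr: "P r" unfolding r_def by (rule LeastI) fact
  have least: "\<not> P s" if "s < r" for s using that unfolding r_def by (rule not_less_Least)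
  from Pr obtain b a :: "nat \<Rightarrow> nat \<Rightarrow> 'a" and K :: "nat set" where K: "finite K" "card K = r"
    and ba: "\<And>i j. i < d \<Longrightarrow> j < d \<Longrightarrow> E $$ (i, j) = (\<Sum>k\<in>K. b i k * a k j)"
    unfolding P_def by blast
  \<comment> \<open>If one summand of a factorization of minimal length vanishes, it can be deleted,
    contradicting \<open>least\<close>.\<close>
  have red: False if k0: "k0 \<in> K" and h: "\<And>i j. i < d \<Longrightarrow> j < d \<Longrightarrow> E $$ (i, j) = (\<Sum>k\<in>K. b' i k * a' k j)"
    "\<And>i j. i < d \<Longrightarrow> j < d \<Longrightarrow> b' i k0 * a' k0 j = 0" for k0 and b' :: "nat \<Rightarrow> nat \<Rightarrow> 'a" and a'
  proof -
    have "E $$ (i, j) = (\<Sum>k\<in>K - {k0}. b' i k * a' k j)" if "i < d" "j < d" for i j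
      using h[OF that] by (simp add: sum.remove[OF K(1) k0])
    moreover have "card (K - {k0}) = r - 1" "r > 0" using K k0 by (auto simp: card_gt_0_iff)
    ultimately have "P (r - 1)" unfolding P_def using K by (intro exI[of _ b'] exI[of _ a'] exI[of _ "K - {k0}"]) auto
    then show False using least[of "r - 1"] \<open>r > 0\<close> by auto
  qed
  have injb: "x k = 0" if "\<And>i. i < d \<Longrightarrow> (\<Sum>k\<in>K. b i k * x k) = 0" "k \<in> K" for x k
  proof (rule ccontr)
    assume xk: "x k \<noteq> 0"
    \<comment> \<open>A relation between the columns of \<open>b\<close> with nonzero coefficient at
      \<open>k\<close> lets column \<open>k\<close> be absorbed by the others: the product is
      unchanged and row \<open>k\<close> of \<open>a'\<close> is zero.\<close>
    define a' where "a' l j = a l j - x l * (a k j / x k)" for l j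
    have "(\<Sum>l\<in>K. b i l * a' l j) = E $$ (i, j)" if "i < d" "j < d" for i j
    proof -
      have "(\<Sum>l\<in>K. b i l * a' l j) = E $$ (i, j) - (\<Sum>l\<in>K. b i l * x l) * (a k j / x k)"
        unfolding ba[OF that] by (simp add: a'_def algebra_simps sum_subtractf sum_distrib_left sum_distrib_right)
      with \<open>\<And>i. i < d \<Longrightarrow> _\<close> that show ?thesis by simp
    qed
    moreover have "a' k j = 0" for j using xk by (simp add: a'_def)
    ultimately show False using red[of k b a'] that(2) by auto
  qed
  have inja: "y k = 0" if "\<And>j. j < d \<Longrightarrow> (\<Sum>k\<in>K. y k * a k j) = 0" "k \<in> K" for y k
  proof (rule ccontr)
    assume yk: "y k \<noteq> 0"
    define b' where "b' i l = b i l - (b i k / y k) * y l" for l i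
    have "(\<Sum>l\<in>K. b' i l * a l j) = E $$ (i, j)" if "i < d" "j < d" for i j
    proof -
      have "(\<Sum>l\<in>K. b' i l * a l j) = E $$ (i, j) - (b i k / y k) * (\<Sum>l\<in>K. y l * a l j)"
        unfolding ba[OF that] by (simp add: b'_def algebra_simps sum_subtractf sum_distrib_left sum_distrib_right)
      with \<open>\<And>i. i < d \<Longrightarrow> _\<close> that show ?thesis by simp
    qed
    moreover have "b' i k = 0" for i using yk by (simp add: b'_def)
    ultimately show False using red[of k b' a] that(2) by auto
  qed
  \<comment> \<open>\<open>C\<close> is A B - 1. From E E = E follows B C A = 0; cancelling B on the
    left by \<open>injb\<close> and A on the right by \<open>inja\<close> gives C = 0.\<close>
  define C where "C k l = (\<Sum>m<d. a k m * b m l) - (if k = l then 1 else 0)" for k l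
  have z1: "(\<Sum>k\<in>K. b i k * (\<Sum>l\<in>K. C k l * a l j)) = 0" if ij: "i < d" "j < d" for i j
  proof -
    have "E $$ (i, j) = (\<Sum>m<d. E $$ (i, m) * E $$ (m, j))"
      by (subst EE[symmetric], rule mult_mat_index[OF E E ij])
    also have "\<dots> = (\<Sum>m<d. \<Sum>k\<in>K. \<Sum>l\<in>K. b i k * (a k m * b m l * a l j))"
      using ij by (intro sum.cong refl) (simp add: ba sum_product mult.assoc)
    also have "\<dots> = (\<Sum>k\<in>K. \<Sum>m<d. \<Sum>l\<in>K. b i k * (a k m * b m l * a l j))" by (rule sum.swap)
    also have "\<dots> = (\<Sum>k\<in>K. \<Sum>l\<in>K. \<Sum>m<d. b i k * (a k m * b m l * a l j))"
      by (intro sum.cong refl sum.swap)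
    also have "\<dots> = (\<Sum>k\<in>K. b i k * (\<Sum>l\<in>K. (\<Sum>m<d. a k m * b m l) * a l j))"
      by (simp add: sum_distrib_left sum_distrib_right)
    finally have e1: "E $$ (i, j) = (\<Sum>k\<in>K. b i k * (\<Sum>l\<in>K. (\<Sum>m<d. a k m * b m l) * a l j))" .
    have e2: "(\<Sum>l\<in>K. C k l * a l j) = (\<Sum>l\<in>K. (\<Sum>m<d. a k m * b m l) * a l j) - a k j" if "k \<in> K" for k
    proof -
      have "(\<Sum>l\<in>K. (if k = l then 1 else 0) * a l j) = (\<Sum>l\<in>K. if k = l then a l j else 0)"
        by (intro sum.cong) auto
      also have "\<dots> = a k j" using that K by simp
      finally show ?thesis by (simp add: C_def left_diff_distrib sum_subtractf)
    qed
    have "(\<Sum>k\<in>K. b i k * (\<Sum>l\<in>K. C k l * a l j)) =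
      (\<Sum>k\<in>K. b i k * (\<Sum>l\<in>K. (\<Sum>m<d. a k m * b m l) * a l j)) - (\<Sum>k\<in>K. b i k * a k j)"
      by (simp add: e2 right_diff_distrib sum_subtractf)
    then show ?thesis using e1 ba[OF ij] by simp
  qed
  have "(\<Sum>l\<in>K. C k l * a l j) = 0" if "k \<in> K" "j < d" for k j
    using injb[of "\<lambda>k. \<Sum>l\<in>K. C k l * a l j" k] z1 that by blast
  then have C0: "C k l = 0" if "k \<in> K" "l \<in> K" for k l
    using inja[of "C k" l] that by blast
  from K obtain f where f: "bij_betw f {..<r} K"
    using ex_bij_betw_nat_finite[OF K(1)] by (auto simp: atLeast0LessThan)
  define B where "B = mat d r (\<lambda>(i, k). b i (f k))"
  define A where "A = mat r d (\<lambda>(k, j). a (f k) j)"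
  have cA: "A \<in> carrier_mat r d" and cB: "B \<in> carrier_mat d r" by (auto simp: A_def B_def)
  have "B * A = E"
  proof (rule eq_matI)
    fix i j assume "i < dim_row E" "j < dim_col E"
    then have ij: "i < d" "j < d" using E by auto
    show "(B * A) $$ (i, j) = E $$ (i, j)"
      unfolding mult_mat_index[OF cB cA ij] ba[OF ij] sum.reindex_bij_betw[OF f, symmetric]
      using ij by (intro sum.cong refl) (auto simp: A_def B_def)
  qed (use E cA cB in auto)
  moreover have "A * B = 1\<^sub>m r"
  proof (rule eq_matI)
    fix k l assume "k < dim_row (1\<^sub>m r)" "l < dim_col (1\<^sub>m r)"
    then have kl: "k < r" "l < r" by auto
    then have fK: "f k \<in> K" "f l \<in> K" "f k = f l \<longleftrightarrow> k = l" using f by (auto simp: bij_betw_def inj_on_def)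
    have "(A * B) $$ (k, l) = (\<Sum>m<d. a (f k) m * b m (f l))"
      unfolding mult_mat_index[OF cA cB kl] using kl by (intro sum.cong refl) (auto simp: A_def B_def)
    also have "\<dots> = (if k = l then 1 else 0)" using C0[OF fK(1,2)] fK(3) by (simp add: C_def)
    finally show "(A * B) $$ (k, l) = 1\<^sub>m r $$ (k, l)" using kl by simp
  qed (use cA cB in auto)
  ultimately show ?thesis using that cA cB by blast
qed

text \<open>The trace of an idempotent is its rank: cycling the factors of a full rank factorization
  turns \<open>B * A\<close> into an identity matrix of size \<open>r\<close>. In characteristic 0
  the trace determines \<open>r\<close>.\<close>

lemma idempotent_trace_eq_0:
  fixes E :: "'a::field_char_0 mat"
  assumes E: "E \<in> carrier_mat d d" "E * E = E" and tr: "mat_trace E = 0"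
  shows "E = 0\<^sub>m d d"
proof -
  obtain r A B where f: "A \<in> carrier_mat r d" "B \<in> carrier_mat d r" "B * A = E" "A * B = 1\<^sub>m r"
    using idempotent_factorization[OF E] .
  have "of_nat r = (0::'a)" using mat_trace_mult_comm[OF f(1,2)] f(3,4) tr by simp
  then have "r = 0" by simp
  then show ?thesis using f(1-3) E by (intro eq_matI) (auto simp: scalar_prod_def)
qed

lemma idempotent_complement:
  fixes E :: "'a::ring_1 mat"
  assumes E: "E \<in> carrier_mat d d" "E * E = E"
  shows "(1\<^sub>m d - E) * (1\<^sub>m d - E) = 1\<^sub>m d - E"
proof -
  have "(1\<^sub>m d - E) * (1\<^sub>m d - E) = (1\<^sub>m d - E) * 1\<^sub>m d - (1\<^sub>m d - E) * E"
    using E by (intro mult_minus_distrib_mat[of _ d d]) auto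
  also have "(1\<^sub>m d - E) * E = 1\<^sub>m d * E - E * E"
    using E by (intro minus_mult_distrib_mat[of _ d d]) auto
  finally show ?thesis using E by (auto intro!: eq_matI)
qed

lemma subspace_vec_iff:
  "VectorSpace.subspace class_ring W (module_vec TYPE('a::field) d) \<longleftrightarrow>
     W \<subseteq> carrier_vec d \<and> 0\<^sub>v d \<in> W \<and> (\<forall>v\<in>W. \<forall>w\<in>W. v + w \<in> W) \<and> (\<forall>c. \<forall>v\<in>W. c \<cdot>\<^sub>v v \<in> W)"
proof -
  have "vectorspace class_ring (module_vec TYPE('a) d)" by (rule vec_vs)
  moreover have "Module.module class_ring (module_vec TYPE('a) d)" by (rule vec_module)
  ultimately show ?thesis
    unfolding VectorSpace.subspace_def LinearCombinations.submodule_def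
    by (auto simp: module_vec_simps class_ring_simps)
qed

section \<open>Representations and characters of finite groups\<close>

lemma mult_assoc_dim:
  "dim_col A = dim_row B \<Longrightarrow> dim_col B = dim_row C \<Longrightarrow> (A * B) * C = A * (B * (C :: 'a::semiring_0 mat))"
  by (rule assoc_mult_mat[of _ "dim_row A" "dim_row B" _ "dim_row C" _ "dim_col C"]) (auto intro: carrier_matI)

lemma mult_vec_assoc_dim:
  "dim_col A = dim_row B \<Longrightarrow> dim_col B = dim_vec v \<Longrightarrow> (A * B) *\<^sub>v v = A *\<^sub>v (B *\<^sub>v (v :: 'a::semiring_0 vec))"
  by (rule assoc_mult_mat_vec[of _ "dim_row A" "dim_row B" _ "dim_vec v"]) (auto intro: carrier_matI carrier_vecI)

lemma mult_one_dim:
  "dim_row A = n \<Longrightarrow> 1\<^sub>m n * A = (A :: 'a::semiring_1 mat)"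
  "dim_col A = n \<Longrightarrow> A * 1\<^sub>m n = (A :: 'a::semiring_1 mat)"
  by (auto intro: left_mult_one_mat right_mult_one_mat carrier_matI)

lemma msum_vec_index:
  assumes f: "\<And>x. x \<in> A \<Longrightarrow> f x \<in> carrier_mat n m" and v: "v \<in> carrier_vec m" and i: "i < n"
  shows "(msum n m f A *\<^sub>v v) $ i = (\<Sum>x\<in>A. (f x *\<^sub>v v) $ i :: 'a::comm_semiring_1)"
proof -
  have "(msum n m f A *\<^sub>v v) $ i = (\<Sum>k<m. \<Sum>x\<in>A. f x $$ (i, k) * v $ k)"
    by (simp only: mult_vec_index[OF msum_carrier v i]) (simp add: i sum_distrib_right)
  also have "\<dots> = (\<Sum>x\<in>A. \<Sum>k<m. f x $$ (i, k) * v $ k)" by (rule sum.swap)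
  also have "\<dots> = (\<Sum>x\<in>A. (f x *\<^sub>v v) $ i)"
    by (intro sum.cong refl) (simp only: mult_vec_index[OF f v i])
  finally show ?thesis .
qed

lemma msum_vec_mem:
  assumes W: "VectorSpace.subspace class_ring W (module_vec TYPE('a::field) d)" and A: "finite A"
    and f: "\<And>x. x \<in> A \<Longrightarrow> f x \<in> carrier_mat d n" "\<And>x. x \<in> A \<Longrightarrow> f x *\<^sub>v v \<in> W" and v: "v \<in> carrier_vec n"
  shows "msum d n f A *\<^sub>v v \<in> W"
  using A f
proof (induction A)
  case empty
  have "msum d n f {} *\<^sub>v v = 0\<^sub>v d" using v by (auto simp: msum_empty intro!: eq_vecI)
  then show ?case using W by (simp add: subspace_vec_iff)
next
  case (insert a A)
  have "msum d n f (insert a A) *\<^sub>v v = f a *\<^sub>v v + msum d n f A *\<^sub>v v"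
    using insert.hyps insert.prems v by (simp add: msum_insert add_mult_distrib_mat_vec[of _ d n])
  moreover have "f a *\<^sub>v v \<in> W" "msum d n f A *\<^sub>v v \<in> W" using insert by auto
  ultimately show ?case using W by (simp add: subspace_vec_iff)
qed

lemma smult_mat_vec:
  "v \<in> carrier_vec m \<Longrightarrow> A \<in> carrier_mat n m \<Longrightarrow> (c \<cdot>\<^sub>m A) *\<^sub>v v = c \<cdot>\<^sub>v (A *\<^sub>v (v :: 'a::comm_semiring_1 vec))"
  by (intro eq_vecI) (auto simp: scalar_prod_def sum_distrib_left mult.assoc intro!: sum.cong)

text \<open>The bound comes from the complementary idempotent, whose rank is \<open>d - r\<close>
  and therefore cannot be negative.\<close>

lemma idempotent_trace_nat:
  fixes E :: "'a::field_char_0 mat"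
  assumes E: "E \<in> carrier_mat d d" "E * E = E"
  obtains r where "mat_trace E = of_nat r" "r \<le> d"
proof -
  obtain r A B where f: "A \<in> carrier_mat r d" "B \<in> carrier_mat d r" "B * A = E" "A * B = 1\<^sub>m r"
    using idempotent_factorization[OF E] .
  obtain r' A' B' where f': "A' \<in> carrier_mat r' d" "B' \<in> carrier_mat d r'" "B' * A' = 1\<^sub>m d - E" "A' * B' = 1\<^sub>m r'"
    using idempotent_factorization[OF _ idempotent_complement[OF E]] E by (metis minus_carrier_mat)
  have 1: "mat_trace E = of_nat r" using mat_trace_mult_comm[OF f(1,2)] f(3,4) by simp
  have "mat_trace (1\<^sub>m d - E) = of_nat r'" using mat_trace_mult_comm[OF f'(1,2)] f'(3,4) by simp
  then have "of_nat d - of_nat r = (of_nat r' :: 'a)" using 1 E by (simp add: mat_trace_diff[of _ d])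
  then have "of_nat d = (of_nat (r + r') :: 'a)" by (simp add: algebra_simps)
  then have "r \<le> d" by (simp only: of_nat_eq_iff)
  then show ?thesis using 1 that by blast
qed

lemma sum_lessThan_add: "(\<Sum>i<m + n. f i) = (\<Sum>i<m. f i) + (\<Sum>i<n. f (i + m :: nat) :: 'a::comm_monoid_add)"
  by (induction n) (auto simp: ac_simps)

lemma sum_swap_pairs:
  "(\<Sum>i\<in>A. \<Sum>j\<in>B. \<Sum>h\<in>C. \<Sum>k\<in>D. f i j h k) = (\<Sum>h\<in>C. \<Sum>k\<in>D. \<Sum>i\<in>A. \<Sum>j\<in>B. f i j h k)"
proof -
  have "(\<Sum>i\<in>A. \<Sum>j\<in>B. \<Sum>h\<in>C. \<Sum>k\<in>D. f i j h k) = (\<Sum>i\<in>A. \<Sum>h\<in>C. \<Sum>j\<in>B. \<Sum>k\<in>D. f i j h k)"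
    by (rule sum.cong[OF refl], rule sum.swap)
  also have "\<dots> = (\<Sum>h\<in>C. \<Sum>i\<in>A. \<Sum>j\<in>B. \<Sum>k\<in>D. f i j h k)" by (rule sum.swap)
  also have "\<dots> = (\<Sum>h\<in>C. \<Sum>i\<in>A. \<Sum>k\<in>D. \<Sum>j\<in>B. f i j h k)"
    by (rule sum.cong[OF refl], rule sum.cong[OF refl], rule sum.swap)
  also have "\<dots> = (\<Sum>h\<in>C. \<Sum>k\<in>D. \<Sum>i\<in>A. \<Sum>j\<in>B. f i j h k)"
    by (rule sum.cong[OF refl], rule sum.swap)
  finally show ?thesis .
qed

lemma count_list_filter: "P x \<Longrightarrow> count_list (filter P xs) x = count_list xs x"
  by (induction xs) auto

section \<open>Representations of finite groups, cut down by commuting idempotents\<close>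

locale fin_group = group G for G :: "'a monoid" (structure) +
  assumes fin: "finite (carrier G)"

text \<open>Once the identity goes to the identity, \<open>\<rho> (inv g)\<close> inverts
  \<open>\<rho> g\<close>, so membership in \<open>GL d\<close> reduces to having the right
  size.\<close>

lemma (in fin_group) representation_iff:
  "representation G d \<rho> \<longleftrightarrow> (\<forall>g\<in>carrier G. \<rho> g \<in> carrier_mat d d) \<and>
     (\<forall>g\<in>carrier G. \<forall>h\<in>carrier G. \<rho> (g \<otimes> h) = \<rho> g * \<rho> h) \<and> \<rho> \<one> = 1\<^sub>m d"
proof -
  interpret R: ring "ring_mat TYPE(complex) d ()" by (rule ring_mat)
  have grp: "group (GL d :: complex mat monoid)" unfolding GL_def by (rule R.units_group)
  have mult: "x \<otimes>\<^bsub>GL d\<^esub> y = x * y" and one: "\<one>\<^bsub>GL d\<^esub> = (1\<^sub>m d)" for x y :: "complex mat"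
    by (auto simp: GL_def units_of_def ring_mat_def)
  have car: "x \<in> carrier (GL d) \<longleftrightarrow> x \<in> carrier_mat d d \<and> (\<exists>y\<in>carrier_mat d d. y * x = 1\<^sub>m d \<and> x * y = 1\<^sub>m d)" for x :: "complex mat"
    by (auto simp: GL_def units_of_def ring_mat_def Units_def)
  show ?thesis (is "_ \<longleftrightarrow> ?R")
  proof
    assume "representation G d \<rho>"
    then have h: "\<rho> \<in> hom G (GL d)" by (simp add: representation_def)
    interpret group_hom G "GL d" \<rho> using h grp by (simp add: group_hom_def group_hom_axioms_def is_group)
    show ?R using hom_closed hom_mult hom_one unfolding mult one car by auto
  next
    assume R: ?R
    show "representation G d \<rho>" unfolding representation_def
    proof (rule homI)
      fix x assume x: "x \<in> carrier G"
      then have "\<rho> (inv x) * \<rho> x = 1\<^sub>m d" "\<rho> x * \<rho> (inv x) = 1\<^sub>m d"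
        using R by (metis inv_closed l_inv, metis inv_closed r_inv)
      then show "\<rho> x \<in> carrier (GL d)" unfolding car using R x by auto
    qed (use R mult in auto)
  qed
qed

context fin_group begin

lemma rep_carrier: "representation G d \<rho> \<Longrightarrow> g \<in> carrier G \<Longrightarrow> \<rho> g \<in> carrier_mat d d"
  and rep_mult: "representation G d \<rho> \<Longrightarrow> g \<in> carrier G \<Longrightarrow> h \<in> carrier G \<Longrightarrow> \<rho> (g \<otimes> h) = \<rho> g * \<rho> h"
  and rep_one: "representation G d \<rho> \<Longrightarrow> \<rho> \<one> = 1\<^sub>m d"
  by (auto simp: representation_iff)

lemma rep_inv:
  assumes "representation G d \<rho>" "g \<in> carrier G"
  shows "\<rho> g * \<rho> (inv g) = 1\<^sub>m d" "\<rho> (inv g) * \<rho> g = 1\<^sub>m d"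
  using rep_mult[OF assms(1)] rep_one[OF assms(1)] assms(2) by (metis inv_closed r_inv, metis inv_closed l_inv)

text \<open>If E = B A and A B = 1, then \<open>A\<close> and \<open>B\<close> identify the image of
  \<open>E\<close> with a coordinate space of dimension \<open>r\<close>. Commutation with
  \<open>E\<close> makes \<open>A * (\<rho> g * B)\<close> multiplicative. This yields both the
  complete reducibility of representations and the label character of an inertia complement.\<close>

lemma rep_compress:
  assumes rep: "representation G d \<rho>" and E: "E \<in> carrier_mat d d" "E * E = E"
    and comm: "\<And>g. g \<in> carrier G \<Longrightarrow> \<rho> g * E = E * \<rho> g"
  obtains r \<sigma> where "representation G r \<sigma>" "of_nat r = mat_trace E"
    "\<And>g. g \<in> carrier G \<Longrightarrow> mat_trace (\<sigma> g) = mat_trace (\<rho> g * E)"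
proof -
  obtain r A B where f: "A \<in> carrier_mat r d" "B \<in> carrier_mat d r" "B * A = E" "A * B = 1\<^sub>m r"
    using idempotent_factorization[OF E] .
  define \<sigma> where "\<sigma> g = A * (\<rho> g * B)" for g
  note dims = carrier_matD[OF E(1)] carrier_matD[OF f(1)] carrier_matD[OF f(2)] rep_carrier[OF rep, THEN carrier_matD(1)]
    rep_carrier[OF rep, THEN carrier_matD(2)]
  have EB: "E * B = B"
    unfolding f(3)[symmetric] by (simp add: mult_assoc_dim dims f(4) mult_one_dim)
  have BA: "B * (A * X) = E * X" if "dim_row X = d" for X
    using that by (simp add: f(3)[symmetric] mult_assoc_dim dims)
  have "representation G r \<sigma>" unfolding representation_iff
  proof (intro conjI ballI)
    fix g h assume gh: "g \<in> carrier G" "h \<in> carrier G"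
    have "\<sigma> g * \<sigma> h = A * (\<rho> g * (E * (\<rho> h * B)))"
      using gh by (simp add: \<sigma>_def mult_assoc_dim dims BA)
    also have "E * (\<rho> h * B) = (\<rho> h * E) * B" using gh by (simp add: comm mult_assoc_dim dims)
    also have "\<dots> = \<rho> h * B" using gh by (simp add: mult_assoc_dim dims EB)
    finally show "\<sigma> (g \<otimes> h) = \<sigma> g * \<sigma> h" using gh by (simp add: \<sigma>_def rep_mult[OF rep] mult_assoc_dim dims)
  next
    fix g assume "g \<in> carrier G"
    then show "\<sigma> g \<in> carrier_mat r r" unfolding \<sigma>_def using f rep_carrier[OF rep] by auto
  next
    show "\<sigma> \<one> = 1\<^sub>m r" by (simp add: \<sigma>_def rep_one[OF rep] mult_one_dim dims f(4))
  qed
  moreover have "of_nat r = mat_trace E"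
    using mat_trace_mult_comm[OF f(1,2)] f(3,4) by simp
  moreover have "mat_trace (\<sigma> g) = mat_trace (\<rho> g * E)" if g: "g \<in> carrier G" for g
  proof -
    have "mat_trace (\<sigma> g) = mat_trace ((\<rho> g * B) * A)"
      unfolding \<sigma>_def using f rep_carrier[OF rep g] by (intro mat_trace_mult_comm[of _ r d]) auto
    then show ?thesis using g by (simp add: mult_assoc_dim dims f(3))
  qed
  ultimately show ?thesis using that by blast
qed

text \<open>The fixed vectors of \<open>E\<close>, which make up its image, form an invariant
  subspace; irreducibility leaves only the two extreme cases.\<close>

lemma irreducible_idempotent:
  assumes irr: "irreducible_rep G d \<rho>" and E: "E \<in> carrier_mat d d" "E * E = E"
    and comm: "\<And>g. g \<in> carrier G \<Longrightarrow> \<rho> g * E = E * \<rho> g"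
  shows "E = 0\<^sub>m d d \<or> E = 1\<^sub>m d"
proof -
  have rep: "representation G d \<rho>" using irr by (simp add: irreducible_rep_def)
  define W where "W = {v \<in> carrier_vec d. E *\<^sub>v v = v}"
  have "VectorSpace.subspace class_ring W (module_vec TYPE(complex) d)"
    unfolding subspace_vec_iff W_def using E(1)
    by (auto simp: mult_add_distrib_mat_vec[OF E(1)] mult_mat_vec[OF E(1)] intro!: eq_vecI)
  moreover have "\<rho> g *\<^sub>v w \<in> W" if g: "g \<in> carrier G" and w: "w \<in> W" for g w
  proof -
    have "E *\<^sub>v (\<rho> g *\<^sub>v w) = (\<rho> g * E) *\<^sub>v w"
      unfolding comm[OF g] using w g E rep_carrier[OF rep g] by (simp add: W_def mult_vec_assoc_dim)
    also have "\<dots> = \<rho> g *\<^sub>v w" using w g E rep_carrier[OF rep g] by (simp add: W_def mult_vec_assoc_dim)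
    finally show ?thesis using w rep_carrier[OF rep g] by (auto simp: W_def)
  qed
  ultimately have "W = {0\<^sub>v d} \<or> W = carrier_vec d" using irr unfolding irreducible_rep_def by blast
  then show ?thesis
  proof
    assume W: "W = {0\<^sub>v d}"
    have "E *\<^sub>v v \<in> W" if "v \<in> carrier_vec d" for v
      unfolding W_def using that E by (auto simp: mult_vec_assoc_dim[symmetric])
    then have "E *\<^sub>v v = 0\<^sub>m d d *\<^sub>v v" if "v \<in> carrier_vec d" for v using that W by auto
    then have "E = 0\<^sub>m d d" by (intro eq_mat_by_action[OF E(1)]) auto
    then show ?thesis ..
  next
    assume W: "W = carrier_vec d"
    have "E *\<^sub>v v = 1\<^sub>m d *\<^sub>v v" if "v \<in> carrier_vec d" for v using that W by (auto simp: W_def)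
    then have "E = 1\<^sub>m d" by (intro eq_mat_by_action[OF E(1)]) auto
    then show ?thesis ..
  qed
qed

end

section \<open>Projectors, Maschke's theorem and complete reducibility\<close>

lemma projector_onto_subspace:
  assumes W: "VectorSpace.subspace class_ring W (module_vec TYPE('a::field_char_0) d)"
  obtains p where "p \<in> carrier_mat d d" "\<And>v. v \<in> carrier_vec d \<Longrightarrow> p *\<^sub>v v \<in> W" "\<And>w. w \<in> W \<Longrightarrow> p *\<^sub>v w = w"
proof -
  note Ws = W[unfolded subspace_vec_iff]
  \<comment> \<open>\<open>Q r\<close> says that some idempotent of rank \<open>r\<close> has its
    image in \<open>W\<close>. One of largest rank is taken; if it failed to fix a vector of
    \<open>W\<close>, there would be one of rank \<open>r + 1\<close>.\<close>
  define Q where "Q r \<longleftrightarrow> (\<exists>p\<in>carrier_mat d d. p * p = p \<and> (\<forall>v\<in>carrier_vec d. p *\<^sub>v v \<in> W) \<and> mat_trace p = (of_nat r :: 'a))" for r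
  have zero_mult: "0\<^sub>m d d *\<^sub>v v = 0\<^sub>v d" if "v \<in> carrier_vec d" for v :: "'a vec"
    using that by (auto intro!: eq_vecI)
  have "Q 0" unfolding Q_def using Ws zero_mult by (intro bexI[of _ "0\<^sub>m d d"]) auto
  have bd: "\<forall>r. Q r \<longrightarrow> r \<le> d"
    unfolding Q_def by (metis idempotent_trace_nat of_nat_eq_iff)
  define r where "r = (GREATEST r. Q r)"
  have "Q r" unfolding r_def using GreatestI_nat[of Q, OF \<open>Q 0\<close>] bd by blast
  then obtain p where p: "p \<in> carrier_mat d d" "p * p = p" "\<And>v. v \<in> carrier_vec d \<Longrightarrow> p *\<^sub>v v \<in> W" "mat_trace p = of_nat r"
    unfolding Q_def by blast
  have "p *\<^sub>v w = w" if w: "w \<in> W" for w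
  proof (rule ccontr)
    assume ne: "p *\<^sub>v w \<noteq> w"
    have wc: "w \<in> carrier_vec d" using w Ws by auto
    \<comment> \<open>The part of \<open>w\<close> killed by \<open>p\<close>; it is nonzero because
      \<open>p\<close> does not fix \<open>w\<close>.\<close>
    define w' where "w' = w + (- 1) \<cdot>\<^sub>v (p *\<^sub>v w)"
    have w'W: "w' \<in> W" unfolding w'_def using p(3)[OF wc] w Ws by auto
    then have w'c: "w' \<in> carrier_vec d" using Ws by auto
    have ppw: "p *\<^sub>v (p *\<^sub>v v) = p *\<^sub>v v" if "v \<in> carrier_vec d" for v
      using that p by (simp add: mult_vec_assoc_dim[symmetric])
    have pw': "p *\<^sub>v w' = 0\<^sub>v d" unfolding w'_def using p(1) wc
      by (subst mult_add_distrib_mat_vec[OF p(1)], auto)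
         (subst mult_mat_vec[OF p(1)], auto simp: ppw)
    have "\<exists>i<d. w' $ i \<noteq> 0"
    proof (rule ccontr)
      assume "\<not> ?thesis"
      then have "w $ i = (p *\<^sub>v w) $ i" if "i < d" for i
        using that wc p(1) unfolding w'_def by (auto simp del: index_mult_mat_vec)
      then show False using ne wc p(1) by (auto simp del: index_mult_mat_vec intro!: eq_vecI)
    qed
    then obtain i where i: "i < d" "w' $ i \<noteq> 0" by blast
    \<comment> \<open>\<open>\<phi>\<close> vanishes on the image of \<open>p\<close> and takes the
      value 1 at \<open>w'\<close>, which \<open>p\<close> kills. Adding the rank one map
      \<open>v \<mapsto> \<phi> v \<cdot>\<^sub>v w'\<close> to \<open>p\<close> therefore gives an
      idempotent again.\<close>
    define \<phi> where "\<phi> v = (v $ i - (p *\<^sub>v v) $ i) / w' $ i" for v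
    define c where "c b = ((if b = i then 1 else 0) - p $$ (i, b)) / w' $ i" for b
    have \<phi>c: "\<phi> v = (\<Sum>b<d. c b * v $ b)" if v: "v \<in> carrier_vec d" for v
    proof -
      have "(\<Sum>b<d. (if b = i then 1 else 0) * v $ b) = (\<Sum>b<d. if b = i then v $ i else 0)"
        by (intro sum.cong) auto
      also have "\<dots> = v $ i" using i by simp
      finally have e: "(\<Sum>b<d. (if b = i then 1 else 0) * v $ b) = v $ i" .
      have "(\<Sum>b<d. c b * v $ b) = (\<Sum>b<d. (if b = i then 1 else 0) * v $ b - p $$ (i, b) * v $ b) / w' $ i"
        unfolding sum_divide_distrib c_def by (intro sum.cong refl) (simp add: left_diff_distrib)
      then show ?thesis
        unfolding \<phi>_def mult_vec_index[OF p(1) v i(1)] by (simp only: sum_subtractf e)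
    qed
    define p' where "p' = p + mat d d (\<lambda>(a, b). w' $ a * c b)"
    have p'c: "p' \<in> carrier_mat d d" unfolding p'_def by auto
    have act: "p' *\<^sub>v v = p *\<^sub>v v + \<phi> v \<cdot>\<^sub>v w'" if v: "v \<in> carrier_vec d" for v
    proof -
      have m: "mat d d (\<lambda>(a, b). w' $ a * c b) *\<^sub>v v = \<phi> v \<cdot>\<^sub>v w'"
      proof (rule eq_vecI)
        fix a assume "a < dim_vec (\<phi> v \<cdot>\<^sub>v w')"
        then have a: "a < d" using w'c by auto
        show "(mat d d (\<lambda>(a, b). w' $ a * c b) *\<^sub>v v) $ a = (\<phi> v \<cdot>\<^sub>v w') $ a"
          using a w'c by (subst mult_vec_index[of _ d d]) (auto simp: v \<phi>c sum_distrib_left sum_distrib_right algebra_simps)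
      qed (use w'c in auto)
      show ?thesis unfolding p'_def
        by (subst add_mult_distrib_mat_vec[OF p(1) _ v]) (auto simp: m)
    qed
    have "p' * p' = p'"
    proof (rule eq_mat_by_action[of _ d d])
      fix v :: "'a vec" assume v: "v \<in> carrier_vec d"
      have v2: "p' *\<^sub>v v \<in> carrier_vec d" using v p'c by auto
      have "p *\<^sub>v (p' *\<^sub>v v) = p *\<^sub>v v"
        unfolding act[OF v] using p(1) w'c v
        by (subst mult_add_distrib_mat_vec[OF p(1)], auto)
           (subst mult_mat_vec[OF p(1)], auto simp: ppw pw')
      moreover from this have "\<phi> (p' *\<^sub>v v) = \<phi> v"
        unfolding \<phi>_def using i v w'c p(1) by (subst act[OF v]) (auto simp: \<phi>_def simp del: index_mult_mat_vec)
      ultimately have "p' *\<^sub>v (p' *\<^sub>v v) = p *\<^sub>v v + \<phi> v \<cdot>\<^sub>v w'" by (simp only: act[OF v2])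
      then have "p' *\<^sub>v (p' *\<^sub>v v) = p' *\<^sub>v v" by (simp only: act[OF v])
      then show "p' * p' *\<^sub>v v = p' *\<^sub>v v" using v p'c by (simp add: mult_vec_assoc_dim)
    qed (use p'c in auto)
    moreover have "\<forall>v\<in>carrier_vec d. p' *\<^sub>v v \<in> W" using act p(3) w'W Ws by auto
    moreover have "mat_trace p' = of_nat (r + 1)"
    proof -
      have "mat_trace (mat d d (\<lambda>(a, b). w' $ a * c b)) = \<phi> w'"
        unfolding \<phi>c[OF w'c] by (auto simp: mat_trace_def intro!: sum.cong)
      also have "\<dots> = 1" using i by (simp add: \<phi>_def pw')
      finally show ?thesis unfolding p'_def using p by (subst mat_trace_add[of _ d]) auto
    qed
    ultimately have "Q (r + 1)" unfolding Q_def using p'c by blast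
    then have "r + 1 \<le> r" unfolding r_def using bd by (intro Greatest_le_nat) auto
    then show False by simp
  qed
  with p that show ?thesis by blast
qed

context fin_group begin

lemma bij_betw_translate: "h \<in> carrier G \<Longrightarrow> bij_betw (\<lambda>g. h \<otimes> g) (carrier G) (carrier G)"
  by (rule bij_betwI[of _ _ _ "\<lambda>g. inv h \<otimes> g"]) (auto simp: m_assoc[symmetric])

lemma card_carrier_pos: "card (carrier G) > 0"
  using fin one_closed by (auto simp: card_gt_0_iff)

text \<open>The average of a linear map over the group, up to the factor 1/|G|. With a projector for
  \<open>X\<close> it proves Maschke's theorem, with a matrix unit the orthogonality
  relations.\<close>

definition averaged :: "nat \<Rightarrow> nat \<Rightarrow> ('a \<Rightarrow> complex mat) \<Rightarrow> ('a \<Rightarrow> complex mat) \<Rightarrow> complex mat \<Rightarrow> complex mat" where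
  "averaged d d' \<rho> \<sigma> X = msum d d' (\<lambda>g. (\<rho> g * X) * \<sigma> (inv g)) (carrier G)"

lemma averaged_carrier [simp]: "averaged d d' \<rho> \<sigma> X \<in> carrier_mat d d'"
  by (simp add: averaged_def)

lemma averaged_intertwines:
  assumes \<rho>: "representation G d \<rho>" and \<sigma>: "representation G d' \<sigma>" and X: "X \<in> carrier_mat d d'"
    and h: "h \<in> carrier G"
  shows "\<rho> h * averaged d d' \<rho> \<sigma> X = averaged d d' \<rho> \<sigma> X * \<sigma> h"
proof -
  note dims = carrier_matD[OF X] rep_carrier[OF \<rho>, THEN carrier_matD(1)] rep_carrier[OF \<rho>, THEN carrier_matD(2)]
    rep_carrier[OF \<sigma>, THEN carrier_matD(1)] rep_carrier[OF \<sigma>, THEN carrier_matD(2)]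
  have car: "(\<rho> g * X) * \<sigma> (inv g) \<in> carrier_mat d d'" if "g \<in> carrier G" for g
    by (rule mult_carrier_mat[OF mult_carrier_mat[OF rep_carrier[OF \<rho> that] X] rep_carrier[OF \<sigma> inv_closed[OF that]]])
  have "averaged d d' \<rho> \<sigma> X * \<sigma> h = msum d d' (\<lambda>g. ((\<rho> g * X) * \<sigma> (inv g)) * \<sigma> h) (carrier G)"
    unfolding averaged_def using car rep_carrier[OF \<sigma> h] by (intro msum_mult)
  also have "\<dots> = msum d d' (\<lambda>g. ((\<rho> (h \<otimes> g) * X) * \<sigma> (inv (h \<otimes> g))) * \<sigma> h) (carrier G)"
    by (rule msum_reindex[OF bij_betw_translate[OF h]])
  also have "\<dots> = msum d d' (\<lambda>g. \<rho> h * ((\<rho> g * X) * \<sigma> (inv g))) (carrier G)"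
  proof (rule msum_cong[OF refl])
    fix g assume g: "g \<in> carrier G"
    have "((\<rho> (h \<otimes> g) * X) * \<sigma> (inv (h \<otimes> g))) * \<sigma> h = (\<rho> (h \<otimes> g) * X) * (\<sigma> (inv (h \<otimes> g)) * \<sigma> h)"
      using g h by (simp add: mult_assoc_dim dims)
    also have "\<sigma> (inv (h \<otimes> g)) * \<sigma> h = \<sigma> (inv g)"
      using g h by (simp add: rep_mult[OF \<sigma>, symmetric] inv_mult_group m_assoc)
    finally show "((\<rho> (h \<otimes> g) * X) * \<sigma> (inv (h \<otimes> g))) * \<sigma> h = \<rho> h * ((\<rho> g * X) * \<sigma> (inv g))"
      using g h by (simp add: rep_mult[OF \<rho>] mult_assoc_dim dims)
  qed
  also have "\<dots> = \<rho> h * averaged d d' \<rho> \<sigma> X"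
    unfolding averaged_def using car rep_carrier[OF \<rho> h] by (intro mult_msum[symmetric])
  finally show ?thesis by simp
qed

text \<open>Maschke's theorem. Averaging a projector onto an invariant subspace \<open>W\<close>
  keeps its image inside \<open>W\<close> and still fixes \<open>W\<close> pointwise, and the
  average commutes with the group.\<close>

lemma irreducible_or_idempotent:
  assumes rep: "representation G d \<rho>" and d: "d \<noteq> 0" and nirr: "\<not> irreducible_rep G d \<rho>"
  obtains E where "E \<in> carrier_mat d d" "E * E = E" "\<And>g. g \<in> carrier G \<Longrightarrow> \<rho> g * E = E * \<rho> g"
    "E \<noteq> 0\<^sub>m d d" "E \<noteq> 1\<^sub>m d"
proof -
  obtain W where W: "VectorSpace.subspace class_ring W (module_vec TYPE(complex) d)"
    and inv: "\<And>g w. g \<in> carrier G \<Longrightarrow> w \<in> W \<Longrightarrow> \<rho> g *\<^sub>v w \<in> W" and ne: "W \<noteq> {0\<^sub>v d}" "W \<noteq> carrier_vec d"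
    using nirr rep d unfolding irreducible_rep_def by blast
  note Ws = W[unfolded subspace_vec_iff]
  obtain p where p: "p \<in> carrier_mat d d" "\<And>v. v \<in> carrier_vec d \<Longrightarrow> p *\<^sub>v v \<in> W" "\<And>w. w \<in> W \<Longrightarrow> p *\<^sub>v w = w"
    using projector_onto_subspace[OF W] by metis
  define n where "n = (of_nat (card (carrier G)) :: complex)"
  have n: "n \<noteq> 0" using card_carrier_pos by (simp add: n_def)
  define A where "A = averaged d d \<rho> \<rho> p"
  define E where "E = (1 / n) \<cdot>\<^sub>m A"
  have Ac: "A \<in> carrier_mat d d" by (simp add: A_def)
  have Ec: "E \<in> carrier_mat d d" using Ac by (simp add: E_def)
  have act: "((\<rho> g * p) * \<rho> (inv g)) *\<^sub>v v = \<rho> g *\<^sub>v (p *\<^sub>v (\<rho> (inv g) *\<^sub>v v))" if "g \<in> carrier G" "v \<in> carrier_vec d" for g v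
    using that p(1) rep_carrier[OF rep that(1)] rep_carrier[OF rep inv_closed[OF that(1)]]
    by (simp add: mult_vec_assoc_dim)
  have car: "(\<rho> g * p) * \<rho> (inv g) \<in> carrier_mat d d" if "g \<in> carrier G" for g
    using that p(1) rep_carrier[OF rep that(1)] rep_carrier[OF rep inv_closed[OF that(1)]] by auto
  have EW: "E *\<^sub>v v \<in> W" if v: "v \<in> carrier_vec d" for v
  proof -
    have "A *\<^sub>v v \<in> W" unfolding A_def averaged_def
    proof (rule msum_vec_mem[OF W fin car _ v])
      fix g assume g: "g \<in> carrier G"
      show "((\<rho> g * p) * \<rho> (inv g)) *\<^sub>v v \<in> W"
        unfolding act[OF g v] using g v rep_carrier[OF rep inv_closed[OF g]] by (intro inv p(2)) auto
    qed
    then show ?thesis unfolding E_def using Ac v Ws by (simp add: smult_mat_vec)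
  qed
  have Ew: "E *\<^sub>v w = w" if w: "w \<in> W" for w
  proof (rule eq_vecI)
    have wc: "w \<in> carrier_vec d" using w Ws by auto
    fix i assume "i < dim_vec w"
    then have i: "i < d" using wc by auto
    have "(A *\<^sub>v w) $ i = (\<Sum>g\<in>carrier G. (((\<rho> g * p) * \<rho> (inv g)) *\<^sub>v w) $ i)"
      unfolding A_def averaged_def using car wc i by (rule msum_vec_index)
    also have "\<dots> = (\<Sum>g\<in>carrier G. w $ i)"
    proof (rule sum.cong[OF refl])
      fix g assume g: "g \<in> carrier G"
      have "\<rho> g *\<^sub>v (\<rho> (inv g) *\<^sub>v w) = (\<rho> g * \<rho> (inv g)) *\<^sub>v w"
        using g wc rep_carrier[OF rep g] rep_carrier[OF rep inv_closed[OF g]] by (simp add: mult_vec_assoc_dim)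
      then show "(((\<rho> g * p) * \<rho> (inv g)) *\<^sub>v w) $ i = w $ i"
        unfolding act[OF g wc] using inv[OF inv_closed[OF g] w] wc by (simp add: p(3) rep_inv[OF rep g])
    qed
    finally show "(E *\<^sub>v w) $ i = w $ i"
      unfolding E_def smult_mat_vec[OF wc Ac] using n Ac i by (simp add: n_def del: index_mult_mat_vec)
  qed (use w Ws Ec in auto)
  show ?thesis
  proof (rule that[OF Ec])
    show "E * E = E" using Ec EW Ew by (intro eq_mat_by_action[of _ d d]) (auto simp: mult_vec_assoc_dim)
    show "\<rho> g * E = E * \<rho> g" if g: "g \<in> carrier G" for g
      using averaged_intertwines[OF rep rep p(1) g] rep_carrier[OF rep g] Ac unfolding E_def A_def
      by (simp add: mult_smult_distrib[of _ d d _ d] mult_smult_assoc_mat[of _ d d _ d])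
    show "E \<noteq> 0\<^sub>m d d"
    proof
      assume "E = 0\<^sub>m d d"
      moreover have "0\<^sub>m d d *\<^sub>v w = 0\<^sub>v d" if "w \<in> W" for w using that Ws by (auto intro!: eq_vecI)
      ultimately have "w = 0\<^sub>v d" if "w \<in> W" for w using Ew[OF that] that by metis
      then show False using ne(1) Ws by blast
    qed
    show "E \<noteq> 1\<^sub>m d"
    proof
      assume "E = 1\<^sub>m d"
      then have "v \<in> W" if "v \<in> carrier_vec d" for v using EW[OF that] that by simp
      then show False using ne(2) Ws by blast
    qed
  qed
qed

text \<open>Induction on the degree: a commuting idempotent and its complement cut the
  representation into two of smaller degree. The constituents form a list, so that multiplicities
  are kept.\<close>

lemma representation_decomposition:
  "representation G d \<rho> \<Longrightarrow> \<exists>\<psi>s. set \<psi>s \<subseteq> Irr G \<and> afforded G \<rho> = (\<lambda>g. \<Sum>\<psi>\<leftarrow>\<psi>s. \<psi> g)"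
proof (induction d arbitrary: \<rho> rule: less_induct)
  case (less d)
  note rep = less.prems
  consider "d = 0" | "irreducible_rep G d \<rho>" | "d \<noteq> 0" "\<not> irreducible_rep G d \<rho>" by blast
  then show ?case
  proof cases
    case 1
    have "mat_trace (\<rho> g) = 0" if "g \<in> carrier G" for g
      using rep_carrier[OF rep that] 1 by (auto simp: mat_trace_def)
    then show ?thesis by (intro exI[of _ "[]"]) (auto simp: afforded_def)
  next
    case 2
    then have "afforded G \<rho> \<in> Irr G" by (auto simp: Irr_def)
    then show ?thesis by (intro exI[of _ "[afforded G \<rho>]"]) auto
  next
    case 3
    obtain E where E: "E \<in> carrier_mat d d" "E * E = E" and comm: "\<And>g. g \<in> carrier G \<Longrightarrow> \<rho> g * E = E * \<rho> g"
      and ne: "E \<noteq> 0\<^sub>m d d" "E \<noteq> 1\<^sub>m d"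
      using irreducible_or_idempotent[OF rep 3] by metis
    define F where "F = 1\<^sub>m d - E"
    have F: "F \<in> carrier_mat d d" "F * F = F"
      using idempotent_complement[OF E] E by (auto simp: F_def)
    have commF: "\<rho> g * F = F * \<rho> g" if "g \<in> carrier G" for g
      unfolding F_def using rep_carrier[OF rep that] E comm[OF that]
      by (simp add: mult_minus_distrib_mat[of _ d d _ d] minus_mult_distrib_mat[of _ d d _ _ d])
    obtain r \<sigma> where s: "representation G r \<sigma>" "of_nat r = mat_trace E"
      "\<And>g. g \<in> carrier G \<Longrightarrow> mat_trace (\<sigma> g) = mat_trace (\<rho> g * E)"
      using rep_compress[OF rep E comm] by metis
    obtain r' \<sigma>' where s': "representation G r' \<sigma>'" "of_nat r' = mat_trace F"
      "\<And>g. g \<in> carrier G \<Longrightarrow> mat_trace (\<sigma>' g) = mat_trace (\<rho> g * F)"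
      using rep_compress[OF rep F commF] by metis
    have "mat_trace F = of_nat d - mat_trace E" unfolding F_def using E by (subst mat_trace_diff[of _ d]) auto
    then have "of_nat d = (of_nat (r + r') :: complex)" using s(2) s'(2) by simp
    then have drr: "d = r + r'" by (simp only: of_nat_eq_iff)
    have "r \<noteq> 0" using s(2) idempotent_trace_eq_0[OF E] ne(1) by auto
    moreover have "r' \<noteq> 0"
    proof
      assume "r' = 0"
      then have "F = 0\<^sub>m d d" using s'(2) idempotent_trace_eq_0[OF F] by auto
      have "1\<^sub>m d = E"
      proof (rule eq_matI)
        fix i j assume "i < dim_row E" "j < dim_col E"
        then have ij: "i < d" "j < d" using E by auto
        have "F $$ (i, j) = 0" using \<open>F = 0\<^sub>m d d\<close> ij by simp
        then show "1\<^sub>m d $$ (i, j) = E $$ (i, j)" using ij E by (simp add: F_def del: index_one_mat(1))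
      qed (use E in auto)
      then show False using ne(2) by simp
    qed
    ultimately have lt: "r < d" "r' < d" using drr by auto
    obtain \<psi>s where 1: "set \<psi>s \<subseteq> Irr G" "afforded G \<sigma> = (\<lambda>g. \<Sum>\<psi>\<leftarrow>\<psi>s. \<psi> g)"
      using less.IH[OF lt(1) s(1)] by blast
    obtain \<psi>s' where 2: "set \<psi>s' \<subseteq> Irr G" "afforded G \<sigma>' = (\<lambda>g. \<Sum>\<psi>\<leftarrow>\<psi>s'. \<psi> g)"
      using less.IH[OF lt(2) s'(1)] by blast
    have "mat_trace (\<rho> g) = mat_trace (\<rho> g * E) + mat_trace (\<rho> g * F)" if g: "g \<in> carrier G" for g
    proof -
      have "\<rho> g * F = \<rho> g - \<rho> g * E" unfolding F_def using E rep_carrier[OF rep g]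
        by (subst mult_minus_distrib_mat[of _ d d]) auto
      then show ?thesis using E rep_carrier[OF rep g] by (simp add: mat_trace_diff[of _ d])
    qed
    then have "afforded G \<rho> = (\<lambda>g. afforded G \<sigma> g + afforded G \<sigma>' g)"
      by (auto simp: afforded_def s(3) s'(3))
    then show ?thesis using 1 2 by (intro exI[of _ "\<psi>s @ \<psi>s'"]) auto
  qed
qed

lemma character_decomposition:
  assumes "is_character G \<chi>"
  obtains \<psi>s where "set \<psi>s \<subseteq> Irr G" "\<chi> = (\<lambda>g. \<Sum>\<psi>\<leftarrow>\<psi>s. \<psi> g)"
  using assms representation_decomposition unfolding is_character_def by metis

lemma is_character_zero: "is_character G (\<lambda>g. 0)"
proof -
  have "representation G 0 (\<lambda>g. 1\<^sub>m 0)" unfolding representation_iff by (auto intro!: eq_matI)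
  moreover have "(\<lambda>g. 0) = afforded G (\<lambda>g. 1\<^sub>m 0)" by (auto simp: afforded_def)
  ultimately show ?thesis unfolding is_character_def by blast
qed

lemma is_character_add:
  assumes "is_character G \<chi>" "is_character G \<psi>"
  shows "is_character G (\<lambda>g. \<chi> g + \<psi> g)"
proof -
  obtain d \<rho> e \<sigma> where \<rho>: "representation G d \<rho>" "\<chi> = afforded G \<rho>" and \<sigma>: "representation G e \<sigma>" "\<psi> = afforded G \<sigma>"
    using assms unfolding is_character_def by blast
  define \<tau> where "\<tau> g = four_block_mat (\<rho> g) (0\<^sub>m d e) (0\<^sub>m e d) (\<sigma> g)" for g
  note cs = rep_carrier[OF \<rho>(1)] rep_carrier[OF \<sigma>(1)]
  have "representation G (d + e) \<tau>" unfolding representation_iff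
  proof (intro conjI ballI)
    fix g h assume gh: "g \<in> carrier G" "h \<in> carrier G"
    have "\<tau> g * \<tau> h = four_block_mat (\<rho> g * \<rho> h + 0\<^sub>m d e * 0\<^sub>m e d) (\<rho> g * 0\<^sub>m d e + 0\<^sub>m d e * \<sigma> h)
       (0\<^sub>m e d * \<rho> h + \<sigma> g * 0\<^sub>m e d) (0\<^sub>m e d * 0\<^sub>m d e + \<sigma> g * \<sigma> h)"
      unfolding \<tau>_def by (rule mult_four_block_mat[of _ d d _ e _ e _ _ d _ e]) (use cs gh in auto)
    moreover have "\<rho> g * \<rho> h + 0\<^sub>m d e * 0\<^sub>m e d = \<rho> g * \<rho> h"
      "\<rho> g * 0\<^sub>m d e + 0\<^sub>m d e * \<sigma> h = 0\<^sub>m d e" "0\<^sub>m e d * \<rho> h + \<sigma> g * 0\<^sub>m e d = 0\<^sub>m e d"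
      "0\<^sub>m e d * 0\<^sub>m d e + \<sigma> g * \<sigma> h = \<sigma> g * \<sigma> h"
      using cs[OF gh(1)] cs[OF gh(2)] by (auto simp: right_mult_zero_mat[of _ d d] left_mult_zero_mat[of _ e e] right_mult_zero_mat[of _ e e] left_mult_zero_mat[of _ d d])
    ultimately show "\<tau> (g \<otimes> h) = \<tau> g * \<tau> h" by (simp add: \<tau>_def rep_mult[OF \<rho>(1)] rep_mult[OF \<sigma>(1)] gh)
  qed (use cs in \<open>auto simp: \<tau>_def rep_one[OF \<rho>(1)] rep_one[OF \<sigma>(1)] intro!: eq_matI\<close>)
  moreover have "(\<lambda>g. \<chi> g + \<psi> g) = afforded G \<tau>"
  proof
    fix g
    show "\<chi> g + \<psi> g = afforded G \<tau> g"
    proof (cases "g \<in> carrier G")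
      case True
      note c = cs(1)[OF True] cs(2)[OF True]
      have "mat_trace (\<tau> g) = (\<Sum>i<d + e. \<tau> g $$ (i, i))" using c by (simp add: mat_trace_def \<tau>_def)
      also have "\<dots> = (\<Sum>i<d. \<tau> g $$ (i, i)) + (\<Sum>i<e. \<tau> g $$ (i + d, i + d))"
        by (rule sum_lessThan_add)
      also have "\<dots> = mat_trace (\<rho> g) + mat_trace (\<sigma> g)"
        using c by (auto simp: \<tau>_def mat_trace_def intro!: sum.cong arg_cong2[of _ _ _ _ "(+)"])
      finally show ?thesis using True by (simp add: \<rho>(2) \<sigma>(2) afforded_def)
    qed (simp add: \<rho>(2) \<sigma>(2) afforded_def)
  qed
  ultimately show ?thesis unfolding is_character_def by blast
qed

lemma Irr_is_character: "\<psi> \<in> Irr G \<Longrightarrow> is_character G \<psi>"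
  unfolding Irr_def is_character_def irreducible_rep_def by blast

lemma is_character_sum_list:
  "set \<psi>s \<subseteq> Irr G \<Longrightarrow> is_character G (\<lambda>g. \<Sum>\<psi>\<leftarrow>\<psi>s. \<psi> g)"
  by (induction \<psi>s) (auto intro: is_character_zero is_character_add Irr_is_character)

section \<open>Values at inverses, Schur's lemma and orthogonality of characters\<close>

lemma adjoint_mult:
  assumes "A \<in> carrier_mat n m" "B \<in> carrier_mat m p"
  shows "mat p n (\<lambda>(i, j). cnj ((A * B) $$ (j, i))) =
    mat p m (\<lambda>(i, j). cnj (B $$ (j, i))) * mat m n (\<lambda>(i, j). cnj (A $$ (j, i)))"
proof (rule eq_matI)
  fix i j assume "i < dim_row (mat p m (\<lambda>(i, j). cnj (B $$ (j, i))) * mat m n (\<lambda>(i, j). cnj (A $$ (j, i))))"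
    "j < dim_col (mat p m (\<lambda>(i, j). cnj (B $$ (j, i))) * mat m n (\<lambda>(i, j). cnj (A $$ (j, i))))"
  then have ij: "i < p" "j < n" by auto
  show "mat p n (\<lambda>(i, j). cnj ((A * B) $$ (j, i))) $$ (i, j) =
    (mat p m (\<lambda>(i, j). cnj (B $$ (j, i))) * mat m n (\<lambda>(i, j). cnj (A $$ (j, i)))) $$ (i, j)"
    using ij by (simp add: mult_mat_index[OF assms ij(2,1)] mult_mat_index[of _ p m _ n] mult.commute del: index_mult_mat(1))
qed auto

(* Weyl's unitary trick: rho is unitary for the form H, so conjugate transposes are similar to inverses. *)
lemma trace_rep_inv:
  assumes rep: "representation G d \<rho>" and g: "g \<in> carrier G"
  shows "mat_trace (\<rho> (inv g)) = cnj (mat_trace (\<rho> g))"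
proof -
  define S where "S h = mat d d (\<lambda>(i, j). cnj (\<rho> h $$ (j, i)))" for h
  define H where "H = msum d d (\<lambda>h. S h * \<rho> h) (carrier G)"
  note c = rep_carrier[OF rep]
  have Sc: "S h \<in> carrier_mat d d" for h by (simp add: S_def)
  have Hc: "H \<in> carrier_mat d d" by (simp add: H_def)
  have Smult: "S (h \<otimes> k) = S k * S h" if "h \<in> carrier G" "k \<in> carrier G" for h k
    unfolding S_def rep_mult[OF rep that] by (rule adjoint_mult[OF c[OF that(1)] c[OF that(2)]])
  note dims = carrier_matD[OF Sc] carrier_matD[OF Hc] c[THEN carrier_matD(1)] c[THEN carrier_matD(2)]
  have "H * \<rho> g = msum d d (\<lambda>h. S h * \<rho> h * \<rho> g) (carrier G)"
    unfolding H_def by (rule msum_mult[OF c[OF g] mult_carrier_mat[OF Sc c]])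
  also have "\<dots> = msum d d (\<lambda>h. S (inv g) * (S (h \<otimes> g) * \<rho> (h \<otimes> g))) (carrier G)"
  proof (rule msum_cong[OF refl])
    fix h assume h: "h \<in> carrier G"
    have "S h = S (h \<otimes> g \<otimes> inv g)" using g h by (simp add: m_assoc)
    also have "\<dots> = S (inv g) * S (h \<otimes> g)" using g h by (intro Smult) auto
    finally have "S h = S (inv g) * S (h \<otimes> g)" .
    then show "S h * \<rho> h * \<rho> g = S (inv g) * (S (h \<otimes> g) * \<rho> (h \<otimes> g))"
      using g h by (simp add: rep_mult[OF rep] mult_assoc_dim dims)
  qed
  also have "\<dots> = msum d d (\<lambda>h. S (inv g) * (S h * \<rho> h)) (carrier G)"
    by (rule msum_reindex[symmetric, of "\<lambda>h. h \<otimes> g"], rule bij_betwI[of _ _ _ "\<lambda>h. h \<otimes> inv g"])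
       (use g in \<open>auto simp: m_assoc\<close>)
  also have "\<dots> = S (inv g) * H" unfolding H_def by (rule mult_msum[OF Sc mult_carrier_mat[OF Sc c], symmetric])
  finally have HS: "H * \<rho> g = S (inv g) * H" .
  \<comment> \<open>The hermitian form of \<open>H\<close> at \<open>v\<close> is the sum of the
    squared norms of all \<open>\<rho> h *\<^sub>v v\<close>. If it vanishes, so does the summand of
    the identity, which is the squared norm of \<open>v\<close> itself.\<close>
  have "det H \<noteq> 0"
  proof
    assume "det H = 0"
    then obtain v where v: "v \<in> carrier_vec d" "v \<noteq> 0\<^sub>v d" "H *\<^sub>v v = 0\<^sub>v d"
      using det_0_iff_vec_prod_zero_field[OF Hc] by blast
    have Hij: "H $$ (i, j) = (\<Sum>h\<in>carrier G. \<Sum>k<d. cnj (\<rho> h $$ (k, i)) * \<rho> h $$ (k, j))" if "i < d" "j < d" for i j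
      unfolding H_def using that
      by (simp del: index_mult_mat(1)) (intro sum.cong refl, subst mult_mat_index[OF Sc c], auto simp: S_def)
    have "(\<Sum>i<d. cnj (v $ i) * (H *\<^sub>v v) $ i) =
      (\<Sum>i<d. \<Sum>j<d. \<Sum>h\<in>carrier G. \<Sum>k<d. cnj (\<rho> h $$ (k, i) * v $ i) * (\<rho> h $$ (k, j) * v $ j))"
      by (intro sum.cong refl) (simp add: mult_vec_index[OF Hc v(1)] Hij sum_distrib_left sum_distrib_right mult_ac del: index_mult_mat_vec)
    also have "\<dots> = (\<Sum>h\<in>carrier G. \<Sum>k<d. \<Sum>i<d. \<Sum>j<d. cnj (\<rho> h $$ (k, i) * v $ i) * (\<rho> h $$ (k, j) * v $ j))"
      by (rule sum_swap_pairs)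
    also have "\<dots> = (\<Sum>h\<in>carrier G. \<Sum>k<d. cnj ((\<rho> h *\<^sub>v v) $ k) * (\<rho> h *\<^sub>v v) $ k)"
      by (intro sum.cong refl) (simp add: mult_vec_index[OF c v(1)] sum_product del: index_mult_mat_vec)
    also have "\<dots> = of_real (\<Sum>h\<in>carrier G. \<Sum>k<d. (cmod ((\<rho> h *\<^sub>v v) $ k))\<^sup>2)"
      unfolding of_real_sum complex_norm_square by (intro sum.cong refl mult.commute)
    finally have "(\<Sum>h\<in>carrier G. \<Sum>k<d. (cmod ((\<rho> h *\<^sub>v v) $ k))\<^sup>2) = 0"
      using v(3) by (simp del: of_real_sum)
    then have "(\<Sum>k<d. (cmod ((\<rho> \<one> *\<^sub>v v) $ k))\<^sup>2) = 0"
      by (subst (asm) sum_nonneg_eq_0_iff) (auto simp: fin intro!: sum_nonneg)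
    then have "v $ k = 0" if "k < d" for k
      using that v(1) by (simp add: rep_one[OF rep] sum_nonneg_eq_0_iff)
    then show False using v(1,2) by (auto intro!: eq_vecI)
  qed
  then have "H \<in> Units (ring_mat TYPE(complex) d ())" by (rule det_non_zero_imp_unit[OF Hc])
  then obtain K where K: "K \<in> carrier_mat d d" "K * H = 1\<^sub>m d" "H * K = 1\<^sub>m d"
    by (auto simp: Units_def ring_mat_def)
  have "S (inv g) = H * (\<rho> g * K)"
    using g arg_cong[OF HS, of "\<lambda>X. X * K"] carrier_matD[OF K(1)] by (simp add: mult_assoc_dim dims K(3) mult_one_dim)
  then have "mat_trace (S (inv g)) = mat_trace ((\<rho> g * K) * H)"
    using mat_trace_mult_comm[OF Hc mult_carrier_mat[OF c[OF g] K(1)]] by simp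
  also have "\<dots> = mat_trace (\<rho> g)"
    using g carrier_matD[OF K(1)] by (simp add: mult_assoc_dim dims K(2) mult_one_dim)
  also have "mat_trace (S (inv g)) = cnj (mat_trace (\<rho> (inv g)))"
    using c[OF inv_closed[OF g]] by (simp add: S_def mat_trace_def)
  finally show ?thesis by (metis complex_cnj_cnj)
qed

lemma character_inv:
  assumes "is_character G \<chi>" "g \<in> carrier G"
  shows "\<chi> (inv g) = cnj (\<chi> g)"
  using assms trace_rep_inv by (auto simp: is_character_def afforded_def)

text \<open>Kernel and image of an intertwiner are invariant, so a nonzero intertwiner is bijective
  and conjugates one representation into the other.\<close>

lemma schur_distinct:
  assumes \<rho>: "irreducible_rep G d \<rho>" and \<sigma>: "irreducible_rep G d' \<sigma>" and T: "T \<in> carrier_mat d d'"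
    and int: "\<And>g. g \<in> carrier G \<Longrightarrow> \<rho> g * T = T * \<sigma> g" and ne: "T \<noteq> 0\<^sub>m d d'"
  shows "afforded G \<rho> = afforded G \<sigma>"
proof -
  have r: "representation G d \<rho>" "representation G d' \<sigma>" using \<rho> \<sigma> by (auto simp: irreducible_rep_def)
  note c = rep_carrier[OF r(1)] rep_carrier[OF r(2)]
  have Tv: "\<rho> g *\<^sub>v (T *\<^sub>v v) = T *\<^sub>v (\<sigma> g *\<^sub>v v)" if "g \<in> carrier G" "v \<in> carrier_vec d'" for g v
    using arg_cong[OF int[OF that(1)], of "\<lambda>X. X *\<^sub>v v"] that c[OF that(1)] T by (simp add: mult_vec_assoc_dim)
  have T0: "T = 0\<^sub>m d d'" if "\<And>v. v \<in> carrier_vec d' \<Longrightarrow> T *\<^sub>v v = 0\<^sub>v d"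
    by (rule eq_mat_by_action[OF T]) (auto simp: that intro!: eq_vecI)
  define K where "K = {v \<in> carrier_vec d'. T *\<^sub>v v = 0\<^sub>v d}"
  have "VectorSpace.subspace class_ring K (module_vec TYPE(complex) d')"
    unfolding subspace_vec_iff K_def using T
    by (auto simp: mult_add_distrib_mat_vec[OF T] mult_mat_vec[OF T] intro!: eq_vecI)
  moreover have "\<sigma> g *\<^sub>v w \<in> K" if "g \<in> carrier G" "w \<in> K" for g w
  proof -
    have "\<rho> g *\<^sub>v 0\<^sub>v d = 0\<^sub>v d" using c[OF that(1)] by (auto intro!: eq_vecI)
    then show ?thesis using Tv[OF that(1), of w] that c[OF that(1)] by (auto simp: K_def)
  qed
  ultimately have "K = {0\<^sub>v d'} \<or> K = carrier_vec d'" using \<sigma> unfolding irreducible_rep_def by blast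
  then have K: "K = {0\<^sub>v d'}" using T0 ne by (auto simp: K_def)
  define I where "I = {T *\<^sub>v v | v. v \<in> carrier_vec d'}"
  have "VectorSpace.subspace class_ring I (module_vec TYPE(complex) d)"
    unfolding subspace_vec_iff
  proof (intro conjI ballI allI)
    show "I \<subseteq> carrier_vec d" using T by (auto simp: I_def)
    have "0\<^sub>v d = T *\<^sub>v 0\<^sub>v d'" using T by (auto intro!: eq_vecI)
    then show "0\<^sub>v d \<in> I" unfolding I_def by (intro CollectI exI[of _ "0\<^sub>v d'"]) auto
  next
    fix v w assume "v \<in> I" "w \<in> I"
    then obtain v' w' where "v' \<in> carrier_vec d'" "w' \<in> carrier_vec d'" "v = T *\<^sub>v v'" "w = T *\<^sub>v w'" by (auto simp: I_def)
    then show "v + w \<in> I" unfolding I_def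
      by (intro CollectI exI[of _ "v' + w'"]) (auto simp: mult_add_distrib_mat_vec[OF T])
  next
    fix k v assume "v \<in> I"
    then obtain v' where "v' \<in> carrier_vec d'" "v = T *\<^sub>v v'" by (auto simp: I_def)
    then show "k \<cdot>\<^sub>v v \<in> I" unfolding I_def
      by (intro CollectI exI[of _ "k \<cdot>\<^sub>v v'"]) (auto simp: mult_mat_vec[OF T])
  qed
  moreover have "\<rho> g *\<^sub>v w \<in> I" if "g \<in> carrier G" "w \<in> I" for g w
  proof -
    obtain v where "v \<in> carrier_vec d'" "w = T *\<^sub>v v" using \<open>w \<in> I\<close> unfolding I_def by blast
    then show ?thesis unfolding I_def using Tv[OF that(1)] c[OF that(1)]
      by (intro CollectI exI[of _ "\<sigma> g *\<^sub>v v"]) auto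
  qed
  ultimately have "I = {0\<^sub>v d} \<or> I = carrier_vec d" using \<rho> unfolding irreducible_rep_def by blast
  then have I: "I = carrier_vec d" using T0 ne by (auto simp: I_def)
  \<comment> \<open>Preimages of the unit vectors become the columns of a right inverse of
    \<open>T\<close>; that it is also a left inverse follows from the trivial kernel.\<close>
  have "\<forall>i. \<exists>v. i < d \<longrightarrow> v \<in> carrier_vec d' \<and> T *\<^sub>v v = unit_vec d i"
  proof
    fix i
    have "unit_vec d i \<in> I" unfolding I by simp
    then show "\<exists>v. i < d \<longrightarrow> v \<in> carrier_vec d' \<and> T *\<^sub>v v = unit_vec d i" by (auto simp: I_def)
  qed
  then obtain u where u: "\<And>i. i < d \<Longrightarrow> u i \<in> carrier_vec d' \<and> T *\<^sub>v u i = unit_vec d i" by metis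
  define S where "S = mat d' d (\<lambda>(i, j). u j $ i)"
  have Sc: "S \<in> carrier_mat d' d" by (simp add: S_def)
  have TS: "T * S = 1\<^sub>m d"
  proof (rule eq_matI)
    fix i j assume "i < dim_row (1\<^sub>m d)" "j < dim_col (1\<^sub>m d)"
    then have ij: "i < d" "j < d" by auto
    have "(T * S) $$ (i, j) = (\<Sum>k<d'. T $$ (i, k) * u j $ k)"
      unfolding mult_mat_index[OF T Sc ij] using ij by (intro sum.cong) (auto simp: S_def)
    also have "\<dots> = (T *\<^sub>v u j) $ i" using u[OF ij(2)] by (intro mult_vec_index[OF T _ ij(1), symmetric]) auto
    finally have "(T * S) $$ (i, j) = (T *\<^sub>v u j) $ i" .
    then show "(T * S) $$ (i, j) = 1\<^sub>m d $$ (i, j)"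
      using ij u[OF ij(2)] by (auto simp: unit_vec_def simp del: index_mult_mat(1) index_mult_mat_vec)
  qed (use T Sc in auto)
  have ST: "S * T = 1\<^sub>m d'"
  proof (rule eq_mat_by_action[of _ d' d'])
    fix v :: "complex vec" assume v: "v \<in> carrier_vec d'"
    define w where "w = S *\<^sub>v (T *\<^sub>v v) - v"
    have "T *\<^sub>v (S *\<^sub>v (T *\<^sub>v v)) = (T * S) *\<^sub>v (T *\<^sub>v v)" using v T Sc by (simp add: mult_vec_assoc_dim)
    also have "\<dots> = T *\<^sub>v v" using v T by (simp add: TS)
    finally have "T *\<^sub>v w = 0\<^sub>v d" unfolding w_def using v T Sc
      by (subst mult_minus_distrib_mat_vec[of _ d d']) (auto simp del: index_mult_mat_vec)
    moreover have wc: "w \<in> carrier_vec d'" unfolding w_def using v T Sc by auto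
    ultimately have "w \<in> K" unfolding K_def by blast
    then have w0: "w = 0\<^sub>v d'" using K by blast
    have "S *\<^sub>v (T *\<^sub>v v) = v"
    proof (rule eq_vecI)
      fix i assume i: "i < dim_vec v"
      have "w $ i = 0" using w0 i v by simp
      then show "(S *\<^sub>v (T *\<^sub>v v)) $ i = v $ i" using i v by (simp add: w_def del: index_mult_mat_vec)
    qed (use v Sc in auto)
    then show "S * T *\<^sub>v v = 1\<^sub>m d' *\<^sub>v v" using v T Sc by (simp add: mult_vec_assoc_dim)
  qed (use T Sc in auto)
  have "mat_trace (\<rho> g) = mat_trace (\<sigma> g)" if g: "g \<in> carrier G" for g
  proof -
    have "\<rho> g = (\<rho> g * T) * S" using c[OF g] T Sc by (simp add: mult_assoc_dim TS mult_one_dim)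
    also have "\<dots> = T * (\<sigma> g * S)" unfolding int[OF g] using c[OF g] T Sc by (simp add: mult_assoc_dim)
    finally have "mat_trace (\<rho> g) = mat_trace (T * (\<sigma> g * S))" by simp
    also have "\<dots> = mat_trace (\<sigma> g * S * T)" using c[OF g] T Sc by (intro mat_trace_mult_comm[of _ d d']) auto
    also have "\<sigma> g * S * T = \<sigma> g" using c[OF g] T Sc by (simp add: mult_assoc_dim ST mult_one_dim)
    finally show ?thesis .
  qed
  then show ?thesis by (auto simp: afforded_def)
qed

text \<open>An eigenspace of \<open>T\<close> is invariant and nonzero, hence everything. An
  eigenvalue exists because the characteristic polynomial has a complex root.\<close>

lemma schur_scalar:
  assumes \<rho>: "irreducible_rep G d \<rho>" and T: "T \<in> carrier_mat d d"
    and int: "\<And>g. g \<in> carrier G \<Longrightarrow> \<rho> g * T = T * \<rho> g"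
  obtains a where "T = a \<cdot>\<^sub>m 1\<^sub>m d"
proof -
  have r: "representation G d \<rho>" and d: "d > 0" using \<rho> by (auto simp: irreducible_rep_def)
  note c = rep_carrier[OF r]
  have "degree (char_poly T) > 0" using degree_monic_char_poly[OF T] d by simp
  then have "\<not> constant (poly (char_poly T))" by (simp add: constant_degree)
  then obtain a where "poly (char_poly T) a = 0" using fundamental_theorem_of_algebra by blast
  then have "eigenvalue T a" using eigenvalue_root_char_poly[OF T] by simp
  then obtain v where v: "v \<in> carrier_vec d" "v \<noteq> 0\<^sub>v d" "T *\<^sub>v v = a \<cdot>\<^sub>v v"
    using T by (auto simp: eigenvalue_def eigenvector_def)
  define W where "W = {w \<in> carrier_vec d. T *\<^sub>v w = a \<cdot>\<^sub>v w}"
  have "VectorSpace.subspace class_ring W (module_vec TYPE(complex) d)"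
    unfolding subspace_vec_iff W_def using T
    by (auto simp: mult_add_distrib_mat_vec[OF T] mult_mat_vec[OF T] smult_add_distrib_vec[of _ d] smult_smult_assoc mult.commute intro!: eq_vecI)
  moreover have "\<rho> g *\<^sub>v w \<in> W" if g: "g \<in> carrier G" and w: "w \<in> W" for g w
  proof -
    have wc: "w \<in> carrier_vec d" "T *\<^sub>v w = a \<cdot>\<^sub>v w" using w by (auto simp: W_def)
    have "T *\<^sub>v (\<rho> g *\<^sub>v w) = \<rho> g *\<^sub>v (T *\<^sub>v w)"
      using arg_cong[OF int[OF g], of "\<lambda>X. X *\<^sub>v w"] wc c[OF g] T by (simp add: mult_vec_assoc_dim)
    then show ?thesis using wc c[OF g] by (auto simp: W_def mult_mat_vec[OF c[OF g]])
  qed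
  ultimately have "W = {0\<^sub>v d} \<or> W = carrier_vec d" using \<rho> unfolding irreducible_rep_def by blast
  then have W: "W = carrier_vec d" using v by (auto simp: W_def)
  have "T = a \<cdot>\<^sub>m 1\<^sub>m d"
  proof (rule eq_mat_by_action[OF T])
    fix w :: "complex vec" assume w: "w \<in> carrier_vec d"
    then have "T *\<^sub>v w = a \<cdot>\<^sub>v w" using W unfolding W_def by blast
    then show "T *\<^sub>v w = (a \<cdot>\<^sub>m 1\<^sub>m d) *\<^sub>v w" using w by (simp add: smult_mat_vec[OF w, of _ d])
  qed auto
  then show ?thesis by (rule that)
qed

text \<open>Averaging a matrix unit isolates one product of matrix coefficients. The inner product
  of two characters expands into sums of such products.\<close>

lemma averaged_unit_index:
  assumes \<rho>: "representation G d \<rho>" and \<sigma>: "representation G d' \<sigma>" and i: "i < d" and j: "j < d'" and k: "k < d" and l: "l < d'"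
  shows "averaged d d' \<rho> \<sigma> (mat d d' (\<lambda>(a, b). if a = i \<and> b = j then 1 else 0)) $$ (k, l) =
    (\<Sum>g\<in>carrier G. \<rho> g $$ (k, i) * \<sigma> (inv g) $$ (j, l))"
proof -
  let ?X = "mat d d' (\<lambda>(a, b). if a = i \<and> b = j then 1 else 0) :: complex mat"
  have X: "?X \<in> carrier_mat d d'" by simp
  have "((\<rho> g * ?X) * \<sigma> (inv g)) $$ (k, l) = \<rho> g $$ (k, i) * \<sigma> (inv g) $$ (j, l)" if g: "g \<in> carrier G" for g
  proof -
    note c = rep_carrier[OF \<rho> g] rep_carrier[OF \<sigma> inv_closed[OF g]]
    have *: "(\<rho> g * ?X) $$ (k, b) = (if b = j then \<rho> g $$ (k, i) else 0)" if b: "b < d'" for b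
    proof -
      have "(\<rho> g * ?X) $$ (k, b) = (\<Sum>a<d. if a = i then (if b = j then \<rho> g $$ (k, i) else 0) else 0)"
        unfolding mult_mat_index[OF c(1) X k b] using b by (intro sum.cong) auto
      then show ?thesis using i by simp
    qed
    have "((\<rho> g * ?X) * \<sigma> (inv g)) $$ (k, l) = (\<Sum>b<d'. if b = j then \<rho> g $$ (k, i) * \<sigma> (inv g) $$ (j, l) else 0)"
      unfolding mult_mat_index[OF mult_carrier_mat[OF c(1) X] c(2) k l] using * by (intro sum.cong) auto
    then show ?thesis using j by simp
  qed
  then show ?thesis using k l unfolding averaged_def by (simp del: index_mult_mat(1))
qed

text \<open>First orthogonality relation. The averaged matrix units vanish for distinct characters;
  for equal ones they are scalar matrices, and the scalar is found from the trace.\<close>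

lemma char_inner_Irr:
  assumes \<psi>: "\<psi> \<in> Irr G" and \<phi>: "\<phi> \<in> Irr G"
  shows "char_inner (carrier G) \<psi> \<phi> = (if \<psi> = \<phi> then 1 else 0)"
proof -
  obtain d \<rho> where \<rho>: "irreducible_rep G d \<rho>" "\<psi> = afforded G \<rho>" using \<psi> by (auto simp: Irr_def)
  \<comment> \<open>If the characters agree, one representation is taken for both, so that the
    scalar form of Schur's lemma applies directly.\<close>
  obtain d' \<sigma> where \<sigma>: "irreducible_rep G d' \<sigma>" "\<phi> = afforded G \<sigma>" "\<psi> = \<phi> \<Longrightarrow> d' = d \<and> \<sigma> = \<rho>"
  proof (cases "\<psi> = \<phi>")
    case True
    then show ?thesis using that[of d \<rho>] \<rho> by auto
  next
    case False
    then show ?thesis using that \<phi> by (auto simp: Irr_def)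
  qed
  have r: "representation G d \<rho>" "representation G d' \<sigma>" using \<rho> \<sigma> by (auto simp: irreducible_rep_def)
  note c = rep_carrier[OF r(1)] rep_carrier[OF r(2)]
  let ?n = "of_nat (card (carrier G)) :: complex"
  let ?X = "\<lambda>i j. mat d d' (\<lambda>(a, b). if a = i \<and> b = j then 1 else 0) :: complex mat"
  have "(\<Sum>g\<in>carrier G. \<psi> g * cnj (\<phi> g)) = (\<Sum>g\<in>carrier G. mat_trace (\<rho> g) * mat_trace (\<sigma> (inv g)))"
    by (intro sum.cong refl) (simp add: \<rho>(2) \<sigma>(2) afforded_def trace_rep_inv[OF r(2)])
  also have "\<dots> = (\<Sum>g\<in>carrier G. \<Sum>i<d. \<Sum>j<d'. \<rho> g $$ (i, i) * \<sigma> (inv g) $$ (j, j))"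
    using c(1)[THEN carrier_matD(1)] c(2)[THEN carrier_matD(1)]
    by (intro sum.cong refl) (simp add: mat_trace_def sum_product)
  also have "\<dots> = (\<Sum>i<d. \<Sum>g\<in>carrier G. \<Sum>j<d'. \<rho> g $$ (i, i) * \<sigma> (inv g) $$ (j, j))" by (rule sum.swap)
  also have "\<dots> = (\<Sum>i<d. \<Sum>j<d'. \<Sum>g\<in>carrier G. \<rho> g $$ (i, i) * \<sigma> (inv g) $$ (j, j))"
    by (intro sum.cong refl sum.swap)
  also have "\<dots> = (\<Sum>i<d. \<Sum>j<d'. averaged d d' \<rho> \<sigma> (?X i j) $$ (i, j))"
    by (intro sum.cong refl) (simp add: averaged_unit_index[OF r])
  also have "\<dots> = (if \<psi> = \<phi> then ?n else 0)"
  proof (cases "\<psi> = \<phi>")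
    case False
    have "averaged d d' \<rho> \<sigma> X = 0\<^sub>m d d'" if "X \<in> carrier_mat d d'" for X
      using schur_distinct[OF \<rho>(1) \<sigma>(1) averaged_carrier averaged_intertwines[OF r that]] False \<rho>(2) \<sigma>(2) by blast
    then show ?thesis using False by simp
  next
    case True
    then have s: "d' = d" "\<sigma> = \<rho>" using \<sigma>(3) by auto
    have d: "d \<noteq> 0" using \<rho>(1) by (auto simp: irreducible_rep_def)
    have "averaged d d' \<rho> \<sigma> (?X i j) $$ (i, j) = (if i = j then ?n / of_nat d else 0)" if ij: "i < d" "j < d" for i j
    proof -
      have X: "?X i j \<in> carrier_mat d d" by (simp add: s)
      obtain a where a: "averaged d d \<rho> \<rho> (?X i j) = a \<cdot>\<^sub>m 1\<^sub>m d"
        using schur_scalar[OF \<rho>(1) averaged_carrier averaged_intertwines[OF r(1) r(1) X]] by blast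
      \<comment> \<open>Conjugation does not change the trace, so the averaged matrix unit has |G|
        times the trace of the unit, which is 1 on the diagonal and 0 off it.\<close>
      have "a * of_nat d = mat_trace (averaged d d \<rho> \<rho> (?X i j))" unfolding a by (simp add: mat_trace_smult[of _ d])
      also have "\<dots> = (\<Sum>g\<in>carrier G. mat_trace ((\<rho> g * ?X i j) * \<rho> (inv g)))"
        unfolding averaged_def
        by (rule mat_trace_msum, rule mult_carrier_mat[OF mult_carrier_mat[OF c(1) X] c(1)[OF inv_closed]])
      also have "\<dots> = (\<Sum>g\<in>carrier G. mat_trace (?X i j))"
      proof (rule sum.cong[OF refl])
        fix g assume g: "g \<in> carrier G"
        have "mat_trace ((\<rho> g * ?X i j) * \<rho> (inv g)) = mat_trace (\<rho> (inv g) * (\<rho> g * ?X i j))"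
          by (rule mat_trace_mult_comm[OF mult_carrier_mat[OF c(1)[OF g] X] c(1)[OF inv_closed[OF g]]])
        also have "\<rho> (inv g) * (\<rho> g * ?X i j) = (\<rho> (inv g) * \<rho> g) * ?X i j"
          by (rule assoc_mult_mat[OF c(1)[OF inv_closed[OF g]] c(1)[OF g] X, symmetric])
        also have "\<dots> = ?X i j" unfolding rep_inv[OF r(1) g] by (rule left_mult_one_mat[OF X])
        finally show "mat_trace ((\<rho> g * ?X i j) * \<rho> (inv g)) = mat_trace (?X i j)" .
      qed
      also have "mat_trace (?X i j) = (\<Sum>k<d. if k = i then (if i = j then 1 else 0) else 0)"
        unfolding mat_trace_def s by (intro sum.cong) auto
      also have "\<dots> = (if i = j then 1 else 0)" using ij by simp
      finally have "a = (if i = j then ?n / of_nat d else 0)" using d by (auto simp: field_simps)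
      then show ?thesis using ij unfolding s a[unfolded s] by simp
    qed
    then have "(\<Sum>i<d. \<Sum>j<d'. averaged d d' \<rho> \<sigma> (?X i j) $$ (i, j)) = (\<Sum>i<d. \<Sum>j<d. if i = j then ?n / of_nat d else 0)"
      unfolding s by (intro sum.cong refl) (simp add: s)
    also have "\<dots> = ?n" using d by simp
    finally show ?thesis using True by simp
  qed
  finally show ?thesis unfolding char_inner_def using card_carrier_pos by simp
qed

end

section \<open>Constituents, and the splitting of a character by type\<close>

lemma char_inner_sum_list:
  "char_inner H (\<lambda>g. \<Sum>\<psi>\<leftarrow>\<psi>s. \<psi> g) \<phi> = (\<Sum>\<psi>\<leftarrow>\<psi>s. char_inner H \<psi> \<phi>)"
  by (induction \<psi>s) (auto simp: char_inner_def distrib_right sum.distrib add_divide_distrib)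

lemma sum_list_eq_sum_count:
  fixes f :: "'b \<Rightarrow> 'c::comm_semiring_1"
  assumes "finite A" "set xs \<subseteq> A"
  shows "(\<Sum>x\<in>A. of_nat (count_list xs x) * f x) = (\<Sum>x\<leftarrow>xs. f x)"
  using assms(2)
proof (induction xs)
  case (Cons y xs)
  have "(\<Sum>x\<in>A. of_nat (count_list (y # xs) x) * f x) = (\<Sum>x\<in>A. (if x = y then f y else 0) + of_nat (count_list xs x) * f x)"
    by (intro sum.cong) (auto simp: algebra_simps)
  then show ?case using Cons assms(1) by (simp add: sum.distrib)
qed simp

context fin_group begin

lemma char_inner_sum_list_Irr:
  assumes "set \<psi>s \<subseteq> Irr G" "\<phi> \<in> Irr G"
  shows "char_inner (carrier G) (\<lambda>g. \<Sum>\<psi>\<leftarrow>\<psi>s. \<psi> g) \<phi> = of_nat (count_list \<psi>s \<phi>)"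
  using assms(1) unfolding char_inner_sum_list
  by (induction \<psi>s) (auto simp: char_inner_Irr assms(2))

lemma constituents_sum_list:
  assumes "set \<psi>s \<subseteq> Irr G"
  shows "constituents G (\<lambda>g. \<Sum>\<psi>\<leftarrow>\<psi>s. \<psi> g) = set \<psi>s"
proof (rule Set.set_eqI)
  fix \<phi>
  show "\<phi> \<in> constituents G (\<lambda>g. \<Sum>\<psi>\<leftarrow>\<psi>s. \<psi> g) \<longleftrightarrow> \<phi> \<in> set \<psi>s"
  proof (cases "\<phi> \<in> Irr G")
    case True
    then show ?thesis by (simp add: constituents_def char_inner_sum_list_Irr[OF assms True] count_list_0_iff)
  qed (use assms in \<open>auto simp: constituents_def\<close>)
qed

lemma constituent_sum_sum_list:
  assumes \<psi>s: "set \<psi>s \<subseteq> Irr G"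
  shows "constituent_sum G T (\<lambda>g. \<Sum>\<psi>\<leftarrow>\<psi>s. \<psi> g) = (\<lambda>g. \<Sum>\<psi>\<leftarrow>filter (\<lambda>\<psi>. \<psi> \<in> T) \<psi>s. \<psi> g)"
proof
  fix g
  have "constituent_sum G T (\<lambda>g. \<Sum>\<psi>\<leftarrow>\<psi>s. \<psi> g) g = (\<Sum>\<psi>\<in>set \<psi>s \<inter> T. of_nat (count_list (filter (\<lambda>\<psi>. \<psi> \<in> T) \<psi>s) \<psi>) * \<psi> g)"
    unfolding constituent_sum_def constituents_sum_list[OF \<psi>s]
  proof (rule sum.cong[OF refl])
    fix \<psi> assume "\<psi> \<in> set \<psi>s \<inter> T"
    then have "\<psi> \<in> Irr G" "\<psi> \<in> T" using \<psi>s by auto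
    then show "char_inner (carrier G) (\<lambda>g. \<Sum>\<psi>\<leftarrow>\<psi>s. \<psi> g) \<psi> * \<psi> g = of_nat (count_list (filter (\<lambda>\<psi>. \<psi> \<in> T) \<psi>s) \<psi>) * \<psi> g"
      by (simp add: char_inner_sum_list_Irr[OF \<psi>s] count_list_filter)
  qed
  also have "\<dots> = (\<Sum>\<psi>\<leftarrow>filter (\<lambda>\<psi>. \<psi> \<in> T) \<psi>s. \<psi> g)" by (rule sum_list_eq_sum_count) auto
  finally show "constituent_sum G T (\<lambda>g. \<Sum>\<psi>\<leftarrow>\<psi>s. \<psi> g) g = (\<Sum>\<psi>\<leftarrow>filter (\<lambda>\<psi>. \<psi> \<in> T) \<psi>s. \<psi> g)" .
qed

text \<open>Valid for every partition of the irreducible characters into four classes. With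
  \<open>\<chi>\<close> written as a list of irreducible characters, the parts are the sublists of
  each class. Any other splitting concatenates to a list with the same sum; filtering that list
  returns its pieces, and the result of filtering depends only on the sum.\<close>

lemma character_parts:
  fixes T :: "char_type \<Rightarrow> ('a \<Rightarrow> complex) set"
  assumes T: "\<And>t. T t \<subseteq> Irr G" "\<And>\<psi>. \<psi> \<in> Irr G \<Longrightarrow> \<exists>!t. \<psi> \<in> T t" and \<chi>: "is_character G \<chi>"
  defines "part \<equiv> \<lambda>t. constituent_sum G (T t) \<chi>"
  shows "is_character G (part t)" "constituents G (part t) \<subseteq> T t"
    "\<chi> = (\<lambda>g. part Type1 g + part Type0 g + part TypePlus g + part TypeMinus g)"
    "(\<And>t. is_character G (\<phi> t) \<and> constituents G (\<phi> t) \<subseteq> T t) \<Longrightarrow>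
      \<chi> = (\<lambda>g. \<phi> Type1 g + \<phi> Type0 g + \<phi> TypePlus g + \<phi> TypeMinus g) \<Longrightarrow> \<phi> = part"
proof -
  obtain \<psi>s where \<psi>s: "set \<psi>s \<subseteq> Irr G" "\<chi> = (\<lambda>g. \<Sum>\<psi>\<leftarrow>\<psi>s. \<psi> g)" using character_decomposition[OF \<chi>] .
  have part: "part t = (\<lambda>g. \<Sum>\<psi>\<leftarrow>filter (\<lambda>\<psi>. \<psi> \<in> T t) \<psi>s. \<psi> g)" for t
    unfolding part_def \<psi>s(2) by (rule constituent_sum_sum_list[OF \<psi>s(1)])
  have sub: "set (filter (\<lambda>\<psi>. \<psi> \<in> T t) \<psi>s) \<subseteq> Irr G" for t using \<psi>s(1) by auto
  show "is_character G (part t)" unfolding part by (rule is_character_sum_list[OF sub])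
  show "constituents G (part t) \<subseteq> T t" unfolding part constituents_sum_list[OF sub] by auto
  have ex: "\<psi> \<in> T Type1 \<and> \<psi> \<notin> T Type0 \<and> \<psi> \<notin> T TypePlus \<and> \<psi> \<notin> T TypeMinus \<or>
    \<psi> \<notin> T Type1 \<and> \<psi> \<in> T Type0 \<and> \<psi> \<notin> T TypePlus \<and> \<psi> \<notin> T TypeMinus \<or>
    \<psi> \<notin> T Type1 \<and> \<psi> \<notin> T Type0 \<and> \<psi> \<in> T TypePlus \<and> \<psi> \<notin> T TypeMinus \<or>
    \<psi> \<notin> T Type1 \<and> \<psi> \<notin> T Type0 \<and> \<psi> \<notin> T TypePlus \<and> \<psi> \<in> T TypeMinus" if "\<psi> \<in> Irr G" for \<psi>
  proof -
    obtain t where t: "\<psi> \<in> T t" "\<And>t'. \<psi> \<in> T t' \<Longrightarrow> t' = t" using T(2)[OF \<open>\<psi> \<in> Irr G\<close>] by (elim ex1E) blast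
    then have iff: "\<psi> \<in> T t' \<longleftrightarrow> t' = t" for t' by metis
    show ?thesis unfolding iff by (cases t) simp_all
  qed
  show "\<chi> = (\<lambda>g. part Type1 g + part Type0 g + part TypePlus g + part TypeMinus g)"
  proof
    fix g
    show "\<chi> g = part Type1 g + part Type0 g + part TypePlus g + part TypeMinus g"
      unfolding part \<psi>s(2) using \<psi>s(1)
    proof (induction \<psi>s)
      case (Cons \<psi> \<psi>s)
      then show ?case using ex[of \<psi>] by auto
    qed simp
  qed
  assume \<phi>: "\<And>t. is_character G (\<phi> t) \<and> constituents G (\<phi> t) \<subseteq> T t"
    and sum: "\<chi> = (\<lambda>g. \<phi> Type1 g + \<phi> Type0 g + \<phi> TypePlus g + \<phi> TypeMinus g)"
  have "\<forall>t. \<exists>\<psi>s. set \<psi>s \<subseteq> Irr G \<and> \<phi> t = (\<lambda>g. \<Sum>\<psi>\<leftarrow>\<psi>s. \<psi> g)" using \<phi> character_decomposition by metis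
  then obtain ps where ps: "\<And>t. set (ps t) \<subseteq> Irr G" "\<And>t. \<phi> t = (\<lambda>g. \<Sum>\<psi>\<leftarrow>ps t. \<psi> g)" by metis
  have pT: "set (ps t) \<subseteq> T t" for t using \<phi>[of t] constituents_sum_list[OF ps(1)[of t]] ps(2)[of t] by simp
  define L where "L = ps Type1 @ ps Type0 @ ps TypePlus @ ps TypeMinus"
  have L: "set L \<subseteq> Irr G" "\<chi> = (\<lambda>g. \<Sum>\<psi>\<leftarrow>L. \<psi> g)" using ps(1) unfolding sum ps(2) by (auto simp: L_def add.assoc)
  have filt: "filter (\<lambda>\<psi>. \<psi> \<in> T t) (ps t') = (if t = t' then ps t' else [])" for t t'
  proof (cases "t = t'")
    case True
    then show ?thesis using pT[of t'] by (auto simp: filter_id_conv)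
  next
    case False
    have "\<psi> \<notin> T t" if "\<psi> \<in> set (ps t')" for \<psi>
      using T(2)[of \<psi>] that pT[of t'] ps(1)[of t'] False by blast
    then show ?thesis using False by (auto simp: filter_empty_conv)
  qed
  have "filter (\<lambda>\<psi>. \<psi> \<in> T t) L = ps t" for t
    by (cases t) (auto simp: L_def filt)
  then have "part t = \<phi> t" for t
    unfolding part_def L(2) constituent_sum_sum_list[OF L(1)] ps(2) by simp
  then show "\<phi> = part" by auto
qed

end

section \<open>Clifford theory over an abelian normal subgroup\<close>

lemma smult_smult_mat: "a \<cdot>\<^sub>m (b \<cdot>\<^sub>m A) = (a * b :: 'a::semigroup_mult) \<cdot>\<^sub>m A"
  by (auto intro!: eq_matI simp: mult.assoc)

text \<open>The value is zero off \<open>U\<close>, as characters are stored, so that conjugates are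
  compared as functions on the whole type and the stabilizer can be stated by an equation.\<close>

definition conj_char :: "'a monoid \<Rightarrow> 'a set \<Rightarrow> 'a \<Rightarrow> ('a \<Rightarrow> complex) \<Rightarrow> 'a \<Rightarrow> complex" where
  "conj_char G U x \<kappa> = (\<lambda>g. if g \<in> U then \<kappa> (inv\<^bsub>G\<^esub> x \<otimes>\<^bsub>G\<^esub> g \<otimes>\<^bsub>G\<^esub> x) else 0)"

(* The two orthogonality relations express that Lam is the full character group of the abelian group U. *)
locale normal_with_chars = fin_group G for G :: "'a monoid" (structure) +
  fixes U :: "'a set" and Lam :: "('a \<Rightarrow> complex) set"
  assumes U_sub: "subgroup U G"
    and U_norm: "x \<in> carrier G \<Longrightarrow> u \<in> U \<Longrightarrow> inv x \<otimes> u \<otimes> x \<in> U"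
    and Lam_fin: "finite Lam"
    and Lam_mult: "\<kappa> \<in> Lam \<Longrightarrow> u \<in> U \<Longrightarrow> v \<in> U \<Longrightarrow> \<kappa> (u \<otimes> v) = \<kappa> u * \<kappa> v"
    and Lam_inv: "\<kappa> \<in> Lam \<Longrightarrow> u \<in> U \<Longrightarrow> \<kappa> (inv u) = cnj (\<kappa> u)"
    and Lam_off: "\<kappa> \<in> Lam \<Longrightarrow> g \<notin> U \<Longrightarrow> \<kappa> g = 0"
    and Lam_orth: "\<kappa> \<in> Lam \<Longrightarrow> \<mu> \<in> Lam \<Longrightarrow> (\<Sum>u\<in>U. \<kappa> u * cnj (\<mu> u)) = (if \<kappa> = \<mu> then of_nat (card U) else 0)"
    and Lam_complete: "u \<in> U \<Longrightarrow> (\<Sum>\<kappa>\<in>Lam. \<kappa> u) = (if u = \<one> then of_nat (card U) else 0)"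
    and Lam_conj: "x \<in> carrier G \<Longrightarrow> \<kappa> \<in> Lam \<Longrightarrow> conj_char G U x \<kappa> \<in> Lam"
begin

abbreviation cj :: "'a \<Rightarrow> ('a \<Rightarrow> complex) \<Rightarrow> 'a \<Rightarrow> complex" where "cj \<equiv> conj_char G U"

definition orbit :: "('a \<Rightarrow> complex) \<Rightarrow> ('a \<Rightarrow> complex) set" where
  "orbit \<kappa> = (\<lambda>x. cj x \<kappa>) ` carrier G"

text \<open>The image under \<open>\<rho>\<close> of the primitive idempotent of the group algebra
  of \<open>U\<close> that belongs to \<open>\<kappa>\<close>: the projector onto the
  \<open>\<kappa>\<close>-part of the restriction to \<open>U\<close>.\<close>

definition eproj :: "nat \<Rightarrow> ('a \<Rightarrow> complex mat) \<Rightarrow> ('a \<Rightarrow> complex) \<Rightarrow> complex mat" where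
  "eproj d \<rho> \<kappa> = msum d d (\<lambda>u. (cnj (\<kappa> u) / of_nat (card U)) \<cdot>\<^sub>m \<rho> u) U"

lemma U_carrier: "u \<in> U \<Longrightarrow> u \<in> carrier G" using subgroup.mem_carrier[OF U_sub] .
lemma U_one: "\<one> \<in> U" using subgroup.one_closed[OF U_sub] .
lemma U_mult: "u \<in> U \<Longrightarrow> v \<in> U \<Longrightarrow> u \<otimes> v \<in> U" using subgroup.m_closed[OF U_sub] .
lemma U_inv: "u \<in> U \<Longrightarrow> inv u \<in> U" using subgroup.m_inv_closed[OF U_sub] .
lemma U_fin: "finite U" using fin U_carrier by (auto intro: finite_subset)
lemma U_card: "of_nat (card U) \<noteq> (0 :: complex)" using U_fin U_one by auto

lemma Lam_one: assumes "\<kappa> \<in> Lam" shows "\<kappa> \<one> = 1"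
proof (rule ccontr)
  assume "\<kappa> \<one> \<noteq> 1"
  moreover have "\<kappa> \<one> = \<kappa> \<one> * \<kappa> \<one>" using Lam_mult[OF assms U_one U_one] by simp
  ultimately have "\<kappa> \<one> = 0" by auto
  then have "\<kappa> u = 0" if "u \<in> U" for u using Lam_mult[OF assms that U_one] U_carrier[OF that] by simp
  then show False using Lam_orth[OF assms assms] U_card by simp
qed

lemma Lam_cnj: assumes "\<kappa> \<in> Lam" "u \<in> U" shows "\<kappa> u * cnj (\<kappa> u) = 1" "cnj (\<kappa> u) * \<kappa> u = 1"
  using Lam_mult[OF assms U_inv[OF assms(2)]] Lam_inv[OF assms] Lam_one[OF assms(1)] U_carrier[OF assms(2)]
  by (simp_all add: mult.commute)

lemma cj_cj: "x \<in> carrier G \<Longrightarrow> y \<in> carrier G \<Longrightarrow> cj x (cj y \<kappa>) = cj (x \<otimes> y) \<kappa>"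
proof (rule ext)
  fix g
  assume xy: "x \<in> carrier G" "y \<in> carrier G"
  show "cj x (cj y \<kappa>) g = cj (x \<otimes> y) \<kappa> g"
  proof (cases "g \<in> U")
    case True
    have "inv y \<otimes> (inv x \<otimes> g \<otimes> x) \<otimes> y = inv (x \<otimes> y) \<otimes> g \<otimes> (x \<otimes> y)"
      using xy U_carrier[OF True] by (simp add: inv_mult_group m_assoc)
    then show ?thesis using True U_norm[OF xy(1) True] by (simp add: conj_char_def)
  qed (simp add: conj_char_def)
qed

lemma cj_one: "\<kappa> \<in> Lam \<Longrightarrow> cj \<one> \<kappa> = \<kappa>"
  by (auto simp: conj_char_def Lam_off U_carrier)

lemma orbit_Lam: "\<kappa> \<in> Lam \<Longrightarrow> orbit \<kappa> \<subseteq> Lam"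
  by (auto simp: orbit_def Lam_conj)

lemma orbit_self: "\<kappa> \<in> Lam \<Longrightarrow> \<kappa> \<in> orbit \<kappa>"
  unfolding orbit_def using cj_one by force

lemma orbit_bij:
  assumes x: "x \<in> carrier G" and \<kappa>: "\<kappa> \<in> Lam"
  shows "bij_betw (cj x) (orbit \<kappa>) (orbit \<kappa>)"
proof (rule bij_betwI[of _ _ _ "cj (inv x)"])
  have "cj z \<mu> \<in> orbit \<kappa>" if "z \<in> carrier G" "\<mu> \<in> orbit \<kappa>" for z \<mu>
    using that by (auto simp: orbit_def cj_cj)
  then show "cj x \<in> orbit \<kappa> \<rightarrow> orbit \<kappa>" "cj (inv x) \<in> orbit \<kappa> \<rightarrow> orbit \<kappa>" using x by auto
qed (use x orbit_Lam[OF \<kappa>] in \<open>auto simp: cj_cj cj_one subset_iff\<close>)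

text \<open>Orbit-stabilizer counting: the fibres of \<open>x \<mapsto> cj x \<kappa>\<close> are
  the left cosets of the stabilizer. It converts the sum over the group in the induction formula
  into a sum over the orbit.\<close>

lemma sum_over_orbit:
  assumes \<kappa>: "\<kappa> \<in> Lam"
  shows "(\<Sum>x\<in>carrier G. f (cj x \<kappa>)) = of_nat (card {x \<in> carrier G. cj x \<kappa> = \<kappa>}) * (\<Sum>\<mu>\<in>orbit \<kappa>. f \<mu> :: complex)"
proof -
  let ?S = "{x \<in> carrier G. cj x \<kappa> = \<kappa>}"
  have "(\<Sum>x\<in>carrier G. f (cj x \<kappa>)) = (\<Sum>\<mu>\<in>orbit \<kappa>. \<Sum>x\<in>{x \<in> carrier G. cj x \<kappa> = \<mu>}. f (cj x \<kappa>))"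
    unfolding orbit_def by (rule sum.image_gen[OF fin])
  also have "\<dots> = (\<Sum>\<mu>\<in>orbit \<kappa>. of_nat (card ?S) * f \<mu>)"
  proof (rule sum.cong[OF refl])
    fix \<mu> assume "\<mu> \<in> orbit \<kappa>"
    then obtain y where y: "y \<in> carrier G" "\<mu> = cj y \<kappa>" by (auto simp: orbit_def)
    have "bij_betw (\<lambda>x. y \<otimes> x) ?S {x \<in> carrier G. cj x \<kappa> = \<mu>}"
    proof (rule bij_betwI[of _ _ _ "\<lambda>x. inv y \<otimes> x"])
      show "(\<lambda>x. y \<otimes> x) \<in> ?S \<rightarrow> {x \<in> carrier G. cj x \<kappa> = \<mu>}"
        using y by (auto simp: cj_cj[symmetric])
      show "(\<lambda>x. inv y \<otimes> x) \<in> {x \<in> carrier G. cj x \<kappa> = \<mu>} \<rightarrow> ?S"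
      proof
        fix x assume "x \<in> {x \<in> carrier G. cj x \<kappa> = \<mu>}"
        then have x: "x \<in> carrier G" "cj x \<kappa> = cj y \<kappa>" using y by auto
        then have "cj (inv y \<otimes> x) \<kappa> = cj (inv y) (cj y \<kappa>)" using y by (simp add: cj_cj[symmetric])
        also have "\<dots> = \<kappa>" using y by (simp add: cj_cj cj_one \<kappa>)
        finally show "inv y \<otimes> x \<in> ?S" using x y by auto
      qed
    qed (use y in \<open>auto simp: m_assoc[symmetric]\<close>)
    then have "card {x \<in> carrier G. cj x \<kappa> = \<mu>} = card ?S" by (rule bij_betw_same_card[symmetric])
    then show "(\<Sum>x\<in>{x \<in> carrier G. cj x \<kappa> = \<mu>}. f (cj x \<kappa>)) = of_nat (card ?S) * f \<mu>" by simp
  qed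
  finally show ?thesis by (simp add: sum_distrib_left)
qed

section \<open>The isotypic projectors of \<open>U\<close> in a representation of
  \<open>G\<close>\<close>

context
  fixes d \<rho> assumes rep: "representation G d \<rho>"
begin

lemma rep_U: "u \<in> U \<Longrightarrow> \<rho> u \<in> carrier_mat d d"
  using rep_carrier[OF rep U_carrier] .

lemma eproj_carrier [simp]: "eproj d \<rho> \<kappa> \<in> carrier_mat d d"
  by (simp add: eproj_def)

lemma U_mult_eproj:
  assumes \<kappa>: "\<kappa> \<in> Lam" and v: "v \<in> U"
  shows "\<rho> v * eproj d \<rho> \<kappa> = \<kappa> v \<cdot>\<^sub>m eproj d \<rho> \<kappa>"
proof -
  let ?n = "of_nat (card U) :: complex"
  have bij: "bij_betw (\<lambda>u. v \<otimes> u) U U"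
    by (rule bij_betwI[of _ _ _ "\<lambda>u. inv v \<otimes> u"]) (use v in \<open>auto simp: m_assoc[symmetric] U_carrier U_mult U_inv\<close>)
  have "\<kappa> v \<cdot>\<^sub>m eproj d \<rho> \<kappa> = msum d d (\<lambda>u. \<kappa> v \<cdot>\<^sub>m ((cnj (\<kappa> u) / ?n) \<cdot>\<^sub>m \<rho> u)) U"
    unfolding eproj_def using rep_U by (intro smult_msum) auto
  also have "\<dots> = msum d d (\<lambda>u. \<kappa> v \<cdot>\<^sub>m ((cnj (\<kappa> (v \<otimes> u)) / ?n) \<cdot>\<^sub>m \<rho> (v \<otimes> u))) U"
    by (rule msum_reindex[OF bij])
  also have "\<dots> = msum d d (\<lambda>u. \<rho> v * ((cnj (\<kappa> u) / ?n) \<cdot>\<^sub>m \<rho> u)) U"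
  proof (rule msum_cong[OF refl])
    fix u assume u: "u \<in> U"
    have "\<kappa> v * (cnj (\<kappa> (v \<otimes> u)) / ?n) = cnj (\<kappa> u) / ?n"
      using Lam_cnj[OF \<kappa> v] by (simp add: Lam_mult[OF \<kappa> v u] mult.assoc[symmetric])
    then show "\<kappa> v \<cdot>\<^sub>m ((cnj (\<kappa> (v \<otimes> u)) / ?n) \<cdot>\<^sub>m \<rho> (v \<otimes> u)) = \<rho> v * ((cnj (\<kappa> u) / ?n) \<cdot>\<^sub>m \<rho> u)"
      unfolding smult_smult_mat rep_mult[OF rep U_carrier[OF v] U_carrier[OF u]]
      using rep_U[OF u] rep_U[OF v] by (simp only: mult_smult_distrib[of _ d d _ d])
  qed
  also have "\<dots> = \<rho> v * eproj d \<rho> \<kappa>"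
    unfolding eproj_def using rep_U v by (intro mult_msum[symmetric]) auto
  finally show ?thesis by simp
qed

lemma eproj_mult:
  assumes \<kappa>: "\<kappa> \<in> Lam" and \<mu>: "\<mu> \<in> Lam"
  shows "eproj d \<rho> \<mu> * eproj d \<rho> \<kappa> = (if \<kappa> = \<mu> then eproj d \<rho> \<kappa> else 0\<^sub>m d d)"
proof -
  let ?n = "of_nat (card U) :: complex" and ?E = "eproj d \<rho> \<kappa>"
  have "eproj d \<rho> \<mu> * ?E = msum d d (\<lambda>u. ((cnj (\<mu> u) / ?n) \<cdot>\<^sub>m \<rho> u) * ?E) U"
    unfolding eproj_def[of d \<rho> \<mu>] using rep_U by (intro msum_mult) auto
  also have "\<dots> = msum d d (\<lambda>u. (cnj (\<mu> u) / ?n * \<kappa> u) \<cdot>\<^sub>m ?E) U"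
    using rep_U by (intro msum_cong[OF refl]) (simp add: mult_smult_assoc_mat[of _ d d _ d] U_mult_eproj[OF \<kappa>] smult_smult_mat)
  also have "\<dots> = (\<Sum>u\<in>U. cnj (\<mu> u) / ?n * \<kappa> u) \<cdot>\<^sub>m ?E" by (rule msum_smult_const) simp
  also have "(\<Sum>u\<in>U. cnj (\<mu> u) / ?n * \<kappa> u) = (\<Sum>u\<in>U. \<kappa> u * cnj (\<mu> u)) / ?n"
    by (simp add: sum_divide_distrib mult.commute)
  also have "\<dots> = (if \<kappa> = \<mu> then 1 else 0)" using U_card by (simp add: Lam_orth[OF \<kappa> \<mu>])
  finally show ?thesis using carrier_matD[OF eproj_carrier[of \<kappa>]] by (auto intro!: eq_matI)
qed

text \<open>Completeness of \<open>Lam\<close> enters here: the identity is the sum of the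
  projectors, so every representation splits into its \<open>\<kappa>\<close>-parts.\<close>

lemma eproj_sum: "msum d d (eproj d \<rho>) Lam = 1\<^sub>m d"
proof -
  let ?n = "of_nat (card U) :: complex"
  have "msum d d (eproj d \<rho>) Lam = msum d d (\<lambda>u. msum d d (\<lambda>\<kappa>. (cnj (\<kappa> u) / ?n) \<cdot>\<^sub>m \<rho> u) Lam) U"
    unfolding eproj_def[abs_def] by (rule msum_swap)
  also have "\<dots> = msum d d (\<lambda>u. (if u = \<one> then 1 else 0) \<cdot>\<^sub>m \<rho> u) U"
  proof (rule msum_cong[OF refl])
    fix u assume u: "u \<in> U"
    have "(\<Sum>\<kappa>\<in>Lam. cnj (\<kappa> u) / ?n) = cnj (\<Sum>\<kappa>\<in>Lam. \<kappa> u) / ?n" by (simp add: sum_divide_distrib)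
    also have "\<dots> = (if u = \<one> then 1 else 0)" using U_card by (simp add: Lam_complete[OF u])
    finally show "msum d d (\<lambda>\<kappa>. (cnj (\<kappa> u) / ?n) \<cdot>\<^sub>m \<rho> u) Lam = (if u = \<one> then 1 else 0) \<cdot>\<^sub>m \<rho> u"
      by (simp add: msum_smult_const[OF rep_U[OF u]])
  qed
  also have "\<dots> = (if \<one> = \<one> then 1 else 0) \<cdot>\<^sub>m \<rho> \<one>"
  proof (rule msum_delta[OF U_fin U_one])
    show "(if u = \<one> then 1 else 0) \<cdot>\<^sub>m \<rho> u = 0\<^sub>m d d" if "u \<in> U" "u \<noteq> \<one>" for u
      using rep_U[OF that(1)] that(2) by (auto intro!: eq_matI)
  qed (use rep_U[OF U_one] in auto)
  also have "\<dots> = 1\<^sub>m d" by (auto simp: rep_one[OF rep] intro!: eq_matI)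
  finally show ?thesis .
qed

text \<open>Since \<open>U\<close> is normal, \<open>\<rho> x\<close> carries the part of
  \<open>\<kappa>\<close> to the part of its conjugate. All of the Clifford theory below rests on
  this relation.\<close>

lemma eproj_conj:
  assumes x: "x \<in> carrier G" and \<kappa>: "\<kappa> \<in> Lam"
  shows "\<rho> x * eproj d \<rho> \<kappa> = eproj d \<rho> (cj x \<kappa>) * \<rho> x"
proof -
  let ?n = "of_nat (card U) :: complex"
  note c = rep_carrier[OF rep x]
  have bij: "bij_betw (\<lambda>v. inv x \<otimes> v \<otimes> x) U U"
  proof (rule bij_betwI[of _ _ _ "\<lambda>u. x \<otimes> u \<otimes> inv x"])
    show "(\<lambda>u. x \<otimes> u \<otimes> inv x) \<in> U \<rightarrow> U" using U_norm[OF inv_closed[OF x]] x by auto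
  qed (use x U_norm[OF x] in \<open>auto simp: m_assoc[symmetric] U_carrier\<close>, (simp add: m_assoc U_carrier)+)
  have "\<rho> x * eproj d \<rho> \<kappa> = msum d d (\<lambda>u. \<rho> x * ((cnj (\<kappa> u) / ?n) \<cdot>\<^sub>m \<rho> u)) U"
    unfolding eproj_def using rep_U c by (intro mult_msum) auto
  also have "\<dots> = msum d d (\<lambda>v. \<rho> x * ((cnj (\<kappa> (inv x \<otimes> v \<otimes> x)) / ?n) \<cdot>\<^sub>m \<rho> (inv x \<otimes> v \<otimes> x))) U"
    by (rule msum_reindex[OF bij])
  also have "\<dots> = msum d d (\<lambda>v. ((cnj (cj x \<kappa> v) / ?n) \<cdot>\<^sub>m \<rho> v) * \<rho> x) U"
  proof (rule msum_cong[OF refl])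
    fix v assume v: "v \<in> U"
    have "\<rho> x * \<rho> (inv x \<otimes> v \<otimes> x) = \<rho> (x \<otimes> (inv x \<otimes> v \<otimes> x))"
      using x v U_carrier by (intro rep_mult[OF rep, symmetric]) auto
    also have "x \<otimes> (inv x \<otimes> v \<otimes> x) = v \<otimes> x" using x v U_carrier by (simp add: m_assoc[symmetric])
    also have "\<rho> (v \<otimes> x) = \<rho> v * \<rho> x" using x v U_carrier by (intro rep_mult[OF rep]) auto
    finally have "\<rho> x * \<rho> (inv x \<otimes> v \<otimes> x) = \<rho> v * \<rho> x" .
    then show "\<rho> x * ((cnj (\<kappa> (inv x \<otimes> v \<otimes> x)) / ?n) \<cdot>\<^sub>m \<rho> (inv x \<otimes> v \<otimes> x)) = ((cnj (cj x \<kappa> v) / ?n) \<cdot>\<^sub>m \<rho> v) * \<rho> x"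
      using c rep_U[OF v] rep_U[OF U_norm[OF x v]] v
      by (simp add: mult_smult_distrib[of _ d d _ d] mult_smult_assoc_mat[of _ d d _ d] conj_char_def)
  qed
  also have "\<dots> = eproj d \<rho> (cj x \<kappa>) * \<rho> x"
    unfolding eproj_def using rep_U c by (intro msum_mult[symmetric]) auto
  finally show ?thesis .
qed

text \<open>The rank of the projector is the multiplicity of \<open>\<kappa>\<close> in the
  restriction to \<open>U\<close>.\<close>

lemma eproj_trace: "mat_trace (eproj d \<rho> \<kappa>) = char_inner U (afforded G \<rho>) \<kappa>"
proof -
  have "mat_trace (eproj d \<rho> \<kappa>) = (\<Sum>u\<in>U. mat_trace ((cnj (\<kappa> u) / of_nat (card U)) \<cdot>\<^sub>m \<rho> u))"
    unfolding eproj_def using rep_U by (intro mat_trace_msum) auto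
  also have "\<dots> = (\<Sum>u\<in>U. mat_trace (\<rho> u) * cnj (\<kappa> u) / of_nat (card U))"
    using rep_U by (intro sum.cong refl) (simp add: mat_trace_smult[of _ d])
  finally show ?thesis by (simp add: char_inner_def afforded_def U_carrier sum_divide_distrib)
qed

lemma eproj_eq_0: "\<kappa> \<in> Lam \<Longrightarrow> char_inner U (afforded G \<rho>) \<kappa> = 0 \<Longrightarrow> eproj d \<rho> \<kappa> = 0\<^sub>m d d"
  by (rule idempotent_trace_eq_0[OF eproj_carrier]) (auto simp: eproj_mult eproj_trace)

lemma char_inner_cj:
  assumes x: "x \<in> carrier G" and \<kappa>: "\<kappa> \<in> Lam"
  shows "char_inner U (afforded G \<rho>) (cj x \<kappa>) = char_inner U (afforded G \<rho>) \<kappa>"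
proof -
  note c = rep_carrier[OF rep x] rep_carrier[OF rep inv_closed[OF x]]
  have "eproj d \<rho> (cj x \<kappa>) = eproj d \<rho> (cj x \<kappa>) * (\<rho> x * \<rho> (inv x))"
    by (simp add: rep_inv[OF rep x] right_mult_one_mat[OF eproj_carrier])
  also have "\<dots> = (\<rho> x * eproj d \<rho> \<kappa>) * \<rho> (inv x)"
    unfolding eproj_conj[OF x \<kappa>] using c carrier_matD[OF eproj_carrier] by (simp add: mult_assoc_dim)
  finally have "mat_trace (eproj d \<rho> (cj x \<kappa>)) = mat_trace (\<rho> (inv x) * (\<rho> x * eproj d \<rho> \<kappa>))"
    using mat_trace_mult_comm[OF mult_carrier_mat[OF c(1) eproj_carrier[of \<kappa>]] c(2)] by simp
  also have "\<rho> (inv x) * (\<rho> x * eproj d \<rho> \<kappa>) = (\<rho> (inv x) * \<rho> x) * eproj d \<rho> \<kappa>"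
    by (rule assoc_mult_mat[OF c(2,1) eproj_carrier, symmetric])
  also have "\<dots> = eproj d \<rho> \<kappa>" by (simp add: rep_inv[OF rep x] left_mult_one_mat[OF eproj_carrier])
  finally show ?thesis by (simp add: eproj_trace)
qed

end

text \<open>The sum of the projectors over a conjugation orbit commutes with the whole group, hence
  is 0 or 1 in an irreducible representation. A covered character in the orbit excludes 0, a covered
  one outside excludes 1.\<close>

lemma Irr_covers_one_orbit:
  assumes \<psi>: "\<psi> \<in> Irr G" and \<kappa>: "\<kappa> \<in> Lam" "char_inner U \<psi> \<kappa> \<noteq> 0" and \<mu>: "\<mu> \<in> Lam" "char_inner U \<psi> \<mu> \<noteq> 0"
  shows "\<mu> \<in> orbit \<kappa>"
proof (rule ccontr)
  assume n: "\<mu> \<notin> orbit \<kappa>"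
  obtain d \<rho> where irr: "irreducible_rep G d \<rho>" and \<psi>\<rho>: "\<psi> = afforded G \<rho>" using \<psi> by (auto simp: Irr_def)
  have rep: "representation G d \<rho>" using irr by (simp add: irreducible_rep_def)
  note ec = eproj_carrier[OF rep]
  have of: "finite (orbit \<kappa>)" using orbit_Lam[OF \<kappa>(1)] Lam_fin finite_subset by blast
  have ol: "\<nu> \<in> Lam" if "\<nu> \<in> orbit \<kappa>" for \<nu> using that orbit_Lam[OF \<kappa>(1)] by auto
  define E where "E = msum d d (eproj d \<rho>) (orbit \<kappa>)"
  have Ec: "E \<in> carrier_mat d d" by (simp add: E_def)
  have eE: "eproj d \<rho> \<nu> * E = (if \<nu> \<in> orbit \<kappa> then eproj d \<rho> \<nu> else 0\<^sub>m d d)" if \<nu>: "\<nu> \<in> Lam" for \<nu>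
  proof -
    have "eproj d \<rho> \<nu> * E = msum d d (\<lambda>\<tau>. eproj d \<rho> \<nu> * eproj d \<rho> \<tau>) (orbit \<kappa>)"
      unfolding E_def using ec by (intro mult_msum) auto
    also have "\<dots> = msum d d (\<lambda>\<tau>. if \<tau> = \<nu> then eproj d \<rho> \<nu> else 0\<^sub>m d d) (orbit \<kappa>)"
      by (rule msum_cong[OF refl]) (simp add: eproj_mult[OF rep] ol \<nu>)
    also have "\<dots> = (if \<nu> \<in> orbit \<kappa> then eproj d \<rho> \<nu> else 0\<^sub>m d d)"
    proof (cases "\<nu> \<in> orbit \<kappa>")
      case True
      then show ?thesis using msum_delta[OF of True, of "\<lambda>\<tau>. if \<tau> = \<nu> then eproj d \<rho> \<nu> else 0\<^sub>m d d" d d] ec by simp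
    next
      case False
      then have "msum d d (\<lambda>\<tau>. if \<tau> = \<nu> then eproj d \<rho> \<nu> else 0\<^sub>m d d) (orbit \<kappa>) = msum d d (\<lambda>\<tau>. 0\<^sub>m d d) (orbit \<kappa>)"
        by (intro msum_cong) auto
      also have "\<dots> = 0\<^sub>m d d" by (intro eq_matI) auto
      finally show ?thesis using False by simp
    qed
    finally show ?thesis .
  qed
  have "E * E = msum d d (\<lambda>\<nu>. eproj d \<rho> \<nu> * E) (orbit \<kappa>)"
    unfolding E_def using ec by (intro msum_mult) auto
  also have "\<dots> = E" unfolding E_def by (rule msum_cong[OF refl]) (simp add: eE[unfolded E_def] ol)
  finally have EE: "E * E = E" .
  have comm: "\<rho> g * E = E * \<rho> g" if g: "g \<in> carrier G" for g
  proof -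
    have "\<rho> g * E = msum d d (\<lambda>\<nu>. \<rho> g * eproj d \<rho> \<nu>) (orbit \<kappa>)"
      unfolding E_def using ec rep_carrier[OF rep g] by (intro mult_msum) auto
    also have "\<dots> = msum d d (\<lambda>\<nu>. eproj d \<rho> (cj g \<nu>) * \<rho> g) (orbit \<kappa>)"
      by (rule msum_cong[OF refl]) (simp add: eproj_conj[OF rep g] ol)
    also have "\<dots> = msum d d (\<lambda>\<nu>. eproj d \<rho> \<nu> * \<rho> g) (orbit \<kappa>)"
      by (rule msum_reindex[OF orbit_bij[OF g \<kappa>(1)], symmetric])
    also have "\<dots> = E * \<rho> g"
      unfolding E_def using ec rep_carrier[OF rep g] by (intro msum_mult[symmetric]) auto
    finally show ?thesis .
  qed
  have "mat_trace (eproj d \<rho> \<kappa>) \<noteq> 0" "mat_trace (eproj d \<rho> \<mu>) \<noteq> 0"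
    using \<kappa>(2) \<mu>(2) by (simp_all add: eproj_trace[OF rep] \<psi>\<rho>)
  then have ne: "eproj d \<rho> \<kappa> \<noteq> 0\<^sub>m d d" "eproj d \<rho> \<mu> \<noteq> 0\<^sub>m d d" by auto
  from irreducible_idempotent[OF irr Ec EE comm] show False
  proof
    assume "E = 0\<^sub>m d d"
    then show False using eE[OF \<kappa>(1)] orbit_self[OF \<kappa>(1)] ne(1) ec[of \<kappa>] by (simp add: right_mult_zero_mat[of _ d d])
  next
    assume "E = 1\<^sub>m d"
    then show False using eE[OF \<mu>(1)] n ne(2) ec[of \<mu>] by (simp add: right_mult_one_mat[of _ d d])
  qed
qed

lemma Irr_covers_some:
  assumes \<psi>: "\<psi> \<in> Irr G"
  obtains \<kappa> where "\<kappa> \<in> Lam" "char_inner U \<psi> \<kappa> \<noteq> 0"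
proof (rule ccontr)
  assume a: "\<not> thesis"
  obtain d \<rho> where irr: "irreducible_rep G d \<rho>" and \<psi>\<rho>: "\<psi> = afforded G \<rho>" using \<psi> by (auto simp: Irr_def)
  have rep: "representation G d \<rho>" and d: "d \<noteq> 0" using irr by (auto simp: irreducible_rep_def)
  have "eproj d \<rho> \<kappa> = 0\<^sub>m d d" if "\<kappa> \<in> Lam" for \<kappa>
    using a that eproj_eq_0[OF rep that] that \<open>\<And>\<kappa>. \<kappa> \<in> Lam \<Longrightarrow> _ \<Longrightarrow> thesis\<close> \<psi>\<rho> by blast
  then have "msum d d (eproj d \<rho>) Lam = msum d d (\<lambda>\<kappa>. 0\<^sub>m d d) Lam" by (intro msum_cong) auto
  then have "1\<^sub>m d $$ (0, 0) = (0 :: complex)" using d unfolding eproj_sum[OF rep] by simp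
  then show False using d by simp
qed

section \<open>Induction from a split inertia group\<close>

lemma semidirect_unique:
  assumes K: "K \<subseteq> carrier G" "subgroup K G" "U \<inter> K = {\<one>}"
    and u: "u \<in> U" "u' \<in> U" and k: "k \<in> K" "k' \<in> K" and eq: "u \<otimes> k = u' \<otimes> k'"
  shows "u = u' \<and> k = k'"
proof -
  have c: "u \<in> carrier G" "u' \<in> carrier G" "k \<in> carrier G" "k' \<in> carrier G" using K u k U_carrier by auto
  have "inv u' \<otimes> u = inv u' \<otimes> (u \<otimes> k) \<otimes> inv k" using c by (simp add: m_assoc)
  also have "\<dots> = k' \<otimes> inv k" unfolding eq using c by (simp add: m_assoc[symmetric])
  finally have e: "inv u' \<otimes> u = k' \<otimes> inv k" .
  moreover have "inv u' \<otimes> u \<in> U" "k' \<otimes> inv k \<in> K"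
    using u k U_inv U_mult subgroup.m_closed[OF K(2)] subgroup.m_inv_closed[OF K(2)] by auto
  ultimately have "inv u' \<otimes> u = \<one>" "k' \<otimes> inv k = \<one>" using K(3) by auto
  then show ?thesis using c by (metis inv_equality inv_inv inv_closed r_cancel_one' l_inv r_inv l_cancel_one m_assoc r_one)
qed

lemma extended_semidirect:
  assumes K: "K \<subseteq> carrier G" "subgroup K G" "U \<inter> K = {\<one>}" and u: "u \<in> U" and k: "k \<in> K"
  shows "extended G U K \<kappa> (u \<otimes> k) = \<kappa> u" "inflated G U K \<theta> (u \<otimes> k) = \<theta> k"
proof -
  have mem: "u \<otimes> k \<in> U <#> K" using u k by (auto simp: set_mult_def)
  have "(THE u'. u' \<in> U \<and> (\<exists>k'\<in>K. u \<otimes> k = u' \<otimes> k')) = u"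
    using semidirect_unique[OF K u _ k] u k by (intro the_equality) blast+
  then show "extended G U K \<kappa> (u \<otimes> k) = \<kappa> u" using mem by (simp add: extended_def)
  have "(THE k'. k' \<in> K \<and> (\<exists>u'\<in>U. u \<otimes> k = u' \<otimes> k')) = k"
    using semidirect_unique[OF K u _ k] u k by (intro the_equality) blast+
  then show "inflated G U K \<theta> (u \<otimes> k) = \<theta> k" using mem by (simp add: inflated_def)
qed

text \<open>All conjugates of \<open>u\<close> stay in the normal subgroup \<open>U\<close>, where
  the inflated label is constantly \<open>\<theta> \<one>\<close>. What remains is the sum of
  \<open>cj x \<kappa> u\<close> over the group, and the order of the stabilizer cancels against the
  denominator of the induction formula.\<close>

lemma induced_value_on_U:
  assumes \<kappa>: "\<kappa> \<in> Lam" and K: "subgroup K G" "U \<inter> K = {\<one>}"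
    and stab: "{x \<in> carrier G. cj x \<kappa> = \<kappa>} = U <#> K" and u: "u \<in> U"
  shows "induced G (U <#> K) (\<lambda>g. extended G U K \<kappa> g * inflated G U K \<theta> g) u = (\<Sum>\<mu>\<in>orbit \<kappa>. \<mu> u) * \<theta> \<one>"
proof -
  have Kc: "K \<subseteq> carrier G" by (rule subgroup.subset[OF K(1)])
  have one: "\<one> \<in> K" by (rule subgroup.one_closed[OF K(1)])
  define h where "h x = inv x \<otimes> u \<otimes> x" for x
  have "\<one> \<in> U <#> K" using one U_one by (force simp: set_mult_def)
  then have cd: "of_nat (card (U <#> K)) \<noteq> (0 :: complex)"
    using fin stab by (auto simp: card_eq_0_iff dest: finite_subset[rotated] intro: finite_subset[of _ "carrier G"])
  have "(if h x \<in> U <#> K then extended G U K \<kappa> (h x) * inflated G U K \<theta> (h x) else 0) = cj x \<kappa> u * \<theta> \<one>" if x: "x \<in> carrier G" for x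
  proof -
    have hU: "h x \<in> U" unfolding h_def by (rule U_norm[OF x u])
    have 1: "h x = h x \<otimes> \<one>" using U_carrier[OF hU] by simp
    then have "h x \<in> U <#> K" using hU one by (force simp: set_mult_def)
    moreover have "extended G U K \<kappa> (h x) = \<kappa> (h x)" "inflated G U K \<theta> (h x) = \<theta> \<one>"
      using extended_semidirect[OF Kc K hU one] 1 by simp_all
    ultimately show ?thesis using u by (simp add: conj_char_def h_def)
  qed
  then have "induced G (U <#> K) (\<lambda>g. extended G U K \<kappa> g * inflated G U K \<theta> g) u
    = (\<Sum>x\<in>carrier G. cj x \<kappa> u * \<theta> \<one>) / of_nat (card (U <#> K))"
    using U_carrier[OF u] unfolding induced_def h_def by simp
  also have "\<dots> = (\<Sum>\<mu>\<in>orbit \<kappa>. \<mu> u) * \<theta> \<one>"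
    using cd by (simp add: sum_distrib_right[symmetric] sum_over_orbit[OF \<kappa>, of "\<lambda>\<mu>. \<mu> u"] stab)
  finally show ?thesis .
qed

text \<open>Insert the identity as the sum of the projectors into the trace of
  \<open>\<rho> g\<close>. Only projectors in the orbit of \<open>\<kappa>\<close> survive, and the
  term of \<open>cj x \<kappa>\<close> equals \<open>F\<close> at the conjugate of \<open>g\<close>
  by \<open>x\<close>, where \<open>F h\<close> is the trace of \<open>\<rho> h\<close> on the part
  of \<open>\<kappa>\<close>. Since \<open>F\<close> is supported on the inertia group and factors
  there as \<open>\<kappa> u * \<theta> k\<close>, the result is literally the induction
  formula.\<close>

lemma clifford_induced:
  assumes rep: "representation G d \<rho>" and \<kappa>: "\<kappa> \<in> Lam" and K: "subgroup K G" "U \<inter> K = {\<one>}"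
    and stab: "{x \<in> carrier G. cj x \<kappa> = \<kappa>} = U <#> K"
    and off: "\<And>\<mu>. \<mu> \<in> Lam \<Longrightarrow> \<mu> \<notin> orbit \<kappa> \<Longrightarrow> char_inner U (afforded G \<rho>) \<mu> = 0"
  obtains \<theta> where "is_character (G\<lparr>carrier := K\<rparr>) \<theta>"
    "afforded G \<rho> = induced G (U <#> K) (\<lambda>g. extended G U K \<kappa> g * inflated G U K \<theta> g)"
proof -
  have Kc: "K \<subseteq> carrier G" by (rule subgroup.subset[OF K(1)])
  have one: "\<one> \<in> K" by (rule subgroup.one_closed[OF K(1)])
  note c = rep_carrier[OF rep]
  note ec = eproj_carrier[OF rep]
  define e where "e = eproj d \<rho>"
  have ec: "e \<mu> \<in> carrier_mat d d" for \<mu> unfolding e_def by (rule ec)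
  define F where "F h = mat_trace (\<rho> h * e \<kappa>)" for h
  define \<theta> where "\<theta> k = (if k \<in> K then F k else 0)" for k
  interpret KG: fin_group "G\<lparr>carrier := K\<rparr>"
    using subgroup.subgroup_is_group[OF K(1) is_group] finite_subset[OF Kc fin]
    by (simp add: fin_group_def fin_group_axioms_def)
  have Kstab: "cj k \<kappa> = \<kappa>" if "k \<in> K" for k
  proof -
    have "k \<in> U <#> K" using that U_one Kc by (force simp: set_mult_def)
    then show ?thesis using stab by blast
  qed
  have repK: "representation (G\<lparr>carrier := K\<rparr>) d \<rho>"
    using rep Kc unfolding KG.representation_iff representation_iff by auto
  have comm: "\<rho> k * e \<kappa> = e \<kappa> * \<rho> k" if "k \<in> K" for k
    unfolding e_def using eproj_conj[OF rep _ \<kappa>, of k] Kstab[OF that] that Kc by auto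
  have idem: "e \<kappa> * e \<kappa> = e \<kappa>" unfolding e_def by (simp add: eproj_mult[OF rep \<kappa> \<kappa>])
  have comm': "\<rho> k * e \<kappa> = e \<kappa> * \<rho> k" if "k \<in> carrier (G\<lparr>carrier := K\<rparr>)" for k
    using comm that by simp
  obtain r \<sigma> where \<sigma>: "representation (G\<lparr>carrier := K\<rparr>) r \<sigma>"
    "\<And>k. k \<in> carrier (G\<lparr>carrier := K\<rparr>) \<Longrightarrow> mat_trace (\<sigma> k) = mat_trace (\<rho> k * e \<kappa>)"
  proof (rule KG.rep_compress[OF repK ec idem comm'])
    fix r \<sigma> assume 1: "representation (G\<lparr>carrier := K\<rparr>) r \<sigma>" "of_nat r = mat_trace (e \<kappa>)"
      and 2: "\<And>g. g \<in> carrier (G\<lparr>carrier := K\<rparr>) \<Longrightarrow> mat_trace (\<sigma> g) = mat_trace (\<rho> g * e \<kappa>)"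
    show thesis by (rule that[OF 1(1)]) (rule 2)
  qed
  have "\<theta> = afforded (G\<lparr>carrier := K\<rparr>) \<sigma>"
    using \<sigma>(2) by (auto simp: \<theta>_def F_def afforded_def)
  then have char: "is_character (G\<lparr>carrier := K\<rparr>) \<theta>" using \<sigma>(1) unfolding is_character_def by blast
  have of: "finite (orbit \<kappa>)" using orbit_Lam[OF \<kappa>] Lam_fin finite_subset by blast
  have tr_conj: "mat_trace (\<rho> g * e (cj x \<kappa>)) = F (inv x \<otimes> g \<otimes> x)" if g: "g \<in> carrier G" and x: "x \<in> carrier G" for g x
  proof -
    note xi = inv_closed[OF x]
    have "\<rho> g * e (cj x \<kappa>) = \<rho> g * (e (cj x \<kappa>) * (\<rho> x * \<rho> (inv x)))"
      by (simp add: rep_inv[OF rep x] right_mult_one_mat[OF ec])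
    also have "e (cj x \<kappa>) * (\<rho> x * \<rho> (inv x)) = (\<rho> x * e \<kappa>) * \<rho> (inv x)"
      unfolding e_def eproj_conj[OF rep x \<kappa>] by (rule assoc_mult_mat[OF eproj_carrier[OF rep] c[OF x] c[OF xi], symmetric])
    also have "\<rho> g * ((\<rho> x * e \<kappa>) * \<rho> (inv x)) = (\<rho> g * (\<rho> x * e \<kappa>)) * \<rho> (inv x)"
      by (rule assoc_mult_mat[OF c[OF g] mult_carrier_mat[OF c[OF x] ec] c[OF xi], symmetric])
    finally have "mat_trace (\<rho> g * e (cj x \<kappa>)) = mat_trace (\<rho> (inv x) * (\<rho> g * (\<rho> x * e \<kappa>)))"
      using mat_trace_mult_comm[OF mult_carrier_mat[OF c[OF g] mult_carrier_mat[OF c[OF x] ec]] c[OF xi], of \<kappa>] by simp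
    also have "\<rho> (inv x) * (\<rho> g * (\<rho> x * e \<kappa>)) = \<rho> (inv x \<otimes> g \<otimes> x) * e \<kappa>"
      using g x c[OF x, THEN carrier_matD(1)] c[OF x, THEN carrier_matD(2)] c[OF g, THEN carrier_matD(1)] c[OF g, THEN carrier_matD(2)]
        c[OF xi, THEN carrier_matD(1)] c[OF xi, THEN carrier_matD(2)] carrier_matD[OF ec]
      by (simp add: rep_mult[OF rep] mult_assoc_dim)
    finally show ?thesis by (simp add: F_def)
  qed
  \<comment> \<open>Outside the stabilizer the idempotents of \<open>\<kappa>\<close> and of
    \<open>cj h \<kappa>\<close> are orthogonal. Doubling the idempotent inside the trace and
    cycling one copy past \<open>\<rho> h\<close> brings them together.\<close>
  have F0: "F h = 0" if h: "h \<in> carrier G" and ns: "h \<notin> U <#> K" for h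
  proof -
    have ne: "cj h \<kappa> \<noteq> \<kappa>" using h ns stab by blast
    have "F h = mat_trace ((\<rho> h * e \<kappa>) * e \<kappa>)"
      unfolding F_def using assoc_mult_mat[OF c[OF h] ec ec, of \<kappa> \<kappa>] idem by simp
    also have "\<dots> = mat_trace (e \<kappa> * (\<rho> h * e \<kappa>))"
      by (rule mat_trace_mult_comm[OF mult_carrier_mat[OF c[OF h] ec] ec])
    also have "e \<kappa> * (\<rho> h * e \<kappa>) = e \<kappa> * (e (cj h \<kappa>) * \<rho> h)"
      unfolding e_def by (simp add: eproj_conj[OF rep h \<kappa>])
    also have "\<dots> = (e \<kappa> * e (cj h \<kappa>)) * \<rho> h" by (rule assoc_mult_mat[OF ec ec c[OF h], symmetric])
    also have "e \<kappa> * e (cj h \<kappa>) = 0\<^sub>m d d" unfolding e_def using ne by (simp add: eproj_mult[OF rep Lam_conj[OF h \<kappa>] \<kappa>])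
    finally show ?thesis using c[OF h] by (simp add: left_mult_zero_mat[of _ d d])
  qed
  have FUK: "F (u \<otimes> k) = \<kappa> u * \<theta> k" if u: "u \<in> U" and k: "k \<in> K" for u k
  proof -
    have kc: "k \<in> carrier G" using k Kc by auto
    have "\<rho> (u \<otimes> k) * e \<kappa> = \<rho> u * (\<rho> k * e \<kappa>)"
      unfolding rep_mult[OF rep U_carrier[OF u] kc] by (rule assoc_mult_mat[OF c[OF U_carrier[OF u]] c[OF kc] ec])
    also have "\<dots> = (\<rho> u * e \<kappa>) * \<rho> k"
      unfolding comm[OF k] by (rule assoc_mult_mat[OF c[OF U_carrier[OF u]] ec c[OF kc], symmetric])
    also have "\<dots> = \<kappa> u \<cdot>\<^sub>m (\<rho> k * e \<kappa>)"
      unfolding e_def U_mult_eproj[OF rep \<kappa> u] comm[OF k, unfolded e_def]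
      by (rule mult_smult_assoc_mat[OF eproj_carrier[OF rep] c[OF kc]])
    finally show ?thesis using k mult_carrier_mat[OF c[OF kc] ec[of \<kappa>]] by (simp add: F_def \<theta>_def mat_trace_smult[of _ d])
  qed
  have "\<one> \<in> U <#> K" using one U_one by (force simp: set_mult_def)
  then have cd: "of_nat (card (U <#> K)) \<noteq> (0 :: complex)"
    using fin stab by (auto simp: card_eq_0_iff dest: finite_subset[rotated] intro: finite_subset[of _ "carrier G"])
  have main: "mat_trace (\<rho> g) = (\<Sum>x\<in>carrier G. if inv x \<otimes> g \<otimes> x \<in> U <#> K
      then extended G U K \<kappa> (inv x \<otimes> g \<otimes> x) * inflated G U K \<theta> (inv x \<otimes> g \<otimes> x) else 0) / of_nat (card (U <#> K))"
    if g: "g \<in> carrier G" for g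
  proof -
    have "mat_trace (\<rho> g) = mat_trace (\<rho> g * msum d d e Lam)"
      unfolding e_def eproj_sum[OF rep] using right_mult_one_mat[OF c[OF g]] by simp
    also have "\<rho> g * msum d d e Lam = msum d d (\<lambda>\<mu>. \<rho> g * e \<mu>) Lam" by (rule mult_msum[OF c[OF g] ec])
    also have "mat_trace \<dots> = (\<Sum>\<mu>\<in>Lam. mat_trace (\<rho> g * e \<mu>))"
      by (rule mat_trace_msum[OF mult_carrier_mat[OF c[OF g] ec]])
    also have "\<dots> = (\<Sum>\<mu>\<in>orbit \<kappa>. mat_trace (\<rho> g * e \<mu>))"
    proof (rule sum.mono_neutral_right[OF Lam_fin orbit_Lam[OF \<kappa>]], rule ballI)
      fix \<mu> assume "\<mu> \<in> Lam - orbit \<kappa>"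
      then have "e \<mu> = 0\<^sub>m d d" unfolding e_def using off by (intro eproj_eq_0[OF rep]) auto
      then show "mat_trace (\<rho> g * e \<mu>) = 0" using c[OF g] by (simp add: right_mult_zero_mat[of _ d d])
    qed
    also have "\<dots> = (\<Sum>x\<in>carrier G. mat_trace (\<rho> g * e (cj x \<kappa>))) / of_nat (card (U <#> K))"
      using cd by (simp add: sum_over_orbit[OF \<kappa>, of "\<lambda>\<mu>. mat_trace (\<rho> g * e \<mu>)"] stab)
    also have "(\<Sum>x\<in>carrier G. mat_trace (\<rho> g * e (cj x \<kappa>))) = (\<Sum>x\<in>carrier G. if inv x \<otimes> g \<otimes> x \<in> U <#> K
      then extended G U K \<kappa> (inv x \<otimes> g \<otimes> x) * inflated G U K \<theta> (inv x \<otimes> g \<otimes> x) else 0)"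
    proof (rule sum.cong[OF refl])
      fix x assume x: "x \<in> carrier G"
      let ?h = "inv x \<otimes> g \<otimes> x"
      have "F ?h = (if ?h \<in> U <#> K then extended G U K \<kappa> ?h * inflated G U K \<theta> ?h else 0)"
      proof (cases "?h \<in> U <#> K")
        case True
        then obtain u k where uk: "u \<in> U" "k \<in> K" "?h = u \<otimes> k" by (auto simp: set_mult_def)
        show ?thesis using True unfolding uk(3) FUK[OF uk(1,2)] extended_semidirect[OF Kc K uk(1,2)] by simp
      next
        case False
        then show ?thesis using F0[of ?h] g x by simp
      qed
      then show "mat_trace (\<rho> g * e (cj x \<kappa>)) = (if ?h \<in> U <#> K then extended G U K \<kappa> ?h * inflated G U K \<theta> ?h else 0)"
        unfolding tr_conj[OF g x] .
    qed
    finally show ?thesis .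
  qed
  have "afforded G \<rho> = induced G (U <#> K) (\<lambda>g. extended G U K \<kappa> g * inflated G U K \<theta> g)"
    by (rule ext) (simp add: afforded_def induced_def main)
  then show ?thesis using that char by blast
qed

text \<open>Only one projector is nonzero, so it is the identity, and \<open>U\<close> acts through
  the trivial character.\<close>

lemma trivial_on_U:
  assumes rep: "representation G d \<rho>" and \<kappa>: "\<kappa> \<in> Lam" and triv: "\<And>u. u \<in> U \<Longrightarrow> \<kappa> u = 1"
    and off: "\<And>\<mu>. \<mu> \<in> Lam \<Longrightarrow> \<mu> \<noteq> \<kappa> \<Longrightarrow> char_inner U (afforded G \<rho>) \<mu> = 0" and u: "u \<in> U"
  shows "\<rho> u = 1\<^sub>m d"
proof -
  have "eproj d \<rho> \<mu> = 0\<^sub>m d d" if "\<mu> \<in> Lam" "\<mu> \<noteq> \<kappa>" for \<mu>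
    using that off by (intro eproj_eq_0[OF rep]) auto
  then have "msum d d (eproj d \<rho>) Lam = eproj d \<rho> \<kappa>"
    by (intro msum_delta[OF Lam_fin \<kappa>] eproj_carrier[OF rep]) auto
  then have e: "eproj d \<rho> \<kappa> = 1\<^sub>m d" unfolding eproj_sum[OF rep] by simp
  have "\<rho> u = \<rho> u * eproj d \<rho> \<kappa>" unfolding e using right_mult_one_mat[OF rep_U[OF rep u]] by simp
  also have "\<dots> = \<kappa> u \<cdot>\<^sub>m eproj d \<rho> \<kappa>" by (rule U_mult_eproj[OF rep \<kappa> u])
  also have "\<dots> = 1\<^sub>m d" unfolding triv[OF u] e by (auto intro!: eq_matI)
  finally show ?thesis .
qed

text \<open>The counterpart of \<open>clifford_induced\<close> for type 1: the orbit is a single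
  point, and the label is the restriction to the complement.\<close>

lemma inflated_from_complement:
  assumes rep: "representation G d \<rho>" and \<kappa>: "\<kappa> \<in> Lam" "\<And>u. u \<in> U \<Longrightarrow> \<kappa> u = 1"
    and off: "\<And>\<mu>. \<mu> \<in> Lam \<Longrightarrow> \<mu> \<noteq> \<kappa> \<Longrightarrow> char_inner U (afforded G \<rho>) \<mu> = 0"
    and K: "subgroup K G" "U \<inter> K = {\<one>}" "U <#> K = carrier G"
  obtains \<theta> where "is_character (G\<lparr>carrier := K\<rparr>) \<theta>" "afforded G \<rho> = inflated G U K \<theta>"
proof -
  have Kc: "K \<subseteq> carrier G" by (rule subgroup.subset[OF K(1)])
  interpret KG: fin_group "G\<lparr>carrier := K\<rparr>"
    using subgroup.subgroup_is_group[OF K(1) is_group] finite_subset[OF Kc fin]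
    by (simp add: fin_group_def fin_group_axioms_def)
  have repK: "representation (G\<lparr>carrier := K\<rparr>) d \<rho>"
    using rep Kc unfolding KG.representation_iff representation_iff by auto
  have "afforded G \<rho> g = inflated G U K (afforded (G\<lparr>carrier := K\<rparr>) \<rho>) g" for g
  proof (cases "g \<in> carrier G")
    case True
    then have "g \<in> U <#> K" by (simp add: K(3))
    then obtain u k where uk: "u \<in> U" "k \<in> K" "g = u \<otimes> k" by (auto simp: set_mult_def)
    have kc: "k \<in> carrier G" using uk(2) Kc by auto
    have \<rho>u: "\<rho> u = 1\<^sub>m d" by (rule trivial_on_U[OF rep \<kappa> off uk(1)])
    have "\<rho> g = \<rho> k"
      unfolding uk(3) rep_mult[OF rep U_carrier[OF uk(1)] kc] \<rho>u
      by (rule left_mult_one_mat[OF rep_carrier[OF rep kc]])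
    then show ?thesis using True uk(2) unfolding uk(3) extended_semidirect[OF Kc K(1,2) uk(1,2)] by (simp add: afforded_def)
  next
    case False
    then show ?thesis using K(3) by (simp add: afforded_def inflated_def)
  qed
  then show ?thesis using that[of "afforded (G\<lparr>carrier := K\<rparr>) \<rho>"] repK unfolding is_character_def by blast
qed

lemma inflated_value_on_U:
  assumes K: "subgroup K G" "U \<inter> K = {\<one>}" and u: "u \<in> U"
  shows "inflated G U K \<theta> u = \<theta> \<one>"
  using extended_semidirect(2)[OF subgroup.subset[OF K(1)] K u subgroup.one_closed[OF K(1)]] U_carrier[OF u] by simp

text \<open>Translates the kernel condition that defines type 1 into covering the trivial character,
  so that all four types are described in the same way.\<close>

lemma Irr_trivial_on_U_iff:
  assumes \<psi>: "\<psi> \<in> Irr G" and \<kappa>: "\<kappa> \<in> Lam" "\<And>u. u \<in> U \<Longrightarrow> \<kappa> u = 1"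
  shows "(\<forall>u\<in>U. \<psi> u = \<psi> \<one>) \<longleftrightarrow> char_inner U \<psi> \<kappa> \<noteq> 0"
proof -
  obtain d \<rho> where irr: "irreducible_rep G d \<rho>" and \<psi>\<rho>: "\<psi> = afforded G \<rho>" using \<psi> by (auto simp: Irr_def)
  have rep: "representation G d \<rho>" and d: "d \<noteq> 0" using irr by (auto simp: irreducible_rep_def)
  have orb: "orbit \<kappa> = {\<kappa>}"
  proof -
    have "cj x \<kappa> = \<kappa>" if "x \<in> carrier G" for x
      by (rule ext) (auto simp: conj_char_def \<kappa>(2) U_norm that Lam_off[OF \<kappa>(1)])
    then show ?thesis unfolding orbit_def using one_closed by force
  qed
  show ?thesis
  proof
    assume a: "\<forall>u\<in>U. \<psi> u = \<psi> \<one>"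
    have "char_inner U \<psi> \<kappa> = (\<Sum>u\<in>U. \<psi> \<one>) / of_nat (card U)"
      unfolding char_inner_def using a \<kappa>(2) by (intro arg_cong2[of _ _ _ _ "(/)"] sum.cong) auto
    also have "\<dots> = of_nat d" using U_card by (simp add: \<psi>\<rho> afforded_def rep_one[OF rep])
    finally show "char_inner U \<psi> \<kappa> \<noteq> 0" using d by simp
  next
    assume a: "char_inner U \<psi> \<kappa> \<noteq> 0"
    have off: "char_inner U (afforded G \<rho>) \<mu> = 0" if "\<mu> \<in> Lam" "\<mu> \<noteq> \<kappa>" for \<mu>
      using Irr_covers_one_orbit[OF \<psi> \<kappa>(1) a that(1)] orb that(2) \<psi>\<rho> by auto
    show "\<forall>u\<in>U. \<psi> u = \<psi> \<one>"
    proof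
      fix u assume u: "u \<in> U"
      have "\<rho> u = 1\<^sub>m d" by (rule trivial_on_U[OF rep \<kappa> off u])
      then show "\<psi> u = \<psi> \<one>" by (simp add: \<psi>\<rho> afforded_def U_carrier[OF u] rep_one[OF rep])
    qed
  qed
qed

end

section \<open>Parity of the field, and finiteness of vector and matrix spaces\<close>

lemma even_card_involution:
  assumes "finite A" "\<And>x. x \<in> A \<Longrightarrow> f x \<in> A" "\<And>x. x \<in> A \<Longrightarrow> f (f x) = x" "\<And>x. x \<in> A \<Longrightarrow> f x \<noteq> x"
  shows "even (card A)"
  using assms
proof (induction "card A" arbitrary: A rule: less_induct)
  case less
  show ?case
  proof (cases "A = {}")
    case False
    then obtain x where x: "x \<in> A" by blast
    define B where "B = A - {x, f x}"
    have B: "finite B" "card A = Suc (Suc (card B))"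
      using less.prems(1) less.prems(2)[OF x] x card_Diff_subset[of "{x, f x}" A] card_mono[of A "{x, f x}"]
        card_2_iff[of "{x, f x}"] less.prems(4)[OF x] by (auto simp: B_def)
    have "even (card B)"
    proof (rule less.hyps)
      fix y assume y: "y \<in> B"
      then have yA: "y \<in> A" "y \<noteq> x" "y \<noteq> f x" by (auto simp: B_def)
      have "f y \<noteq> x" using less.prems(3)[OF yA(1)] yA(3) by auto
      moreover have "f y \<noteq> f x" using less.prems(3)[OF yA(1)] less.prems(3)[OF x] yA(2) by metis
      ultimately show "f y \<in> B" using less.prems(2)[OF yA(1)] by (simp add: B_def)
      show "f (f y) = y" "f y \<noteq> y" using less.prems yA by auto
    qed (use B in auto)
    then show ?thesis using B by simp
  qed simp
qed

text \<open>Fixed-point-free involutions: \<open>x + 1\<close> on the field if 2 = 0, and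
  \<open>- x\<close> on the nonzero elements otherwise. This links the case distinction on
  \<open>CARD('a)\<close> to computations in the field.\<close>

lemma even_card_field_iff: "even CARD('a::{field,finite}) \<longleftrightarrow> (2 :: 'a) = 0"
proof
  assume two: "(2 :: 'a) = 0"
  have "even (card (UNIV :: 'a set))"
  proof (rule even_card_involution[of _ "\<lambda>x. x + 1"])
    have "x + 1 + 1 = x + 2" for x :: 'a by simp
    then show "x + 1 + 1 = x" for x :: 'a using two by simp
  qed auto
  then show "even CARD('a)" .
next
  assume ev: "even CARD('a)"
  show "(2 :: 'a) = 0"
  proof (rule ccontr)
    assume two: "(2 :: 'a) \<noteq> 0"
    have "even (card (UNIV - {0 :: 'a}))"
    proof (rule even_card_involution[of _ "\<lambda>x. - x"])
      fix x :: 'a assume "x \<in> UNIV - {0}"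
      then have "2 * x \<noteq> 0" using two by simp
      then show "- x \<noteq> x" by (metis add_eq_0_iff mult_2)
    qed auto
    then have "odd CARD('a)" by (simp add: card_Diff_subset finite_UNIV_card_ge_0)
    then show False using ev by simp
  qed
qed

lemma finite_carrier_vec [simp]: "finite (carrier_vec n :: 'a::finite vec set)"
proof -
  have inj: "inj_on list_of_vec (carrier_vec n :: 'a vec set)" by (rule inj_on_inverseI[of _ vec_of_list]) (simp add: vec_list)
  have sub: "list_of_vec ` (carrier_vec n :: 'a vec set) \<subseteq> {xs. set xs \<subseteq> UNIV \<and> length xs = n}" by auto
  have "finite {xs :: 'a list. set xs \<subseteq> UNIV \<and> length xs = n}" by (rule finite_lists_length_eq) simp
  then show ?thesis by (rule finite_imageD[OF finite_subset[OF sub] inj])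
qed

lemma finite_carrier_mat [simp]: "finite (carrier_mat n m :: 'a::finite mat set)"
proof -
  have "carrier_mat n m \<subseteq> (\<lambda>f. mat n m f) ` (PiE ({..<n} \<times> {..<m}) (\<lambda>_. UNIV :: 'a set))"
  proof
    fix A :: "'a mat" assume A: "A \<in> carrier_mat n m"
    let ?f = "restrict (\<lambda>ij. A $$ ij) ({..<n} \<times> {..<m})"
    have "A = mat n m ?f" using A by (intro eq_matI) auto
    then show "A \<in> (\<lambda>f. mat n m f) ` (PiE ({..<n} \<times> {..<m}) (\<lambda>_. UNIV))" by auto
  qed
  then show ?thesis by (rule finite_subset) (intro finite_imageI finite_PiE, auto)
qed

section \<open>Vectors with two outer coordinates\<close>

text \<open>Adds a new outermost pair of coordinates, that is, an orthogonal hyperbolic plane. Every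
  passage from rank \<open>l\<close> to \<open>Suc l\<close> uses this form of a vector.\<close>

definition brd :: "'a \<Rightarrow> 'a vec \<Rightarrow> 'a \<Rightarrow> 'a vec" where
  "brd a v b = vec (dim_vec v + 2) (\<lambda>i. if i = 0 then a else if i = dim_vec v + 1 then b else v $ (i - 1))"

lemma dim_brd [simp]: "dim_vec (brd a v b) = dim_vec v + 2"
  by (simp add: brd_def)

lemma brd_carrier: "v \<in> carrier_vec (2 * l + 1) \<Longrightarrow> brd a v b \<in> carrier_vec (2 * Suc l + 1)"
  by (rule carrier_vecI) auto

lemma brd_index:
  assumes "v \<in> carrier_vec (2 * l + 1)"
  shows "brd a v b $ 0 = a" "i < 2 * l + 1 \<Longrightarrow> brd a v b $ Suc i = v $ i" "brd a v b $ (2 * Suc l) = b"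
  using assms by (auto simp: brd_def)

lemma brd_inject:
  assumes "v \<in> carrier_vec (2 * l + 1)" "w \<in> carrier_vec (2 * l + 1)"
  shows "brd a v b = brd c w d \<longleftrightarrow> a = c \<and> v = w \<and> b = d"
proof
  assume e: "brd a v b = brd c w d"
  have "v $ i = w $ i" if "i < 2 * l + 1" for i using that brd_index(2)[OF assms(1) that] brd_index(2)[OF assms(2) that] e by metis
  then have "v = w" using assms by (intro eq_vecI) auto
  then show "a = c \<and> v = w \<and> b = d"
    using e brd_index(1,3)[OF assms(1)] brd_index(1,3)[OF assms(2)] by metis
qed auto

lemma brd_cases:
  fixes w :: "'a vec"
  assumes w: "w \<in> carrier_vec (2 * Suc l + 1)"
  obtains a v b where "v \<in> carrier_vec (2 * l + 1)" "w = brd a v b"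
proof -
  define v where "v = vec (2 * l + 1) (\<lambda>i. w $ Suc i)"
  have v: "v \<in> carrier_vec (2 * l + 1)" by (simp add: v_def)
  have "w = brd (w $ 0) v (w $ (2 * l + 2))"
  proof (rule eq_vecI)
    fix i assume "i < dim_vec (brd (w $ 0) v (w $ (2 * l + 2)))"
    then have i: "i < 2 * l + 3" using v by auto
    consider "i = 0" | "i = 2 * l + 2" | j where "i = Suc j" "j < 2 * l + 1" using i by (cases i) force+
    then show "w $ i = brd (w $ 0) v (w $ (2 * l + 2)) $ i"
    proof cases
      case 2
      then show ?thesis using brd_index(3)[OF v] by simp
    next
      case (3 j)
      then show ?thesis using brd_index(2)[OF v 3(2)] by (simp add: v_def)
    qed (simp add: brd_index(1)[OF v])
  qed (use w v in auto)
  then show ?thesis using that v by blast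
qed

lemma brd_add:
  assumes "v \<in> carrier_vec (2 * l + 1)" "w \<in> carrier_vec (2 * l + 1)"
  shows "brd a v b + brd c w d = brd (a + c) (v + w) (b + d)"
  using assms by (intro eq_vecI) (auto simp: brd_def)

lemma brd_smult: "k \<cdot>\<^sub>v brd a v b = brd (k * a) (k \<cdot>\<^sub>v v) (k * b)"
  by (intro eq_vecI) (auto simp: brd_def)

lemma brd_scalar_prod:
  assumes v: "v \<in> carrier_vec (2 * l + 1)" and w: "w \<in> carrier_vec (2 * l + 1)"
  shows "brd a v b \<bullet> brd c w d = a * c + v \<bullet> w + b * (d :: 'a::comm_semiring_0)"
proof -
  have "brd a v b \<bullet> brd c w d = (\<Sum>i<Suc (Suc (2 * l + 1)). brd a v b $ i * brd c w d $ i)"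
    using w by (simp add: scalar_prod_def lessThan_atLeast0)
  also have "\<dots> = (\<Sum>i<Suc (2 * l + 1). brd a v b $ i * brd c w d $ i) + b * d"
    using brd_index(3)[OF v] brd_index(3)[OF w] by simp
  also have "(\<Sum>i<Suc (2 * l + 1). brd a v b $ i * brd c w d $ i) = a * c + (\<Sum>i<2 * l + 1. v $ i * w $ i)"
    unfolding sum.lessThan_Suc_shift
    by (intro arg_cong2[of _ _ _ _ "(+)"] sum.cong) (auto simp: brd_index(1,2)[OF v] brd_index(1,2)[OF w])
  finally show ?thesis using w by (simp add: scalar_prod_def lessThan_atLeast0)
qed

text \<open>The hyperbolic part of \<open>Q_odd\<close>. It is applied to functionals as well, where
  it is the right-hand side of the quadratic that decides the type.\<close>

definition hyp :: "nat \<Rightarrow> 'a::comm_semiring_1 vec \<Rightarrow> 'a" where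
  "hyp l v = (\<Sum>j=1..l. v $ (l - j) * v $ (l + j))"

lemma Q_odd_hyp: "Q_odd l v = (v $ l)\<^sup>2 + hyp l v"
  by (simp add: Q_odd_def hyp_def)

lemma brd_center: "v \<in> carrier_vec (2 * l + 1) \<Longrightarrow> brd a v b $ Suc l = v $ l"
  by (rule brd_index(2)) auto

lemma hyp_brd:
  assumes v: "v \<in> carrier_vec (2 * l + 1)"
  shows "hyp (Suc l) (brd a v b) = hyp l v + a * b"
proof -
  have "hyp (Suc l) (brd a v b) = (\<Sum>j=1..l. brd a v b $ (Suc l - j) * brd a v b $ (Suc l + j)) + brd a v b $ 0 * brd a v b $ (2 * Suc l)"
    by (simp add: hyp_def mult_2)
  also have "(\<Sum>j=1..l. brd a v b $ (Suc l - j) * brd a v b $ (Suc l + j)) = hyp l v"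
    unfolding hyp_def
  proof (rule sum.cong[OF refl])
    fix j assume j: "j \<in> {1..l}"
    have e: "Suc l - j = Suc (l - j)" "Suc l + j = Suc (l + j)" using j by auto
    show "brd a v b $ (Suc l - j) * brd a v b $ (Suc l + j) = v $ (l - j) * v $ (l + j)"
      unfolding e using j by (simp add: brd_index(2)[OF v])
  qed
  finally show ?thesis using brd_index(1,3)[OF v] by simp
qed

lemma Q_odd_brd: "v \<in> carrier_vec (2 * l + 1) \<Longrightarrow> Q_odd (Suc l) (brd a v b) = Q_odd l v + a * b"
  by (simp add: Q_odd_hyp hyp_brd brd_center)

section \<open>Sums over vectors\<close>

lemma sum_brd:
  fixes F :: "'a::finite vec \<Rightarrow> 'b::comm_monoid_add"
  shows "(\<Sum>c\<in>carrier_vec (2 * Suc l + 1). F c) = (\<Sum>a\<in>UNIV. \<Sum>b\<in>UNIV. \<Sum>c\<in>carrier_vec (2 * l + 1). F (brd a c b))"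
proof -
  have "bij_betw (\<lambda>(a, b, c). brd a c b) (UNIV \<times> UNIV \<times> carrier_vec (2 * l + 1)) (carrier_vec (2 * Suc l + 1) :: 'a vec set)"
  proof (rule bij_betw_imageI)
    show "inj_on (\<lambda>(a, b, c). brd a c b) (UNIV \<times> UNIV \<times> carrier_vec (2 * l + 1))"
      by (rule inj_onI) (auto simp: brd_inject)
    show "(\<lambda>(a, b, c). brd a c b) ` (UNIV \<times> UNIV \<times> carrier_vec (2 * l + 1)) = (carrier_vec (2 * Suc l + 1) :: 'a vec set)"
    proof (rule Set.set_eqI)
      fix w :: "'a vec"
      show "w \<in> (\<lambda>(a, b, c). brd a c b) ` (UNIV \<times> UNIV \<times> carrier_vec (2 * l + 1)) \<longleftrightarrow> w \<in> carrier_vec (2 * Suc l + 1)"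
      proof
        assume "w \<in> carrier_vec (2 * Suc l + 1)"
        then obtain a v b where "v \<in> carrier_vec (2 * l + 1)" "w = brd a v b" by (rule brd_cases)
        then show "w \<in> (\<lambda>(a, b, c). brd a c b) ` (UNIV \<times> UNIV \<times> carrier_vec (2 * l + 1))" by force
      next
        assume "w \<in> (\<lambda>(a, b, c). brd a c b) ` (UNIV \<times> UNIV \<times> carrier_vec (2 * l + 1))"
        then show "w \<in> carrier_vec (2 * Suc l + 1)" using brd_carrier by fastforce
      qed
    qed
  qed
  then show ?thesis
    by (simp add: sum.reindex_bij_betw[symmetric] sum.cartesian_product case_prod_unfold)
qed

lemma sum_mult_translate:
  fixes f :: "'a::{field,finite} \<Rightarrow> complex"
  shows "(\<Sum>s\<in>UNIV. f (s + a)) = (\<Sum>s\<in>UNIV. f s)" "a \<noteq> 0 \<Longrightarrow> (\<Sum>s\<in>UNIV. f (a * s)) = (\<Sum>s\<in>UNIV. f s)"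
proof -
  have "bij (\<lambda>s. s + a)" by (rule bijI', auto, metis diff_add_cancel)
  then show "(\<Sum>s\<in>UNIV. f (s + a)) = (\<Sum>s\<in>UNIV. f s)" by (rule sum.reindex_bij_betw)
  assume a: "a \<noteq> 0"
  have "\<exists>x. y = a * x" for y using a by (intro exI[of _ "y / a"]) simp
  then have "bij (\<lambda>s. a * s)" using a by (intro bijI') auto
  then show "(\<Sum>s\<in>UNIV. f (a * s)) = (\<Sum>s\<in>UNIV. f s)" by (rule sum.reindex_bij_betw)
qed

text \<open>The number of ways to give the 2 l outer coordinates so that \<open>hyp\<close> takes a
  fixed nonzero value; for the value 0 there are q^l more. It is q^(2l-1) - q^(l-1) for l > 0; the
  recursion avoids the division by q and covers l = 0.\<close>

fun hcoef :: "complex \<Rightarrow> nat \<Rightarrow> complex" where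
  "hcoef q 0 = 0"
| "hcoef q (Suc l) = q\<^sup>2 * hcoef q l + q ^ l * (q - 1)"

lemma hcoef_eq: "q * hcoef q l = q ^ (2 * l) - q ^ l"
proof (induction l)
  case (Suc l)
  have "q * hcoef q (Suc l) = q\<^sup>2 * (q * hcoef q l) + q ^ Suc l * (q - 1)" by (simp add: algebra_simps)
  also have "\<dots> = q ^ (2 * Suc l) - q ^ Suc l" unfolding Suc.IH by (simp add: algebra_simps power2_eq_square)
  finally show ?case .
qed simp

text \<open>The values of \<open>hyp\<close> are equidistributed up to an excess of q^l at the value
  0, independently of the middle coordinate. Keeping an arbitrary function of both quantities makes
  the induction go through, since the new pair only shifts the second argument by
  \<open>a * b\<close>.\<close>

lemma sum_vec_hyp:
  fixes f :: "'a::{field,finite} \<Rightarrow> 'a \<Rightarrow> complex"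
  defines "q \<equiv> of_nat CARD('a)"
  shows "(\<Sum>c\<in>carrier_vec (2 * l + 1). f (c $ l) (hyp l c)) = (\<Sum>x\<in>UNIV. hcoef q l * (\<Sum>s\<in>UNIV. f x s) + q ^ l * f x 0)"
proof (induction l arbitrary: f)
  case 0
  have "bij_betw (\<lambda>x. vec 1 (\<lambda>_. x)) UNIV (carrier_vec 1 :: 'a vec set)"
  proof (rule bij_betw_imageI)
    show "inj (\<lambda>x. vec 1 (\<lambda>_. x) :: 'a vec)" by (rule injI) (auto dest: vec_eq_iff[THEN iffD1])
    show "range (\<lambda>x. vec 1 (\<lambda>_. x)) = (carrier_vec 1 :: 'a vec set)"
    proof (rule Set.set_eqI)
      fix w :: "'a vec"
      show "w \<in> range (\<lambda>x. vec 1 (\<lambda>_. x)) \<longleftrightarrow> w \<in> carrier_vec 1"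
      proof
        assume "w \<in> carrier_vec 1"
        then have "w = vec 1 (\<lambda>_. w $ 0)" by (intro eq_vecI) auto
        then show "w \<in> range (\<lambda>x. vec 1 (\<lambda>_. x))" by blast
      qed auto
    qed
  qed
  then show ?case by (simp add: sum.reindex_bij_betw[symmetric] hyp_def)
next
  case (Suc l)
  let ?T = "\<Sum>x\<in>UNIV. \<Sum>s\<in>UNIV. f x s"
  have "(\<Sum>c\<in>carrier_vec (2 * Suc l + 1). f (c $ Suc l) (hyp (Suc l) c)) =
    (\<Sum>a\<in>UNIV. \<Sum>b\<in>UNIV. \<Sum>c\<in>carrier_vec (2 * l + 1). f (c $ l) (hyp l c + a * b))"
    unfolding sum_brd by (intro sum.cong refl) (simp add: brd_center hyp_brd)
  also have "\<dots> = (\<Sum>a\<in>UNIV. \<Sum>b\<in>UNIV. \<Sum>x\<in>UNIV. hcoef q l * (\<Sum>s\<in>UNIV. f x s) + q ^ l * f x (a * b))"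
  proof (intro sum.cong refl)
    fix a b :: 'a
    show "(\<Sum>c\<in>carrier_vec (2 * l + 1). f (c $ l) (hyp l c + a * b)) =
      (\<Sum>x\<in>UNIV. hcoef q l * (\<Sum>s\<in>UNIV. f x s) + q ^ l * f x (a * b))"
      unfolding Suc.IH[of "\<lambda>x s. f x (s + a * b)"] by (simp add: sum_mult_translate)
  qed
  also have "\<dots> = q\<^sup>2 * hcoef q l * ?T + q ^ l * (\<Sum>a\<in>UNIV. \<Sum>b\<in>UNIV. \<Sum>x\<in>UNIV. f x (a * b))"
    by (simp add: sum.distrib sum_distrib_left[symmetric] q_def power2_eq_square)
  \<comment> \<open>For a nonzero \<open>a\<close> the product \<open>a * b\<close> runs once
    through the field; the excess at 0 comes from \<open>a = 0\<close> alone.\<close>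
  also have "(\<Sum>a\<in>UNIV. \<Sum>b\<in>UNIV. \<Sum>x\<in>UNIV. f x (a * b)) = (\<Sum>a\<in>(UNIV :: 'a set). if a = 0 then q * (\<Sum>x\<in>UNIV. f x 0) else ?T)"
  proof (rule sum.cong[OF refl])
    fix a :: 'a
    show "(\<Sum>b\<in>UNIV. \<Sum>x\<in>UNIV. f x (a * b)) = (if a = 0 then q * (\<Sum>x\<in>UNIV. f x 0) else ?T)"
    proof (cases "a = 0")
      case False
      have "(\<Sum>b\<in>UNIV. \<Sum>x\<in>UNIV. f x (a * b)) = (\<Sum>x\<in>UNIV. \<Sum>b\<in>UNIV. f x (a * b))" by (rule sum.swap)
      then show ?thesis using False by (simp add: sum_mult_translate)
    qed (simp add: q_def)
  qed
  also have "\<dots> = q * (\<Sum>x\<in>UNIV. f x 0) + (q - 1) * ?T"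
    by (simp add: sum.remove[of UNIV "0::'a"] q_def card_Diff_subset of_nat_diff Suc_leI finite_UNIV_card_ge_0)
  finally have e: "(\<Sum>c\<in>carrier_vec (2 * Suc l + 1). f (c $ Suc l) (hyp (Suc l) c)) =
    q\<^sup>2 * hcoef q l * ?T + q ^ l * (q * (\<Sum>x\<in>UNIV. f x 0) + (q - 1) * ?T)" .
  have "(\<Sum>x\<in>UNIV. hcoef q (Suc l) * (\<Sum>s\<in>UNIV. f x s) + q ^ Suc l * f x 0) = hcoef q (Suc l) * ?T + q ^ Suc l * (\<Sum>x\<in>UNIV. f x 0)"
    by (simp only: sum.distrib sum_distrib_left)
  then show ?case unfolding e by (simp only:) (simp add: algebra_simps)
qed

declare hcoef.simps [simp del]

text \<open>The equidistributed part of the inner sum does not depend on the outer pair, so a weight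
  of total 0 kills it. Only the excess, a sum over three coordinates, is left.\<close>

lemma sum_vec_hyp_outer:
  fixes f :: "'a::{field,finite} \<Rightarrow> 'a \<Rightarrow> complex" and w :: "'a \<Rightarrow> 'a \<Rightarrow> complex"
  assumes w: "(\<Sum>a\<in>UNIV. \<Sum>b\<in>UNIV. w a b) = 0"
  shows "(\<Sum>a\<in>UNIV. \<Sum>b\<in>UNIV. \<Sum>c\<in>carrier_vec (2 * l + 1). w a b * f (c $ l) (hyp l c + a * b)) =
    of_nat CARD('a) ^ l * (\<Sum>a\<in>UNIV. \<Sum>b\<in>UNIV. w a b * (\<Sum>x\<in>UNIV. f x (a * b)))"
proof -
  let ?q = "of_nat CARD('a) :: complex"
  define C where "C = hcoef ?q l * (\<Sum>x\<in>UNIV. \<Sum>s\<in>UNIV. f x s)"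
  have "(\<Sum>a\<in>UNIV. \<Sum>b\<in>UNIV. \<Sum>c\<in>carrier_vec (2 * l + 1). w a b * f (c $ l) (hyp l c + a * b)) =
    (\<Sum>a\<in>UNIV. \<Sum>b\<in>UNIV. w a b * C + ?q ^ l * (w a b * (\<Sum>x\<in>UNIV. f x (a * b))))"
  proof (intro sum.cong refl)
    fix a b :: 'a
    show "(\<Sum>c\<in>carrier_vec (2 * l + 1). w a b * f (c $ l) (hyp l c + a * b)) =
      w a b * C + ?q ^ l * (w a b * (\<Sum>x\<in>UNIV. f x (a * b)))"
    proof -
      have "(\<Sum>x\<in>UNIV. hcoef ?q l * (\<Sum>s\<in>UNIV. f x (s + a * b)) + ?q ^ l * f x (0 + a * b)) = C + ?q ^ l * (\<Sum>x\<in>UNIV. f x (a * b))"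
        by (simp add: sum_mult_translate sum.distrib sum_distrib_left C_def)
      then show ?thesis
        unfolding sum_distrib_left[symmetric] sum_vec_hyp[of "\<lambda>x s. f x (s + a * b)" l]
        by (simp only:) (simp add: algebra_simps)
    qed
  qed
  also have "\<dots> = (\<Sum>a\<in>UNIV. \<Sum>b\<in>UNIV. w a b) * C + ?q ^ l * (\<Sum>a\<in>UNIV. \<Sum>b\<in>UNIV. w a b * (\<Sum>x\<in>UNIV. f x (a * b)))"
    by (simp only: sum.distrib sum_distrib_left sum_distrib_right)
  finally show ?thesis by (simp add: w)
qed

section \<open>Quadratics over a finite field\<close>

definition nroots :: "'a::field \<Rightarrow> 'a \<Rightarrow> nat" where
  "nroots x s = card {t. t\<^sup>2 + x * t = s}"

lemma quadratic_roots:
  fixes x :: "'a::field"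
  assumes "t\<^sup>2 + x * t = s"
  shows "{t. t\<^sup>2 + x * t = s} = {t, - x - t}"
proof -
  have "u\<^sup>2 + x * u = s \<longleftrightarrow> (u - t) * (u + t + x) = 0" for u
    unfolding assms[symmetric] by (auto simp: algebra_simps power2_eq_square)
  moreover have "u + t + x = 0 \<longleftrightarrow> u = - x - t" for u by (auto simp: algebra_simps eq_neg_iff_add_eq_0)
  ultimately show ?thesis by auto
qed

text \<open>The second root is \<open>- x - t\<close>; it coincides with \<open>t\<close> exactly
  when the derivative \<open>2 * t + x\<close> vanishes there, a criterion that holds in every
  characteristic.\<close>

lemma nroots_eq:
  fixes x :: "'a::field"
  shows "t\<^sup>2 + x * t = s \<Longrightarrow> nroots x s = (if 2 * t + x = 0 then 1 else 2)"
    "(\<And>t. t\<^sup>2 + x * t \<noteq> s) \<Longrightarrow> nroots x s = 0"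
proof -
  assume t: "t\<^sup>2 + x * t = s"
  have e: "2 * t + x = t - (- x - t)" by (simp add: algebra_simps)
  have iff: "2 * t + x = 0 \<longleftrightarrow> - x - t = t" unfolding e right_minus_eq by (rule eq_commute)
  show "nroots x s = (if 2 * t + x = 0 then 1 else 2)"
  proof (cases "2 * t + x = 0")
    case True
    then have "- x - t = t" using iff by simp
    then have "{t, - x - t} = {t}" by (simp only: insert_absorb2)
    then show ?thesis unfolding nroots_def quadratic_roots[OF t] using True by simp
  next
    case False
    then have "- x - t \<noteq> t" using iff by simp
    then have "card {t, - x - t} = 2" by (metis card_2_iff)
    then show ?thesis unfolding nroots_def quadratic_roots[OF t] using False by simp
  qed
next
  assume "\<And>t. t\<^sup>2 + x * t \<noteq> s"
  then show "nroots x s = 0" by (simp add: nroots_def)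
qed

lemma nroots_cases:
  fixes x :: "'a::field"
  obtains (one) t where "t\<^sup>2 + x * t = s" "2 * t + x = 0" "nroots x s = 1"
  | (two) t where "t\<^sup>2 + x * t = s" "2 * t + x \<noteq> 0" "nroots x s = 2"
  | (none) "\<And>t. t\<^sup>2 + x * t \<noteq> s" "nroots x s = 0"
  using nroots_eq(1)[of _ x s] nroots_eq(2)[of x s] by metis

text \<open>Squaring is additive, hence injective, in characteristic 2, and so surjective on a
  finite field.\<close>

lemma char2_sqrt:
  assumes "(2 :: 'a::{field,finite}) = 0"
  shows "\<exists>t. t\<^sup>2 = (s :: 'a)"
proof -
  have "inj (\<lambda>t :: 'a. t\<^sup>2)"
  proof (rule injI)
    fix t u :: 'a assume "t\<^sup>2 = u\<^sup>2"
    then have "(t - u)\<^sup>2 = 2 * (u * (u - t))" by (simp add: power2_eq_square algebra_simps)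
    then show "t = u" using assms by simp
  qed
  then have "surj (\<lambda>t :: 'a. t\<^sup>2)" by (simp add: finite_UNIV_inj_surj)
  then show ?thesis by (metis surjD)
qed

text \<open>A single root means that the discriminant vanishes. In characteristic 2 the discriminant
  is the square of \<open>x\<close>, and for \<open>x = 0\<close> the root exists because every
  element is a square.\<close>

lemma nroots_eq_1_iff:
  fixes x s :: "'a::{field,finite}"
  shows "(2 :: 'a) \<noteq> 0 \<Longrightarrow> nroots x s = 1 \<longleftrightarrow> x\<^sup>2 + 4 * s = 0"
    "(2 :: 'a) = 0 \<Longrightarrow> nroots x s = 1 \<longleftrightarrow> x = 0"
proof -
  have disc: "x\<^sup>2 + 4 * s = (2 * t + x)\<^sup>2" if "t\<^sup>2 + x * t = s" for t
    unfolding that[symmetric] by (simp add: power2_eq_square algebra_simps)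
  assume two: "(2 :: 'a) \<noteq> 0"
  show "nroots x s = 1 \<longleftrightarrow> x\<^sup>2 + 4 * s = 0"
  proof (cases rule: nroots_cases[of x s])
    \<comment> \<open>Completing the square: with a vanishing discriminant, \<open>- h\<close> would
      be a root.\<close>
    case (none)
    have four: "(4 :: 'a) \<noteq> 0" using two by (metis mult_2 mult_eq_0_iff numeral_Bit0)
    define h where "h = x / 2"
    have x: "x = 2 * h" using two by (simp add: h_def)
    have "(- h)\<^sup>2 + x * (- h) = - h\<^sup>2" by (simp add: x power2_eq_square algebra_simps)
    then have "h\<^sup>2 + s \<noteq> 0" using none(1)[of "- h"] by (metis add.inverse_unique)
    moreover have "x\<^sup>2 + 4 * s = 4 * (h\<^sup>2 + s)" by (simp add: x power2_eq_square algebra_simps)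
    ultimately have "x\<^sup>2 + 4 * s \<noteq> 0" using four by (metis mult_eq_0_iff)
    then show ?thesis using none by simp
  qed (use disc in auto)
next
  assume two: "(2 :: 'a) = 0"
  obtain t where t: "t\<^sup>2 = s" using char2_sqrt[OF two] by blast
  show "nroots x s = 1 \<longleftrightarrow> x = 0"
  proof (cases rule: nroots_cases[of x s])
    case none
    then show ?thesis using none(1)[of t] t by auto
  qed (use two in auto)
qed

text \<open>Summing over the unknown root first makes the equation linear in the remaining variable.
  Only the root \<open>t = 0\<close> is exceptional in the first sum, being a root for all
  \<open>x\<close> or for none.\<close>

lemma sum_nroots:
  fixes x y :: "'a::{field,finite}"
  shows "(\<Sum>x\<in>UNIV. of_nat (nroots x y) :: complex) = of_nat CARD('a) - 1 + (if y = 0 then of_nat CARD('a) else 0)"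
    "(\<Sum>s\<in>UNIV. of_nat (nroots x s) :: complex) = of_nat CARD('a)"
proof -
  have c: "(of_nat (card {t :: 'a. P t}) :: complex) = (\<Sum>t\<in>UNIV. if P t then 1 else 0)" for P
    by (simp add: sum.If_cases)
  have "(\<Sum>x\<in>UNIV. of_nat (nroots x y) :: complex) = (\<Sum>t\<in>UNIV. \<Sum>x\<in>UNIV. if t\<^sup>2 + x * t = y then 1 else 0)"
    unfolding nroots_def c by (rule sum.swap)
  also have "\<dots> = (\<Sum>t\<in>(UNIV :: 'a set). if t = 0 then (if y = 0 then of_nat CARD('a) else 0) else 1)"
  proof (rule sum.cong[OF refl])
    fix t :: 'a
    show "(\<Sum>x\<in>UNIV. if t\<^sup>2 + x * t = y then 1 else 0 :: complex) = (if t = 0 then (if y = 0 then of_nat CARD('a) else 0) else 1)"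
    proof (cases "t = 0")
      case False
      then have "t\<^sup>2 + x * t = y \<longleftrightarrow> x = (y - t\<^sup>2) / t" for x by (auto simp: field_simps)
      then show ?thesis using False by simp
    qed auto
  qed
  also have "\<dots> = (if y = 0 then of_nat CARD('a) else 0) + (of_nat CARD('a) - 1)"
    by (simp add: sum.remove[of UNIV "0::'a"] card_Diff_subset of_nat_diff Suc_leI finite_UNIV_card_ge_0)
  finally show "(\<Sum>x\<in>UNIV. of_nat (nroots x y) :: complex) = of_nat CARD('a) - 1 + (if y = 0 then of_nat CARD('a) else 0)" by simp
  have "(\<Sum>s\<in>UNIV. of_nat (nroots x s) :: complex) = (\<Sum>t\<in>UNIV. \<Sum>s\<in>UNIV. if t\<^sup>2 + x * t = s then 1 else 0)"
    unfolding nroots_def c by (rule sum.swap)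
  then show "(\<Sum>s\<in>UNIV. of_nat (nroots x s) :: complex) = of_nat CARD('a)" by simp
qed

section \<open>Orbit sums\<close>

locale add_char =
  fixes \<xi> :: "'a::{field,finite} \<Rightarrow> complex"
  assumes add: "\<xi> (x + y) = \<xi> x * \<xi> y" and nontriv: "\<xi> \<noteq> (\<lambda>_. 1)" and cnj: "\<xi> (- x) = cnj (\<xi> x)" and zero: "\<xi> 0 = 1"
begin

lemma sum_eq_0: "(\<Sum>x\<in>UNIV. \<xi> x) = 0"
proof -
  obtain y where y: "\<xi> y \<noteq> 1" using nontriv by auto
  have "(\<Sum>x\<in>UNIV. \<xi> x) = (\<Sum>x\<in>UNIV. \<xi> (x + y))" by (rule sum_mult_translate(1)[symmetric])
  also have "\<dots> = (\<Sum>x\<in>UNIV. \<xi> x) * \<xi> y" by (simp add: add sum_distrib_right)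
  finally show ?thesis using y by simp
qed

lemma sum_scaled: "(\<Sum>x\<in>UNIV. \<xi> (a * x)) = (if a = 0 then of_nat CARD('a) else 0)"
  by (simp add: sum_mult_translate sum_eq_0 zero)

lemma sum_nonzero: "a \<noteq> 0 \<Longrightarrow> (\<Sum>x\<in>UNIV - {0}. \<xi> (a * x)) = - 1"
  using sum_scaled[of a] by (simp add: sum.remove[of UNIV "0::'a"] zero) (metis add_eq_0_iff)

lemma sum_pairs: "\<alpha> \<noteq> 0 \<Longrightarrow> (\<Sum>a\<in>UNIV. \<Sum>b\<in>UNIV. \<xi> (\<alpha> * a + \<beta> * b)) = 0"
  by (simp add: add sum_distrib_left[symmetric] sum_distrib_right[symmetric] sum_scaled)

text \<open>A sum over the two coordinate axes, which meet in the origin.\<close>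

lemma sum_degenerate_pairs:
  assumes "\<alpha> \<noteq> 0"
  shows "(\<Sum>a\<in>UNIV. \<Sum>b\<in>UNIV. \<xi> (\<alpha> * a + \<beta> * b) * (if a * b = 0 then 1 else 0)) = (if \<beta> = 0 then of_nat CARD('a) - 1 else - 1)"
proof -
  have "(\<Sum>a\<in>UNIV. \<Sum>b\<in>UNIV. \<xi> (\<alpha> * a + \<beta> * b) * (if a * b = 0 then 1 else 0)) =
    (\<Sum>a\<in>UNIV. if a = 0 then (\<Sum>b\<in>UNIV. \<xi> (\<beta> * b)) else \<xi> (\<alpha> * a))"
  proof (rule sum.cong[OF refl])
    fix a :: 'a
    have "(\<Sum>b\<in>UNIV. \<xi> (\<alpha> * a + \<beta> * b) * (if a * b = 0 then 1 else 0)) = (\<Sum>b\<in>(UNIV :: 'a set). if b = 0 then \<xi> (\<alpha> * a) else 0)" if "a \<noteq> 0"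
      using that by (intro sum.cong) auto
    then show "(\<Sum>b\<in>UNIV. \<xi> (\<alpha> * a + \<beta> * b) * (if a * b = 0 then 1 else 0)) = (if a = 0 then (\<Sum>b\<in>UNIV. \<xi> (\<beta> * b)) else \<xi> (\<alpha> * a))"
      by simp
  qed
  also have "\<dots> = (\<Sum>b\<in>UNIV. \<xi> (\<beta> * b)) + (\<Sum>a\<in>UNIV - {0}. \<xi> (\<alpha> * a))"
    by (simp add: sum.remove[of UNIV "0::'a"])
  finally show ?thesis using assms by (simp add: sum_scaled sum_nonzero)
qed

text \<open>Only points of the cone x^2 + 4 a b = 0 contribute. For nonzero \<open>a\<close> it is
  parametrized by x = 2 a y, b = - a y^2, and the character becomes
  \<open>\<xi> ((1 - \<beta> * y\<^sup>2) * a)\<close>. If \<open>\<beta>\<close> is a nonsquare,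
  the first factor never vanishes, and summing over \<open>a\<close> gives -1 for each of the q
  values of \<open>y\<close>.\<close>

lemma sum_cone:
  assumes two: "(2 :: 'a) \<noteq> 0"
  shows "(\<Sum>a\<in>UNIV. \<Sum>b\<in>UNIV. \<xi> a * (\<Sum>x\<in>UNIV. if x\<^sup>2 + 4 * (a * b) = 0 then 1 else 0)) = 0"
    "\<beta> \<noteq> 0 \<Longrightarrow> \<not> (\<exists>x. \<beta> = x\<^sup>2) \<Longrightarrow>
      (\<Sum>a\<in>UNIV. \<Sum>b\<in>UNIV. \<xi> (a + \<beta> * b) * (\<Sum>x\<in>UNIV. if x\<^sup>2 + 4 * (a * b) = 0 then 1 else 0)) = - of_nat CARD('a)"
proof -
  have four: "(4 :: 'a) \<noteq> 0" using two by (metis mult_2 mult_eq_0_iff numeral_Bit0)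
  define W where "W \<beta> a = (\<Sum>b\<in>UNIV. \<xi> (a + \<beta> * b) * (\<Sum>x\<in>UNIV. if x\<^sup>2 + 4 * (a * b) = 0 then 1 else 0))" for \<beta> a
  have W0: "W \<beta> 0 = (\<Sum>b\<in>UNIV. \<xi> (\<beta> * b))" for \<beta> by (simp add: W_def)
  have Wa: "W \<beta> a = (\<Sum>y\<in>UNIV. \<xi> ((1 - \<beta> * y\<^sup>2) * a))" if a: "a \<noteq> 0" for \<beta> a
  proof -
    have "W \<beta> a = (\<Sum>x\<in>UNIV. \<Sum>b\<in>UNIV. \<xi> (a + \<beta> * b) * (if x\<^sup>2 + 4 * (a * b) = 0 then 1 else 0))"
      unfolding W_def sum_distrib_left by (rule sum.swap)
    also have "\<dots> = (\<Sum>x\<in>UNIV. \<Sum>b\<in>UNIV. if b = - x\<^sup>2 / (4 * a) then \<xi> (a + \<beta> * (- x\<^sup>2 / (4 * a))) else 0)"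
    proof (intro sum.cong refl)
      fix x b :: 'a
      have "x\<^sup>2 + 4 * (a * b) = 0 \<longleftrightarrow> b = - x\<^sup>2 / (4 * a)"
        using a four by (auto simp: field_simps add_eq_0_iff)
      then show "\<xi> (a + \<beta> * b) * (if x\<^sup>2 + 4 * (a * b) = 0 then 1 else 0) = (if b = - x\<^sup>2 / (4 * a) then \<xi> (a + \<beta> * (- x\<^sup>2 / (4 * a))) else 0)"
        by auto
    qed
    also have "\<dots> = (\<Sum>x\<in>UNIV. \<xi> (a + \<beta> * (- x\<^sup>2 / (4 * a))))" by simp
    also have "\<dots> = (\<Sum>y\<in>UNIV. \<xi> (a + \<beta> * (- (2 * a * y)\<^sup>2 / (4 * a))))"
      using a two by (intro sum_mult_translate(2)[symmetric]) simp
    also have "\<dots> = (\<Sum>y\<in>UNIV. \<xi> ((1 - \<beta> * y\<^sup>2) * a))"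
      using a four by (intro sum.cong refl arg_cong[of _ _ \<xi>]) (simp add: power2_eq_square field_simps)
    finally show ?thesis .
  qed
  have tot: "(\<Sum>a\<in>UNIV. W \<beta> a) = (\<Sum>b\<in>UNIV. \<xi> (\<beta> * b)) + (\<Sum>y\<in>UNIV. \<Sum>a\<in>UNIV - {0}. \<xi> ((1 - \<beta> * y\<^sup>2) * a))" for \<beta>
  proof -
    have "(\<Sum>a\<in>UNIV. W \<beta> a) = W \<beta> 0 + (\<Sum>a\<in>UNIV - {0}. W \<beta> a)" by (rule sum.remove) auto
    also have "(\<Sum>a\<in>UNIV - {0}. W \<beta> a) = (\<Sum>a\<in>UNIV - {0}. \<Sum>y\<in>UNIV. \<xi> ((1 - \<beta> * y\<^sup>2) * a))"
      by (intro sum.cong refl Wa) auto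
    also have "\<dots> = (\<Sum>y\<in>UNIV. \<Sum>a\<in>UNIV - {0}. \<xi> ((1 - \<beta> * y\<^sup>2) * a))" by (rule sum.swap)
    finally show ?thesis by (simp add: W0)
  qed
  show "(\<Sum>a\<in>UNIV. \<Sum>b\<in>UNIV. \<xi> a * (\<Sum>x\<in>UNIV. if x\<^sup>2 + 4 * (a * b) = 0 then 1 else 0)) = 0"
    using tot[of 0] sum_nonzero[of 1] by (simp add: W_def zero)
  assume \<beta>: "\<beta> \<noteq> 0" "\<not> (\<exists>x. \<beta> = x\<^sup>2)"
  have "1 - \<beta> * y\<^sup>2 \<noteq> 0" for y
  proof
    assume e: "1 - \<beta> * y\<^sup>2 = 0"
    then have "y \<noteq> 0" by auto
    then have "\<beta> = (1 / y)\<^sup>2" using e by (simp add: power_divide field_simps)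
    then show False using \<beta>(2) by blast
  qed
  then have "(\<Sum>y\<in>UNIV. \<Sum>a\<in>UNIV - {0}. \<xi> ((1 - \<beta> * y\<^sup>2) * a)) = - of_nat CARD('a)" by (simp add: sum_nonzero)
  then show "(\<Sum>a\<in>UNIV. \<Sum>b\<in>UNIV. \<xi> (a + \<beta> * b) * (\<Sum>x\<in>UNIV. if x\<^sup>2 + 4 * (a * b) = 0 then 1 else 0)) = - of_nat CARD('a)"
    using tot[of \<beta>] \<beta>(1) by (simp add: W_def sum_scaled)
qed

text \<open>For \<open>r = 1\<close> the zero functional is included; it is subtracted again in
  \<open>orbit_value\<close>.\<close>

definition orbit_sum :: "nat \<Rightarrow> nat \<Rightarrow> 'a vec \<Rightarrow> complex" where
  "orbit_sum l r z = (\<Sum>c | c \<in> carrier_vec (2 * l + 1) \<and> nroots (c $ l) (hyp l c) = r. \<xi> (c \<bullet> z))"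

section \<open>Weighted sums over functionals at the test vectors\<close>

definition weighted_sum :: "nat \<Rightarrow> ('a \<Rightarrow> 'a \<Rightarrow> complex) \<Rightarrow> 'a vec \<Rightarrow> complex" where
  "weighted_sum l f z = (\<Sum>c\<in>carrier_vec (2 * l + 1). f (c $ l) (hyp l c) * \<xi> (c \<bullet> z))"

lemma orbit_sum_weighted: "orbit_sum l r z = weighted_sum l (\<lambda>x s. if nroots x s = r then 1 else 0) z"
  unfolding orbit_sum_def weighted_sum_def by (intro sum.mono_neutral_cong_left) auto

text \<open>The test vectors are of two kinds. Those of the identity and of \<open>z_one\<close> are
  multiples of the middle unit vector and are treated here; those of \<open>z_zero\<close> and
  \<open>z_two\<close> are supported on the outermost pair and are treated by
  \<open>weighted_sum_outer\<close>.\<close>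

lemma weighted_sum_center:
  "weighted_sum l f (x \<cdot>\<^sub>v unit_vec (2 * l + 1) l) = (\<Sum>y\<in>UNIV. (hcoef (of_nat CARD('a)) l * (\<Sum>s\<in>UNIV. f y s) + of_nat CARD('a) ^ l * f y 0) * \<xi> (x * y))"
proof -
  have "weighted_sum l f (x \<cdot>\<^sub>v unit_vec (2 * l + 1) l) = (\<Sum>c\<in>carrier_vec (2 * l + 1). f (c $ l) (hyp l c) * \<xi> (x * c $ l))"
    unfolding weighted_sum_def by (intro sum.cong refl) simp
  also have "\<dots> = (\<Sum>y\<in>UNIV. hcoef (of_nat CARD('a)) l * (\<Sum>s\<in>UNIV. f y s * \<xi> (x * y)) + of_nat CARD('a) ^ l * (f y 0 * \<xi> (x * y)))"
    by (rule sum_vec_hyp[of "\<lambda>y s. f y s * \<xi> (x * y)"])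
  also have "\<dots> = (\<Sum>y\<in>UNIV. (hcoef (of_nat CARD('a)) l * (\<Sum>s\<in>UNIV. f y s) + of_nat CARD('a) ^ l * f y 0) * \<xi> (x * y))"
    by (simp add: distrib_right sum_distrib_right mult.assoc)
  finally show ?thesis .
qed

lemma weighted_sum_outer:
  assumes "\<alpha> \<noteq> 0"
  shows "weighted_sum (Suc l) f (brd \<alpha> (0\<^sub>v (2 * l + 1)) \<beta>) =
    of_nat CARD('a) ^ l * (\<Sum>a\<in>UNIV. \<Sum>b\<in>UNIV. \<xi> (\<alpha> * a + \<beta> * b) * (\<Sum>x\<in>UNIV. f x (a * b)))"
proof -
  have "weighted_sum (Suc l) f (brd \<alpha> (0\<^sub>v (2 * l + 1)) \<beta>) =
    (\<Sum>a\<in>UNIV. \<Sum>b\<in>UNIV. \<Sum>c\<in>carrier_vec (2 * l + 1). \<xi> (\<alpha> * a + \<beta> * b) * f (c $ l) (hyp l c + a * b))"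
    unfolding weighted_sum_def sum_brd
    by (intro sum.cong refl) (simp add: brd_center hyp_brd brd_scalar_prod[of _ l] mult.commute)
  also have "\<dots> = of_nat CARD('a) ^ l * (\<Sum>a\<in>UNIV. \<Sum>b\<in>UNIV. \<xi> (\<alpha> * a + \<beta> * b) * (\<Sum>x\<in>UNIV. f x (a * b)))"
    by (rule sum_vec_hyp_outer[OF sum_pairs[OF assms]])
  finally show ?thesis .
qed

lemma weighted_sum_one: "weighted_sum l (\<lambda>_ _. 1) z = orbit_sum l 0 z + orbit_sum l 1 z + orbit_sum l 2 z"
proof -
  have "(1 :: complex) = (if nroots x s = 0 then 1 else 0) + (if nroots x s = 1 then 1 else 0) + (if nroots x s = 2 then 1 else 0)" for x s :: 'a
    by (cases rule: nroots_cases[of x s]) auto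
  then have "weighted_sum l (\<lambda>_ _. 1) z = (\<Sum>c\<in>carrier_vec (2 * l + 1). ((if nroots (c $ l) (hyp l c) = 0 then 1 else 0) +
      (if nroots (c $ l) (hyp l c) = 1 then 1 else 0) + (if nroots (c $ l) (hyp l c) = 2 then 1 else 0)) * \<xi> (c \<bullet> z))"
    unfolding weighted_sum_def by (intro sum.cong refl arg_cong2[of _ _ _ _ "(*)"])
  then show ?thesis unfolding orbit_sum_weighted by (simp only: weighted_sum_def distrib_right sum.distrib)
qed

lemma weighted_sum_nroots: "weighted_sum l (\<lambda>x s. of_nat (nroots x s)) z = orbit_sum l 1 z + 2 * orbit_sum l 2 z"
proof -
  have "(of_nat (nroots x s) :: complex) = (if nroots x s = 1 then 1 else 0) + 2 * (if nroots x s = 2 then 1 else 0)" for x s :: 'a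
    by (cases rule: nroots_cases[of x s]) auto
  then have "weighted_sum l (\<lambda>x s. of_nat (nroots x s)) z = (\<Sum>c\<in>carrier_vec (2 * l + 1). ((if nroots (c $ l) (hyp l c) = 1 then 1 else 0) +
      2 * (if nroots (c $ l) (hyp l c) = 2 then 1 else 0)) * \<xi> (c \<bullet> z))"
    unfolding weighted_sum_def by (intro sum.cong refl arg_cong2[of _ _ _ _ "(*)"])
  then show ?thesis unfolding orbit_sum_weighted
    by (simp only: weighted_sum_def distrib_right sum.distrib mult.assoc sum_distrib_left)
qed

lemma nroots_0: "(of_nat (nroots x (0 :: 'a)) :: complex) = (if x = 0 then 1 else 2)"
  using nroots_eq(1)[of 0 x 0] by simp

lemma sum_nonzero_split: "(\<Sum>x\<in>(UNIV :: 'a set). if x = 0 then a else f x) = (a :: complex) + (\<Sum>x\<in>UNIV - {0}. f x)"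
  by (simp add: sum.remove[of UNIV "0::'a"])

text \<open>\<open>Q\<close> is the power q^(m-1) of the value matrix, with m = l + 2. The results
  hold in every characteristic, because \<open>sum_nroots\<close> does not distinguish them.\<close>

lemma weighted_values:
  fixes l :: nat
  defines "Q \<equiv> (of_nat CARD('a) :: complex) ^ Suc l" and "q \<equiv> (of_nat CARD('a) :: complex)"
  shows "weighted_sum (Suc l) (\<lambda>_ _. 1) (0 \<cdot>\<^sub>v unit_vec (2 * Suc l + 1) (Suc l)) = q * Q\<^sup>2"
    "weighted_sum (Suc l) (\<lambda>_ _. 1) (1 \<cdot>\<^sub>v unit_vec (2 * Suc l + 1) (Suc l)) = 0"
    "weighted_sum (Suc l) (\<lambda>_ _. 1) (brd 1 (0\<^sub>v (2 * l + 1)) \<beta>) = 0"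
    "weighted_sum (Suc l) (\<lambda>x s. of_nat (nroots x s)) (0 \<cdot>\<^sub>v unit_vec (2 * Suc l + 1) (Suc l)) = q * Q\<^sup>2 + q * Q - Q"
    "weighted_sum (Suc l) (\<lambda>x s. of_nat (nroots x s)) (1 \<cdot>\<^sub>v unit_vec (2 * Suc l + 1) (Suc l)) = - Q"
    "weighted_sum (Suc l) (\<lambda>x s. of_nat (nroots x s)) (brd 1 (0\<^sub>v (2 * l + 1)) \<beta>) = (if \<beta> = 0 then Q * (q - 1) else - Q)"
proof -
  have Qq: "Q = q ^ Suc l" by (simp only: Q_def q_def)
  have h: "q * hcoef q (Suc l) = Q\<^sup>2 - Q" unfolding hcoef_eq Q_def q_def by (simp add: power2_eq_square power_add[symmetric] mult_2)
  have s1: "(\<Sum>y\<in>UNIV. \<xi> (1 * y)) = 0" using sum_scaled[of 1] by simp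
  show "weighted_sum (Suc l) (\<lambda>_ _. 1) (0 \<cdot>\<^sub>v unit_vec (2 * Suc l + 1) (Suc l)) = q * Q\<^sup>2"
    unfolding weighted_sum_center q_def[symmetric] Qq[symmetric] using h by (simp add: zero q_def mult.commute)
  show "weighted_sum (Suc l) (\<lambda>_ _. 1) (1 \<cdot>\<^sub>v unit_vec (2 * Suc l + 1) (Suc l)) = 0"
    unfolding weighted_sum_center sum_distrib_left[symmetric] s1 by simp
  show "weighted_sum (Suc l) (\<lambda>_ _. 1) (brd 1 (0\<^sub>v (2 * l + 1)) \<beta>) = 0"
    unfolding weighted_sum_outer[OF one_neq_zero] sum_distrib_right[symmetric] sum_pairs[OF one_neq_zero] by simp
  have n0: "(\<Sum>y\<in>(UNIV :: 'a set). if y = 0 then 1 else 2 :: complex) = 2 * q - 1"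
    unfolding sum_nonzero_split by (simp add: q_def card_Diff_subset of_nat_diff Suc_leI finite_UNIV_card_ge_0)
  show "weighted_sum (Suc l) (\<lambda>x s. of_nat (nroots x s)) (0 \<cdot>\<^sub>v unit_vec (2 * Suc l + 1) (Suc l)) = q * Q\<^sup>2 + q * Q - Q"
    unfolding weighted_sum_center sum_nroots nroots_0 q_def[symmetric] Qq[symmetric]
    by (simp add: zero sum.distrib sum_distrib_left[symmetric] n0 q_def[symmetric] mult.commute[of _ q] h) (simp add: algebra_simps h power2_eq_square)
  have n1: "(\<Sum>y\<in>UNIV. (if y = 0 then 1 else 2) * \<xi> (1 * y)) = - 1"
  proof -
    have "(\<Sum>y\<in>UNIV. (if y = 0 then 1 else 2) * \<xi> (1 * y)) = (\<Sum>y\<in>(UNIV :: 'a set). if y = 0 then 1 else 2 * \<xi> (1 * y))"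
      by (intro sum.cong) (auto simp: zero)
    also have "\<dots> = 1 + 2 * (\<Sum>y\<in>UNIV - {0}. \<xi> (1 * y))" unfolding sum_nonzero_split sum_distrib_left ..
    finally show ?thesis unfolding sum_nonzero[OF one_neq_zero] by simp
  qed
  show "weighted_sum (Suc l) (\<lambda>x s. of_nat (nroots x s)) (1 \<cdot>\<^sub>v unit_vec (2 * Suc l + 1) (Suc l)) = - Q"
    unfolding weighted_sum_center sum_nroots nroots_0 q_def[symmetric] Qq[symmetric] distrib_right sum.distrib mult.assoc
      sum_distrib_left[symmetric] s1 n1 by simp
  have "(\<Sum>a\<in>UNIV. \<Sum>b\<in>UNIV. \<xi> (1 * a + \<beta> * b) * (\<Sum>x\<in>UNIV. of_nat (nroots x (a * b)))) =
    (\<Sum>a\<in>UNIV. \<Sum>b\<in>UNIV. \<xi> (1 * a + \<beta> * b)) * (q - 1) + q * (\<Sum>a\<in>UNIV. \<Sum>b\<in>UNIV. \<xi> (1 * a + \<beta> * b) * (if a * b = 0 then 1 else 0))"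
    unfolding sum_nroots sum_distrib_right sum_distrib_left sum.distrib[symmetric] q_def
    by (intro sum.cong refl) (auto simp: algebra_simps)
  also have "\<dots> = q * (if \<beta> = 0 then q - 1 else - 1)"
    unfolding sum_pairs[OF one_neq_zero] sum_degenerate_pairs[OF one_neq_zero] q_def by simp
  finally show "weighted_sum (Suc l) (\<lambda>x s. of_nat (nroots x s)) (brd 1 (0\<^sub>v (2 * l + 1)) \<beta>) = (if \<beta> = 0 then Q * (q - 1) else - Q)"
    unfolding weighted_sum_outer[OF one_neq_zero] by (simp add: Q_def q_def)
qed

text \<open>Here the characteristics part: one root is a quadratic condition on the functional for
  odd q and the linear condition of a vanishing middle coordinate for even q. This is why the last
  two rows of the matrix differ in the two cases while the first two agree.\<close>

lemma one_root_values_odd: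
  fixes l :: nat
  defines "Q \<equiv> (of_nat CARD('a) :: complex) ^ Suc l"
  assumes two: "(2 :: 'a) \<noteq> 0"
  shows "orbit_sum (Suc l) 1 (0 \<cdot>\<^sub>v unit_vec (2 * Suc l + 1) (Suc l)) = Q\<^sup>2"
    "orbit_sum (Suc l) 1 (1 \<cdot>\<^sub>v unit_vec (2 * Suc l + 1) (Suc l)) = Q"
    "orbit_sum (Suc l) 1 (brd 1 (0\<^sub>v (2 * l + 1)) 0) = 0"
    "\<beta> \<noteq> 0 \<Longrightarrow> \<not> (\<exists>x. \<beta> = x\<^sup>2) \<Longrightarrow> orbit_sum (Suc l) 1 (brd 1 (0\<^sub>v (2 * l + 1)) \<beta>) = - Q"
proof -
  define q where "q = (of_nat CARD('a) :: complex)"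
  have four: "(4 :: 'a) \<noteq> 0" using two by (metis mult_2 mult_eq_0_iff numeral_Bit0)
  have Qq: "Q = q ^ Suc l" by (simp only: Q_def q_def)
  have h: "q * hcoef q (Suc l) = Q\<^sup>2 - Q" unfolding hcoef_eq Q_def q_def by (simp add: power2_eq_square power_add[symmetric] mult_2)
  note e = orbit_sum_weighted nroots_eq_1_iff(1)[OF two]
  have c1: "(\<Sum>s\<in>UNIV. if x\<^sup>2 + 4 * s = 0 then 1 else 0 :: complex) = 1" for x :: 'a
  proof -
    have "x\<^sup>2 + 4 * s = 0 \<longleftrightarrow> s = - x\<^sup>2 / 4" for s using four by (auto simp: field_simps add_eq_0_iff)
    then show ?thesis by simp
  qed
  have c0: "y\<^sup>2 + 4 * 0 = 0 \<longleftrightarrow> y = 0" for y :: 'a by simp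
  show "orbit_sum (Suc l) 1 (0 \<cdot>\<^sub>v unit_vec (2 * Suc l + 1) (Suc l)) = Q\<^sup>2"
    unfolding e weighted_sum_center c1 c0 q_def[symmetric] Qq[symmetric] using h
    by (simp add: zero sum.distrib sum_distrib_left[symmetric] q_def[symmetric] mult.commute)
  have "(\<Sum>y\<in>UNIV. (hcoef q (Suc l) * 1 + Q * (if y = 0 then 1 else 0)) * \<xi> (1 * y)) =
    hcoef q (Suc l) * (\<Sum>y\<in>UNIV. \<xi> (1 * y)) + (\<Sum>y\<in>(UNIV :: 'a set). if y = 0 then Q else 0)"
    unfolding sum_distrib_left sum.distrib[symmetric] by (intro sum.cong) (auto simp: zero algebra_simps)
  then show "orbit_sum (Suc l) 1 (1 \<cdot>\<^sub>v unit_vec (2 * Suc l + 1) (Suc l)) = Q"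
    unfolding e weighted_sum_center c1 c0 q_def[symmetric] Qq[symmetric] sum_scaled by simp
  show "orbit_sum (Suc l) 1 (brd 1 (0\<^sub>v (2 * l + 1)) 0) = 0"
    unfolding e weighted_sum_outer[OF one_neq_zero] using sum_cone(1)[OF two] by simp
  show "orbit_sum (Suc l) 1 (brd 1 (0\<^sub>v (2 * l + 1)) \<beta>) = - Q" if "\<beta> \<noteq> 0" "\<not> (\<exists>x. \<beta> = x\<^sup>2)"
    unfolding e weighted_sum_outer[OF one_neq_zero] mult_1_left sum_cone(2)[OF two that] by (simp add: Q_def)
qed

lemma one_root_values_even:
  fixes l :: nat
  defines "Q \<equiv> (of_nat CARD('a) :: complex) ^ Suc l"
  assumes two: "(2 :: 'a) = 0"
  shows "orbit_sum (Suc l) 1 (x \<cdot>\<^sub>v unit_vec (2 * Suc l + 1) (Suc l)) = Q\<^sup>2"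
    "orbit_sum (Suc l) 1 (brd 1 (0\<^sub>v (2 * l + 1)) \<beta>) = 0"
proof -
  define q where "q = (of_nat CARD('a) :: complex)"
  have Qq: "Q = q ^ Suc l" by (simp only: Q_def q_def)
  have h: "q * hcoef q (Suc l) = Q\<^sup>2 - Q" unfolding hcoef_eq Q_def q_def by (simp add: power2_eq_square power_add[symmetric] mult_2)
  note e = orbit_sum_weighted nroots_eq_1_iff(2)[OF two]
  have "(\<Sum>y\<in>UNIV. (hcoef q (Suc l) * (\<Sum>s\<in>(UNIV :: 'a set). if y = 0 then 1 else 0) + Q * (if y = 0 then 1 else 0)) * \<xi> (x * y)) =
    (\<Sum>y\<in>(UNIV :: 'a set). if y = 0 then Q\<^sup>2 else 0)"
    using h by (intro sum.cong) (auto simp: zero q_def[symmetric] mult.commute)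
  then show "orbit_sum (Suc l) 1 (x \<cdot>\<^sub>v unit_vec (2 * Suc l + 1) (Suc l)) = Q\<^sup>2"
    unfolding e weighted_sum_center q_def[symmetric] Qq[symmetric] by simp
  show "orbit_sum (Suc l) 1 (brd 1 (0\<^sub>v (2 * l + 1)) \<beta>) = 0"
    unfolding e weighted_sum_outer[OF one_neq_zero] sum_distrib_right[symmetric] sum_pairs[OF one_neq_zero] by simp
qed

end

section \<open>The polar form and the standard matrices\<close>

lemma scalar_split:
  fixes v w :: "'a::comm_semiring_0 vec"
  assumes "v \<in> carrier_vec (2 * l + 1)" "w \<in> carrier_vec (2 * l + 1)"
  shows "v \<bullet> w = v $ l * w $ l + (\<Sum>j=1..l. v $ (l - j) * w $ (l - j) + v $ (l + j) * w $ (l + j))"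
  using assms
proof (induction l arbitrary: v w)
  case 0
  then show ?case by (simp add: scalar_prod_def)
next
  case (Suc l)
  obtain a v' b where v: "v' \<in> carrier_vec (2 * l + 1)" "v = brd a v' b" using Suc.prems(1) by (rule brd_cases)
  obtain c w' d where w: "w' \<in> carrier_vec (2 * l + 1)" "w = brd c w' d" using Suc.prems(2) by (rule brd_cases)
  have e: "(\<Sum>j=1..Suc l. v $ (Suc l - j) * w $ (Suc l - j) + v $ (Suc l + j) * w $ (Suc l + j)) =
    (\<Sum>j=1..l. v $ (Suc l - j) * w $ (Suc l - j) + v $ (Suc l + j) * w $ (Suc l + j)) + (v $ 0 * w $ 0 + v $ (2 * Suc l) * w $ (2 * Suc l))"
    by (simp add: mult_2)
  have "(\<Sum>j=1..l. v $ (Suc l - j) * w $ (Suc l - j) + v $ (Suc l + j) * w $ (Suc l + j)) =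
    (\<Sum>j=1..l. v' $ (l - j) * w' $ (l - j) + v' $ (l + j) * w' $ (l + j))"
  proof (rule sum.cong[OF refl])
    fix j assume j: "j \<in> {1..l}"
    have e: "Suc l - j = Suc (l - j)" "Suc l + j = Suc (l + j)" using j by auto
    show "v $ (Suc l - j) * w $ (Suc l - j) + v $ (Suc l + j) * w $ (Suc l + j) = v' $ (l - j) * w' $ (l - j) + v' $ (l + j) * w' $ (l + j)"
      unfolding e v(2) w(2) using j by (simp add: brd_index(2)[OF v(1)] brd_index(2)[OF w(1)])
  qed
  then show ?case
    unfolding e unfolding v(2) w(2) brd_scalar_prod[OF v(1) w(1)] Suc.IH[OF v(1) w(1)] brd_center[OF v(1)] brd_center[OF w(1)]
      brd_index(1,3)[OF v(1)] brd_index(1,3)[OF w(1)]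
    by (simp add: ac_simps)
qed

definition bil :: "nat \<Rightarrow> 'a::comm_semiring_1 vec \<Rightarrow> 'a vec \<Rightarrow> 'a" where
  "bil l v w = (\<Sum>j=1..l. v $ (l - j) * w $ (l + j) + v $ (l + j) * w $ (l - j))"

text \<open>The Gram matrix \<open>gram_J\<close> applied to \<open>v\<close>, in coordinates. The
  middle entry carries the factor 2 and vanishes in characteristic 2, where the middle line is the
  radical.\<close>

definition Jv :: "nat \<Rightarrow> 'a::comm_semiring_1 vec \<Rightarrow> 'a vec" where
  "Jv l v = vec (2 * l + 1) (\<lambda>i. if i = l then 2 * v $ l else v $ (2 * l - i))"

lemma Jv_carrier [simp]: "Jv l v \<in> carrier_vec (2 * l + 1)"
  by (simp add: Jv_def)

lemma Jv_carrier' [simp]: "Jv l v \<in> carrier_vec (Suc (2 * l))" and Jv_dim [simp]: "dim_vec (Jv l v) = Suc (2 * l)"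
  by (simp_all add: Jv_def)

lemma Jv_index: "Jv l v $ l = 2 * v $ l" "j \<in> {1..l} \<Longrightarrow> Jv l v $ (l - j) = v $ (l + j)" "j \<in> {1..l} \<Longrightarrow> Jv l v $ (l + j) = v $ (l - j)"
  by (auto simp: Jv_def intro!: arg_cong[of _ _ "\<lambda>i. v $ i"])

lemma Jv_scalar:
  assumes "w \<in> carrier_vec (2 * l + 1)"
  shows "Jv l v \<bullet> w = 2 * v $ l * w $ l + bil l v w"
proof -
  have "(\<Sum>j=1..l. Jv l v $ (l - j) * w $ (l - j) + Jv l v $ (l + j) * w $ (l + j)) = bil l v w"
    unfolding bil_def
  proof (rule sum.cong[OF refl])
    fix j assume "j \<in> {1..l}"
    then show "Jv l v $ (l - j) * w $ (l - j) + Jv l v $ (l + j) * w $ (l + j) = v $ (l - j) * w $ (l + j) + v $ (l + j) * w $ (l - j)"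
      by (simp only: Jv_index(2,3)) (rule add.commute)
  qed
  then show ?thesis unfolding scalar_split[OF Jv_carrier assms] Jv_index(1) by simp
qed

lemma hyp_add:
  assumes "v \<in> carrier_vec (2 * l + 1)" "w \<in> carrier_vec (2 * l + 1)"
  shows "hyp l (v + w) = hyp l v + hyp l w + bil l v w"
  unfolding hyp_def bil_def sum.distrib[symmetric]
  using assms by (intro sum.cong refl) (auto simp: algebra_simps)

lemma hyp_smult:
  assumes "v \<in> carrier_vec (2 * l + 1)"
  shows "hyp l (a \<cdot>\<^sub>v v) = a\<^sup>2 * hyp l v"
  unfolding hyp_def sum_distrib_left using assms by (intro sum.cong refl) (auto simp: power2_eq_square algebra_simps)

lemma polar_form_Jv:
  assumes "v \<in> carrier_vec (2 * l + 1)" "w \<in> carrier_vec (2 * l + 1)"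
  shows "polar_form l v w = Jv l v \<bullet> w"
  unfolding polar_form_def Q_odd_hyp hyp_add[OF assms] Jv_scalar[OF assms(2)]
  using assms by (simp add: power2_eq_square algebra_simps)

lemma polar_form_commute:
  assumes "v \<in> carrier_vec (2 * l + 1)" "w \<in> carrier_vec (2 * l + 1)"
  shows "polar_form l v w = polar_form l w v"
  unfolding polar_form_def comm_add_vec[OF assms] by simp

lemma polar_form_brd:
  assumes "v \<in> carrier_vec (2 * l + 1)" "w \<in> carrier_vec (2 * l + 1)"
  shows "polar_form (Suc l) (brd a v b) (brd c w d) = polar_form l v w + a * d + b * c"
  unfolding polar_form_def brd_add[OF assms] using assms by (simp add: Q_odd_brd algebra_simps)

lemma Q_odd_smult: "v \<in> carrier_vec (2 * l + 1) \<Longrightarrow> Q_odd l (a \<cdot>\<^sub>v v) = a\<^sup>2 * Q_odd l v"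
  unfolding Q_odd_hyp by (simp add: hyp_smult power_mult_distrib distrib_left)

lemma Q_odd_add:
  "Q_odd l (v + w) = Q_odd l v + Q_odd l w + polar_form l v w"
  by (simp add: polar_form_def)

lemma scalar_col_gram:
  fixes v :: "'a::field vec"
  assumes v: "v \<in> carrier_vec (2 * l + 1)" and j: "j < 2 * l + 1"
  shows "v \<bullet> col (gram_J l) j = Jv l v $ j"
proof -
  have u: "(unit_vec (2 * l + 1) i :: 'a vec) \<in> carrier_vec (2 * l + 1)" for i by simp
  have "v \<bullet> col (gram_J l) j = (\<Sum>i<2 * l + 1. v $ i * polar_form l (unit_vec (2 * l + 1) i) (unit_vec (2 * l + 1) j))"
    using j by (auto simp: scalar_prod_def gram_J_def lessThan_atLeast0 intro!: sum.cong)
  also have "\<dots> = (\<Sum>i<2 * l + 1. v $ i * Jv l (unit_vec (2 * l + 1) j) $ i)"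
  proof (intro sum.cong refl)
    fix i assume i: "i \<in> {..<2 * l + 1}"
    have "polar_form l (unit_vec (2 * l + 1) i) (unit_vec (2 * l + 1) j :: 'a vec) = Jv l (unit_vec (2 * l + 1) j) \<bullet> unit_vec (2 * l + 1) i"
      unfolding polar_form_commute[OF u[of i] u[of j]] by (rule polar_form_Jv[OF u u])
    then show "v $ i * polar_form l (unit_vec (2 * l + 1) i) (unit_vec (2 * l + 1) j) = v $ i * Jv l (unit_vec (2 * l + 1) j) $ i"
      using i by simp
  qed
  also have "\<dots> = Jv l (unit_vec (2 * l + 1) j) \<bullet> v"
    using v by (simp add: scalar_prod_def lessThan_atLeast0 mult.commute)
  also have "\<dots> = polar_form l v (unit_vec (2 * l + 1) j)"
    using polar_form_Jv[OF u v] polar_form_commute[OF u v] by simp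
  also have "\<dots> = Jv l v $ j" unfolding polar_form_Jv[OF v u] using j by simp
  finally show ?thesis .
qed

section \<open>The action of unipotent and Levi matrices in split coordinates\<close>

lemma mat_brd_index:
  assumes M: "M \<in> carrier_mat n (2 * Suc l + 1)" and w: "w \<in> carrier_vec (2 * l + 1)" and i: "i < n"
  shows "(M *\<^sub>v brd a w b) $ i = M $$ (i, 0) * a + (\<Sum>j<2 * l + 1. M $$ (i, Suc j) * w $ j) + M $$ (i, 2 * Suc l) * (b :: 'a::semiring_0)"
proof -
  have "(M *\<^sub>v brd a w b) $ i = (\<Sum>j<Suc (Suc (2 * l + 1)). M $$ (i, j) * brd a w b $ j)"
    using mult_vec_index[OF M brd_carrier[OF w] i] by simp
  also have "\<dots> = (\<Sum>j<Suc (2 * l + 1). M $$ (i, j) * brd a w b $ j) + M $$ (i, 2 * Suc l) * b"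
    using brd_index(3)[OF w] by simp
  also have "(\<Sum>j<Suc (2 * l + 1). M $$ (i, j) * brd a w b $ j) = M $$ (i, 0) * a + (\<Sum>j<2 * l + 1. M $$ (i, Suc j) * w $ j)"
    unfolding sum.lessThan_Suc_shift brd_index(1)[OF w]
    by (intro arg_cong2[of _ _ _ _ "(+)"] sum.cong) (auto simp: brd_index(2)[OF w])
  finally show ?thesis .
qed

lemma eq_brdI:
  fixes y :: "'a vec"
  assumes y: "y \<in> carrier_vec (2 * Suc l + 1)" and w: "w \<in> carrier_vec (2 * l + 1)"
    and "y $ 0 = a" "\<And>i. i < 2 * l + 1 \<Longrightarrow> y $ Suc i = w $ i" "y $ (2 * Suc l) = b"
  shows "y = brd a w b"
proof -
  obtain a' w' b' where y': "w' \<in> carrier_vec (2 * l + 1)" "y = brd a' w' b'" using y by (rule brd_cases)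
  have "w' = w" using assms(4) w y' by (intro eq_vecI) (auto simp: brd_index(2)[OF y'(1)])
  then show ?thesis using assms(3,5) brd_index(1,3)[OF y'(1)] y'(2) by simp
qed

lemma u_mat_carrier [simp]: "u_mat m v \<in> carrier_mat (2 * m + 1) (2 * m + 1)"
  by (simp add: u_mat_def)

lemma u_mat_action:
  assumes v: "v \<in> carrier_vec (2 * l + 1)" and w: "w \<in> carrier_vec (2 * l + 1)"
  shows "u_mat (Suc l) v *\<^sub>v brd a w b = brd (a - polar_form l v w - Q_odd l v * b) (w + b \<cdot>\<^sub>v v) b"
proof (rule eq_brdI)
  let ?u = "u_mat (Suc l) v"
  note ind = mat_brd_index[OF u_mat_carrier w]
  have u: "?u $$ (i, j) = (if i = j then 1 else if i = 0 \<and> j = 2 * Suc l then - Q_odd l v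
     else if i = 0 then - (v \<bullet> col (gram_J l) (j - 1)) else if j = 2 * Suc l then v $ (i - 1) else 0)"
    if "i < 2 * Suc l + 1" "j < 2 * Suc l + 1" for i j
    using that by (simp add: u_mat_def)
  show "?u *\<^sub>v brd a w b \<in> carrier_vec (2 * Suc l + 1)" by (rule mult_mat_vec_carrier[OF u_mat_carrier brd_carrier[OF w]])
  show "w + b \<cdot>\<^sub>v v \<in> carrier_vec (2 * l + 1)" using v w by simp
  have "(\<Sum>j<2 * l + 1. ?u $$ (0, Suc j) * w $ j) = (\<Sum>j<2 * l + 1. - (Jv l v $ j * w $ j))"
    by (intro sum.cong refl) (simp add: u scalar_col_gram[OF v])
  also have "\<dots> = - polar_form l v w"
    unfolding polar_form_Jv[OF v w] using w by (simp add: scalar_prod_def lessThan_atLeast0 sum_negf)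
  finally show "(?u *\<^sub>v brd a w b) $ 0 = a - polar_form l v w - Q_odd l v * b"
    by (subst ind) (simp_all add: u)
  show "(?u *\<^sub>v brd a w b) $ Suc i = (w + b \<cdot>\<^sub>v v) $ i" if i: "i < 2 * l + 1" for i
  proof -
    have "(\<Sum>j<2 * l + 1. ?u $$ (Suc i, Suc j) * w $ j) = (\<Sum>j<2 * l + 1. if j = i then w $ i else 0)"
      using i by (intro sum.cong refl) (auto simp: u)
    then show ?thesis using i v w by (subst ind) (simp_all add: u mult.commute)
  qed
  have "(\<Sum>j<2 * l + 1. ?u $$ (2 * Suc l, Suc j) * w $ j) = 0"
    by (intro sum.neutral ballI) (auto simp: u)
  then show "(?u *\<^sub>v brd a w b) $ (2 * Suc l) = b"
    by (subst ind) (simp_all add: u)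
qed

text \<open>The opposite unipotent: \<open>u_mat\<close> with the two outermost coordinates
  exchanged. Together with \<open>u_mat\<close> and torus elements of the same rank it supplies all
  isometries needed for reducing functionals.\<close>

definition low_mat :: "nat \<Rightarrow> 'a::field vec \<Rightarrow> 'a mat" where
  "low_mat m v = mat (2 * m + 1) (2 * m + 1) (\<lambda>(i, j).
     if i = j then 1
     else if i = 2 * m \<and> j = 0 then - Q_odd (m - 1) v
     else if i = 2 * m then - (Jv (m - 1) v $ (j - 1))
     else if j = 0 then v $ (i - 1)
     else 0)"

lemma low_mat_carrier [simp]: "low_mat m v \<in> carrier_mat (2 * m + 1) (2 * m + 1)"
  by (simp add: low_mat_def)

lemma low_mat_action:
  assumes v: "v \<in> carrier_vec (2 * l + 1)" and w: "w \<in> carrier_vec (2 * l + 1)"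
  shows "low_mat (Suc l) v *\<^sub>v brd a w b = brd a (w + a \<cdot>\<^sub>v v) (b - polar_form l v w - Q_odd l v * a)"
proof (rule eq_brdI)
  let ?u = "low_mat (Suc l) v"
  note ind = mat_brd_index[OF low_mat_carrier w]
  have u: "?u $$ (i, j) = (if i = j then 1 else if i = 2 * Suc l \<and> j = 0 then - Q_odd l v
     else if i = 2 * Suc l then - (Jv l v $ (j - 1)) else if j = 0 then v $ (i - 1) else 0)"
    if "i < 2 * Suc l + 1" "j < 2 * Suc l + 1" for i j
    using that by (simp add: low_mat_def)
  show "?u *\<^sub>v brd a w b \<in> carrier_vec (2 * Suc l + 1)" by (rule mult_mat_vec_carrier[OF low_mat_carrier brd_carrier[OF w]])
  show "w + a \<cdot>\<^sub>v v \<in> carrier_vec (2 * l + 1)" using v w by simp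
  have "(\<Sum>j<2 * l + 1. ?u $$ (2 * Suc l, Suc j) * w $ j) = (\<Sum>j<2 * l + 1. - (Jv l v $ j * w $ j))"
    by (intro sum.cong refl) (auto simp: u)
  also have "\<dots> = - polar_form l v w"
    unfolding polar_form_Jv[OF v w] using w by (simp add: scalar_prod_def lessThan_atLeast0 sum_negf)
  finally show "(?u *\<^sub>v brd a w b) $ (2 * Suc l) = b - polar_form l v w - Q_odd l v * a"
    by (subst ind) (simp_all add: u)
  show "(?u *\<^sub>v brd a w b) $ Suc i = (w + a \<cdot>\<^sub>v v) $ i" if i: "i < 2 * l + 1" for i
  proof -
    have "(\<Sum>j<2 * l + 1. ?u $$ (Suc i, Suc j) * w $ j) = (\<Sum>j<2 * l + 1. if j = i then w $ i else 0)"
      using i by (intro sum.cong refl) (auto simp: u)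
    then show ?thesis using i v w by (subst ind) (simp_all add: u mult.commute)
  qed
  have "(\<Sum>j<2 * l + 1. ?u $$ (0, Suc j) * w $ j) = 0"
    by (intro sum.neutral ballI) (auto simp: u)
  then show "(?u *\<^sub>v brd a w b) $ 0 = a"
    by (subst ind) (simp_all add: u)
qed

lemma s_mat_four_block:
  "s_mat x a = four_block_mat (mat 1 1 (\<lambda>_. a)) (0\<^sub>m 1 (dim_col x + 1)) (0\<^sub>m (dim_row x + 1) 1)
     (four_block_mat x (0\<^sub>m (dim_row x) 1) (0\<^sub>m 1 (dim_col x)) (mat 1 1 (\<lambda>_. inverse a)))"
proof -
  have "diag_block_mat [mat 1 1 (\<lambda>_. inverse a)] = mat 1 1 (\<lambda>_. inverse a)"
    by (auto simp: Let_def intro!: eq_matI)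
  then show ?thesis unfolding s_mat_def by (simp add: Let_def)
qed

lemma s_mat_carrier: "x \<in> carrier_mat (2 * l + 1) (2 * l + 1) \<Longrightarrow> s_mat x a \<in> carrier_mat (2 * Suc l + 1) (2 * Suc l + 1)"
  unfolding s_mat_four_block by (auto intro!: carrier_matI)

lemma s_mat_index:
  assumes x: "x \<in> carrier_mat (2 * l + 1) (2 * l + 1)" and ij: "i < 2 * Suc l + 1" "j < 2 * Suc l + 1"
  shows "s_mat x a $$ (i, j) = (if i = 0 \<and> j = 0 then a else if i = 2 * Suc l \<and> j = 2 * Suc l then inverse a
    else if i = 0 \<or> j = 0 \<or> i = 2 * Suc l \<or> j = 2 * Suc l then 0 else x $$ (i - 1, j - 1))"
  using assms unfolding s_mat_four_block by auto

lemma s_mat_action: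
  assumes x: "x \<in> carrier_mat (2 * l + 1) (2 * l + 1)" and w: "w \<in> carrier_vec (2 * l + 1)"
  shows "s_mat x a *\<^sub>v brd \<alpha> w \<beta> = brd (a * \<alpha>) (x *\<^sub>v w) (inverse a * \<beta>)"
proof (rule eq_brdI)
  note ind = mat_brd_index[OF s_mat_carrier[OF x] w]
  note s = s_mat_index[OF x]
  show "s_mat x a *\<^sub>v brd \<alpha> w \<beta> \<in> carrier_vec (2 * Suc l + 1)" by (rule mult_mat_vec_carrier[OF s_mat_carrier[OF x] brd_carrier[OF w]])
  show xw: "x *\<^sub>v w \<in> carrier_vec (2 * l + 1)" using x w by simp
  have "(\<Sum>j<2 * l + 1. s_mat x a $$ (0, Suc j) * w $ j) = 0" "(\<Sum>j<2 * l + 1. s_mat x a $$ (2 * Suc l, Suc j) * w $ j) = 0"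
    by (auto intro!: sum.neutral simp: s)
  then show "(s_mat x a *\<^sub>v brd \<alpha> w \<beta>) $ 0 = a * \<alpha>" "(s_mat x a *\<^sub>v brd \<alpha> w \<beta>) $ (2 * Suc l) = inverse a * \<beta>"
    by (subst ind; simp add: s)+
  show "(s_mat x a *\<^sub>v brd \<alpha> w \<beta>) $ Suc i = (x *\<^sub>v w) $ i" if i: "i < 2 * l + 1" for i
  proof -
    have "(\<Sum>j<2 * l + 1. s_mat x a $$ (Suc i, Suc j) * w $ j) = (x *\<^sub>v w) $ i"
      unfolding mult_vec_index[OF x w i] using i by (intro sum.cong refl) (auto simp: s)
    then show ?thesis using i by (subst ind) (simp_all add: s)
  qed
qed

text \<open>Identities between block matrices are checked on vectors: in these coordinates matrix
  products become compositions of short formulas.\<close>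

lemma eq_mat_by_brd:
  fixes A :: "'a::semiring_1 mat"
  assumes A: "A \<in> carrier_mat n (2 * Suc l + 1)" and B: "B \<in> carrier_mat n (2 * Suc l + 1)"
    and eq: "\<And>a v b. v \<in> carrier_vec (2 * l + 1) \<Longrightarrow> A *\<^sub>v brd a v b = B *\<^sub>v brd a v b"
  shows "A = B"
proof (rule eq_mat_by_action[OF A B])
  fix y :: "'a vec" assume "y \<in> carrier_vec (2 * Suc l + 1)"
  then obtain a v b where "v \<in> carrier_vec (2 * l + 1)" "y = brd a v b" by (rule brd_cases)
  then show "A *\<^sub>v y = B *\<^sub>v y" using eq by simp
qed

section \<open>The special orthogonal group and its explicit elements\<close>

lemma SO_odd_iff:
  "x \<in> SO_odd l \<longleftrightarrow> x \<in> carrier_mat (2 * l + 1) (2 * l + 1) \<and> (\<forall>v\<in>carrier_vec (2 * l + 1). Q_odd l (x *\<^sub>v v) = Q_odd l v) \<and> det x = 1"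
proof -
  have "carrier (GL n) = Units (ring_mat TYPE('a) n ())" for n by (simp add: GL_def units_of_def)
  moreover have "x \<in> Units (ring_mat TYPE('a) n ())" if "x \<in> carrier_mat n n" "det x = 1" for n
    using det_non_zero_imp_unit[OF that(1)] that(2) by simp
  moreover have "x \<in> carrier_mat n n" if "x \<in> Units (ring_mat TYPE('a) n ())" for n
    using that by (auto simp: Units_def ring_mat_def)
  ultimately show ?thesis unfolding SO_odd_def by blast
qed

lemma SO_carrier: "x \<in> SO_odd l \<Longrightarrow> x \<in> carrier_mat (2 * l + 1) (2 * l + 1)"
  and SO_Q: "x \<in> SO_odd l \<Longrightarrow> v \<in> carrier_vec (2 * l + 1) \<Longrightarrow> Q_odd l (x *\<^sub>v v) = Q_odd l v"
  by (auto simp: SO_odd_iff)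

lemma SO_polar:
  assumes x: "x \<in> SO_odd l" and v: "v \<in> carrier_vec (2 * l + 1)" and w: "w \<in> carrier_vec (2 * l + 1)"
  shows "polar_form l (x *\<^sub>v v) (x *\<^sub>v w) = polar_form l v w"
proof -
  have "x *\<^sub>v v + x *\<^sub>v w = x *\<^sub>v (v + w)" by (rule mult_add_distrib_mat_vec[OF SO_carrier[OF x] v w, symmetric])
  then show ?thesis using v w by (simp add: polar_form_def SO_Q[OF x])
qed

lemma SO_one: "1\<^sub>m (2 * l + 1) \<in> SO_odd l"
  by (auto simp: SO_odd_iff)

lemma SO_mult:
  assumes x: "x \<in> SO_odd l" and y: "y \<in> SO_odd l"
  shows "x * y \<in> SO_odd l"
proof -
  note c = SO_carrier[OF x] SO_carrier[OF y]
  have "Q_odd l ((x * y) *\<^sub>v v) = Q_odd l v" if v: "v \<in> carrier_vec (2 * l + 1)" for v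
    using assoc_mult_mat_vec[OF c v] mult_mat_vec_carrier[OF c(2) v] SO_Q[OF x] SO_Q[OF y v] by simp
  moreover have "det (x * y) = 1" using x y det_mult[OF c] by (simp add: SO_odd_iff)
  ultimately show ?thesis using mult_carrier_mat[OF c] by (simp add: SO_odd_iff)
qed

lemma SO_inverse:
  assumes x: "x \<in> SO_odd l"
  obtains y where "y \<in> SO_odd l" "y * x = 1\<^sub>m (2 * l + 1)" "x * y = 1\<^sub>m (2 * l + 1)"
proof -
  note c = SO_carrier[OF x]
  have "x \<in> Units (ring_mat TYPE('a) (2 * l + 1) ())" using x by (intro det_non_zero_imp_unit[OF c]) (simp add: SO_odd_iff)
  then obtain y where y: "y \<in> carrier_mat (2 * l + 1) (2 * l + 1)" "y * x = 1\<^sub>m (2 * l + 1)" "x * y = 1\<^sub>m (2 * l + 1)"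
    by (auto simp: Units_def ring_mat_def)
  have "Q_odd l (y *\<^sub>v v) = Q_odd l v" if v: "v \<in> carrier_vec (2 * l + 1)" for v
    using SO_Q[OF x mult_mat_vec_carrier[OF y(1) v]] assoc_mult_mat_vec[OF c y(1) v] y(3) v by simp
  moreover have "det y = 1" using det_mult[OF c y(1)] y(3) x by (simp add: SO_odd_iff)
  ultimately have "y \<in> SO_odd l" using y(1) by (simp add: SO_odd_iff)
  then show ?thesis using that y by blast
qed

lemma SO_Suc_I:
  assumes "x \<in> carrier_mat (2 * Suc l + 1) (2 * Suc l + 1)" "det x = 1"
    "\<And>a v b. v \<in> carrier_vec (2 * l + 1) \<Longrightarrow> Q_odd (Suc l) (x *\<^sub>v brd a v b) = Q_odd (Suc l) (brd a v b)"
  shows "x \<in> SO_odd (Suc l)"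
  unfolding SO_odd_iff using assms by (metis brd_cases)

lemma u_mat_SO:
  assumes v: "v \<in> carrier_vec (2 * l + 1)"
  shows "u_mat (Suc l) v \<in> SO_odd (Suc l)"
proof (rule SO_Suc_I[OF u_mat_carrier])
  have "det (u_mat (Suc l) v) = prod_list (diag_mat (u_mat (Suc l) v))"
    by (rule det_upper_triangular[OF _ u_mat_carrier]) (auto simp: u_mat_def)
  also have "diag_mat (u_mat (Suc l) v) = map (\<lambda>_. 1) [0..<2 * Suc l + 1]"
    unfolding diag_mat_def carrier_matD(1)[OF u_mat_carrier]
  proof (rule map_cong[OF refl])
    fix i assume "i \<in> set [0..<2 * Suc l + 1]"
    then have "i < 2 * Suc l + 1" by auto
    then show "u_mat (Suc l) v $$ (i, i) = 1" by (simp add: u_mat_def)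
  qed
  also have "prod_list \<dots> = 1" by (rule prod_list_neutral) auto
  finally show "det (u_mat (Suc l) v) = 1" .
  show "Q_odd (Suc l) (u_mat (Suc l) v *\<^sub>v brd a w b) = Q_odd (Suc l) (brd a w b)" if w: "w \<in> carrier_vec (2 * l + 1)" for a w b
  proof -
    have bv: "b \<cdot>\<^sub>v v \<in> carrier_vec (2 * l + 1)" using v by simp
    have "polar_form l w (b \<cdot>\<^sub>v v) = b * polar_form l v w"
      unfolding polar_form_commute[OF v w] polar_form_Jv[OF w v] polar_form_Jv[OF w bv]
      by (rule scalar_prod_smult_distrib[OF Jv_carrier v])
    then show ?thesis
      unfolding u_mat_action[OF v w] Q_odd_brd[OF add_carrier_vec[OF w bv]] Q_odd_brd[OF w] Q_odd_add Q_odd_smult[OF v]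
      by (simp add: power2_eq_square algebra_simps)
  qed
qed

lemma low_mat_SO:
  assumes v: "v \<in> carrier_vec (2 * l + 1)"
  shows "low_mat (Suc l) v \<in> SO_odd (Suc l)"
proof (rule SO_Suc_I[OF low_mat_carrier])
  have "det (low_mat (Suc l) v) = prod_list (diag_mat (low_mat (Suc l) v))"
    by (rule det_lower_triangular[OF _ low_mat_carrier]) (auto simp: low_mat_def)
  also have "diag_mat (low_mat (Suc l) v) = map (\<lambda>_. 1) [0..<2 * Suc l + 1]"
    unfolding diag_mat_def carrier_matD(1)[OF low_mat_carrier]
  proof (rule map_cong[OF refl])
    fix i assume "i \<in> set [0..<2 * Suc l + 1]"
    then have "i < 2 * Suc l + 1" by auto
    then show "low_mat (Suc l) v $$ (i, i) = 1" by (simp add: low_mat_def)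
  qed
  also have "prod_list \<dots> = 1" by (rule prod_list_neutral) auto
  finally show "det (low_mat (Suc l) v) = 1" .
  show "Q_odd (Suc l) (low_mat (Suc l) v *\<^sub>v brd a w b) = Q_odd (Suc l) (brd a w b)" if w: "w \<in> carrier_vec (2 * l + 1)" for a w b
  proof -
    have bv: "a \<cdot>\<^sub>v v \<in> carrier_vec (2 * l + 1)" using v by simp
    have "polar_form l w (a \<cdot>\<^sub>v v) = a * polar_form l v w"
      unfolding polar_form_commute[OF v w] polar_form_Jv[OF w v] polar_form_Jv[OF w bv]
      by (rule scalar_prod_smult_distrib[OF Jv_carrier v])
    then show ?thesis
      unfolding low_mat_action[OF v w] Q_odd_brd[OF add_carrier_vec[OF w bv]] Q_odd_brd[OF w] Q_odd_add Q_odd_smult[OF v]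
      by (simp add: power2_eq_square algebra_simps)
  qed
qed

lemma det_s_mat:
  assumes x: "x \<in> carrier_mat (2 * l + 1) (2 * l + 1)" and a: "a \<noteq> 0"
  shows "det (s_mat x a) = det x"
proof -
  let ?B = "four_block_mat x (0\<^sub>m (dim_row x) 1) (0\<^sub>m 1 (dim_col x)) (mat 1 1 (\<lambda>_. inverse a))"
  have B: "?B \<in> carrier_mat (2 * l + 1 + 1) (2 * l + 1 + 1)" using x by auto
  have "det ?B = det x * det (mat 1 1 (\<lambda>_. inverse a))"
    using x by (intro det_four_block_mat_lower_left_zero[of _ "2 * l + 1" _ 1]) auto
  moreover have "det (s_mat x a) = det (mat 1 1 (\<lambda>_. a)) * det ?B"
    unfolding s_mat_four_block using x B by (intro det_four_block_mat_lower_left_zero[of _ 1 _ "2 * l + 1 + 1"]) auto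
  ultimately show ?thesis using a by (simp add: det_single)
qed

lemma s_mat_SO:
  assumes x: "x \<in> SO_odd l" and a: "a \<noteq> 0"
  shows "s_mat x a \<in> SO_odd (Suc l)"
proof (rule SO_Suc_I[OF s_mat_carrier[OF SO_carrier[OF x]]])
  show "det (s_mat x a) = 1" using det_s_mat[OF SO_carrier[OF x] a] x by (simp add: SO_odd_iff)
  show "Q_odd (Suc l) (s_mat x a *\<^sub>v brd \<alpha> w \<beta>) = Q_odd (Suc l) (brd \<alpha> w \<beta>)" if w: "w \<in> carrier_vec (2 * l + 1)" for \<alpha> w \<beta>
    unfolding s_mat_action[OF SO_carrier[OF x] w] Q_odd_brd[OF w] Q_odd_brd[OF mult_mat_vec_carrier[OF SO_carrier[OF x] w]]
    using a by (simp add: SO_Q[OF x w])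
qed

section \<open>Equivalence of functionals\<close>

text \<open>A functional \<open>v \<mapsto> c \<bullet> v\<close> is stored as the vector \<open>c\<close>.\<close>

definition fequiv :: "nat \<Rightarrow> 'a::field vec \<Rightarrow> 'a vec \<Rightarrow> bool" where
  "fequiv l c c' \<longleftrightarrow> (\<exists>x\<in>SO_odd l. \<exists>a. a \<noteq> 0 \<and> (\<forall>v\<in>carrier_vec (2 * l + 1). c' \<bullet> v = a * (c \<bullet> (x *\<^sub>v v))))"

lemma fequivI:
  assumes "x \<in> SO_odd l" "a \<noteq> 0" "\<And>v. v \<in> carrier_vec (2 * l + 1) \<Longrightarrow> c' \<bullet> v = a * (c \<bullet> (x *\<^sub>v v))"
  shows "fequiv l c c'"
  using assms unfolding fequiv_def by blast

lemma fequiv_trans: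
  assumes "fequiv l c c'" "fequiv l c' c''"
  shows "fequiv l c c''"
proof -
  obtain x a where x: "x \<in> SO_odd l" "a \<noteq> 0" "\<And>v. v \<in> carrier_vec (2 * l + 1) \<Longrightarrow> c' \<bullet> v = a * (c \<bullet> (x *\<^sub>v v))"
    using assms(1) unfolding fequiv_def by blast
  obtain y b where y: "y \<in> SO_odd l" "b \<noteq> 0" "\<And>v. v \<in> carrier_vec (2 * l + 1) \<Longrightarrow> c'' \<bullet> v = b * (c' \<bullet> (y *\<^sub>v v))"
    using assms(2) unfolding fequiv_def by blast
  show ?thesis
  proof (rule fequivI[OF SO_mult[OF x(1) y(1)], of "a * b"])
    fix v :: "'a vec" assume v: "v \<in> carrier_vec (2 * l + 1)"
    show "c'' \<bullet> v = a * b * (c \<bullet> (x * y *\<^sub>v v))"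
      unfolding y(3)[OF v] x(3)[OF mult_mat_vec_carrier[OF SO_carrier[OF y(1)] v]] assoc_mult_mat_vec[OF SO_carrier[OF x(1)] SO_carrier[OF y(1)] v]
      by simp
  qed (use x y in auto)
qed

lemma fequiv_sym:
  assumes "fequiv l c c'"
  shows "fequiv l c' c"
proof -
  obtain x a where x: "x \<in> SO_odd l" "a \<noteq> 0" "\<And>v. v \<in> carrier_vec (2 * l + 1) \<Longrightarrow> c' \<bullet> v = a * (c \<bullet> (x *\<^sub>v v))"
    using assms(1) unfolding fequiv_def by blast
  obtain y where y: "y \<in> SO_odd l" "x * y = 1\<^sub>m (2 * l + 1)" using SO_inverse[OF x(1)] by metis
  show ?thesis
  proof (rule fequivI[OF y(1), of "inverse a"])
    fix v :: "'a vec" assume v: "v \<in> carrier_vec (2 * l + 1)"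
    have "x *\<^sub>v (y *\<^sub>v v) = v" using assoc_mult_mat_vec[OF SO_carrier[OF x(1)] SO_carrier[OF y(1)] v] y(2) v by simp
    then show "c \<bullet> v = inverse a * (c' \<bullet> (y *\<^sub>v v))"
      using x(2) x(3)[OF mult_mat_vec_carrier[OF SO_carrier[OF y(1)] v]] by simp
  qed (use x in auto)
qed

lemma fequiv_Suc_I:
  assumes "x \<in> SO_odd (Suc l)" "a \<noteq> 0"
    "\<And>\<alpha> v \<beta>. v \<in> carrier_vec (2 * l + 1) \<Longrightarrow> c' \<bullet> brd \<alpha> v \<beta> = a * (c \<bullet> (x *\<^sub>v brd \<alpha> v \<beta>))"
  shows "fequiv (Suc l) c c'"
  using assms(1,2)
proof (rule fequivI)
  fix v :: "'a vec" assume "v \<in> carrier_vec (2 * Suc l + 1)"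
  then obtain \<alpha> w \<beta> where "w \<in> carrier_vec (2 * l + 1)" "v = brd \<alpha> w \<beta>" by (rule brd_cases)
  then show "c' \<bullet> v = a * (c \<bullet> (x *\<^sub>v v))" using assms(3) by simp
qed

text \<open>Pullback along \<open>u_mat\<close> keeps the first coordinate and changes the others;
  \<open>fequiv_lower\<close> does the same with the last coordinate fixed. All normal forms are
  reached by these moves, the torus and scalars.\<close>

lemma fequiv_upper:
  assumes c: "c \<in> carrier_vec (2 * l + 1)" and w: "w \<in> carrier_vec (2 * l + 1)"
  shows "fequiv (Suc l) (brd p c r) (brd p (c + (- p) \<cdot>\<^sub>v Jv l w) (r - p * Q_odd l w + c \<bullet> w))"
proof (rule fequiv_Suc_I[OF u_mat_SO[OF w] one_neq_zero])
  fix \<alpha> \<beta> and v :: "'a vec" assume v: "v \<in> carrier_vec (2 * l + 1)"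
  have "(c + (- p) \<cdot>\<^sub>v Jv l w) \<bullet> v = c \<bullet> v - p * (Jv l w \<bullet> v)"
    using c v by (subst add_scalar_prod_distrib[of _ "2 * l + 1"]) auto
  moreover have "c \<bullet> (v + \<beta> \<cdot>\<^sub>v w) = c \<bullet> v + \<beta> * (c \<bullet> w)"
    using c v w by (subst scalar_prod_add_distrib[of _ "2 * l + 1"]) auto
  moreover have d: "v + \<beta> \<cdot>\<^sub>v w \<in> carrier_vec (2 * l + 1)" "c + (- p) \<cdot>\<^sub>v Jv l w \<in> carrier_vec (2 * l + 1)" using c v w by auto
  ultimately show "brd p (c + (- p) \<cdot>\<^sub>v Jv l w) (r - p * Q_odd l w + c \<bullet> w) \<bullet> brd \<alpha> v \<beta> =
    1 * (brd p c r \<bullet> (u_mat (Suc l) w *\<^sub>v brd \<alpha> v \<beta>))"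
    unfolding u_mat_action[OF w v] brd_scalar_prod[OF d(2) v] brd_scalar_prod[OF c d(1)] polar_form_Jv[OF w v]
    by (simp add: algebra_simps)
qed

lemma fequiv_lower:
  assumes c: "c \<in> carrier_vec (2 * l + 1)" and w: "w \<in> carrier_vec (2 * l + 1)"
  shows "fequiv (Suc l) (brd p c r) (brd (p - r * Q_odd l w + c \<bullet> w) (c + (- r) \<cdot>\<^sub>v Jv l w) r)"
proof (rule fequiv_Suc_I[OF low_mat_SO[OF w] one_neq_zero])
  fix \<alpha> \<beta> and v :: "'a vec" assume v: "v \<in> carrier_vec (2 * l + 1)"
  have "(c + (- r) \<cdot>\<^sub>v Jv l w) \<bullet> v = c \<bullet> v - r * (Jv l w \<bullet> v)"
    using c v by (subst add_scalar_prod_distrib[of _ "2 * l + 1"]) auto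
  moreover have "c \<bullet> (v + \<alpha> \<cdot>\<^sub>v w) = c \<bullet> v + \<alpha> * (c \<bullet> w)"
    using c v w by (subst scalar_prod_add_distrib[of _ "2 * l + 1"]) auto
  moreover have d: "v + \<alpha> \<cdot>\<^sub>v w \<in> carrier_vec (2 * l + 1)" "c + (- r) \<cdot>\<^sub>v Jv l w \<in> carrier_vec (2 * l + 1)" using c v w by auto
  ultimately show "brd (p - r * Q_odd l w + c \<bullet> w) (c + (- r) \<cdot>\<^sub>v Jv l w) r \<bullet> brd \<alpha> v \<beta> =
    1 * (brd p c r \<bullet> (low_mat (Suc l) w *\<^sub>v brd \<alpha> v \<beta>))"
    unfolding low_mat_action[OF w v] brd_scalar_prod[OF d(2) v] brd_scalar_prod[OF c d(1)] polar_form_Jv[OF w v]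
    by (simp add: algebra_simps)
qed

lemma fequiv_torus:
  assumes c: "c \<in> carrier_vec (2 * l + 1)" and a: "a \<noteq> 0"
  shows "fequiv (Suc l) (brd p c r) (brd (a * p) c (r / a))"
proof (rule fequiv_Suc_I[OF s_mat_SO[OF SO_one a] one_neq_zero])
  fix \<alpha> \<beta> and v :: "'a vec" assume v: "v \<in> carrier_vec (2 * l + 1)"
  show "brd (a * p) c (r / a) \<bullet> brd \<alpha> v \<beta> = 1 * (brd p c r \<bullet> (s_mat (1\<^sub>m (2 * l + 1)) a *\<^sub>v brd \<alpha> v \<beta>))"
    unfolding s_mat_action[OF one_carrier_mat v] one_mult_mat_vec[OF v] brd_scalar_prod[OF c v] using a by (simp add: field_simps)
qed

lemma fequiv_scale:
  assumes "c \<in> carrier_vec (2 * l + 1)" "a \<noteq> 0"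
  shows "fequiv l c (a \<cdot>\<^sub>v c)"
  by (rule fequivI[OF SO_one assms(2)]) (use assms in auto)

lemma fequiv_refl: "c \<in> carrier_vec (2 * l + 1) \<Longrightarrow> fequiv l c c"
  using fequiv_scale[of c l 1] by simp

section \<open>The number of roots under the explicit moves, and nonsquares in finite fields\<close>

abbreviation rts :: "nat \<Rightarrow> 'a::field vec \<Rightarrow> nat" where
  "rts l c \<equiv> nroots (c $ l) (hyp l c)"

text \<open>Translation of the unknown by \<open>y\<close>.\<close>

lemma nroots_shift:
  fixes x :: "'a::field"
  shows "nroots (x - 2 * y) (s + x * y - y\<^sup>2) = nroots x s"
proof -
  have "bij_betw (\<lambda>t. t + y) {t. t\<^sup>2 + x * t = s} {t. t\<^sup>2 + (x - 2 * y) * t = s + x * y - y\<^sup>2}"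
  proof (rule bij_betwI[of _ _ _ "\<lambda>t. t - y"])
    show "(\<lambda>t. t + y) \<in> {t. t\<^sup>2 + x * t = s} \<rightarrow> {t. t\<^sup>2 + (x - 2 * y) * t = s + x * y - y\<^sup>2}"
      by (auto simp: power2_eq_square algebra_simps)
    show "(\<lambda>t. t - y) \<in> {t. t\<^sup>2 + (x - 2 * y) * t = s + x * y - y\<^sup>2} \<rightarrow> {t. t\<^sup>2 + x * t = s}"
    proof
      fix t assume "t \<in> {t. t\<^sup>2 + (x - 2 * y) * t = s + x * y - y\<^sup>2}"
      then have e: "t\<^sup>2 + (x - 2 * y) * t = s + x * y - y\<^sup>2" by simp
      have "(t - y)\<^sup>2 + x * (t - y) = t\<^sup>2 + (x - 2 * y) * t - x * y + y\<^sup>2" by (simp add: power2_eq_square algebra_simps)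
      then show "t - y \<in> {t. t\<^sup>2 + x * t = s}" unfolding e by simp
    qed
  qed auto
  then show ?thesis unfolding nroots_def by (rule bij_betw_same_card[symmetric])
qed

lemma nroots_scale:
  fixes x :: "'a::field"
  assumes a: "a \<noteq> 0"
  shows "nroots (a * x) (a\<^sup>2 * s) = nroots x s"
proof -
  have e: "(a * t)\<^sup>2 + a * x * (a * t) = a\<^sup>2 * s \<longleftrightarrow> t\<^sup>2 + x * t = s" for t
  proof -
    have "(a * t)\<^sup>2 + a * x * (a * t) = a\<^sup>2 * (t\<^sup>2 + x * t)" by (simp add: power2_eq_square algebra_simps)
    then show ?thesis using a by simp
  qed
  have "bij_betw (\<lambda>t. a * t) {t. t\<^sup>2 + x * t = s} {t. t\<^sup>2 + a * x * t = a\<^sup>2 * s}"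
  proof (rule bij_betwI[of _ _ _ "\<lambda>t. t / a"])
    show "(\<lambda>t. t / a) \<in> {t. t\<^sup>2 + a * x * t = a\<^sup>2 * s} \<rightarrow> {t. t\<^sup>2 + x * t = s}"
      using e[of "t / a" for t] a by auto
  qed (use a in \<open>auto simp: e\<close>)
  then show ?thesis unfolding nroots_def by (rule bij_betw_same_card[symmetric])
qed

lemma hyp_Jv: "hyp l (Jv l w) = hyp l w"
  unfolding hyp_def by (intro sum.cong refl) (simp only: Jv_index(2,3) mult.commute)

lemma bil_Jv:
  assumes "c \<in> carrier_vec (2 * l + 1)" "w \<in> carrier_vec (2 * l + 1)"
  shows "bil l c (a \<cdot>\<^sub>v Jv l w) = a * (c \<bullet> w - c $ l * w $ l :: 'a::comm_ring_1)"
proof -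
  have "bil l c (a \<cdot>\<^sub>v Jv l w) = (\<Sum>j=1..l. a * (c $ (l - j) * w $ (l - j) + c $ (l + j) * w $ (l + j)))"
    unfolding bil_def
  proof (rule sum.cong[OF refl])
    fix j assume j: "j \<in> {1..l}"
    then have d: "l - j < dim_vec (Jv l w)" "l + j < dim_vec (Jv l w)" by (auto simp: Jv_def)
    show "c $ (l - j) * (a \<cdot>\<^sub>v Jv l w) $ (l + j) + c $ (l + j) * (a \<cdot>\<^sub>v Jv l w) $ (l - j) =
      a * (c $ (l - j) * w $ (l - j) + c $ (l + j) * w $ (l + j))"
      unfolding index_smult_vec(1)[OF d(1)] index_smult_vec(1)[OF d(2)] Jv_index(2,3)[OF j] by (simp only: distrib_left mult.left_commute)
  qed
  then show ?thesis unfolding scalar_split[OF assms] sum_distrib_left[symmetric] by (simp only: add_diff_cancel_left')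
qed

text \<open>An upper move by \<open>w\<close> translates the unknown of the quadratic by
  \<open>p * w $ l\<close>, hence preserves the number of roots; the lower moves follow with the
  roles of \<open>p\<close> and \<open>r\<close> exchanged. For general isometries the invariance is
  obtained only from the singular count.\<close>

lemma rts_shift:
  assumes c: "c \<in> carrier_vec (2 * l + 1)" and w: "w \<in> carrier_vec (2 * l + 1)"
  shows "nroots ((c + (- p) \<cdot>\<^sub>v Jv l w) $ l) (hyp l (c + (- p) \<cdot>\<^sub>v Jv l w) + p * (r - p * Q_odd l w + c \<bullet> w)) =
    nroots (c $ l) (hyp l c + p * (r :: 'a::field))"
proof -
  have "(c + (- p) \<cdot>\<^sub>v Jv l w) $ l = c $ l - 2 * (p * w $ l)"
    using c by (simp add: Jv_def)
  moreover have "hyp l (c + (- p) \<cdot>\<^sub>v Jv l w) + p * (r - p * Q_odd l w + c \<bullet> w) = (hyp l c + p * r) + c $ l * (p * w $ l) - (p * w $ l)\<^sup>2"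
    unfolding hyp_add[OF c smult_carrier_vec[THEN iffD2, OF Jv_carrier]] hyp_smult[OF Jv_carrier] bil_Jv[OF c w] hyp_Jv Q_odd_hyp
    by (simp add: power2_eq_square algebra_simps)
  ultimately show ?thesis by (simp only: nroots_shift)
qed

text \<open>The image of an at most two-to-one map contains at least half of \<open>A\<close>; a
  disjoint translate of it must then be all the rest. In place of index computations in quotient
  groups this serves the squares in the multiplicative group and the elements t^2 + t in the
  additive group.\<close>

lemma union_of_translate:
  assumes A: "finite A" "f ` A \<subseteq> A" "\<And>y. card {x \<in> A. f x = y} \<le> 2"
    and g: "inj_on g A" "g ` A \<subseteq> A" "g ` f ` A \<inter> f ` A = {}" and y: "y \<in> A"
  shows "y \<in> f ` A \<or> y \<in> g ` f ` A"
proof -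
  have "A = (\<Union>y\<in>f ` A. {x \<in> A. f x = y})" by auto
  then have "card A \<le> (\<Sum>y\<in>f ` A. card {x \<in> A. f x = y})"
    using card_UN_le[of "f ` A" "\<lambda>y. {x \<in> A. f x = y}"] A(1) by simp
  also have "\<dots> \<le> (\<Sum>y\<in>f ` A. 2)" by (rule sum_mono[OF A(3)])
  finally have "card A \<le> card (f ` A) + card (f ` A)" by simp
  moreover have "card (g ` f ` A) = card (f ` A)" by (rule card_image[OF inj_on_subset[OF g(1) A(2)]])
  moreover have "card (g ` f ` A \<union> f ` A) = card (g ` f ` A) + card (f ` A)"
    using A(1) g(3) by (intro card_Un_disjoint) auto
  ultimately have "g ` f ` A \<union> f ` A = A" using A(1,2) g(2) by (intro card_seteq) auto
  then show ?thesis using y by blast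
qed

text \<open>The nonzero squares and their translate by the nonsquare \<open>d\<close> exhaust the
  multiplicative group.\<close>

lemma ratio_of_nonsquares:
  fixes d d' :: "'a::{field,finite}"
  assumes "(2 :: 'a) \<noteq> 0" "\<not> (\<exists>t. t\<^sup>2 = d)" "\<not> (\<exists>t. t\<^sup>2 = d')"
  shows "\<exists>k. k \<noteq> 0 \<and> d' = k\<^sup>2 * d"
proof -
  have d: "d \<noteq> 0" "d' \<noteq> 0" using assms by (metis zero_power2)+
  have "d' \<in> (\<lambda>t. t\<^sup>2) ` (UNIV - {0}) \<or> d' \<in> (\<lambda>t. d * t) ` (\<lambda>t. t\<^sup>2) ` (UNIV - {0})"
  proof (rule union_of_translate)
    fix y :: 'a
    have "{x \<in> UNIV - {0}. x\<^sup>2 = y} \<subseteq> {t. t\<^sup>2 + 0 * t = y}" by auto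
    then have "card {x \<in> UNIV - {0}. x\<^sup>2 = y} \<le> nroots 0 y" unfolding nroots_def by (intro card_mono) auto
    also have "\<dots> \<le> 2" by (cases rule: nroots_cases[of 0 y]) auto
    finally show "card {x \<in> UNIV - {0}. x\<^sup>2 = y} \<le> 2" .
  next
    have False if "s \<noteq> 0" "d * t\<^sup>2 = s\<^sup>2" "t \<noteq> 0" for s t
    proof -
      have "d = (s / t)\<^sup>2" using that by (simp add: power_divide field_simps)
      then show False using assms(2) by metis
    qed
    then show "(\<lambda>t. d * t) ` (\<lambda>t. t\<^sup>2) ` (UNIV - {0}) \<inter> (\<lambda>t. t\<^sup>2) ` (UNIV - {0}) = {}" by auto
  qed (use d in \<open>auto simp: inj_on_def\<close>)
  then show ?thesis
  proof
    assume "d' \<in> (\<lambda>t. t\<^sup>2) ` (UNIV - {0})"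
    then show ?thesis using assms(3) by auto
  next
    assume "d' \<in> (\<lambda>t. d * t) ` (\<lambda>t. t\<^sup>2) ` (UNIV - {0})"
    then show ?thesis by (auto simp: mult.commute)
  qed
qed

text \<open>The additive analogue of \<open>ratio_of_nonsquares\<close>: the image of t^2 + t and
  its translate by \<open>a\<close> exhaust the field.\<close>

lemma difference_of_non_artin_schreier:
  fixes a a' :: "'a::{field,finite}"
  assumes two: "(2 :: 'a) = 0" and a: "\<not> (\<exists>t. t\<^sup>2 + t = a)" and a': "\<not> (\<exists>t. t\<^sup>2 + t = a')"
  shows "\<exists>t. a' = a + t\<^sup>2 + t"
proof -
  have neg: "- x = x" for x :: 'a
  proof -
    have "x + x = 2 * x" by simp
    then show ?thesis using two by (simp add: eq_neg_iff_add_eq_0[symmetric] add_eq_0_iff)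
  qed
  have "a' \<in> (\<lambda>t. t\<^sup>2 + t) ` UNIV \<or> a' \<in> (\<lambda>t. a + t) ` (\<lambda>t. t\<^sup>2 + t) ` UNIV"
  proof (rule union_of_translate)
    fix y :: 'a
    have "card {x \<in> UNIV. x\<^sup>2 + x = y} = nroots 1 y" unfolding nroots_def by simp
    also have "\<dots> \<le> 2" by (cases rule: nroots_cases[of 1 y]) auto
    finally show "card {x \<in> UNIV. x\<^sup>2 + x = y} \<le> 2" .
  next
    have False if e: "a + (t\<^sup>2 + t) = s\<^sup>2 + s" for s t
    proof -
      have "a = s\<^sup>2 + s - (t\<^sup>2 + t)" using e by (simp add: algebra_simps)
      also have "\<dots> = (s - t)\<^sup>2 + (s - t) + 2 * (t * (s - t))" by (simp add: power2_eq_square algebra_simps)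
      finally show False using a two by (metis add.right_neutral mult_zero_left)
    qed
    then show "(\<lambda>t. a + t) ` (\<lambda>t. t\<^sup>2 + t) ` UNIV \<inter> (\<lambda>t. t\<^sup>2 + t) ` UNIV = {}" by auto
  qed (auto simp: inj_on_def)
  then show ?thesis using a' by (auto simp: add.assoc)
qed

section \<open>Normal forms of functionals\<close>

abbreviation mid :: "nat \<Rightarrow> 'a::field \<Rightarrow> 'a vec" where
  "mid l x \<equiv> x \<cdot>\<^sub>v unit_vec (2 * l + 1) l"

text \<open>Support on the outermost pair and the middle: after the inner coordinates are cleared,
  the whole reduction takes place in dimension 3.\<close>

abbreviation nf :: "nat \<Rightarrow> 'a::field \<Rightarrow> 'a \<Rightarrow> 'a \<Rightarrow> 'a vec" where
  "nf l p x r \<equiv> brd p (mid l x) r"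

lemma mid_carrier: "mid l x \<in> carrier_vec (2 * l + 1)" by simp

lemma mid_simps: "mid l x $ l = x" "hyp l (mid l x) = 0" "Q_odd l (mid l x) = x\<^sup>2"
  "v \<in> carrier_vec (2 * l + 1) \<Longrightarrow> mid l x \<bullet> v = x * v $ l"
  "Jv l (mid l x) = mid l (2 * x)" "mid l x + a \<cdot>\<^sub>v mid l y = mid l (x + a * y)"
proof -
  show 1: "mid l x $ l = x" by simp
  show 2: "hyp l (mid l x) = 0" unfolding hyp_def by (intro sum.neutral) auto
  show "Q_odd l (mid l x) = x\<^sup>2" unfolding Q_odd_hyp 1 2 by simp
  show "v \<in> carrier_vec (2 * l + 1) \<Longrightarrow> mid l x \<bullet> v = x * v $ l" by simp
  show "Jv l (mid l x) = mid l (2 * x)" by (intro eq_vecI) (auto simp: Jv_def)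
  show "mid l x + a \<cdot>\<^sub>v mid l y = mid l (x + a * y)" by (intro eq_vecI) auto
qed

lemma rts_brd: "c \<in> carrier_vec (2 * l + 1) \<Longrightarrow> rts (Suc l) (brd p c r) = nroots (c $ l) (hyp l c + p * r)"
  by (simp only: brd_center hyp_brd)

lemma rts_nf: "rts (Suc l) (nf l p x r) = nroots x (p * r)"
  unfolding rts_brd[OF mid_carrier] mid_simps by simp

lemma rts_upper:
  assumes c: "c \<in> carrier_vec (2 * l + 1)" and w: "w \<in> carrier_vec (2 * l + 1)"
  shows "rts (Suc l) (brd p (c + (- p) \<cdot>\<^sub>v Jv l w) (r - p * Q_odd l w + c \<bullet> w)) = rts (Suc l) (brd p c r)"
proof -
  have d: "c + (- p) \<cdot>\<^sub>v Jv l w \<in> carrier_vec (2 * l + 1)" using c by simp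
  show ?thesis unfolding rts_brd[OF d] rts_brd[OF c] by (rule rts_shift[OF c w])
qed

lemma rts_lower:
  assumes c: "c \<in> carrier_vec (2 * l + 1)" and w: "w \<in> carrier_vec (2 * l + 1)"
  shows "rts (Suc l) (brd (p - r * Q_odd l w + c \<bullet> w) (c + (- r) \<cdot>\<^sub>v Jv l w) r) = rts (Suc l) (brd p c r)"
proof -
  have d: "c + (- r) \<cdot>\<^sub>v Jv l w \<in> carrier_vec (2 * l + 1)" using c by simp
  show ?thesis unfolding rts_brd[OF d] rts_brd[OF c] mult.commute[of _ r] by (rule rts_shift[OF c w])
qed

lemma fequiv_nf_lower: "fequiv (Suc l) (nf l p x r) (nf l (p - r * t\<^sup>2 + x * t) (x - 2 * r * t) r)"
  using fequiv_lower[OF mid_carrier mid_carrier, of l p x r t] unfolding mid_simps mid_simps(4)[OF mid_carrier]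
  by (simp add: algebra_simps)

lemma fequiv_nf_upper: "fequiv (Suc l) (nf l p x r) (nf l p (x - 2 * p * t) (r - p * t\<^sup>2 + x * t))"
  using fequiv_upper[OF mid_carrier mid_carrier, of l p x r t] unfolding mid_simps mid_simps(4)[OF mid_carrier]
  by (simp add: algebra_simps)

lemma fequiv_nf_torus: "a \<noteq> 0 \<Longrightarrow> fequiv (Suc l) (nf l p x r) (nf l (a * p) x (r / a))"
  by (rule fequiv_torus[OF mid_carrier])

lemma fequiv_nf_scale: "a \<noteq> 0 \<Longrightarrow> fequiv (Suc l) (nf l p x r) (nf l (a * p) (a * x) (a * r))"
  using fequiv_scale[OF brd_carrier[OF mid_carrier], of a l p x r] by (simp add: brd_smult smult_smult_assoc)

text \<open>The last coordinate is the pivot for clearing the inner ones. If it is zero, an upper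
  move creates it, either from a nonzero inner coordinate or, when these all vanish, from the first
  coordinate.\<close>

lemma last_coordinate_nonzero:
  fixes c :: "'a::field vec"
  assumes c: "c \<in> carrier_vec (2 * Suc l + 1)" and ne: "c \<noteq> 0\<^sub>v (2 * Suc l + 1)"
  obtains p d r where "d \<in> carrier_vec (2 * l + 1)" "r \<noteq> 0" "fequiv (Suc l) c (brd p d r)" "rts (Suc l) (brd p d r) = rts (Suc l) c"
proof -
  obtain p d r where d: "d \<in> carrier_vec (2 * l + 1)" "c = brd p d r" using c by (rule brd_cases)
  consider "r \<noteq> 0" | "r = 0" "\<exists>i<2 * l + 1. d $ i \<noteq> 0" | "r = 0" "\<forall>i<2 * l + 1. d $ i = 0" by blast
  then show ?thesis
  proof cases
    case 1
    then show ?thesis using that[OF d(1), of r p] fequiv_refl[OF c] d(2) by simp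
  next
    case 2
    then obtain i where i: "i < 2 * l + 1" "d $ i \<noteq> 0" by blast
    define w where "w x = (x / d $ i) \<cdot>\<^sub>v unit_vec (2 * l + 1) i" for x
    have w: "w x \<in> carrier_vec (2 * l + 1)" for x by (simp add: w_def)
    have dw: "d \<bullet> w x = x" for x using i d(1) by (simp add: w_def)
    have z: "d + (- 0) \<cdot>\<^sub>v Jv l v = d" for v using d(1) by (intro eq_vecI) auto
    \<comment> \<open>Clearing the first coordinate beforehand ensures that the next upper move
      changes the last coordinate only.\<close>
    have 1: "fequiv (Suc l) (brd p d 0) (brd 0 d 0)" "rts (Suc l) (brd 0 d 0) = rts (Suc l) (brd p d 0)"
      using fequiv_lower[OF d(1) w[of "- p"], of p 0] rts_lower[OF d(1) w[of "- p"], of p 0] unfolding dw z by simp_all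
    have 2: "fequiv (Suc l) (brd 0 d 0) (brd 0 d 1)" "rts (Suc l) (brd 0 d 1) = rts (Suc l) (brd 0 d 0)"
      using fequiv_upper[OF d(1) w[of 1], of 0 0] rts_upper[OF d(1) w[of 1], of 0 0] unfolding dw z by simp_all
    show ?thesis
      using that[OF d(1), of 1 0] fequiv_trans[OF 1(1) 2(1)] 1(2) 2(2) d(2) \<open>r = 0\<close> by simp
  next
    case 3
    then have d0: "d = 0\<^sub>v (2 * l + 1)" using d(1) by (intro eq_vecI) auto
    have p: "p \<noteq> 0"
    proof
      assume "p = 0"
      then have "c = 0\<^sub>v (2 * Suc l + 1)" using d0 d(2) \<open>r = 0\<close> by (intro eq_vecI) (auto simp: brd_def)
      then show False using ne by simp
    qed
    let ?d = "d + (- p) \<cdot>\<^sub>v Jv l (mid l 1)"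
    have dd: "?d \<in> carrier_vec (2 * l + 1)" using d(1) by simp
    have e: "r - p * Q_odd l (mid l 1) + d \<bullet> mid l 1 = - p" unfolding mid_simps(3) using \<open>r = 0\<close> d0 by simp
    show ?thesis
      using that[OF dd, of "- p" p] fequiv_upper[OF d(1) mid_carrier[of 1 l], of p r] rts_upper[OF d(1) mid_carrier[of 1 l], of p r] p d(2)
      unfolding e by simp
  qed
qed

lemma fequiv_to_nf:
  fixes c :: "'a::field vec"
  assumes c: "c \<in> carrier_vec (2 * Suc l + 1)" and ne: "c \<noteq> 0\<^sub>v (2 * Suc l + 1)"
  obtains p x r where "r \<noteq> 0" "fequiv (Suc l) c (nf l p x r)" "nroots x (p * r) = rts (Suc l) c"
proof -
  obtain p d r where d: "d \<in> carrier_vec (2 * l + 1)" "r \<noteq> 0" "fequiv (Suc l) c (brd p d r)" "rts (Suc l) (brd p d r) = rts (Suc l) c"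
    using last_coordinate_nonzero[OF c ne] .
  \<comment> \<open>\<open>w\<close> is chosen such that \<open>r \<cdot>\<^sub>v Jv l w\<close>
    agrees with \<open>d\<close> away from the middle. The middle coordinate cannot be cleared in
    this way in general, as \<open>Jv\<close> has the factor 2 there, and is left alone.\<close>
  define w where "w = vec (2 * l + 1) (\<lambda>i. if i = l then 0 else d $ (2 * l - i) / r)"
  have w: "w \<in> carrier_vec (2 * l + 1)" by (simp add: w_def)
  have k: "d + (- r) \<cdot>\<^sub>v Jv l w = mid l (d $ l)"
  proof (rule eq_vecI)
    fix i assume "i < dim_vec (mid l (d $ l))"
    then have i: "i < 2 * l + 1" by simp
    have "Jv l w $ i = (if i = l then 0 else d $ i / r)" using i by (auto simp: Jv_def w_def)
    then show "(d + (- r) \<cdot>\<^sub>v Jv l w) $ i = mid l (d $ l) $ i" using i d(1,2) by (auto simp: Jv_dim)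
  qed (use d(1) in auto)
  show ?thesis
    using that[OF d(2)] fequiv_trans[OF d(3) fequiv_lower[OF d(1) w]] rts_lower[OF d(1) w, of p r] d(4)
    unfolding k rts_nf by metis
qed

text \<open>A root \<open>\<tau>\<close> is exactly what a lower move needs to clear the first
  coordinate: the parameter \<open>- \<tau> / r\<close> turns it into (p r - \<tau>^2 - x \<tau>) /
  r = 0. The middle coordinate becomes x + 2 \<tau>, which is 0 precisely for a double root.\<close>

lemma nf_one_root:
  assumes r: "r \<noteq> 0" and n: "nroots x (p * r) = 1"
  shows "fequiv (Suc l) (nf l p x r) (nf l 0 0 1)"
proof -
  obtain \<tau> where \<tau>: "\<tau>\<^sup>2 + x * \<tau> = p * r" "2 * \<tau> + x = 0" using n by (cases rule: nroots_cases[of x "p * r"]) auto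
  have "p - r * (- \<tau> / r)\<^sup>2 + x * (- \<tau> / r) = (p * r - (\<tau>\<^sup>2 + x * \<tau>)) / r" using r by (simp add: power2_eq_square field_simps)
  also have "\<dots> = 0" unfolding \<tau>(1) by simp
  finally have 1: "p - r * (- \<tau> / r)\<^sup>2 + x * (- \<tau> / r) = 0" .
  have 2: "x - 2 * r * (- \<tau> / r) = 0" using r \<tau>(2) by (simp add: add.commute)
  have "fequiv (Suc l) (nf l p x r) (nf l 0 0 r)" using fequiv_nf_lower[of l p x r "- \<tau> / r"] unfolding 1 2 .
  moreover have "fequiv (Suc l) (nf l 0 0 r) (nf l 0 0 1)" using fequiv_nf_torus[OF r, of l 0 0 r] r by simp
  ultimately show ?thesis by (rule fequiv_trans)
qed

lemma nf_two_roots: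
  assumes r: "r \<noteq> 0" and n: "nroots x (p * r) = 2"
  shows "fequiv (Suc l) (nf l p x r) (nf l 0 1 0)"
proof -
  obtain \<tau> where \<tau>: "\<tau>\<^sup>2 + x * \<tau> = p * r" "2 * \<tau> + x \<noteq> 0" using n by (cases rule: nroots_cases[of x "p * r"]) auto
  define y where "y = 2 * \<tau> + x"
  have y: "y \<noteq> 0" using \<tau>(2) by (simp add: y_def)
  have "p - r * (- \<tau> / r)\<^sup>2 + x * (- \<tau> / r) = (p * r - (\<tau>\<^sup>2 + x * \<tau>)) / r" using r by (simp add: power2_eq_square field_simps)
  also have "\<dots> = 0" unfolding \<tau>(1) by simp
  finally have 1: "p - r * (- \<tau> / r)\<^sup>2 + x * (- \<tau> / r) = 0" .
  have 2: "x - 2 * r * (- \<tau> / r) = y" using r by (simp add: y_def)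
  have a: "fequiv (Suc l) (nf l p x r) (nf l 0 y r)" using fequiv_nf_lower[of l p x r "- \<tau> / r"] unfolding 1 2 .
  \<comment> \<open>With first coordinate 0 and middle coordinate \<open>y\<close> nonzero, an upper
    move adds any multiple of \<open>y\<close> to the last coordinate and nothing else.\<close>
  have b: "fequiv (Suc l) (nf l 0 y r) (nf l 0 y 0)" using fequiv_nf_upper[of l 0 y r "- r / y"] y by simp
  have c: "fequiv (Suc l) (nf l 0 y 0) (nf l 0 1 0)" using fequiv_nf_scale[of "inverse y" l 0 y 0] y by simp
  show ?thesis using fequiv_trans[OF fequiv_trans[OF a b] c] .
qed

lemma nf_no_root:
  assumes r: "r \<noteq> 0" and n: "nroots x (p * r) = 0"
  obtains a y where "fequiv (Suc l) (nf l p x r) (nf l a y 1)" "nroots y a = 0"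
proof -
  have "fequiv (Suc l) (nf l p x r) (nf l (inverse r * p) (inverse r * x) 1)"
    using fequiv_nf_scale[of "inverse r" l p x r] r by simp
  moreover have "nroots (inverse r * x) (inverse r * p) = 0"
    using nroots_scale[of "inverse r" x "p * r"] r n by (simp add: power2_eq_square algebra_simps)
  ultimately show ?thesis using that by blast
qed

lemma nf_rescale: "k \<noteq> 0 \<Longrightarrow> fequiv (Suc l) (nf l a y 1) (nf l (k\<^sup>2 * a) (k * y) 1)"
  using fequiv_trans[OF fequiv_nf_scale[of k l a y 1] fequiv_nf_torus[of k l "k * a" "k * y" "k * 1"]]
  by (simp add: power2_eq_square mult.assoc)

text \<open>For odd q completing the square makes the middle coordinate 0, and two nonsquares differ
  by a square factor, which \<open>nf_rescale\<close> realizes. For even q the middle coordinate is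
  scaled to 1, and two such forms differ by a term t^2 + t, which a lower move realizes.\<close>

lemma irreducible_nf_equiv:
  fixes a y :: "'a::{field,finite}"
  assumes "nroots y a = 0" "nroots y' a' = 0"
  shows "fequiv (Suc l) (nf l a y 1) (nf l a' y' 1)"
proof (cases "(2 :: 'a) = 0")
  case two: False
  have four: "(4 :: 'a) \<noteq> 0" using two by (metis mult_2 mult_eq_0_iff numeral_Bit0)
  have sq: "\<exists>d. fequiv (Suc l) (nf l a y 1) (nf l d 0 1) \<and> \<not> (\<exists>t. t\<^sup>2 = d)" if n: "nroots y a = 0" for a y :: 'a
  proof -
    define h where "h = y / 2"
    have y: "y = 2 * h" using two by (simp add: h_def)
    have "fequiv (Suc l) (nf l a y 1) (nf l (a + h\<^sup>2) 0 1)"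
      using fequiv_nf_lower[of l a y 1 h] unfolding y by (simp add: power2_eq_square algebra_simps)
    moreover have "t\<^sup>2 \<noteq> a + h\<^sup>2" for t
    proof
      assume "t\<^sup>2 = a + h\<^sup>2"
      then have "(t - h)\<^sup>2 + y * (t - h) = a" unfolding y by (simp add: power2_eq_square algebra_simps)
      then show False using nroots_eq(1)[of "t - h" y a] n by (simp split: if_splits)
    qed
    ultimately show ?thesis by blast
  qed
  obtain d where d: "fequiv (Suc l) (nf l a y 1) (nf l d 0 1)" "\<not> (\<exists>t. t\<^sup>2 = d)" using sq[OF assms(1)] by blast
  obtain d' where d': "fequiv (Suc l) (nf l a' y' 1) (nf l d' 0 1)" "\<not> (\<exists>t. t\<^sup>2 = d')" using sq[OF assms(2)] by blast
  obtain k where k: "k \<noteq> 0" "d' = k\<^sup>2 * d" using ratio_of_nonsquares[OF two d(2) d'(2)] by blast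
  have "fequiv (Suc l) (nf l d 0 1) (nf l d' 0 1)" using nf_rescale[OF k(1), of l d 0] by (simp add: k(2))
  then show ?thesis using fequiv_trans[OF fequiv_trans[OF d(1)] fequiv_sym[OF d'(1)]] by blast
next
  case two: True
  have sq: "\<exists>d. fequiv (Suc l) (nf l a y 1) (nf l d 1 1) \<and> \<not> (\<exists>t. t\<^sup>2 + t = d)" if n: "nroots y a = 0" for a y :: 'a
  proof -
    have y: "y \<noteq> 0" using nroots_eq_1_iff(2)[OF two, of y a] n by auto
    then have "fequiv (Suc l) (nf l a y 1) (nf l ((inverse y)\<^sup>2 * a) 1 1)"
      using nf_rescale[of "inverse y" l a y] by simp
    moreover have "nroots 1 ((inverse y)\<^sup>2 * a) = 0" using nroots_scale[of "inverse y" y a] y n by simp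
    then have "t\<^sup>2 + t \<noteq> (inverse y)\<^sup>2 * a" for t using nroots_eq(1)[of t 1 "(inverse y)\<^sup>2 * a"] by (auto split: if_splits)
    ultimately show ?thesis by blast
  qed
  obtain d where d: "fequiv (Suc l) (nf l a y 1) (nf l d 1 1)" "\<not> (\<exists>t. t\<^sup>2 + t = d)" using sq[OF assms(1)] by blast
  obtain d' where d': "fequiv (Suc l) (nf l a' y' 1) (nf l d' 1 1)" "\<not> (\<exists>t. t\<^sup>2 + t = d')" using sq[OF assms(2)] by blast
  obtain t where t: "d' = d + t\<^sup>2 + t" using difference_of_non_artin_schreier[OF two d(2) d'(2)] by blast
  \<comment> \<open>A lower move subtracts t^2 where it has to be added; in characteristic 2 this is
    the same.\<close>
  have "d - 1 * t\<^sup>2 + 1 * t = d + t\<^sup>2 + t - 2 * t\<^sup>2" by simp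
  then have e: "d - 1 * t\<^sup>2 + 1 * t = d'" unfolding t two by simp
  have "fequiv (Suc l) (nf l d 1 1) (nf l d' 1 1)" using fequiv_nf_lower[of l d 1 1 t] unfolding e two by simp
  then show ?thesis using fequiv_trans[OF fequiv_trans[OF d(1)] fequiv_sym[OF d'(1)]] by blast
qed

section \<open>Singular vectors in the kernel of a functional\<close>

definition singular_count :: "nat \<Rightarrow> 'a::field vec \<Rightarrow> nat" where
  "singular_count l c = card {v \<in> carrier_vec (2 * l + 1). Q_odd l v = 0 \<and> c \<bullet> v = 0}"

lemma singular_count_fequiv:
  assumes "fequiv l c c'"
  shows "singular_count l c = singular_count l c'"
proof -
  obtain x a where x: "x \<in> SO_odd l" "a \<noteq> 0" "\<And>v. v \<in> carrier_vec (2 * l + 1) \<Longrightarrow> c' \<bullet> v = a * (c \<bullet> (x *\<^sub>v v))"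
    using assms(1) unfolding fequiv_def by blast
  obtain y where y: "y \<in> SO_odd l" "y * x = 1\<^sub>m (2 * l + 1)" "x * y = 1\<^sub>m (2 * l + 1)" using SO_inverse[OF x(1)] .
  note cx = SO_carrier[OF x(1)] and cy = SO_carrier[OF y(1)]
  have xy: "x *\<^sub>v (y *\<^sub>v v) = v" "y *\<^sub>v (x *\<^sub>v v) = v" if "v \<in> carrier_vec (2 * l + 1)" for v
    using assoc_mult_mat_vec[OF cx cy that] assoc_mult_mat_vec[OF cy cx that] y(2,3) that by simp_all
  have "bij_betw (\<lambda>v. x *\<^sub>v v) {v \<in> carrier_vec (2 * l + 1). Q_odd l v = 0 \<and> c' \<bullet> v = 0} {v \<in> carrier_vec (2 * l + 1). Q_odd l v = 0 \<and> c \<bullet> v = 0}"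
  proof (rule bij_betwI[of _ _ _ "\<lambda>v. y *\<^sub>v v"])
    show "(\<lambda>v. x *\<^sub>v v) \<in> {v \<in> carrier_vec (2 * l + 1). Q_odd l v = 0 \<and> c' \<bullet> v = 0} \<rightarrow> {v \<in> carrier_vec (2 * l + 1). Q_odd l v = 0 \<and> c \<bullet> v = 0}"
      using SO_Q[OF x(1)] mult_mat_vec_carrier[OF cx] x(2,3) by auto
    show "(\<lambda>v. y *\<^sub>v v) \<in> {v \<in> carrier_vec (2 * l + 1). Q_odd l v = 0 \<and> c \<bullet> v = 0} \<rightarrow> {v \<in> carrier_vec (2 * l + 1). Q_odd l v = 0 \<and> c' \<bullet> v = 0}"
      using SO_Q[OF y(1)] mult_mat_vec_carrier[OF cy] x(2,3) xy by auto
  qed (use xy in auto)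
  then show ?thesis unfolding singular_count_def by (rule bij_betw_same_card[symmetric])
qed

lemma of_nat_singular_count:
  "(of_nat (singular_count (Suc l) (c :: 'a::{field,finite} vec)) :: complex) =
    (\<Sum>\<alpha>\<in>UNIV. \<Sum>\<beta>\<in>UNIV. \<Sum>v\<in>carrier_vec (2 * l + 1). if Q_odd l v + \<alpha> * \<beta> = 0 \<and> c \<bullet> brd \<alpha> v \<beta> = 0 then 1 else 0)"
proof -
  have "(of_nat (singular_count (Suc l) c) :: complex) =
    (\<Sum>v\<in>carrier_vec (2 * Suc l + 1). if Q_odd (Suc l) v = 0 \<and> c \<bullet> v = 0 then 1 else 0)"
    unfolding singular_count_def by (subst sum.inter_filter[symmetric]) auto
  also have "\<dots> = (\<Sum>\<alpha>\<in>UNIV. \<Sum>\<beta>\<in>UNIV. \<Sum>v\<in>carrier_vec (2 * l + 1). if Q_odd l v + \<alpha> * \<beta> = 0 \<and> c \<bullet> brd \<alpha> v \<beta> = 0 then 1 else 0)"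
    unfolding sum_brd by (intro sum.cong refl) (simp add: Q_odd_brd)
  finally show ?thesis .
qed

text \<open>The inner coordinates enter only through \<open>hyp\<close>, which is equidistributed up
  to its excess at 0. What remains is dimension 3: the points of a plane and the points of its
  section with the cone y^2 + \<alpha> \<beta> = 0.\<close>

lemma singular_count_nf:
  fixes l :: nat and p x r :: "'a::{field,finite}"
  defines "q \<equiv> (of_nat CARD('a) :: complex)"
  shows "of_nat (singular_count (Suc l) (nf l p x r)) =
    hcoef q l * (\<Sum>\<alpha>\<in>UNIV. \<Sum>\<beta>\<in>UNIV. \<Sum>y\<in>UNIV. if p * \<alpha> + x * y + r * \<beta> = 0 then 1 else 0) +
    q ^ l * (\<Sum>\<alpha>\<in>UNIV. \<Sum>\<beta>\<in>UNIV. \<Sum>y\<in>UNIV. if y\<^sup>2 + \<alpha> * \<beta> = 0 \<and> p * \<alpha> + x * y + r * \<beta> = 0 then 1 else 0)"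
proof -
  let ?f = "\<lambda>\<alpha> \<beta> y s. (if y\<^sup>2 + s + \<alpha> * \<beta> = 0 \<and> p * \<alpha> + x * y + r * \<beta> = 0 then 1 else 0) :: complex"
  have "of_nat (singular_count (Suc l) (nf l p x r)) = (\<Sum>\<alpha>\<in>UNIV. \<Sum>\<beta>\<in>UNIV. \<Sum>v\<in>carrier_vec (2 * l + 1). ?f \<alpha> \<beta> (v $ l) (hyp l v))"
    unfolding of_nat_singular_count
    by (intro sum.cong refl) (simp only: brd_scalar_prod[OF mid_carrier] mid_simps(4) Q_odd_hyp)
  also have "\<dots> = (\<Sum>\<alpha>\<in>UNIV. \<Sum>\<beta>\<in>UNIV. \<Sum>y\<in>UNIV. hcoef q l * (\<Sum>s\<in>UNIV. ?f \<alpha> \<beta> y s) + q ^ l * ?f \<alpha> \<beta> y 0)"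
    unfolding q_def by (intro sum.cong refl sum_vec_hyp)
  also have "\<dots> = (\<Sum>\<alpha>\<in>UNIV. \<Sum>\<beta>\<in>UNIV. \<Sum>y\<in>UNIV. hcoef q l * (if p * \<alpha> + x * y + r * \<beta> = 0 then 1 else 0) + q ^ l * ?f \<alpha> \<beta> y 0)"
  proof (intro sum.cong refl arg_cong2[of _ _ _ _ "(+)"] arg_cong2[of _ _ _ _ "(*)"])
    fix \<alpha> \<beta> y :: 'a
    have "y\<^sup>2 + s + \<alpha> * \<beta> = 0 \<longleftrightarrow> s = - (y\<^sup>2 + \<alpha> * \<beta>)" for s
      unfolding eq_neg_iff_add_eq_0 by (simp only: ac_simps)
    then show "(\<Sum>s\<in>UNIV. ?f \<alpha> \<beta> y s) = (if p * \<alpha> + x * y + r * \<beta> = 0 then 1 else 0)" by simp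
  qed
  finally show ?thesis by (simp only: sum.distrib sum_distrib_left add_0_right)
qed

text \<open>The plane always has q^2 points. Its section with the cone is a line, a pair of lines or
  the origin alone, with q, 2 q - 1 or 1 points. The factor \<open>q\<close> on the left clears the
  denominator hidden in \<open>hcoef\<close>.\<close>

lemma singular_count_values:
  fixes l :: nat and a y :: "'a::{field,finite}"
  defines "q \<equiv> (of_nat CARD('a) :: complex)"
  shows "q * of_nat (singular_count (Suc l) (nf l 0 0 1 :: 'a vec)) = q ^ (2 * l + 2)"
    "q * of_nat (singular_count (Suc l) (nf l 0 1 0 :: 'a vec)) = q ^ (2 * l + 2) + (q ^ (l + 2) - q ^ (l + 1))"
    "nroots y a = 0 \<Longrightarrow> q * of_nat (singular_count (Suc l) (nf l a y 1)) = q ^ (2 * l + 2) - (q ^ (l + 2) - q ^ (l + 1))"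
proof -
  have h: "q * hcoef q l = q ^ (2 * l) - q ^ l" by (rule hcoef_eq)
  have comb: "q * (hcoef q l * q\<^sup>2 + q ^ l * z) = (q ^ (2 * l) - q ^ l) * q\<^sup>2 + q ^ (l + 1) * z" for z
    unfolding h[symmetric] by (simp add: algebra_simps)
  have "(\<Sum>\<alpha>\<in>(UNIV :: 'a set). \<Sum>\<beta>\<in>(UNIV :: 'a set). \<Sum>y\<in>(UNIV :: 'a set). if 0 * \<alpha> + 0 * y + 1 * \<beta> = 0 then 1 else 0 :: complex) = q\<^sup>2"
    by (simp add: q_def power2_eq_square sum.delta if_distrib[of "\<lambda>z. _ * z"] cong: if_cong)
  moreover have "(\<Sum>\<alpha>\<in>(UNIV :: 'a set). \<Sum>\<beta>\<in>(UNIV :: 'a set). \<Sum>y\<in>(UNIV :: 'a set). if y\<^sup>2 + \<alpha> * \<beta> = 0 \<and> 0 * \<alpha> + 0 * y + 1 * \<beta> = 0 then 1 else 0 :: complex) = q"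
  proof -
    have "(\<Sum>y\<in>(UNIV :: 'a set). if y\<^sup>2 + \<alpha> * \<beta> = 0 \<and> 0 * \<alpha> + 0 * y + 1 * \<beta> = 0 then 1 else 0 :: complex) = (if \<beta> = 0 then 1 else 0)" for \<alpha> \<beta> :: 'a
      by (cases "\<beta> = 0") auto
    then show ?thesis by (simp add: q_def)
  qed
  ultimately have "q * of_nat (singular_count (Suc l) (nf l 0 0 1 :: 'a vec)) = (q ^ (2 * l) - q ^ l) * q\<^sup>2 + q ^ (l + 1) * q"
    unfolding singular_count_nf q_def[symmetric] by (simp only: comb)
  then show "q * of_nat (singular_count (Suc l) (nf l 0 0 1 :: 'a vec)) = q ^ (2 * l + 2)"
    by (simp add: algebra_simps power2_eq_square)
  have "(\<Sum>\<alpha>\<in>(UNIV :: 'a set). \<Sum>\<beta>\<in>(UNIV :: 'a set). \<Sum>y\<in>(UNIV :: 'a set). if 0 * \<alpha> + 1 * y + 0 * \<beta> = 0 then 1 else 0 :: complex) = q\<^sup>2"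
    by (simp add: q_def power2_eq_square)
  moreover have "(\<Sum>\<alpha>\<in>(UNIV :: 'a set). \<Sum>\<beta>\<in>(UNIV :: 'a set). \<Sum>y\<in>(UNIV :: 'a set). if y\<^sup>2 + \<alpha> * \<beta> = 0 \<and> 0 * \<alpha> + 1 * y + 0 * \<beta> = 0 then 1 else 0 :: complex) = 2 * q - 1"
  proof -
    have "(\<Sum>y\<in>(UNIV :: 'a set). if y\<^sup>2 + \<alpha> * \<beta> = 0 \<and> 0 * \<alpha> + 1 * y + 0 * \<beta> = 0 then 1 else 0 :: complex) = (if \<alpha> * \<beta> = 0 then 1 else 0)" for \<alpha> \<beta> :: 'a
    proof -
      have "(\<Sum>y\<in>(UNIV :: 'a set). if y\<^sup>2 + \<alpha> * \<beta> = 0 \<and> 0 * \<alpha> + 1 * y + 0 * \<beta> = 0 then 1 else 0 :: complex) =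
        (\<Sum>y\<in>(UNIV :: 'a set). if y = 0 then (if \<alpha> * \<beta> = 0 then 1 else 0) else 0)" by (intro sum.cong) auto
      then show ?thesis by simp
    qed
    moreover have "(\<Sum>\<beta>\<in>(UNIV :: 'a set). if \<alpha> * \<beta> = 0 then 1 else 0 :: complex) = (if \<alpha> = 0 then q else 1)" for \<alpha> :: 'a
      by (cases "\<alpha> = 0") (auto simp: q_def)
    ultimately have "(\<Sum>\<alpha>\<in>(UNIV :: 'a set). \<Sum>\<beta>\<in>(UNIV :: 'a set). \<Sum>y\<in>(UNIV :: 'a set). if y\<^sup>2 + \<alpha> * \<beta> = 0 \<and> 0 * \<alpha> + 1 * y + 0 * \<beta> = 0 then 1 else 0 :: complex) =
      (\<Sum>\<alpha>\<in>(UNIV :: 'a set). if \<alpha> = 0 then q else 1)" by (simp only:)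
    also have "\<dots> = q + (\<Sum>\<alpha>\<in>UNIV - {0 :: 'a}. 1)" by (simp add: sum.remove[of UNIV "0::'a"])
    also have "\<dots> = 2 * q - 1" by (simp add: q_def card_Diff_subset of_nat_diff Suc_leI finite_UNIV_card_ge_0)
    finally show ?thesis .
  qed
  ultimately have "q * of_nat (singular_count (Suc l) (nf l 0 1 0 :: 'a vec)) = (q ^ (2 * l) - q ^ l) * q\<^sup>2 + q ^ (l + 1) * (2 * q - 1)"
    unfolding singular_count_nf q_def[symmetric] by (simp only: comb)
  then show "q * of_nat (singular_count (Suc l) (nf l 0 1 0 :: 'a vec)) = q ^ (2 * l + 2) + (q ^ (l + 2) - q ^ (l + 1))"
    by (simp add: algebra_simps power2_eq_square)
  assume n: "nroots y a = 0"
  have \<beta>: "a * \<alpha> + y * z + 1 * \<beta> = 0 \<longleftrightarrow> \<beta> = - (a * \<alpha> + y * z)" for \<alpha> \<beta> z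
    unfolding eq_neg_iff_add_eq_0 by (simp add: ac_simps)
  have "(\<Sum>\<alpha>\<in>(UNIV :: 'a set). \<Sum>\<beta>\<in>(UNIV :: 'a set). \<Sum>z\<in>(UNIV :: 'a set). if a * \<alpha> + y * z + 1 * \<beta> = 0 then 1 else 0 :: complex) =
    (\<Sum>\<alpha>\<in>(UNIV :: 'a set). \<Sum>z\<in>(UNIV :: 'a set). \<Sum>\<beta>\<in>(UNIV :: 'a set). if a * \<alpha> + y * z + 1 * \<beta> = 0 then 1 else 0)"
    by (rule sum.cong[OF refl], rule sum.swap)
  also have "\<dots> = q\<^sup>2" unfolding \<beta> by (simp add: q_def power2_eq_square)
  finally have 1: "(\<Sum>\<alpha>\<in>(UNIV :: 'a set). \<Sum>\<beta>\<in>(UNIV :: 'a set). \<Sum>z\<in>(UNIV :: 'a set). if a * \<alpha> + y * z + 1 * \<beta> = 0 then 1 else 0 :: complex) = q\<^sup>2" .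
  \<comment> \<open>A point of the section with nonzero \<open>\<alpha>\<close> would make
    \<open>- z / \<alpha>\<close> a root of the quadratic.\<close>
  have key: "z\<^sup>2 + \<alpha> * \<beta> = 0 \<and> a * \<alpha> + y * z + 1 * \<beta> = 0 \<longleftrightarrow> \<alpha> = 0 \<and> z = 0 \<and> \<beta> = 0" for \<alpha> \<beta> z :: 'a
  proof
    assume e: "z\<^sup>2 + \<alpha> * \<beta> = 0 \<and> a * \<alpha> + y * z + 1 * \<beta> = 0"
    then have b: "\<beta> = - (a * \<alpha> + y * z)" using \<beta> by blast
    have \<alpha>: "\<alpha> = 0"
    proof (rule ccontr)
      assume a0: "\<alpha> \<noteq> 0"
      have "z\<^sup>2 - y * z * \<alpha> = a * \<alpha>\<^sup>2" using e unfolding b by (simp add: power2_eq_square algebra_simps)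
      then have "(- z / \<alpha>)\<^sup>2 + y * (- z / \<alpha>) = a" using a0 by (simp add: power2_eq_square field_simps)
      then show False using nroots_eq(1)[of "- z / \<alpha>" y a] n by (simp split: if_splits)
    qed
    then show "\<alpha> = 0 \<and> z = 0 \<and> \<beta> = 0" using e b by simp
  qed auto
  have "(\<Sum>\<alpha>\<in>(UNIV :: 'a set). \<Sum>\<beta>\<in>(UNIV :: 'a set). \<Sum>z\<in>(UNIV :: 'a set). if z\<^sup>2 + \<alpha> * \<beta> = 0 \<and> a * \<alpha> + y * z + 1 * \<beta> = 0 then 1 else 0 :: complex) = 1"
  proof -
    have "(\<Sum>z\<in>(UNIV :: 'a set). if \<alpha> = 0 \<and> z = 0 \<and> \<beta> = 0 then 1 else 0 :: complex) = (if \<beta> = 0 then (if \<alpha> = 0 then 1 else 0) else 0)" for \<alpha> \<beta> :: 'a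
      by (cases "\<alpha> = 0 \<and> \<beta> = 0") auto
    then show ?thesis unfolding key by simp
  qed
  then have "q * of_nat (singular_count (Suc l) (nf l a y 1)) = (q ^ (2 * l) - q ^ l) * q\<^sup>2 + q ^ (l + 1) * 1"
    unfolding singular_count_nf q_def[symmetric] using 1 by (simp only: comb)
  then show "q * of_nat (singular_count (Suc l) (nf l a y 1)) = q ^ (2 * l + 2) - (q ^ (l + 2) - q ^ (l + 1))"
    by (simp add: algebra_simps power2_eq_square)
qed

lemma fequiv_normal_form_cases:
  fixes c :: "'a::{field,finite} vec"
  assumes c: "c \<in> carrier_vec (2 * Suc l + 1)" "c \<noteq> 0\<^sub>v (2 * Suc l + 1)"
  obtains (one) "rts (Suc l) c = 1" "fequiv (Suc l) c (nf l 0 0 1)"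
  | (two) "rts (Suc l) c = 2" "fequiv (Suc l) c (nf l 0 1 0)"
  | (none) a y where "rts (Suc l) c = 0" "fequiv (Suc l) c (nf l a y 1)" "nroots y a = 0"
proof -
  obtain p x r where nf: "r \<noteq> 0" "fequiv (Suc l) c (nf l p x r)" "nroots x (p * r) = rts (Suc l) c" using fequiv_to_nf[OF c] .
  consider "rts (Suc l) c = 1" | "rts (Suc l) c = 2" | "rts (Suc l) c = 0"
    by (cases rule: nroots_cases[of "c $ Suc l" "hyp (Suc l) c"])
  then show ?thesis
  proof cases
    case 1
    then show ?thesis using one fequiv_trans[OF nf(2) nf_one_root[OF nf(1)]] nf(3) by simp
  next
    case 2
    then show ?thesis using two fequiv_trans[OF nf(2) nf_two_roots[OF nf(1)]] nf(3) by simp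
  next
    case 3
    then obtain a y where "fequiv (Suc l) (nf l p x r) (nf l a y 1)" "nroots y a = 0" using nf_no_root[OF nf(1)] nf(3) by metis
    then show ?thesis using none 3 fequiv_trans[OF nf(2)] by blast
  qed
qed

text \<open>The three values lie on one affine function of the number of roots, so the singular
  count and the number of roots determine each other once the slope is nonzero.\<close>

lemma singular_count_rts:
  fixes c :: "'a::{field,finite} vec"
  defines "q \<equiv> (of_nat CARD('a) :: complex)"
  assumes c: "c \<in> carrier_vec (2 * Suc l + 1)" "c \<noteq> 0\<^sub>v (2 * Suc l + 1)"
  shows "q * of_nat (singular_count (Suc l) c) = q ^ (2 * l + 2) + (of_nat (rts (Suc l) c) - 1) * (q ^ (l + 2) - q ^ (l + 1))"
  using c
proof (cases rule: fequiv_normal_form_cases)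
  case one
  then show ?thesis unfolding singular_count_fequiv[OF one(2)] q_def singular_count_values by simp
next
  case two
  then show ?thesis unfolding singular_count_fequiv[OF two(2)] q_def singular_count_values by simp
next
  case (none a y)
  then show ?thesis unfolding singular_count_fequiv[OF none(2)] q_def singular_count_values(3)[OF none(3)] by simp
qed

theorem fequiv_iff_rts:
  fixes c c' :: "'a::{field,finite} vec"
  assumes c: "c \<in> carrier_vec (2 * Suc l + 1)" "c \<noteq> 0\<^sub>v (2 * Suc l + 1)"
    and c': "c' \<in> carrier_vec (2 * Suc l + 1)" "c' \<noteq> 0\<^sub>v (2 * Suc l + 1)"
  shows "fequiv (Suc l) c c' \<longleftrightarrow> rts (Suc l) c = rts (Suc l) c'"
proof
  let ?q = "of_nat CARD('a) :: complex"
  assume e: "fequiv (Suc l) c c'"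
  have "card {0, 1 :: 'a} \<le> CARD('a)" by (rule card_mono) auto
  then have q: "CARD('a) \<ge> 2" by simp
  \<comment> \<open>The slope q^(l+2) - q^(l+1) is nonzero because q is at least 2.\<close>
  then have "?q * ?q ^ (l + 1) \<noteq> 1 * ?q ^ (l + 1)" by (simp only: mult_cancel_right) auto
  then have ne: "?q ^ (l + 2) - ?q ^ (l + 1) \<noteq> 0" by simp
  have "(of_nat (rts (Suc l) c) - 1) * (?q ^ (l + 2) - ?q ^ (l + 1)) = (of_nat (rts (Suc l) c') - 1) * (?q ^ (l + 2) - ?q ^ (l + 1))"
    using singular_count_rts[OF c] singular_count_rts[OF c'] singular_count_fequiv[OF e] by (metis add_left_cancel)
  then have "(of_nat (rts (Suc l) c) :: complex) = of_nat (rts (Suc l) c')" using ne by (simp only: mult_cancel_right) auto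
  then show "rts (Suc l) c = rts (Suc l) c'" by (simp only: of_nat_eq_iff)
next
  assume e: "rts (Suc l) c = rts (Suc l) c'"
  have *: "fequiv (Suc l) c d \<Longrightarrow> fequiv (Suc l) c' d \<Longrightarrow> fequiv (Suc l) c c'" for d
    using fequiv_trans fequiv_sym by blast
  show "fequiv (Suc l) c c'"
    using c
  proof (cases rule: fequiv_normal_form_cases)
    case one
    show ?thesis using c' by (cases rule: fequiv_normal_form_cases) (use one e * in auto)
  next
    case two
    show ?thesis using c' by (cases rule: fequiv_normal_form_cases) (use two e * in auto)
  next
    case (none a y)
    show ?thesis using c'
    proof (cases rule: fequiv_normal_form_cases)
      case (none a' y')
      then show ?thesis using *[OF \<open>fequiv (Suc l) c (nf l a y 1)\<close>]
        fequiv_trans[OF none(2) irreducible_nf_equiv[OF none(3) \<open>nroots y a = 0\<close>]] by blast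
    qed (use none e in auto)
  qed
qed

section \<open>The parabolic subgroup\<close>

lemma mat_group_simps [simp]:
  "carrier (mat_group d H) = H" "x \<otimes>\<^bsub>mat_group d H\<^esub> y = x * y" "\<one>\<^bsub>mat_group d H\<^esub> = 1\<^sub>m d"
  "mat_group d H\<lparr>carrier := K\<rparr> = mat_group d K"
  by (simp_all add: mat_group_def GL_def units_of_def ring_mat_def)

lemma mat_group_group:
  assumes H: "H \<subseteq> carrier_mat d d" "1\<^sub>m d \<in> H" "\<And>x y. x \<in> H \<Longrightarrow> y \<in> H \<Longrightarrow> x * y \<in> H"
    and inv: "\<And>x. x \<in> H \<Longrightarrow> \<exists>y\<in>H. y * x = 1\<^sub>m d"
  shows "group (mat_group d H)"
proof (rule groupI)
  fix x y z assume "x \<in> carrier (mat_group d H)" "y \<in> carrier (mat_group d H)" "z \<in> carrier (mat_group d H)"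
  then have "x \<in> carrier_mat d d" "y \<in> carrier_mat d d" "z \<in> carrier_mat d d" using H(1) by auto
  then show "x \<otimes>\<^bsub>mat_group d H\<^esub> y \<otimes>\<^bsub>mat_group d H\<^esub> z = x \<otimes>\<^bsub>mat_group d H\<^esub> (y \<otimes>\<^bsub>mat_group d H\<^esub> z)"
    by (simp add: assoc_mult_mat[of _ d d _ d _ d])
qed (use assms in auto)

section \<open>Products of unipotent and Levi elements, and the decomposition of
  \<open>P\<close>\<close>

abbreviation um :: "nat \<Rightarrow> 'a::field vec \<Rightarrow> 'a mat" where "um l \<equiv> u_mat (Suc l)"

lemma polar_form_zero: "v \<in> carrier_vec (2 * l + 1) \<Longrightarrow> polar_form l v (0\<^sub>v (2 * l + 1)) = 0"
  unfolding polar_form_Jv[OF _ zero_carrier_vec] by (simp add: scalar_prod_def)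

lemma Q_odd_zero: "Q_odd l (0\<^sub>v (2 * l + 1)) = 0"
  by (simp add: Q_odd_def)

lemma polar_form_smult:
  assumes "v \<in> carrier_vec (2 * l + 1)" "w \<in> carrier_vec (2 * l + 1)"
  shows "polar_form l (a \<cdot>\<^sub>v v) w = a * polar_form l v w" "polar_form l v (a \<cdot>\<^sub>v w) = a * polar_form l v w"
proof -
  have *: "polar_form l v (a \<cdot>\<^sub>v w) = a * polar_form l v w" if "v \<in> carrier_vec (2 * l + 1)" "w \<in> carrier_vec (2 * l + 1)" for v w
    unfolding polar_form_Jv[OF that] polar_form_Jv[OF that(1) smult_carrier_vec[THEN iffD2, OF that(2)]]
    by (rule scalar_prod_smult_distrib[OF Jv_carrier that(2)])
  then show "polar_form l v (a \<cdot>\<^sub>v w) = a * polar_form l v w" using assms by blast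
  show "polar_form l (a \<cdot>\<^sub>v v) w = a * polar_form l v w"
    using *[OF assms(2,1)] polar_form_commute[OF assms] polar_form_commute[OF smult_carrier_vec[THEN iffD2, OF assms(1)] assms(2)] by simp
qed

lemma um_mult:
  assumes v: "v \<in> carrier_vec (2 * l + 1)" and w: "w \<in> carrier_vec (2 * l + 1)"
  shows "um l v * um l w = um l (v + w)"
proof (rule eq_mat_by_brd[OF mult_carrier_mat[OF u_mat_carrier u_mat_carrier] u_mat_carrier])
  fix a b and y :: "'a vec" assume y: "y \<in> carrier_vec (2 * l + 1)"
  have vw: "v + w \<in> carrier_vec (2 * l + 1)" and bw: "b \<cdot>\<^sub>v w \<in> carrier_vec (2 * l + 1)" using v w by auto
  then have ybw: "y + b \<cdot>\<^sub>v w \<in> carrier_vec (2 * l + 1)" using y by simp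
  have p1: "polar_form l (v + w) y = polar_form l v y + polar_form l w y"
    unfolding polar_form_commute[OF vw y] polar_form_commute[OF v y] polar_form_commute[OF w y]
      polar_form_Jv[OF y vw] polar_form_Jv[OF y v] polar_form_Jv[OF y w] by (rule scalar_prod_add_distrib[OF Jv_carrier v w])
  have p2: "polar_form l v (y + b \<cdot>\<^sub>v w) = polar_form l v y + b * polar_form l v w"
    unfolding polar_form_smult(2)[OF v w, symmetric] polar_form_Jv[OF v ybw] polar_form_Jv[OF v y] polar_form_Jv[OF v bw]
    by (rule scalar_prod_add_distrib[OF Jv_carrier y bw])
  have v1: "y + b \<cdot>\<^sub>v w + b \<cdot>\<^sub>v v = y + b \<cdot>\<^sub>v (v + w)" using y v w by (intro eq_vecI) (auto simp: algebra_simps)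
  have "um l v * um l w *\<^sub>v brd a y b = um l v *\<^sub>v (um l w *\<^sub>v brd a y b)"
    by (rule assoc_mult_mat_vec[OF u_mat_carrier u_mat_carrier brd_carrier[OF y]])
  also have "\<dots> = um l (v + w) *\<^sub>v brd a y b"
    unfolding u_mat_action[OF w y] u_mat_action[OF v ybw] u_mat_action[OF vw y] v1 p1 p2 Q_odd_add by (simp add: algebra_simps)
  finally show "um l v * um l w *\<^sub>v brd a y b = um l (v + w) *\<^sub>v brd a y b" .
qed

lemma um_zero: "um l (0\<^sub>v (2 * l + 1)) = 1\<^sub>m (2 * Suc l + 1)"
proof (rule eq_mat_by_brd[OF u_mat_carrier one_carrier_mat])
  fix a b and y :: "'a vec" assume y: "y \<in> carrier_vec (2 * l + 1)"
  have "y + b \<cdot>\<^sub>v 0\<^sub>v (2 * l + 1) = y" using y by (intro eq_vecI) auto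
  then show "um l (0\<^sub>v (2 * l + 1)) *\<^sub>v brd a y b = 1\<^sub>m (2 * Suc l + 1) *\<^sub>v brd a y b"
    unfolding u_mat_action[OF zero_carrier_vec y] one_mult_mat_vec[OF brd_carrier[OF y]]
    by (simp only: polar_form_commute[OF zero_carrier_vec y] polar_form_zero[OF y] Q_odd_zero) simp
qed

lemma s_mult:
  assumes x: "x \<in> carrier_mat (2 * l + 1) (2 * l + 1)" and y: "y \<in> carrier_mat (2 * l + 1) (2 * l + 1)"
  shows "s_mat x a * s_mat y b = s_mat (x * y) (a * b)"
proof (rule eq_mat_by_brd[OF mult_carrier_mat[OF s_mat_carrier[OF x] s_mat_carrier[OF y]] s_mat_carrier[OF mult_carrier_mat[OF x y]]])
  fix \<alpha> \<beta> and v :: "'a vec" assume v: "v \<in> carrier_vec (2 * l + 1)"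
  have "s_mat x a * s_mat y b *\<^sub>v brd \<alpha> v \<beta> = s_mat x a *\<^sub>v (s_mat y b *\<^sub>v brd \<alpha> v \<beta>)"
    by (rule assoc_mult_mat_vec[OF s_mat_carrier[OF x] s_mat_carrier[OF y] brd_carrier[OF v]])
  also have "\<dots> = s_mat (x * y) (a * b) *\<^sub>v brd \<alpha> v \<beta>"
    unfolding s_mat_action[OF y v] s_mat_action[OF x mult_mat_vec_carrier[OF y v]] s_mat_action[OF mult_carrier_mat[OF x y] v]
      assoc_mult_mat_vec[OF x y v] by (simp add: mult.assoc)
  finally show "s_mat x a * s_mat y b *\<^sub>v brd \<alpha> v \<beta> = s_mat (x * y) (a * b) *\<^sub>v brd \<alpha> v \<beta>" .
qed

lemma s_one: "s_mat (1\<^sub>m (2 * l + 1)) 1 = 1\<^sub>m (2 * Suc l + 1)"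
proof (rule eq_mat_by_brd[OF s_mat_carrier[OF one_carrier_mat] one_carrier_mat])
  fix \<alpha> \<beta> and v :: "'a vec" assume v: "v \<in> carrier_vec (2 * l + 1)"
  show "s_mat (1\<^sub>m (2 * l + 1)) 1 *\<^sub>v brd \<alpha> v \<beta> = 1\<^sub>m (2 * Suc l + 1) *\<^sub>v brd \<alpha> v \<beta>"
    unfolding s_mat_action[OF one_carrier_mat v] one_mult_mat_vec[OF v] one_mult_mat_vec[OF brd_carrier[OF v]] by simp
qed

lemma s_mult_um:
  assumes x: "x \<in> SO_odd l" and a: "a \<noteq> 0" and v: "v \<in> carrier_vec (2 * l + 1)"
  shows "s_mat x a * um l v = um l (a \<cdot>\<^sub>v (x *\<^sub>v v)) * s_mat x a"
proof -
  note xc = SO_carrier[OF x] and sc = s_mat_carrier[OF SO_carrier[OF x]]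
  have xv: "x *\<^sub>v v \<in> carrier_vec (2 * l + 1)" and axv: "a \<cdot>\<^sub>v (x *\<^sub>v v) \<in> carrier_vec (2 * l + 1)"
    using mult_mat_vec_carrier[OF xc v] by auto
  show ?thesis
  proof (rule eq_mat_by_brd[OF mult_carrier_mat[OF sc u_mat_carrier] mult_carrier_mat[OF u_mat_carrier sc]])
    fix \<alpha> \<beta> and w :: "'a vec" assume w: "w \<in> carrier_vec (2 * l + 1)"
    have bv: "\<beta> \<cdot>\<^sub>v v \<in> carrier_vec (2 * l + 1)" and wbv: "w + \<beta> \<cdot>\<^sub>v v \<in> carrier_vec (2 * l + 1)" and xw: "x *\<^sub>v w \<in> carrier_vec (2 * l + 1)"
      using v w mult_mat_vec_carrier[OF xc w] by auto
    have ab: "inverse a * \<beta> * a = \<beta>" using a by simp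
    have Qa: "a\<^sup>2 * Q_odd l v * (inverse a * \<beta>) = a * (Q_odd l v * \<beta>)" using a by (simp add: power2_eq_square)
    have e: "x *\<^sub>v w + (inverse a * \<beta>) \<cdot>\<^sub>v (a \<cdot>\<^sub>v (x *\<^sub>v v)) = x *\<^sub>v (w + \<beta> \<cdot>\<^sub>v v)"
      unfolding mult_add_distrib_mat_vec[OF xc w bv] mult_mat_vec[OF xc v] smult_smult_assoc ab ..
    have "s_mat x a * um l v *\<^sub>v brd \<alpha> w \<beta> = s_mat x a *\<^sub>v (um l v *\<^sub>v brd \<alpha> w \<beta>)"
      by (rule assoc_mult_mat_vec[OF sc u_mat_carrier brd_carrier[OF w]])
    also have "\<dots> = um l (a \<cdot>\<^sub>v (x *\<^sub>v v)) *\<^sub>v (s_mat x a *\<^sub>v brd \<alpha> w \<beta>)"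
      unfolding u_mat_action[OF v w] s_mat_action[OF xc wbv] s_mat_action[OF xc w] u_mat_action[OF axv xw] e
        polar_form_smult(1)[OF xv xw] SO_polar[OF x v w] Q_odd_smult[OF xv] SO_Q[OF x v] Qa
      by (simp add: algebra_simps)
    also have "\<dots> = um l (a \<cdot>\<^sub>v (x *\<^sub>v v)) * s_mat x a *\<^sub>v brd \<alpha> w \<beta>"
      by (rule assoc_mult_mat_vec[OF u_mat_carrier sc brd_carrier[OF w], symmetric])
    finally show "s_mat x a * um l v *\<^sub>v brd \<alpha> w \<beta> = um l (a \<cdot>\<^sub>v (x *\<^sub>v v)) * s_mat x a *\<^sub>v brd \<alpha> w \<beta>" .
  qed
qed

lemma us_action:
  assumes v: "v \<in> carrier_vec (2 * l + 1)" and x: "x \<in> carrier_mat (2 * l + 1) (2 * l + 1)" and w: "w \<in> carrier_vec (2 * l + 1)"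
  shows "um l v * s_mat x a *\<^sub>v brd \<alpha> w \<beta> =
    brd (a * \<alpha> - polar_form l v (x *\<^sub>v w) - Q_odd l v * (inverse a * \<beta>)) (x *\<^sub>v w + (inverse a * \<beta>) \<cdot>\<^sub>v v) (inverse a * \<beta>)"
  unfolding assoc_mult_mat_vec[OF u_mat_carrier s_mat_carrier[OF x] brd_carrier[OF w]] s_mat_action[OF x w]
    u_mat_action[OF v mult_mat_vec_carrier[OF x w]] ..

lemma us_inject:
  assumes v: "v \<in> carrier_vec (2 * l + 1)" "v' \<in> carrier_vec (2 * l + 1)"
    and x: "x \<in> carrier_mat (2 * l + 1) (2 * l + 1)" "x' \<in> carrier_mat (2 * l + 1) (2 * l + 1)" and a: "a \<noteq> 0" "a' \<noteq> 0"
    and eq: "um l v * s_mat x a = um l v' * s_mat x' a'"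
  shows "v = v'" "x = x'" "a = a'"
proof -
  let ?z = "0\<^sub>v (2 * l + 1) :: 'a vec"
  have xz: "y *\<^sub>v ?z = ?z" if "y \<in> carrier_mat (2 * l + 1) (2 * l + 1)" for y
    using that by (intro eq_vecI) auto
  have act: "um l v * s_mat x a *\<^sub>v brd 0 w \<beta> = um l v' * s_mat x' a' *\<^sub>v brd 0 w \<beta>" for w \<beta> using eq by simp
  have c: "x *\<^sub>v w + b \<cdot>\<^sub>v v \<in> carrier_vec (2 * l + 1)" "x' *\<^sub>v w + b \<cdot>\<^sub>v v' \<in> carrier_vec (2 * l + 1)" if "w \<in> carrier_vec (2 * l + 1)" for w b
    using that v x mult_mat_vec_carrier[OF x(1) that] mult_mat_vec_carrier[OF x(2) that] by auto
  note e = act[unfolded us_action[OF v(1) x(1)] us_action[OF v(2) x(2)]]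
  have "x *\<^sub>v ?z + (inverse a * 1) \<cdot>\<^sub>v v = x' *\<^sub>v ?z + (inverse a' * 1) \<cdot>\<^sub>v v' \<and> inverse a * 1 = inverse a' * 1"
    using act[of ?z 1] unfolding us_action[OF v(1) x(1) zero_carrier_vec] us_action[OF v(2) x(2) zero_carrier_vec]
      brd_inject[OF c(1)[OF zero_carrier_vec] c(2)[OF zero_carrier_vec]] by blast
  then have ia: "inverse a = inverse a'" and iv: "?z + inverse a \<cdot>\<^sub>v v = ?z + inverse a \<cdot>\<^sub>v v'" unfolding xz[OF x(1)] xz[OF x(2)] by auto
  show aa: "a = a'" using ia by (metis inverse_inverse_eq)
  have "a \<cdot>\<^sub>v (inverse a \<cdot>\<^sub>v v) = a \<cdot>\<^sub>v (inverse a \<cdot>\<^sub>v v')" using iv v by simp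
  then show vv: "v = v'" using a by (simp add: smult_smult_assoc)
  show "x = x'"
  proof (rule eq_mat_by_action[OF x])
    fix w :: "'a vec" assume w: "w \<in> carrier_vec (2 * l + 1)"
    have "x *\<^sub>v w + (inverse a * 0) \<cdot>\<^sub>v v = x' *\<^sub>v w + (inverse a' * 0) \<cdot>\<^sub>v v'"
      using act[of w 0] unfolding us_action[OF v(1) x(1) w] us_action[OF v(2) x(2) w] brd_inject[OF c(1)[OF w] c(2)[OF w]] by blast
    moreover have "y + (b * 0) \<cdot>\<^sub>v u = y" if "y \<in> carrier_vec (2 * l + 1)" "u \<in> carrier_vec (2 * l + 1)" for y u :: "'a vec" and b
      using that by (intro eq_vecI) auto
    ultimately show "x *\<^sub>v w = x' *\<^sub>v w" using v mult_mat_vec_carrier[OF x(1) w] mult_mat_vec_carrier[OF x(2) w] by metis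
  qed
qed

lemma unit_vec_brd: "unit_vec (2 * Suc l + 1) 0 = brd 1 (0\<^sub>v (2 * l + 1)) 0"
  by (intro eq_vecI) (auto simp: brd_def)

lemma us_in_P_set:
  assumes v: "v \<in> carrier_vec (2 * l + 1)" and x: "x \<in> SO_odd l" and a: "a \<noteq> 0"
  shows "um l v * s_mat x a \<in> P_set (Suc l)"
proof -
  let ?z = "0\<^sub>v (2 * l + 1) :: 'a vec"
  have xz: "x *\<^sub>v ?z = ?z" using SO_carrier[OF x] by (intro eq_vecI) auto
  have zz: "?z + (inverse a * 0) \<cdot>\<^sub>v v = ?z" using v by (intro eq_vecI) auto
  have "um l v * s_mat x a *\<^sub>v brd 1 ?z 0 = brd a ?z 0"
    unfolding us_action[OF v SO_carrier[OF x] zero_carrier_vec] xz zz polar_form_zero[OF v] by simp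
  also have "\<dots> = a \<cdot>\<^sub>v brd 1 ?z 0" by (intro eq_vecI) (auto simp: brd_def)
  finally show ?thesis
    unfolding P_set_def unit_vec_brd using SO_mult[OF u_mat_SO[OF v] s_mat_SO[OF x a]] by blast
qed

text \<open>An element of \<open>P\<close> scales the first basis vector \<open>?e\<close>;
  multiplying by a suitable unipotent makes it scale the opposite vector \<open>?f\<close> as well.
  An isometry that preserves this hyperbolic pair up to scalars preserves the vectors polar to both,
  so it is block diagonal. The middle block is then an isometry of determinant 1.\<close>

lemma P_set_decomposition:
  fixes g :: "'a::field mat"
  assumes g: "g \<in> P_set (Suc l)"
  obtains v x a where "v \<in> carrier_vec (2 * l + 1)" "x \<in> SO_odd l" "a \<noteq> 0" "g = um l v * s_mat x a"
proof -
  let ?z = "0\<^sub>v (2 * l + 1) :: 'a vec"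
  let ?e = "brd 1 ?z 0 :: 'a vec" and ?f = "brd 0 ?z 1 :: 'a vec"
  have zc: "?z \<in> carrier_vec (2 * l + 1)" by simp
  have gS: "g \<in> SO_odd (Suc l)" using g by (auto simp: P_set_def)
  note gc = SO_carrier[OF gS]
  obtain c where c: "g *\<^sub>v ?e = c \<cdot>\<^sub>v ?e" using g unfolding P_set_def unit_vec_brd by blast
  have cE: "c \<cdot>\<^sub>v ?e = brd c ?z 0" by (intro eq_vecI) (auto simp: brd_def)
  have polar_e: "polar_form (Suc l) (brd a ?z 0) (brd \<alpha> w \<beta>) = a * \<beta>" if "w \<in> carrier_vec (2 * l + 1)" for a \<alpha> w \<beta>
    unfolding polar_form_brd[OF zc that] polar_form_commute[OF zc that] polar_form_zero[OF that] by simp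
  have last: "c * \<beta>' = \<beta>" if "w \<in> carrier_vec (2 * l + 1)" "w' \<in> carrier_vec (2 * l + 1)" "g *\<^sub>v brd \<alpha> w \<beta> = brd \<alpha>' w' \<beta>'" for \<alpha> w \<beta> \<alpha>' w' \<beta>'
    using SO_polar[OF gS brd_carrier[OF zc, of 1 0] brd_carrier[OF that(1), of \<alpha> \<beta>]]
    unfolding c cE that(3) polar_e[OF that(1)] polar_e[OF that(2)] by simp
  obtain \<gamma> w0 \<delta> where f: "w0 \<in> carrier_vec (2 * l + 1)" "g *\<^sub>v ?f = brd \<gamma> w0 \<delta>"
    using mult_mat_vec_carrier[OF gc brd_carrier[OF zc]] by (rule brd_cases)
  have c\<delta>: "c * \<delta> = 1" by (rule last[OF zc f])
  then have c0: "c \<noteq> 0" by auto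
  have \<delta>: "\<delta> = inverse c" using c\<delta> c0 by (simp add: field_simps)
  \<comment> \<open>Chosen such that the unipotent of \<open>- v\<close> clears the middle part of
    the image of \<open>?f\<close>, whose last coordinate is the inverse of
    \<open>c\<close>.\<close>
  define v where "v = c \<cdot>\<^sub>v w0"
  have v: "v \<in> carrier_vec (2 * l + 1)" "- v \<in> carrier_vec (2 * l + 1)" using f(1) by (auto simp: v_def)
  define h where "h = um l (- v) * g"
  have hS: "h \<in> SO_odd (Suc l)" unfolding h_def by (rule SO_mult[OF u_mat_SO[OF v(2)] gS])
  note hc = SO_carrier[OF hS]
  have hv: "h *\<^sub>v y = um l (- v) *\<^sub>v (g *\<^sub>v y)" if "y \<in> carrier_vec (2 * Suc l + 1)" for y
    unfolding h_def by (rule assoc_mult_mat_vec[OF u_mat_carrier gc that])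
  have he: "h *\<^sub>v ?e = brd c ?z 0"
  proof -
    have zz: "?z + 0 \<cdot>\<^sub>v (- v) = ?z" using v by (intro eq_vecI) auto
    show ?thesis unfolding hv[OF brd_carrier[OF zc]] c cE u_mat_action[OF v(2) zc] zz polar_form_zero[OF v(2)] by simp
  qed
  have hf: "h *\<^sub>v ?f = brd 0 ?z (inverse c)"
  proof -
    have zz: "w0 + inverse c \<cdot>\<^sub>v (- v) = ?z" using c0 f(1) by (intro eq_vecI) (auto simp: v_def field_simps)
    obtain \<gamma>' where e: "h *\<^sub>v ?f = brd \<gamma>' ?z (inverse c)"
      unfolding hv[OF brd_carrier[OF zc]] f(2) u_mat_action[OF v(2) f(1)] \<delta> zz by blast
    \<comment> \<open>The image of the singular vector \<open>?f\<close> is singular; with no middle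
      part and a nonzero last coordinate its first coordinate must vanish.\<close>
    have "Q_odd (Suc l) (brd \<gamma>' ?z (inverse c)) = Q_odd (Suc l) ?f" unfolding e[symmetric] by (rule SO_Q[OF hS brd_carrier[OF zc]])
    then have "\<gamma>' = 0" unfolding Q_odd_brd[OF zc] using c0 by simp
    then show ?thesis using e by simp
  qed
  define x where "x = mat (2 * l + 1) (2 * l + 1) (\<lambda>(i, j). h $$ (Suc i, Suc j))"
  have xc: "x \<in> carrier_mat (2 * l + 1) (2 * l + 1)" by (simp add: x_def)
  have hw: "h *\<^sub>v brd 0 w 0 = brd 0 (x *\<^sub>v w) 0" if w: "w \<in> carrier_vec (2 * l + 1)" for w
  proof -
    obtain \<alpha> w' \<beta> where e: "w' \<in> carrier_vec (2 * l + 1)" "h *\<^sub>v brd 0 w 0 = brd \<alpha> w' \<beta>"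
      using mult_mat_vec_carrier[OF hc brd_carrier[OF w]] by (rule brd_cases)
    have "polar_form (Suc l) (brd c ?z 0) (brd \<alpha> w' \<beta>) = polar_form (Suc l) ?e (brd 0 w 0)"
      unfolding he[symmetric] e(2)[symmetric] by (rule SO_polar[OF hS brd_carrier[OF zc] brd_carrier[OF w]])
    then have \<beta>: "\<beta> = 0" unfolding polar_e[OF w] polar_e[OF e(1)] using c0 by simp
    have "polar_form (Suc l) (brd 0 ?z (inverse c)) (brd \<alpha> w' \<beta>) = polar_form (Suc l) ?f (brd 0 w 0)"
      unfolding hf[symmetric] e(2)[symmetric] by (rule SO_polar[OF hS brd_carrier[OF zc] brd_carrier[OF w]])
    then have \<alpha>: "\<alpha> = 0"
      unfolding polar_form_brd[OF zc w] polar_form_brd[OF zc e(1)] polar_form_commute[OF zc w] polar_form_commute[OF zc e(1)]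
        polar_form_zero[OF w] polar_form_zero[OF e(1)] using c0 by simp
    have "w' = x *\<^sub>v w"
    proof (rule eq_vecI)
      fix i assume "i < dim_vec (x *\<^sub>v w)"
      then have i: "i < 2 * l + 1" using xc by simp
      have "w' $ i = (h *\<^sub>v brd 0 w 0) $ Suc i" unfolding e(2) by (rule brd_index(2)[OF e(1) i, symmetric])
      also have "\<dots> = (\<Sum>j<2 * l + 1. h $$ (Suc i, Suc j) * w $ j)" using i by (subst mat_brd_index[OF hc w]) auto
      also have "\<dots> = (x *\<^sub>v w) $ i" unfolding mult_vec_index[OF xc w i] using i by (intro sum.cong refl) (auto simp: x_def)
      finally show "w' $ i = (x *\<^sub>v w) $ i" .
    qed (use e(1) xc in auto)
    then show ?thesis using e(2) \<alpha> \<beta> by simp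
  qed
  have hs: "h = s_mat x c"
  proof (rule eq_mat_by_brd[OF hc s_mat_carrier[OF xc]])
    fix \<alpha> \<beta> and w :: "'a vec" assume w: "w \<in> carrier_vec (2 * l + 1)"
    have d: "brd \<alpha> w \<beta> = \<alpha> \<cdot>\<^sub>v ?e + (brd 0 w 0 + \<beta> \<cdot>\<^sub>v ?f)" using w by (intro eq_vecI) (auto simp: brd_def)
    have dc: "\<alpha> \<cdot>\<^sub>v ?e \<in> carrier_vec (2 * Suc l + 1)" "brd 0 w 0 \<in> carrier_vec (2 * Suc l + 1)" "\<beta> \<cdot>\<^sub>v ?f \<in> carrier_vec (2 * Suc l + 1)"
      using brd_carrier[OF zc] brd_carrier[OF w] by (auto simp only: smult_carrier_vec)
    have xw: "x *\<^sub>v w \<in> carrier_vec (2 * l + 1)" by (rule mult_mat_vec_carrier[OF xc w])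
    have "h *\<^sub>v brd \<alpha> w \<beta> = \<alpha> \<cdot>\<^sub>v (h *\<^sub>v ?e) + (h *\<^sub>v brd 0 w 0 + \<beta> \<cdot>\<^sub>v (h *\<^sub>v ?f))"
      unfolding d mult_add_distrib_mat_vec[OF hc dc(1) add_carrier_vec[OF dc(2,3)]] mult_add_distrib_mat_vec[OF hc dc(2,3)]
        mult_mat_vec[OF hc brd_carrier[OF zc]] ..
    also have "\<dots> = s_mat x c *\<^sub>v brd \<alpha> w \<beta>"
    proof -
      have zc': "k \<cdot>\<^sub>v ?z \<in> carrier_vec (2 * l + 1)" for k by simp
      have zz: "\<alpha> \<cdot>\<^sub>v ?z + (x *\<^sub>v w + \<beta> \<cdot>\<^sub>v ?z) = x *\<^sub>v w"
        using xw carrier_matD[OF xc] by (intro eq_vecI) (auto simp del: index_mult_mat_vec)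
      show ?thesis
        unfolding he hw[OF w] hf s_mat_action[OF xc w] brd_smult brd_add[OF xw zc'] brd_add[OF zc' add_carrier_vec[OF xw zc']] zz
        by (simp add: mult.commute)
    qed
    finally show "h *\<^sub>v brd \<alpha> w \<beta> = s_mat x c *\<^sub>v brd \<alpha> w \<beta>" .
  qed
  have "x \<in> SO_odd l"
    unfolding SO_odd_iff
  proof (intro conjI ballI)
    fix w :: "'a vec" assume w: "w \<in> carrier_vec (2 * l + 1)"
    have "Q_odd (Suc l) (brd 0 (x *\<^sub>v w) 0) = Q_odd (Suc l) (brd 0 w 0)"
      unfolding hw[OF w, symmetric] by (rule SO_Q[OF hS brd_carrier[OF w]])
    then show "Q_odd l (x *\<^sub>v w) = Q_odd l w" unfolding Q_odd_brd[OF w] Q_odd_brd[OF mult_mat_vec_carrier[OF xc w]] by simp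
  next
    show "det x = 1" using det_s_mat[OF xc c0] hS unfolding hs by (simp add: SO_odd_iff)
  qed (rule xc)
  moreover have "g = um l v * s_mat x c"
  proof -
    have "v + - v = ?z" using v by (intro eq_vecI) auto
    then have "um l v * um l (- v) = 1\<^sub>m (2 * Suc l + 1)" using um_mult[OF v] um_zero by metis
    then have "um l v * h = g"
      unfolding h_def assoc_mult_mat[OF u_mat_carrier u_mat_carrier gc, symmetric] using left_mult_one_mat[OF gc] by simp
    then show ?thesis using hs by simp
  qed
  ultimately show ?thesis using that v(1) c0 by blast
qed

lemma us_mult:
  assumes v: "v \<in> carrier_vec (2 * l + 1)" "w \<in> carrier_vec (2 * l + 1)" and x: "x \<in> SO_odd l" "y \<in> SO_odd l" and a: "a \<noteq> 0"
  shows "(um l v * s_mat x a) * (um l w * s_mat y b) = um l (v + a \<cdot>\<^sub>v (x *\<^sub>v w)) * s_mat (x * y) (a * b)"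
proof -
  note uc = u_mat_carrier[of "Suc l"] and sx = s_mat_carrier[OF SO_carrier[OF x(1)]] and sy = s_mat_carrier[OF SO_carrier[OF x(2)]]
  have axw: "a \<cdot>\<^sub>v (x *\<^sub>v w) \<in> carrier_vec (2 * l + 1)" using mult_mat_vec_carrier[OF SO_carrier[OF x(1)] v(2)] by simp
  have "(um l v * s_mat x a) * (um l w * s_mat y b) = um l v * (s_mat x a * um l w * s_mat y b)"
    unfolding assoc_mult_mat[OF uc sx mult_carrier_mat[OF uc sy]] assoc_mult_mat[OF sx uc sy, symmetric] ..
  also have "\<dots> = um l v * um l (a \<cdot>\<^sub>v (x *\<^sub>v w)) * (s_mat x a * s_mat y b)"
    unfolding s_mult_um[OF x(1) a v(2)] assoc_mult_mat[OF uc sx sy] assoc_mult_mat[OF uc uc mult_carrier_mat[OF sx sy]] ..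
  finally show ?thesis unfolding um_mult[OF v(1) axw] s_mult[OF SO_carrier[OF x(1)] SO_carrier[OF x(2)]] .
qed

lemma us_one: "um l (0\<^sub>v (2 * l + 1)) * s_mat (1\<^sub>m (2 * l + 1)) 1 = 1\<^sub>m (2 * Suc l + 1)"
  unfolding um_zero s_one by simp

lemma P_set_carrier: "P_set m \<subseteq> carrier_mat (2 * m + 1) (2 * m + 1)"
  using SO_carrier by (auto simp: P_set_def)

lemma P_grp_group: "group (P_grp (Suc l) :: 'a::field mat monoid)"
  unfolding P_grp_def
proof (rule mat_group_group[OF P_set_carrier])
  show "1\<^sub>m (2 * Suc l + 1) \<in> (P_set (Suc l) :: 'a mat set)"
    unfolding us_one[symmetric] by (rule us_in_P_set[OF zero_carrier_vec SO_one one_neq_zero])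
next
  fix g h :: "'a mat" assume "g \<in> P_set (Suc l)" "h \<in> P_set (Suc l)"
  then obtain v x a w y b where g: "v \<in> carrier_vec (2 * l + 1)" "x \<in> SO_odd l" "a \<noteq> 0" "g = um l v * s_mat x a"
    and h: "w \<in> carrier_vec (2 * l + 1)" "y \<in> SO_odd l" "b \<noteq> 0" "h = um l w * s_mat y b"
    by (metis P_set_decomposition)
  have "v + a \<cdot>\<^sub>v (x *\<^sub>v w) \<in> carrier_vec (2 * l + 1)" using g(1) mult_mat_vec_carrier[OF SO_carrier[OF g(2)] h(1)] by simp
  then show "g * h \<in> P_set (Suc l)"
    unfolding g(4) h(4) us_mult[OF g(1) h(1) g(2) h(2) g(3)] using g(3) h(3) by (intro us_in_P_set SO_mult g h) auto
next
  fix g :: "'a mat" assume "g \<in> P_set (Suc l)"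
  then obtain v x a where g: "v \<in> carrier_vec (2 * l + 1)" "x \<in> SO_odd l" "a \<noteq> 0" "g = um l v * s_mat x a"
    by (metis P_set_decomposition)
  obtain y where y: "y \<in> SO_odd l" "y * x = 1\<^sub>m (2 * l + 1)" using SO_inverse[OF g(2)] by metis
  define w where "w = - (inverse a \<cdot>\<^sub>v (y *\<^sub>v v))"
  have yv: "y *\<^sub>v v \<in> carrier_vec (2 * l + 1)" by (rule mult_mat_vec_carrier[OF SO_carrier[OF y(1)] g(1)])
  have w: "w \<in> carrier_vec (2 * l + 1)" unfolding w_def using yv by auto
  have z: "w + inverse a \<cdot>\<^sub>v (y *\<^sub>v v) = 0\<^sub>v (2 * l + 1)" unfolding w_def using yv by (intro eq_vecI) auto
  have ia: "inverse a \<noteq> 0" using g(3) by simp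
  have "(um l w * s_mat y (inverse a)) * g = 1\<^sub>m (2 * Suc l + 1)"
    unfolding g(4) us_mult[OF w g(1) y(1) g(2) ia] z y(2) left_inverse[OF g(3)] us_one ..
  moreover have "um l w * s_mat y (inverse a) \<in> P_set (Suc l)" by (rule us_in_P_set[OF w y(1) ia])
  ultimately show "\<exists>y\<in>P_set (Suc l). y * g = 1\<^sub>m (2 * Suc l + 1)" by blast
qed

lemma P_set_finite: "finite (P_set m :: 'a::{field,finite} mat set)"
  by (rule finite_subset[OF P_set_carrier finite_carrier_mat])

lemma U_grp_eq: "U_grp (Suc l) = um l ` carrier_vec (2 * l + 1)"
  by (simp add: U_grp_def)

lemma um_in_P_set:
  assumes "v \<in> carrier_vec (2 * l + 1)"
  shows "um l v \<in> P_set (Suc l)"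
  using us_in_P_set[OF assms SO_one one_neq_zero] unfolding s_one right_mult_one_mat[OF u_mat_carrier] .

lemma s_in_P_set:
  assumes "x \<in> SO_odd l" "a \<noteq> 0"
  shows "s_mat x a \<in> P_set (Suc l)"
  using us_in_P_set[OF zero_carrier_vec assms] unfolding um_zero left_mult_one_mat[OF s_mat_carrier[OF SO_carrier[OF assms(1)]]] .

lemma um_inject: "v \<in> carrier_vec (2 * l + 1) \<Longrightarrow> w \<in> carrier_vec (2 * l + 1) \<Longrightarrow> um l v = um l w \<longleftrightarrow> v = w"
  using us_inject(1)[OF _ _ one_carrier_mat one_carrier_mat one_neq_zero one_neq_zero, of v l w] by metis

lemma U_char_um:
  assumes "v \<in> carrier_vec (2 * l + 1)"
  shows "U_char (Suc l) \<xi> f (um l v) = \<xi> (f v)"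
proof -
  have "(THE w. w \<in> carrier_vec (2 * l + 1) \<and> um l v = um l w) = v"
    using assms um_inject[OF assms] by (intro the_equality) auto
  then show ?thesis using assms by (simp add: U_char_def U_grp_eq)
qed

lemma U_char_off: "g \<notin> U_grp m \<Longrightarrow> U_char m \<xi> f g = 0"
  by (simp add: U_char_def)

lemma U_char_eqI:
  assumes "\<And>v. v \<in> carrier_vec (2 * l + 1) \<Longrightarrow> \<xi> (f v) = \<xi> (f' v)"
  shows "U_char (Suc l) \<xi> f = U_char (Suc l) \<xi> f'"
proof
  fix g
  show "U_char (Suc l) \<xi> f g = U_char (Suc l) \<xi> f' g"
  proof (cases "g \<in> U_grp (Suc l)")
    case True
    then obtain v where "v \<in> carrier_vec (2 * l + 1)" "g = um l v" by (auto simp: U_grp_eq)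
    then show ?thesis using assms by (simp add: U_char_um)
  qed (simp add: U_char_off)
qed

text \<open>Here \<open>l\<close> is m - 1, the rank of the orthogonal factor of the Levi group;
  \<open>P\<close> itself has rank \<open>Suc l\<close>, and \<open>U\<close> is a copy of the
  vectors of dimension 2 l + 1.\<close>

locale parabolic = add_char \<xi> for \<xi> :: "'a::{field,finite} \<Rightarrow> complex" +
  fixes l :: nat
begin

abbreviation "V \<equiv> carrier_vec (2 * l + 1) :: 'a vec set"
abbreviation "P \<equiv> P_grp (Suc l) :: 'a mat monoid"
abbreviation "U \<equiv> U_grp (Suc l) :: 'a mat set"

definition lam :: "'a vec \<Rightarrow> 'a mat \<Rightarrow> complex" where
  "lam c = U_char (Suc l) \<xi> (\<lambda>v. c \<bullet> v)"

lemma lam_um: "v \<in> V \<Longrightarrow> lam c (um l v) = \<xi> (c \<bullet> v)"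
  by (simp add: lam_def U_char_um)

lemma xi_trivial: "(\<And>t. \<xi> (a * t) = 1) \<Longrightarrow> a = 0"
proof (rule ccontr)
  assume h: "\<And>t. \<xi> (a * t) = 1" and a: "a \<noteq> 0"
  have "\<xi> t = 1" for t using h[of "t / a"] a by simp
  then show False using nontriv by auto
qed

text \<open>A nontrivial \<open>\<xi>\<close> is nontrivial on every multiple of a nonzero scalar,
  so it suffices to test along the coordinate axes.\<close>

lemma functional_eqI:
  assumes c: "c \<in> V" "c' \<in> V" and e: "\<And>v. v \<in> V \<Longrightarrow> \<xi> (c \<bullet> v) = \<xi> (c' \<bullet> v)"
  shows "c = c'"
proof (rule eq_vecI)
  fix i assume "i < dim_vec c'"
  then have i: "i < 2 * l + 1" using c by auto
  have "\<xi> ((c $ i - c' $ i) * t) = 1" for t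
  proof -
    have "\<xi> (t * c $ i) = \<xi> (t * c' $ i)"
      using e[of "t \<cdot>\<^sub>v unit_vec (2 * l + 1) i"] i c by simp
    moreover have "\<xi> ((c $ i - c' $ i) * t) = \<xi> (t * c $ i) * \<xi> (- (t * c' $ i))" unfolding add[symmetric] by (simp add: algebra_simps)
    moreover have "\<xi> (t * c' $ i) * \<xi> (- (t * c' $ i)) = 1" unfolding add[symmetric] by (simp add: zero)
    ultimately show ?thesis by simp
  qed
  then show "c $ i = c' $ i" using xi_trivial[of "c $ i - c' $ i"] by simp
qed (use c in auto)

lemma lam_inject: "c \<in> V \<Longrightarrow> c' \<in> V \<Longrightarrow> lam c = lam c' \<longleftrightarrow> c = c'"
  using functional_eqI[of c c'] lam_um by metis

lemma sum_vec_char: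
  assumes v: "v \<in> V"
  shows "(\<Sum>c\<in>V. \<xi> (c \<bullet> v)) = (if v = 0\<^sub>v (2 * l + 1) then of_nat (card V) else 0)"
proof (cases "v = 0\<^sub>v (2 * l + 1)")
  case True
  then show ?thesis by (simp add: zero)
next
  case False
  then obtain i where i: "i < 2 * l + 1" "v $ i \<noteq> 0" using v by (metis carrier_vecD eq_vecI index_zero_vec)
  obtain y where y: "\<xi> y \<noteq> 1" using nontriv by auto
  define w where "w = (y / v $ i) \<cdot>\<^sub>v unit_vec (2 * l + 1) i"
  have w: "w \<in> V" by (simp add: w_def)
  have wv: "w \<bullet> v = y" using i v by (simp add: w_def)
  have "bij_betw (\<lambda>c. c + w) V V"
  proof (rule bij_betwI[of _ _ _ "\<lambda>c. c - w"])
    show "c - w + w = c" "c + w - w = c" if "c \<in> V" for c using that w by (auto intro!: eq_vecI)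
  qed (use w in auto)
  then have "(\<Sum>c\<in>V. \<xi> (c \<bullet> v)) = (\<Sum>c\<in>V. \<xi> ((c + w) \<bullet> v))" by (rule sum.reindex_bij_betw[symmetric])
  also have "\<dots> = (\<Sum>c\<in>V. \<xi> (c \<bullet> v)) * \<xi> y"
    unfolding sum_distrib_right by (intro sum.cong refl) (simp only: add_scalar_prod_distrib[OF _ w v] wv add)
  finally show ?thesis using y False by simp
qed

lemma sum_U: "(\<Sum>u\<in>U. f u) = (\<Sum>v\<in>V. f (um l v))"
  unfolding U_grp_eq by (rule sum.reindex[unfolded o_def]) (auto simp: inj_on_def um_inject)

lemma card_U: "card U = card V"
  unfolding U_grp_eq by (rule card_image) (auto simp: inj_on_def um_inject)

lemma P_simps: "carrier P = P_set (Suc l)" "x \<otimes>\<^bsub>P\<^esub> y = x * y" "\<one>\<^bsub>P\<^esub> = 1\<^sub>m (2 * Suc l + 1)"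
  by (simp_all add: P_grp_def)

lemma conj_um:
  assumes w: "w \<in> V" and x: "x \<in> SO_odd l" and a: "a \<noteq> 0" and v: "v \<in> V"
  shows "inv\<^bsub>P\<^esub> (um l w * s_mat x a) \<otimes>\<^bsub>P\<^esub> um l (a \<cdot>\<^sub>v (x *\<^sub>v v)) \<otimes>\<^bsub>P\<^esub> (um l w * s_mat x a) = um l v"
proof -
  interpret group P by (rule P_grp_group)
  let ?p = "um l w * s_mat x a"
  have axv: "a \<cdot>\<^sub>v (x *\<^sub>v v) \<in> V" using mult_mat_vec_carrier[OF SO_carrier[OF x] v] by simp
  have p: "?p \<in> carrier P" "um l v \<in> carrier P" "um l (a \<cdot>\<^sub>v (x *\<^sub>v v)) \<in> carrier P"
    unfolding P_simps using us_in_P_set[OF w x a] um_in_P_set[OF v] um_in_P_set[OF axv] by auto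
  note uc = u_mat_carrier[of "Suc l"] and sc = s_mat_carrier[OF SO_carrier[OF x]]
  have "um l (a \<cdot>\<^sub>v (x *\<^sub>v v)) * ?p = (um l (a \<cdot>\<^sub>v (x *\<^sub>v v)) * um l w) * s_mat x a"
    by (rule assoc_mult_mat[OF uc uc sc, symmetric])
  also have "\<dots> = (um l w * um l (a \<cdot>\<^sub>v (x *\<^sub>v v))) * s_mat x a"
    unfolding um_mult[OF w axv] um_mult[OF axv w] comm_add_vec[OF w axv] ..
  also have "\<dots> = um l w * (um l (a \<cdot>\<^sub>v (x *\<^sub>v v)) * s_mat x a)" by (rule assoc_mult_mat[OF uc uc sc])
  also have "\<dots> = ?p * um l v" unfolding s_mult_um[OF x a v, symmetric] by (rule assoc_mult_mat[OF uc sc uc, symmetric])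
  finally have "um l (a \<cdot>\<^sub>v (x *\<^sub>v v)) \<otimes>\<^bsub>P\<^esub> ?p = ?p \<otimes>\<^bsub>P\<^esub> um l v" unfolding P_simps .
  then show ?thesis using p by (metis inv_closed inv_solve_left m_assoc m_closed)
qed

lemma preimage_under_conj:
  assumes x: "x \<in> SO_odd l" and a: "a \<noteq> 0" and v: "v \<in> V"
  obtains v' where "v' \<in> V" "v = a \<cdot>\<^sub>v (x *\<^sub>v v')"
proof -
  obtain y where y: "y \<in> SO_odd l" "x * y = 1\<^sub>m (2 * l + 1)" using SO_inverse[OF x] by metis
  have yv: "y *\<^sub>v v \<in> V" by (rule mult_mat_vec_carrier[OF SO_carrier[OF y(1)] v])
  have "x *\<^sub>v (y *\<^sub>v v) = v" using assoc_mult_mat_vec[OF SO_carrier[OF x] SO_carrier[OF y(1)] v] y(2) v by simp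
  then have "a \<cdot>\<^sub>v (x *\<^sub>v (inverse a \<cdot>\<^sub>v (y *\<^sub>v v))) = v"
    unfolding mult_mat_vec[OF SO_carrier[OF x] yv] using a by (simp add: smult_smult_assoc)
  then show ?thesis using that[of "inverse a \<cdot>\<^sub>v (y *\<^sub>v v)"] yv by simp
qed

text \<open>Evaluating at the conjugate \<open>a \<cdot>\<^sub>v (x *\<^sub>v v)\<close> instead of
  \<open>v\<close> states the condition without inverting \<open>x\<close>. The unipotent factor
  \<open>w\<close> disappears because \<open>U\<close> is abelian.\<close>

lemma conj_lam_iff:
  assumes w: "w \<in> V" and x: "x \<in> SO_odd l" and a: "a \<noteq> 0" and c: "c \<in> V" "c' \<in> V"
  shows "conj_char P U (um l w * s_mat x a) (lam c) = lam c' \<longleftrightarrow> (\<forall>v\<in>V. c \<bullet> v = a * (c' \<bullet> (x *\<^sub>v v)))"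
proof -
  have val: "conj_char P U (um l w * s_mat x a) (lam c) (um l (a \<cdot>\<^sub>v (x *\<^sub>v v))) = \<xi> (c \<bullet> v)"
    and val': "lam c' (um l (a \<cdot>\<^sub>v (x *\<^sub>v v))) = \<xi> (a * (c' \<bullet> (x *\<^sub>v v)))" if v: "v \<in> V" for v
  proof -
    have xv: "x *\<^sub>v v \<in> V" by (rule mult_mat_vec_carrier[OF SO_carrier[OF x] v])
    then have axv: "a \<cdot>\<^sub>v (x *\<^sub>v v) \<in> V" by simp
    then have "um l (a \<cdot>\<^sub>v (x *\<^sub>v v)) \<in> U" by (auto simp: U_grp_eq)
    then show "conj_char P U (um l w * s_mat x a) (lam c) (um l (a \<cdot>\<^sub>v (x *\<^sub>v v))) = \<xi> (c \<bullet> v)"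
      unfolding conj_char_def conj_um[OF w x a v] by (simp add: lam_um[OF v])
    show "lam c' (um l (a \<cdot>\<^sub>v (x *\<^sub>v v))) = \<xi> (a * (c' \<bullet> (x *\<^sub>v v)))"
      unfolding lam_um[OF axv] scalar_prod_smult_distrib[OF c(2) xv] ..
  qed
  show ?thesis
  proof
    assume e: "\<forall>v\<in>V. c \<bullet> v = a * (c' \<bullet> (x *\<^sub>v v))"
    show "conj_char P U (um l w * s_mat x a) (lam c) = lam c'"
    proof
      fix g
      show "conj_char P U (um l w * s_mat x a) (lam c) g = lam c' g"
      proof (cases "g \<in> U")
        case True
        then obtain v0 where v0: "v0 \<in> V" "g = um l v0" by (auto simp: U_grp_eq)
        obtain v where v: "v \<in> V" "v0 = a \<cdot>\<^sub>v (x *\<^sub>v v)" using preimage_under_conj[OF x a v0(1)] .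
        show ?thesis unfolding v0(2) v(2) val[OF v(1)] val'[OF v(1)] using e v(1) by simp
      qed (simp add: conj_char_def lam_def U_char_off)
    qed
  next
    assume e: "conj_char P U (um l w * s_mat x a) (lam c) = lam c'"
    \<comment> \<open>Represents the right-hand functional by a vector through the transpose of
      \<open>x\<close>, so that equality of characters gives equality of vectors.\<close>
    define d where "d = a \<cdot>\<^sub>v (transpose_mat x *\<^sub>v c')"
    have xt: "transpose_mat x \<in> carrier_mat (2 * l + 1) (2 * l + 1)" using SO_carrier[OF x] by simp
    have tc: "transpose_mat x *\<^sub>v c' \<in> V" by (rule mult_mat_vec_carrier[OF xt c(2)])
    have d: "d \<in> V" unfolding d_def using tc by simp
    have dv: "d \<bullet> v = a * (c' \<bullet> (x *\<^sub>v v))" if v: "v \<in> V" for v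
      unfolding d_def smult_scalar_prod_distrib[OF tc v]
      using transpose_vec_mult_scalar[OF SO_carrier[OF x] v c(2)] by simp
    have "c = d"
    proof (rule functional_eqI[OF c(1) d])
      fix v assume v: "v \<in> V"
      show "\<xi> (c \<bullet> v) = \<xi> (d \<bullet> v)" unfolding dv[OF v] val[OF v, symmetric] val'[OF v, symmetric] e ..
    qed
    then show "\<forall>v\<in>V. c \<bullet> v = a * (c' \<bullet> (x *\<^sub>v v))" using dv by simp
  qed
qed

lemma P_elemE:
  assumes "p \<in> carrier P"
  obtains w x a where "w \<in> V" "x \<in> SO_odd l" "a \<noteq> 0" "p = um l w * s_mat x a"
  using assms unfolding P_simps by (rule P_set_decomposition) (rule that)

lemma P_fin_group: "fin_group P"
  by (simp add: fin_group_def fin_group_axioms_def P_simps P_grp_group P_set_finite)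

lemma U_subgroup: "subgroup U P"
proof -
  interpret group P by (rule P_grp_group)
  have inv: "inv\<^bsub>P\<^esub> (um l v) = um l (- v)" if v: "v \<in> V" for v
  proof (rule inv_equality)
    have "- v + v = 0\<^sub>v (2 * l + 1)" using v by (intro eq_vecI) auto
    then show "um l (- v) \<otimes>\<^bsub>P\<^esub> um l v = \<one>\<^bsub>P\<^esub>"
      unfolding P_simps um_mult[OF uminus_carrier_vec[THEN iffD2, OF v] v] by (simp only: um_zero)
  qed (use v um_in_P_set[of v l] um_in_P_set[of "- v" l] in \<open>simp_all add: P_simps\<close>)
  show ?thesis
  proof (rule subgroupI)
    show "U \<subseteq> carrier P" using um_in_P_set by (auto simp: P_simps U_grp_eq)
    show "U \<noteq> {}" unfolding U_grp_eq using zero_carrier_vec by blast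
    show "inv\<^bsub>P\<^esub> u \<in> U" if "u \<in> U" for u
      using that inv unfolding U_grp_eq by (auto simp del: um_inject)
    show "u \<otimes>\<^bsub>P\<^esub> w \<in> U" if "u \<in> U" "w \<in> U" for u w
      using that unfolding U_grp_eq P_simps by (auto simp: um_mult)
  qed
qed

lemma inv_um: assumes v: "v \<in> V" shows "inv\<^bsub>P\<^esub> (um l v) = um l (- v)"
proof -
  interpret group P by (rule P_grp_group)
  have "- v + v = 0\<^sub>v (2 * l + 1)" using v by (intro eq_vecI) auto
  then have "um l (- v) \<otimes>\<^bsub>P\<^esub> um l v = \<one>\<^bsub>P\<^esub>"
    unfolding P_simps um_mult[OF uminus_carrier_vec[THEN iffD2, OF v] v] by (simp only: um_zero)
  then show ?thesis using v um_in_P_set[of v l] um_in_P_set[of "- v" l] by (intro inv_equality) (simp_all add: P_simps)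
qed

lemma functional_pullback:
  assumes x: "x \<in> SO_odd l" and c: "c \<in> V"
  obtains d where "d \<in> V" "\<And>v. v \<in> V \<Longrightarrow> d \<bullet> v = a * (c \<bullet> (x *\<^sub>v v))"
proof -
  have xt: "transpose_mat x \<in> carrier_mat (2 * l + 1) (2 * l + 1)" using SO_carrier[OF x] by simp
  have tc: "transpose_mat x *\<^sub>v c \<in> V" by (rule mult_mat_vec_carrier[OF xt c])
  show ?thesis
  proof (rule that[of "a \<cdot>\<^sub>v (transpose_mat x *\<^sub>v c)"])
    show "(a \<cdot>\<^sub>v (transpose_mat x *\<^sub>v c)) \<bullet> v = a * (c \<bullet> (x *\<^sub>v v))" if v: "v \<in> V" for v
      unfolding smult_scalar_prod_distrib[OF tc v] transpose_vec_mult_scalar[OF SO_carrier[OF x] v c] ..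
  qed (use tc in simp)
qed

lemma functional_push:
  assumes x: "x \<in> SO_odd l" and a: "a \<noteq> 0" and c: "c \<in> V"
  obtains d where "d \<in> V" "\<And>v. v \<in> V \<Longrightarrow> c \<bullet> v = a * (d \<bullet> (x *\<^sub>v v))"
proof -
  obtain y where y: "y \<in> SO_odd l" "y * x = 1\<^sub>m (2 * l + 1)" using SO_inverse[OF x] by metis
  obtain d where d: "d \<in> V" "\<And>v. v \<in> V \<Longrightarrow> d \<bullet> v = inverse a * (c \<bullet> (y *\<^sub>v v))" using functional_pullback[OF y(1) c] by metis
  show ?thesis
  proof (rule that[OF d(1)])
    fix v assume v: "v \<in> V"
    have "y *\<^sub>v (x *\<^sub>v v) = v" using assoc_mult_mat_vec[OF SO_carrier[OF y(1)] SO_carrier[OF x] v] y(2) v by simp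
    then show "c \<bullet> v = a * (d \<bullet> (x *\<^sub>v v))" using d(2)[OF mult_mat_vec_carrier[OF SO_carrier[OF x] v]] a by simp
  qed
qed

lemma normal_with_chars_P: "normal_with_chars P U (lam ` V)"
proof -
  interpret fin_group P by (rule P_fin_group)
  show ?thesis
  proof (intro normal_with_chars.intro normal_with_chars_axioms.intro P_fin_group)
    show "subgroup U P" by (rule U_subgroup)
    show "inv\<^bsub>P\<^esub> p \<otimes>\<^bsub>P\<^esub> u \<otimes>\<^bsub>P\<^esub> p \<in> U" if p: "p \<in> carrier P" and u: "u \<in> U" for p u
    proof -
      obtain w x a where w: "w \<in> V" "x \<in> SO_odd l" "a \<noteq> 0" "p = um l w * s_mat x a" using P_elemE[OF p] .
      obtain v where v: "v \<in> V" "u = um l v" using u by (auto simp: U_grp_eq)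
      obtain v' where v': "v' \<in> V" "v = a \<cdot>\<^sub>v (x *\<^sub>v v')" using preimage_under_conj[OF w(2,3) v(1)] .
      show ?thesis unfolding v(2) v'(2) w(4) conj_um[OF w(1-3) v'(1)] using v'(1) by (simp add: U_grp_eq)
    qed
    show "finite (lam ` V)" by simp
    show "\<kappa> (u \<otimes>\<^bsub>P\<^esub> v) = \<kappa> u * \<kappa> v" if h: "\<kappa> \<in> lam ` V" "u \<in> U" "v \<in> U" for \<kappa> u v
    proof -
      obtain c u' v' where c: "c \<in> V" "\<kappa> = lam c" "u' \<in> V" "u = um l u'" "v' \<in> V" "v = um l v'" using h by (auto simp: U_grp_eq)
      have "u' + v' \<in> V" using c by simp
      then show ?thesis unfolding P_simps c(2,4,6) um_mult[OF c(3,5)] using c(1,3,5)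
        by (simp only: lam_um scalar_prod_add_distrib[OF c(1,3,5)] add)
    qed
    show "\<kappa> (inv\<^bsub>P\<^esub> u) = cnj (\<kappa> u)" if h: "\<kappa> \<in> lam ` V" "u \<in> U" for \<kappa> u
    proof -
      obtain c u' where c: "c \<in> V" "\<kappa> = lam c" "u' \<in> V" "u = um l u'" using h by (auto simp: U_grp_eq)
      have "c \<bullet> (- u') = - (c \<bullet> u')" using c by simp
      then show ?thesis unfolding c(2,4) inv_um[OF c(3)] using c(3) by (simp add: lam_um cnj)
    qed
    show "\<kappa> g = 0" if "\<kappa> \<in> lam ` V" "g \<notin> U" for \<kappa> g using that by (auto simp: lam_def U_char_off)
    show "(\<Sum>u\<in>U. \<kappa> u * cnj (\<mu> u)) = (if \<kappa> = \<mu> then of_nat (card U) else 0)" if h: "\<kappa> \<in> lam ` V" "\<mu> \<in> lam ` V" for \<kappa> \<mu>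
    proof -
      obtain c c' where c: "c \<in> V" "\<kappa> = lam c" "c' \<in> V" "\<mu> = lam c'" using h by auto
      have d: "c - c' \<in> V" using c by simp
      have "(\<Sum>u\<in>U. \<kappa> u * cnj (\<mu> u)) = (\<Sum>v\<in>V. \<xi> (v \<bullet> (c - c')))"
        unfolding sum_U c(2,4)
      proof (intro sum.cong refl)
        fix v assume v: "v \<in> V"
        have "v \<bullet> (c - c') = c \<bullet> v + - (c' \<bullet> v)"
          using v c by (simp add: scalar_prod_minus_distrib[OF v c(1,3)] comm_scalar_prod[OF v c(1)] comm_scalar_prod[OF v c(3)])
        then show "lam c (um l v) * cnj (lam c' (um l v)) = \<xi> (v \<bullet> (c - c'))" using v by (simp only: lam_um add cnj)
      qed
      also have "\<dots> = (if c - c' = 0\<^sub>v (2 * l + 1) then of_nat (card V) else 0)" by (rule sum_vec_char[OF d])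
      also have "c - c' = 0\<^sub>v (2 * l + 1) \<longleftrightarrow> c = c'"
      proof
        assume z: "c - c' = 0\<^sub>v (2 * l + 1)"
        show "c = c'"
        proof (rule eq_vecI)
          fix i assume i: "i < dim_vec c'"
          then have "(c - c') $ i = 0" using z c by simp
          then show "c $ i = c' $ i" using i by simp
        qed (use c in auto)
      qed (use c in auto)
      finally show ?thesis unfolding card_U c(2,4) lam_inject[OF c(1,3)] .
    qed
    show "(\<Sum>\<kappa>\<in>lam ` V. \<kappa> u) = (if u = \<one>\<^bsub>P\<^esub> then of_nat (card U) else 0)" if h: "u \<in> U" for u
    proof -
      obtain v where v: "v \<in> V" "u = um l v" using h by (auto simp: U_grp_eq)
      have "(\<Sum>\<kappa>\<in>lam ` V. \<kappa> u) = (\<Sum>c\<in>V. \<xi> (c \<bullet> v))"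
        unfolding v(2) lam_um[OF v(1), symmetric] by (rule sum.reindex[unfolded o_def]) (auto simp: inj_on_def lam_inject)
      also have "\<dots> = (if v = 0\<^sub>v (2 * l + 1) then of_nat (card V) else 0)" by (rule sum_vec_char[OF v(1)])
      also have "v = 0\<^sub>v (2 * l + 1) \<longleftrightarrow> u = \<one>\<^bsub>P\<^esub>"
        unfolding P_simps v(2) um_zero[symmetric] um_inject[OF v(1) zero_carrier_vec] ..
      finally show ?thesis by (simp only: card_U)
    qed
    show "conj_char P U p \<kappa> \<in> lam ` V" if p: "p \<in> carrier P" and \<kappa>: "\<kappa> \<in> lam ` V" for p \<kappa>
    proof -
      obtain w x a where w: "w \<in> V" "x \<in> SO_odd l" "a \<noteq> 0" "p = um l w * s_mat x a" using P_elemE[OF p] .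
      obtain c where c: "c \<in> V" "\<kappa> = lam c" using \<kappa> by auto
      obtain d where d: "d \<in> V" "\<And>v. v \<in> V \<Longrightarrow> c \<bullet> v = a * (d \<bullet> (x *\<^sub>v v))" using functional_push[OF w(2,3) c(1)] by metis
      have "conj_char P U p \<kappa> = lam d" unfolding w(4) c(2) conj_lam_iff[OF w(1-3) c(1) d(1)] using d(2) by blast
      then show ?thesis using d(1) by blast
    qed
  qed
qed

sublocale N: normal_with_chars P U "lam ` V"
  by (rule normal_with_chars_P)

section \<open>Orbits and stabilizers of the characters of \<open>U\<close>\<close>

lemma orbit_lam:
  assumes c: "c \<in> V"
  shows "N.orbit (lam c) = lam ` {c' \<in> V. fequiv l c' c}"
proof (rule Set.set_eqI)
  fix \<mu>
  show "\<mu> \<in> N.orbit (lam c) \<longleftrightarrow> \<mu> \<in> lam ` {c' \<in> V. fequiv l c' c}"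
  proof
    assume o: "\<mu> \<in> N.orbit (lam c)"
    then obtain p where p: "p \<in> carrier P" "\<mu> = conj_char P U p (lam c)" unfolding N.orbit_def by auto
    obtain c' where c': "c' \<in> V" "\<mu> = lam c'" using N.Lam_conj[OF p(1), of "lam c"] c p(2) by auto
    obtain w x a where w: "w \<in> V" "x \<in> SO_odd l" "a \<noteq> 0" "p = um l w * s_mat x a" using P_elemE[OF p(1)] .
    have "\<forall>v\<in>V. c \<bullet> v = a * (c' \<bullet> (x *\<^sub>v v))"
      using conj_lam_iff[OF w(1-3) c c'(1)] p(2) c'(2) w(4) by simp
    then have "fequiv l c' c" by (intro fequivI[OF w(2,3)]) auto
    then show "\<mu> \<in> lam ` {c' \<in> V. fequiv l c' c}" using c' by auto
  next
    assume "\<mu> \<in> lam ` {c' \<in> V. fequiv l c' c}"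
    then obtain c' where c': "c' \<in> V" "fequiv l c' c" "\<mu> = lam c'" by auto
    obtain x a where x: "x \<in> SO_odd l" "a \<noteq> 0" "\<forall>v\<in>V. c \<bullet> v = a * (c' \<bullet> (x *\<^sub>v v))" using c'(2) unfolding fequiv_def by blast
    have "conj_char P U (um l (0\<^sub>v (2 * l + 1)) * s_mat x a) (lam c) = \<mu>"
      using conj_lam_iff[OF zero_carrier_vec x(1,2) c c'(1)] x(3) c'(3) by simp
    moreover have "um l (0\<^sub>v (2 * l + 1)) * s_mat x a \<in> carrier P" unfolding P_simps by (rule us_in_P_set[OF zero_carrier_vec x(1,2)])
    ultimately show "\<mu> \<in> N.orbit (lam c)" unfolding N.orbit_def by blast
  qed
qed

text \<open>The stabilizer of \<open>lam c\<close> in the Levi group. Since \<open>U\<close> acts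
  trivially on its own characters, this is a complement of \<open>U\<close> in the inertia
  group.\<close>

definition Kc :: "'a vec \<Rightarrow> 'a mat set" where
  "Kc c = {s_mat x a | x a. x \<in> SO_odd l \<and> a \<noteq> 0 \<and> (\<forall>v\<in>V. c \<bullet> v = a * (c \<bullet> (x *\<^sub>v v)))}"

lemma stabilizer_lam:
  assumes c: "c \<in> V"
  shows "{p \<in> carrier P. conj_char P U p (lam c) = lam c} = U <#>\<^bsub>P\<^esub> Kc c"
proof (rule Set.set_eqI)
  fix p
  show "p \<in> {p \<in> carrier P. conj_char P U p (lam c) = lam c} \<longleftrightarrow> p \<in> U <#>\<^bsub>P\<^esub> Kc c"
  proof
    assume p: "p \<in> {p \<in> carrier P. conj_char P U p (lam c) = lam c}"
    then have "p \<in> carrier P" by simp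
    then obtain w x a where w: "w \<in> V" "x \<in> SO_odd l" "a \<noteq> 0" "p = um l w * s_mat x a" by (rule P_elemE)
    then have "\<forall>v\<in>V. c \<bullet> v = a * (c \<bullet> (x *\<^sub>v v))" using p conj_lam_iff[OF w(1-3) c c] by simp
    then have "s_mat x a \<in> Kc c" unfolding Kc_def using w by blast
    moreover have "um l w \<in> U" using w(1) by (simp add: U_grp_eq)
    ultimately show "p \<in> U <#>\<^bsub>P\<^esub> Kc c" unfolding set_mult_def P_simps w(4) by blast
  next
    assume "p \<in> U <#>\<^bsub>P\<^esub> Kc c"
    then obtain w x a where w: "w \<in> V" "x \<in> SO_odd l" "a \<noteq> 0" "\<forall>v\<in>V. c \<bullet> v = a * (c \<bullet> (x *\<^sub>v v))" "p = um l w * s_mat x a"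
      unfolding set_mult_def P_simps Kc_def U_grp_eq by blast
    then show "p \<in> {p \<in> carrier P. conj_char P U p (lam c) = lam c}"
      using conj_lam_iff[OF w(1-3) c c] us_in_P_set[OF w(1-3)] by (simp add: P_simps)
  qed
qed

lemma Kc_subgroup: "subgroup (Kc c) P"
proof -
  have sub: "Kc c \<subseteq> carrier P" unfolding Kc_def P_simps using s_in_P_set by blast
  show ?thesis
  proof (rule N.subgroupI[OF sub])
    have "s_mat (1\<^sub>m (2 * l + 1)) 1 \<in> Kc c" unfolding Kc_def using SO_one[of l] by fastforce
    then show "Kc c \<noteq> {}" by blast
    fix k assume "k \<in> Kc c"
    then obtain x a where x: "x \<in> SO_odd l" "a \<noteq> 0" "\<And>v. v \<in> V \<Longrightarrow> c \<bullet> v = a * (c \<bullet> (x *\<^sub>v v))" "k = s_mat x a" unfolding Kc_def by blast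
    obtain y where y: "y \<in> SO_odd l" "y * x = 1\<^sub>m (2 * l + 1)" "x * y = 1\<^sub>m (2 * l + 1)" using SO_inverse[OF x(1)] .
    have ia: "inverse a \<noteq> 0" using x(2) by simp
    have "inv\<^bsub>P\<^esub> k = s_mat y (inverse a)"
    proof (rule N.inv_equality)
      show "s_mat y (inverse a) \<otimes>\<^bsub>P\<^esub> k = \<one>\<^bsub>P\<^esub>"
        unfolding P_simps x(4) s_mult[OF SO_carrier[OF y(1)] SO_carrier[OF x(1)]] y(2) left_inverse[OF x(2)] s_one ..
    qed (use s_in_P_set[OF x(1,2)] s_in_P_set[OF y(1) ia] x(4) in \<open>simp_all add: P_simps\<close>)
    moreover have "c \<bullet> v = inverse a * (c \<bullet> (y *\<^sub>v v))" if v: "v \<in> V" for v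
    proof -
      have "x *\<^sub>v (y *\<^sub>v v) = v" using assoc_mult_mat_vec[OF SO_carrier[OF x(1)] SO_carrier[OF y(1)] v] y(3) v by simp
      then show ?thesis using x(3)[OF mult_mat_vec_carrier[OF SO_carrier[OF y(1)] v]] x(2) by simp
    qed
    ultimately show "inv\<^bsub>P\<^esub> k \<in> Kc c" unfolding Kc_def mem_Collect_eq using y(1) ia by blast
    fix k' assume "k' \<in> Kc c"
    then obtain y b where y: "y \<in> SO_odd l" "b \<noteq> 0" "\<And>v. v \<in> V \<Longrightarrow> c \<bullet> v = b * (c \<bullet> (y *\<^sub>v v))" "k' = s_mat y b" unfolding Kc_def by blast
    have "c \<bullet> v = (a * b) * (c \<bullet> ((x * y) *\<^sub>v v))" if v: "v \<in> V" for v
      unfolding assoc_mult_mat_vec[OF SO_carrier[OF x(1)] SO_carrier[OF y(1)] v]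
      using y(3)[OF v] x(3)[OF mult_mat_vec_carrier[OF SO_carrier[OF y(1)] v]] by simp
    moreover have "a * b \<noteq> 0" using x y by simp
    ultimately show "k \<otimes>\<^bsub>P\<^esub> k' \<in> Kc c"
      unfolding Kc_def P_simps x(4) y(4) s_mult[OF SO_carrier[OF x(1)] SO_carrier[OF y(1)]] using SO_mult[OF x(1) y(1)] by blast
  qed
qed

lemma U_inter_Kc: "U \<inter> Kc c = {\<one>\<^bsub>P\<^esub>}"
proof
  show "U \<inter> Kc c \<subseteq> {\<one>\<^bsub>P\<^esub>}"
  proof
    fix g assume "g \<in> U \<inter> Kc c"
    then obtain v x a where g: "v \<in> V" "g = um l v" "x \<in> SO_odd l" "a \<noteq> 0" "g = s_mat x a" unfolding Kc_def U_grp_eq by blast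
    have "um l v * s_mat (1\<^sub>m (2 * l + 1)) 1 = um l (0\<^sub>v (2 * l + 1)) * s_mat x a"
      unfolding s_one um_zero right_mult_one_mat[OF u_mat_carrier] left_mult_one_mat[OF s_mat_carrier[OF SO_carrier[OF g(3)]]]
      using g(2,5) by simp
    then have "v = 0\<^sub>v (2 * l + 1)"
      by (rule us_inject(1)[OF g(1) zero_carrier_vec one_carrier_mat SO_carrier[OF g(3)] one_neq_zero g(4)])
    then show "g \<in> {\<one>\<^bsub>P\<^esub>}" using g(2) um_zero by (simp add: P_simps)
  qed
  show "{\<one>\<^bsub>P\<^esub>} \<subseteq> U \<inter> Kc c" using N.U_one subgroup.one_closed[OF Kc_subgroup] by blast
qed

end

section \<open>Even-dimensional forms\<close>

text \<open>One family for both signs: (\<alpha>, \<nu>) = (0, 0) is the plus form, and \<alpha> = 1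
  with the given \<nu> is the minus form for l > 0. The product of the middle pair is part of the
  sum.\<close>

definition hform :: "'a::field \<Rightarrow> 'a \<Rightarrow> nat \<Rightarrow> 'a vec \<Rightarrow> 'a" where
  "hform \<alpha> \<nu> l w = \<alpha> * (w $ (l - 1))\<^sup>2 + \<nu> * (w $ l)\<^sup>2 + (\<Sum>j=1..l. w $ (l - j) * w $ (l + j - 1))"

text \<open>The Gram matrix of the polar form of \<open>hform\<close>, written as a sum of
  conditionals so that its product with a vector splits into sums with one nonzero term.\<close>

definition hmat :: "'a::field \<Rightarrow> 'a \<Rightarrow> nat \<Rightarrow> 'a mat" where
  "hmat \<alpha> \<nu> l = mat (2 * l) (2 * l) (\<lambda>(i, j). (if j = 2 * l - 1 - i then 1 else 0) +
     ((if j = l - 1 then if i = l - 1 then 2 * \<alpha> else 0 else 0) + (if j = l then if i = l then 2 * \<nu> else 0 else 0)))"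

lemma hmat_carrier [simp]: "hmat \<alpha> \<nu> l \<in> carrier_mat (2 * l) (2 * l)"
  by (simp add: hmat_def)

lemma Q_plus_hform: "Q_plus l w = hform 0 0 l w"
  by (simp add: Q_plus_def hform_def)

lemma sum_first: "(l :: nat) \<ge> 1 \<Longrightarrow> (\<Sum>j=1..l. f j) = f 1 + (\<Sum>j=2..l. f j :: 'a::comm_monoid_add)"
  using sum.atLeast_Suc_atMost[of 1 l f] by (simp add: numeral_2_eq_2)

lemma Q_minus_hform: "l \<ge> 1 \<Longrightarrow> Q_minus \<nu> l w = hform 1 \<nu> l w"
  unfolding Q_minus_def hform_def by (simp add: sum_first[simplified])

lemma sum_even_pairs: "(\<Sum>i<2 * (l :: nat). f i) = (\<Sum>j=1..l. f (l - j) + f (l + j - 1) :: 'a::comm_monoid_add)"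
proof -
  have "(\<Sum>i<2 * l. f i) = (\<Sum>i<l. f i) + (\<Sum>i<l. f (i + l))" using sum_lessThan_add[of f l l] by (simp add: mult_2)
  also have "(\<Sum>i<l. f i) = (\<Sum>j=1..l. f (l - j))"
    by (rule sum.reindex_bij_witness[of _ "\<lambda>j. l - j" "\<lambda>i. l - i"]) auto
  also have "(\<Sum>i<l. f (i + l)) = (\<Sum>j=1..l. f (l + j - 1))"
    by (rule sum.reindex_bij_witness[of _ "\<lambda>j. j - 1" Suc]) (auto simp: add.commute)
  finally show ?thesis by (simp add: sum.distrib)
qed

lemma hmat_action:
  assumes v: "v \<in> carrier_vec (2 * l)" and i: "i < 2 * l"
  shows "(hmat \<alpha> \<nu> l *\<^sub>v v) $ i = v $ (2 * l - 1 - i) + ((if i = l - 1 then 2 * \<alpha> * v $ (l - 1) else 0) + (if i = l then 2 * \<nu> * v $ l else 0))"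
proof -
  have "(hmat \<alpha> \<nu> l *\<^sub>v v) $ i = (\<Sum>k<2 * l. (if k = 2 * l - 1 - i then v $ k else 0) +
      ((if k = l - 1 then if i = l - 1 then 2 * \<alpha> * v $ k else 0 else 0) + (if k = l then if i = l then 2 * \<nu> * v $ k else 0 else 0)))"
    unfolding mult_vec_index[OF hmat_carrier v i] using i
    by (intro sum.cong refl) (simp add: hmat_def distrib_right)
  then show ?thesis using i by (simp add: sum.distrib)
qed

lemma hform_add:
  assumes w: "w \<in> carrier_vec (2 * l)" and v: "v \<in> carrier_vec (2 * l)" and l: "l \<ge> 1"
  shows "hform \<alpha> \<nu> l (w + v) = hform \<alpha> \<nu> l w + hform \<alpha> \<nu> l v + w \<bullet> (hmat \<alpha> \<nu> l *\<^sub>v v)"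
proof -
  have "w \<bullet> (hmat \<alpha> \<nu> l *\<^sub>v v) = (\<Sum>i<2 * l. w $ i * (hmat \<alpha> \<nu> l *\<^sub>v v) $ i)"
    by (simp add: scalar_prod_def lessThan_atLeast0 hmat_def)
  also have "\<dots> = (\<Sum>i<2 * l. w $ i * v $ (2 * l - 1 - i) + ((if i = l - 1 then 2 * \<alpha> * w $ (l - 1) * v $ (l - 1) else 0)
      + (if i = l then 2 * \<nu> * w $ l * v $ l else 0)))"
    by (intro sum.cong refl) (simp add: hmat_action[OF v] distrib_left)
  also have "\<dots> = (\<Sum>i<2 * l. w $ i * v $ (2 * l - 1 - i)) + (2 * \<alpha> * w $ (l - 1) * v $ (l - 1) + 2 * \<nu> * w $ l * v $ l)"
    using l by (simp add: sum.distrib)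
  also have "(\<Sum>i<2 * l. w $ i * v $ (2 * l - 1 - i)) = (\<Sum>j=1..l. w $ (l - j) * v $ (l + j - 1) + w $ (l + j - 1) * v $ (l - j))"
    unfolding sum_even_pairs
  proof (rule sum.cong[OF refl])
    fix j assume j: "j \<in> {1..l}"
    have "2 * l - 1 - (l - j) = l + j - 1" "2 * l - 1 - (l + j - 1) = l - j" using j by auto
    then show "w $ (l - j) * v $ (2 * l - 1 - (l - j)) + w $ (l + j - 1) * v $ (2 * l - 1 - (l + j - 1)) =
      w $ (l - j) * v $ (l + j - 1) + w $ (l + j - 1) * v $ (l - j)" by (simp only:)
  qed
  finally have B: "w \<bullet> (hmat \<alpha> \<nu> l *\<^sub>v v) = (\<Sum>j=1..l. w $ (l - j) * v $ (l + j - 1) + w $ (l + j - 1) * v $ (l - j))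
      + (2 * \<alpha> * w $ (l - 1) * v $ (l - 1) + 2 * \<nu> * w $ l * v $ l)" .
  have S: "(\<Sum>j=1..l. (w + v) $ (l - j) * (w + v) $ (l + j - 1)) = (\<Sum>j=1..l. w $ (l - j) * w $ (l + j - 1))
      + (\<Sum>j=1..l. v $ (l - j) * v $ (l + j - 1)) + (\<Sum>j=1..l. w $ (l - j) * v $ (l + j - 1) + w $ (l + j - 1) * v $ (l - j))"
    unfolding sum.distrib[symmetric] using v w by (intro sum.cong refl) (auto simp: algebra_simps)
  show ?thesis unfolding hform_def S B using v w l by (simp add: power2_eq_square algebra_simps)
qed

text \<open>Outside the middle pair the matrix only reverses coordinates; on the middle pair its
  determinant is 4 \<alpha> \<nu> - 1. For the minus form this is, up to sign, the discriminant of
  X^2 + X + \<nu>.\<close>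

lemma hmat_kernel:
  assumes \<Delta>: "4 * \<alpha> * \<nu> \<noteq> 1" and v: "v \<in> carrier_vec (2 * l)" and l: "l \<ge> 1" and z: "hmat \<alpha> \<nu> l *\<^sub>v v = 0\<^sub>v (2 * l)"
  shows "v = 0\<^sub>v (2 * l)"
proof (rule eq_vecI)
  have e: "v $ (2 * l - 1 - i) + ((if i = l - 1 then 2 * \<alpha> * v $ (l - 1) else 0) + (if i = l then 2 * \<nu> * v $ l else 0)) = 0"
    if "i < 2 * l" for i using hmat_action[OF v that, of \<alpha> \<nu>] that unfolding z by simp
  have mid: "2 * l - 1 - (l - 1) = l" "2 * l - 1 - l = l - 1" "l - 1 \<noteq> l" "l - 1 < 2 * l" "l < 2 * l" using l by auto
  have a: "v $ l + 2 * \<alpha> * v $ (l - 1) = 0" using e[OF mid(4)] mid by simp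
  have b: "v $ (l - 1) + 2 * \<nu> * v $ l = 0" using e[OF mid(5)] mid by simp
  have "v $ (l - 1) * (1 - 4 * \<alpha> * \<nu>) = (v $ (l - 1) + 2 * \<nu> * v $ l) - 2 * \<nu> * (v $ l + 2 * \<alpha> * v $ (l - 1))"
    by (simp add: algebra_simps)
  then have c: "v $ (l - 1) = 0" using \<Delta> unfolding a b by simp
  fix i assume "i < dim_vec (0\<^sub>v (2 * l) :: 'a vec)"
  then have i: "i < 2 * l" by simp
  define k where "k = 2 * l - 1 - i"
  have k: "k < 2 * l" "i = 2 * l - 1 - k" using i by (auto simp: k_def)
  have "v $ i = 0"
  proof (cases "i = l - 1 \<or> i = l")
    case True
    then show ?thesis using a c by auto
  next
    case False
    then have "k \<noteq> l - 1" "k \<noteq> l" using k by auto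
    then show ?thesis using e[OF k(1)] k(2) by simp
  qed
  then show "v $ i = 0\<^sub>v (2 * l) $ i" using i by simp
qed (use v in simp)

text \<open>An isometry preserves the Gram matrix under congruence, and that matrix is invertible.
  In even dimension this holds in characteristic 2 as well.\<close>

lemma isometry_det_squared:
  assumes \<Delta>: "4 * \<alpha> * \<nu> \<noteq> 1" and l: "l \<ge> 1" and g: "g \<in> carrier_mat (2 * l) (2 * l)"
    and iso: "\<And>w. w \<in> carrier_vec (2 * l) \<Longrightarrow> hform \<alpha> \<nu> l (g *\<^sub>v w) = hform \<alpha> \<nu> l w"
  shows "(det g)\<^sup>2 = 1"
proof -
  let ?J = "hmat \<alpha> \<nu> l" and ?V = "carrier_vec (2 * l) :: 'a vec set"
  have gt: "transpose_mat g \<in> carrier_mat (2 * l) (2 * l)" using g by simp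
  have J: "?J \<in> carrier_mat (2 * l) (2 * l)" by simp
  have polar: "(g *\<^sub>v w) \<bullet> (?J *\<^sub>v (g *\<^sub>v v)) = w \<bullet> (?J *\<^sub>v v)" if w: "w \<in> ?V" and v: "v \<in> ?V" for w v
  proof -
    note gw = mult_mat_vec_carrier[OF g w] and gv = mult_mat_vec_carrier[OF g v]
    have "w + v \<in> ?V" using w v by simp
    then have "hform \<alpha> \<nu> l (g *\<^sub>v w + g *\<^sub>v v) = hform \<alpha> \<nu> l (w + v)"
      unfolding mult_add_distrib_mat_vec[OF g w v, symmetric] by (rule iso)
    then show ?thesis unfolding hform_add[OF gw gv l] hform_add[OF w v l] iso[OF w] iso[OF v] by simp
  qed
  have "transpose_mat g * (?J * g) = ?J"
  proof (rule eq_mat_by_action[OF mult_carrier_mat[OF gt mult_carrier_mat[OF J g]] J])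
    fix v :: "'a vec" assume v: "v \<in> ?V"
    note gv = mult_mat_vec_carrier[OF g v]
    have e: "transpose_mat g * (?J * g) *\<^sub>v v = transpose_mat g *\<^sub>v (?J *\<^sub>v (g *\<^sub>v v))"
      unfolding assoc_mult_mat_vec[OF gt mult_carrier_mat[OF J g] v] assoc_mult_mat_vec[OF J g v] ..
    show "transpose_mat g * (?J * g) *\<^sub>v v = ?J *\<^sub>v v"
    proof (rule eq_vecI)
      fix i assume "i < dim_vec (?J *\<^sub>v v)"
      then have i: "i < 2 * l" by (simp add: hmat_def)
      have u: "(unit_vec (2 * l) i :: 'a vec) \<in> ?V" by simp
      have Jgv: "?J *\<^sub>v (g *\<^sub>v v) \<in> ?V" by (rule mult_mat_vec_carrier[OF J gv])
      have "(transpose_mat g *\<^sub>v (?J *\<^sub>v (g *\<^sub>v v))) $ i = (transpose_mat g *\<^sub>v (?J *\<^sub>v (g *\<^sub>v v))) \<bullet> unit_vec (2 * l) i"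
        using i mult_mat_vec_carrier[OF gt Jgv] by simp
      also have "\<dots> = (?J *\<^sub>v (g *\<^sub>v v)) \<bullet> (g *\<^sub>v unit_vec (2 * l) i)" by (rule transpose_vec_mult_scalar[OF g u Jgv])
      also have "\<dots> = unit_vec (2 * l) i \<bullet> (?J *\<^sub>v v)"
        unfolding comm_scalar_prod[OF Jgv mult_mat_vec_carrier[OF g u]] by (rule polar[OF u v])
      also have "\<dots> = (?J *\<^sub>v v) $ i" using i mult_mat_vec_carrier[OF J v] by simp
      finally show "(transpose_mat g * (?J * g) *\<^sub>v v) $ i = (?J *\<^sub>v v) $ i" unfolding e .
    qed (simp add: e hmat_def g[THEN carrier_matD(2)])
  qed
  then have "det (transpose_mat g) * (det ?J * det g) = det ?J"
    using det_mult[OF gt mult_carrier_mat[OF J g]] det_mult[OF J g] by simp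
  moreover have "det ?J \<noteq> 0"
    unfolding det_0_iff_vec_prod_zero_field[OF J] using hmat_kernel[OF \<Delta> _ l] by blast
  ultimately show ?thesis unfolding det_transpose[OF g] by (simp add: power2_eq_square)
qed

section \<open>Inserting a middle coordinate\<close>

definition del_mid :: "nat \<Rightarrow> 'a vec \<Rightarrow> 'a vec" where
  "del_mid l v = vec (2 * l) (\<lambda>i. v $ insert_index l i)"

definition ins_mid :: "nat \<Rightarrow> 'a::zero vec \<Rightarrow> 'a vec" where
  "ins_mid l w = vec (2 * l + 1) (\<lambda>i. if i = l then 0 else w $ delete_index l i)"

text \<open>The odd-dimensional companion of \<open>hform\<close>: (0, 0) gives
  \<open>Q_odd\<close>, and (1, \<nu>) gives \<open>Q_odd'\<close> for l > 0.\<close>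

definition mform :: "'a::field \<Rightarrow> 'a \<Rightarrow> nat \<Rightarrow> 'a vec \<Rightarrow> 'a" where
  "mform \<alpha> \<nu> l v = (v $ l)\<^sup>2 + hform \<alpha> \<nu> l (del_mid l v)"

lemma del_mid_carrier [simp]: "del_mid l v \<in> carrier_vec (2 * l)"
  by (simp add: del_mid_def)

lemma ins_mid_carrier [simp]: "ins_mid l w \<in> carrier_vec (2 * l + 1)"
  by (simp add: ins_mid_def)

lemma insert_index_less: "i < 2 * l \<Longrightarrow> insert_index l i < 2 * l + 1"
  by (auto simp: insert_index_def)

lemma del_ins_mid: "w \<in> carrier_vec (2 * l) \<Longrightarrow> del_mid l (ins_mid l w) = w"
  by (intro eq_vecI) (auto simp: del_mid_def ins_mid_def insert_index_less[simplified])

lemma ins_mid_center [simp]: "ins_mid l w $ l = 0"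
  by (simp add: ins_mid_def)

lemma eq_by_mid:
  assumes "v \<in> carrier_vec (2 * l + 1)" "w \<in> carrier_vec (2 * l + 1)" "v $ l = w $ l" "del_mid l v = del_mid l w"
  shows "v = w"
proof (rule eq_vecI)
  fix i assume "i < dim_vec w"
  then have i: "i < 2 * l + 1" using assms by simp
  show "v $ i = w $ i"
  proof (cases "i = l")
    case False
    then have d: "delete_index l i < 2 * l" using i by (auto simp: delete_index_def)
    have "del_mid l v $ delete_index l i = del_mid l w $ delete_index l i" using assms(4) by simp
    then show ?thesis using d insert_delete_index[OF False] by (simp add: del_mid_def)
  qed (use assms in simp)
qed (use assms in simp)

lemma del_mid_index:
  assumes "j \<in> {1..l}"
  shows "del_mid l v $ (l - j) = v $ (l - j)" "del_mid l v $ (l + j - 1) = v $ (l + j)"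
  using assms by (auto simp: del_mid_def)

lemma Q_odd_mform: "Q_odd l v = mform 0 0 l v"
  unfolding Q_odd_def mform_def hform_def by (simp add: del_mid_index[simplified])

lemma Q_odd'_mform:
  assumes l: "l \<ge> 1"
  shows "Q_odd' \<nu> l v = mform 1 \<nu> l v"
proof -
  have e: "del_mid l v $ (l - 1) = v $ (l - 1)" "del_mid l v $ l = v $ (l + 1)" using del_mid_index[of 1 l v] l by auto
  have "(\<Sum>j=1..l. del_mid l v $ (l - j) * del_mid l v $ (l + j - 1)) = (\<Sum>j=1..l. v $ (l - j) * v $ (l + j))"
    by (intro sum.cong refl) (simp only: del_mid_index)
  then show ?thesis unfolding Q_odd'_def mform_def hform_def e using sum_first[OF l, of "\<lambda>j. v $ (l - j) * v $ (l + j)"] by simp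
qed

lemma mform_add:
  assumes v: "v \<in> carrier_vec (2 * l + 1)" and w: "w \<in> carrier_vec (2 * l + 1)" and l: "l \<ge> 1"
  shows "mform \<alpha> \<nu> l (v + w) = mform \<alpha> \<nu> l v + mform \<alpha> \<nu> l w + 2 * (v $ l * w $ l) + del_mid l v \<bullet> (hmat \<alpha> \<nu> l *\<^sub>v del_mid l w)"
proof -
  have d: "del_mid l (v + w) = del_mid l v + del_mid l w"
    using v w by (intro eq_vecI) (auto simp: del_mid_def insert_index_less[simplified])
  have c: "(v + w) $ l = v $ l + w $ l" using v w by simp
  show ?thesis unfolding mform_def d c hform_add[OF del_mid_carrier del_mid_carrier l] by (simp add: power2_eq_square algebra_simps)
qed

lemma insert_middle_carrier [simp]: "insert_middle l g a \<in> carrier_mat (2 * l + 1) (2 * l + 1)"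
  by (simp add: insert_middle_def)

lemma sum_insert_index: "(\<Sum>k<2 * (l :: nat) + 1. f k) = f l + (\<Sum>k<2 * l. f (insert_index l k) :: 'a::comm_monoid_add)"
proof -
  have "{..<2 * l + 1} = insert l (insert_index l ` {..<2 * l})"
    using insert_index_image[of l "2 * l"] by (auto simp: lessThan_atLeast0)
  moreover have "l \<notin> insert_index l ` {..<2 * l}" using insert_index_exclude by (metis imageE)
  ultimately have "(\<Sum>k<2 * l + 1. f k) = f l + (\<Sum>k\<in>insert_index l ` {..<2 * l}. f k)" by (metis sum.insert finite_imageI finite_lessThan)
  then show ?thesis by (simp add: sum.reindex[OF insert_index_inj_on])
qed

lemma insert_middle_action:
  assumes v: "v \<in> carrier_vec (2 * l + 1)" and g: "g \<in> carrier_mat (2 * l) (2 * l)"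
  shows "(insert_middle l g a *\<^sub>v v) $ l = a * v $ l" "del_mid l (insert_middle l g a *\<^sub>v v) = g *\<^sub>v del_mid l v"
proof -
  note ind = mult_vec_index[OF insert_middle_carrier v]
  show "(insert_middle l g a *\<^sub>v v) $ l = a * v $ l"
  proof -
    have "(insert_middle l g a *\<^sub>v v) $ l = (\<Sum>k<2 * l + 1. insert_middle l g a $$ (l, k) * v $ k)" by (rule ind) simp
    also have "\<dots> = a * v $ l + (\<Sum>k<2 * l. 0)"
      unfolding sum_insert_index by (auto simp: insert_middle_def insert_index_less[simplified] intro!: sum.neutral)
    finally show ?thesis by simp
  qed
  show "del_mid l (insert_middle l g a *\<^sub>v v) = g *\<^sub>v del_mid l v"
  proof (rule eq_vecI)
    fix i assume "i < dim_vec (g *\<^sub>v del_mid l v)"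
    then have i: "i < 2 * l" using g by simp
    have "(insert_middle l g a *\<^sub>v v) $ insert_index l i = (\<Sum>k<2 * l + 1. insert_middle l g a $$ (insert_index l i, k) * v $ k)"
      by (rule ind[OF insert_index_less[OF i]])
    also have "\<dots> = (\<Sum>k<2 * l. g $$ (i, k) * v $ insert_index l k)"
      unfolding sum_insert_index using i by (auto simp: insert_middle_def insert_index_less[simplified] intro!: sum.cong)
    also have "\<dots> = (g *\<^sub>v del_mid l v) $ i"
      unfolding mult_vec_index[OF g del_mid_carrier i] by (intro sum.cong refl) (simp add: del_mid_def)
    finally show "del_mid l (insert_middle l g a *\<^sub>v v) $ i = (g *\<^sub>v del_mid l v) $ i" using i by (simp add: del_mid_def)
  qed (use g in \<open>simp add: del_mid_def\<close>)
qed

lemma det_insert_middle: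
  assumes g: "g \<in> carrier_mat (2 * l) (2 * l)"
  shows "det (insert_middle l g a) = a * det g"
proof -
  let ?A = "insert_middle l g a"
  have "mat_delete ?A l l = g"
    using g by (intro eq_matI) (auto simp: mat_delete_def insert_middle_def insert_index_less[simplified] insert_index_def delete_index_def)
  then have "cofactor ?A l l = det g" by (simp add: cofactor_def)
  moreover have "det ?A = (\<Sum>j<2 * l + 1. ?A $$ (l, j) * cofactor ?A l j)"
    by (rule laplace_expansion_row[OF insert_middle_carrier]) simp
  then have "det ?A = a * cofactor ?A l l + (\<Sum>j<2 * l. 0)"
    unfolding sum_insert_index by (auto simp: insert_middle_def insert_index_less[simplified] intro!: sum.neutral)
  ultimately show ?thesis by simp
qed

text \<open>The kernel of the middle coordinate is mapped to itself and carries a nondegenerate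
  form. The image of the middle basis vector is polar to this hyperplane, so its part inside the
  hyperplane is 0; thus \<open>x\<close> is block diagonal. The condition det = 1 then ties the
  determinant of the even block to the scalar \<open>a\<close>.\<close>

lemma isometry_fixing_middle:
  assumes \<Delta>: "4 * \<alpha> * \<nu> \<noteq> 1" and l: "l \<ge> 1" and x: "x \<in> carrier_mat (2 * l + 1) (2 * l + 1)" "det x = 1"
    and iso: "\<And>v. v \<in> carrier_vec (2 * l + 1) \<Longrightarrow> mform \<alpha> \<nu> l (x *\<^sub>v v) = mform \<alpha> \<nu> l v"
    and a: "\<And>v. v \<in> carrier_vec (2 * l + 1) \<Longrightarrow> v $ l = a * (x *\<^sub>v v) $ l"
  obtains g where "g \<in> carrier_mat (2 * l) (2 * l)" "det g = a" "a \<noteq> 0" "x = insert_middle l g a"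
    "\<And>w. w \<in> carrier_vec (2 * l) \<Longrightarrow> hform \<alpha> \<nu> l (g *\<^sub>v w) = hform \<alpha> \<nu> l w"
proof -
  let ?V = "carrier_vec (2 * l + 1) :: 'a vec set" and ?W = "carrier_vec (2 * l) :: 'a vec set" and ?J = "hmat \<alpha> \<nu> l"
  let ?e = "unit_vec (2 * l + 1) l :: 'a vec"
  have e: "?e \<in> ?V" by simp
  have de: "del_mid l ?e = 0\<^sub>v (2 * l)" by (intro eq_vecI) (auto simp: del_mid_def insert_index_less[simplified])
  note xc = mult_mat_vec_carrier[OF x(1)]
  obtain y where y: "y \<in> carrier_mat (2 * l + 1) (2 * l + 1)" "x * y = 1\<^sub>m (2 * l + 1)"
    using det_non_zero_imp_unit[OF x(1)] x(2) by (auto simp: Units_def ring_mat_def)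
  have polar: "2 * ((x *\<^sub>v v) $ l * (x *\<^sub>v w) $ l) + del_mid l (x *\<^sub>v v) \<bullet> (?J *\<^sub>v del_mid l (x *\<^sub>v w)) =
      2 * (v $ l * w $ l) + del_mid l v \<bullet> (?J *\<^sub>v del_mid l w)" if v: "v \<in> ?V" and w: "w \<in> ?V" for v w
  proof -
    have "v + w \<in> ?V" using v w by simp
    then have "mform \<alpha> \<nu> l (x *\<^sub>v v + x *\<^sub>v w) = mform \<alpha> \<nu> l (v + w)"
      unfolding mult_add_distrib_mat_vec[OF x(1) v w, symmetric] by (rule iso)
    then show ?thesis unfolding mform_add[OF xc[OF v] xc[OF w] l] mform_add[OF v w l] iso[OF v] iso[OF w] by simp
  qed
  define u where "u = del_mid l (x *\<^sub>v ?e)"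
  have u: "u \<in> ?W" by (simp add: u_def)
  have Ju: "?J *\<^sub>v u \<in> ?W" by (rule mult_mat_vec_carrier[OF hmat_carrier u])
  have J0: "?J *\<^sub>v 0\<^sub>v (2 * l) = 0\<^sub>v (2 * l)" by (intro eq_vecI) (auto simp: hmat_def)
  have a0: "a \<noteq> 0" using a[OF e] by auto
  \<comment> \<open>For a preimage of a vector of the hyperplane both terms with the factor 2
    vanish, so the polar identity is usable in every characteristic.\<close>
  have orth: "w \<bullet> (?J *\<^sub>v u) = 0" if w: "w \<in> ?W" for w
  proof -
    let ?v = "y *\<^sub>v ins_mid l w"
    have v: "?v \<in> ?V" by (rule mult_mat_vec_carrier[OF y(1) ins_mid_carrier])
    have xv: "x *\<^sub>v ?v = ins_mid l w" 
      using assoc_mult_mat_vec[OF x(1) y(1) ins_mid_carrier, of w] one_mult_mat_vec[OF ins_mid_carrier] unfolding y(2) by metis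
    have vl: "?v $ l = 0" using a[OF v] unfolding xv by simp
    show ?thesis using polar[OF v e] unfolding xv vl ins_mid_center del_ins_mid[OF w] de J0 u_def[symmetric] by simp
  qed
  have "?J *\<^sub>v u = 0\<^sub>v (2 * l)"
  proof (rule eq_vecI)
    fix i assume "i < dim_vec (0\<^sub>v (2 * l) :: 'a vec)"
    then have i: "i < 2 * l" by simp
    then show "(?J *\<^sub>v u) $ i = 0\<^sub>v (2 * l) $ i" using orth[OF unit_vec_carrier, of i] Ju by simp
  qed (simp add: hmat_def)
  then have u0: "u = 0\<^sub>v (2 * l)" by (rule hmat_kernel[OF \<Delta> u l])
  have xel: "a * (x *\<^sub>v ?e) $ l = 1" using a[OF e] by simp
  have "mform \<alpha> \<nu> l (x *\<^sub>v ?e) = mform \<alpha> \<nu> l ?e" by (rule iso[OF e])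
  \<comment> \<open>The form is 1 at the middle basis vector, which forces a^2 = 1. From
    \<open>a * det g = 1\<close> one then gets det g = a and not merely its inverse.\<close>
  then have "((x *\<^sub>v ?e) $ l)\<^sup>2 = 1"
    unfolding mform_def u_def[symmetric] u0 de by simp
  then have aa: "a\<^sup>2 = 1" using xel by (metis mult.right_neutral power_mult_distrib power_one)
  have av: "(x *\<^sub>v v) $ l = a * v $ l" if "v \<in> ?V" for v
    using a[OF that] aa by (metis mult.assoc mult_1 power2_eq_square)
  define g where "g = mat (2 * l) (2 * l) (\<lambda>(i, j). x $$ (insert_index l i, insert_index l j))"
  have g: "g \<in> carrier_mat (2 * l) (2 * l)" by (simp add: g_def)
  have col: "x $$ (insert_index l i, l) = 0" if i: "i < 2 * l" for i
  proof -
    have "u $ i = (x *\<^sub>v ?e) $ insert_index l i" using i by (simp add: u_def del_mid_def)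
    also have "\<dots> = x $$ (insert_index l i, l)"
      using insert_index_less[OF i] x(1) by simp
    finally show ?thesis using u0 i by simp
  qed
  have xg: "x = insert_middle l g a"
  proof (rule eq_mat_by_action[OF x(1) insert_middle_carrier])
    fix v assume v: "v \<in> ?V"
    show "x *\<^sub>v v = insert_middle l g a *\<^sub>v v"
    proof (rule eq_by_mid[OF xc[OF v] mult_mat_vec_carrier[OF insert_middle_carrier v]])
      show "(x *\<^sub>v v) $ l = (insert_middle l g a *\<^sub>v v) $ l" unfolding insert_middle_action(1)[OF v g] by (rule av[OF v])
      show "del_mid l (x *\<^sub>v v) = del_mid l (insert_middle l g a *\<^sub>v v)"
        unfolding insert_middle_action(2)[OF v g]
      proof (rule eq_vecI)
        fix i assume "i < dim_vec (g *\<^sub>v del_mid l v)"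
        then have i: "i < 2 * l" using g by simp
        have "(x *\<^sub>v v) $ insert_index l i = (\<Sum>k<2 * l. x $$ (insert_index l i, insert_index l k) * v $ insert_index l k)"
          unfolding mult_vec_index[OF x(1) v insert_index_less[OF i]] sum_insert_index col[OF i] by simp
        also have "\<dots> = (g *\<^sub>v del_mid l v) $ i"
          unfolding mult_vec_index[OF g del_mid_carrier i] using i by (intro sum.cong refl) (simp add: del_mid_def g_def)
        finally show "del_mid l (x *\<^sub>v v) $ i = (g *\<^sub>v del_mid l v) $ i" using i by (simp add: del_mid_def)
      qed (simp add: del_mid_def g_def)
    qed
  qed
  have "a * det g = 1" using det_insert_middle[OF g, of a] x(2) xg by simp
  then have dg: "det g = a" using aa a0 by (metis mult_left_cancel power2_eq_square)
  have "hform \<alpha> \<nu> l (g *\<^sub>v w) = hform \<alpha> \<nu> l w" if w: "w \<in> ?W" for w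
  proof -
    have "mform \<alpha> \<nu> l (insert_middle l g a *\<^sub>v ins_mid l w) = mform \<alpha> \<nu> l (ins_mid l w)"
      using iso[OF ins_mid_carrier] xg by simp
    then show ?thesis unfolding mform_def insert_middle_action[OF ins_mid_carrier g] del_ins_mid[OF w] by simp
  qed
  then show ?thesis using that g dg a0 xg by blast
qed

lemma insert_middle_isometry:
  assumes \<Delta>: "4 * \<alpha> * \<nu> \<noteq> 1" and l: "l \<ge> 1" and g: "g \<in> carrier_mat (2 * l) (2 * l)"
    and iso: "\<And>w. w \<in> carrier_vec (2 * l) \<Longrightarrow> hform \<alpha> \<nu> l (g *\<^sub>v w) = hform \<alpha> \<nu> l w"
  shows "det (insert_middle l g (det g)) = 1" "det g \<noteq> 0"
    "v \<in> carrier_vec (2 * l + 1) \<Longrightarrow> mform \<alpha> \<nu> l (insert_middle l g (det g) *\<^sub>v v) = mform \<alpha> \<nu> l v"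
    "v \<in> carrier_vec (2 * l + 1) \<Longrightarrow> v $ l = det g * (insert_middle l g (det g) *\<^sub>v v) $ l"
proof -
  have d: "(det g)\<^sup>2 = 1" by (rule isometry_det_squared[OF \<Delta> l g iso])
  show "det (insert_middle l g (det g)) = 1" unfolding det_insert_middle[OF g] using d by (simp add: power2_eq_square)
  show "det g \<noteq> 0" using d by auto
  assume v: "v \<in> carrier_vec (2 * l + 1)"
  show "mform \<alpha> \<nu> l (insert_middle l g (det g) *\<^sub>v v) = mform \<alpha> \<nu> l v"
    unfolding mform_def insert_middle_action[OF v g] iso[OF del_mid_carrier] power_mult_distrib d by simp
  show "v $ l = det g * (insert_middle l g (det g) *\<^sub>v v) $ l"
    unfolding insert_middle_action(1)[OF v g] using d by (simp add: power2_eq_square mult.assoc[symmetric])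
qed

section \<open>The inertia complements\<close>

lemma carrier_GL_iff: "x \<in> carrier (GL n) \<longleftrightarrow> x \<in> carrier_mat n n \<and> det x \<noteq> 0"
proof
  assume "x \<in> carrier (GL n)"
  then obtain y where x: "x \<in> carrier_mat n n" and y: "y \<in> carrier_mat n n" "x * y = 1\<^sub>m n"
    by (auto simp: GL_def units_of_def Units_def ring_mat_def)
  have "det x * det y = 1" using det_mult[OF x y(1)] unfolding y(2) by simp
  then show "x \<in> carrier_mat n n \<and> det x \<noteq> 0" using x by auto
qed (use det_non_zero_imp_unit in \<open>auto simp: GL_def units_of_def\<close>)

lemma inv_GL:
  assumes x: "x \<in> carrier (GL n)"
  shows "inv\<^bsub>GL n\<^esub> x \<in> carrier_mat n n" "x * inv\<^bsub>GL n\<^esub> x = 1\<^sub>m n" "inv\<^bsub>GL n\<^esub> x * x = 1\<^sub>m n"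
proof -
  interpret R: ring "ring_mat TYPE('a) n ()" by (rule ring_mat)
  interpret G: group "GL n :: 'a mat monoid" unfolding GL_def by (rule R.units_group)
  have s: "y \<otimes>\<^bsub>GL n\<^esub> z = y * z" "\<one>\<^bsub>GL n\<^esub> = 1\<^sub>m n" for y z :: "'a mat"
    by (simp_all add: GL_def units_of_def ring_mat_def)
  show "inv\<^bsub>GL n\<^esub> x \<in> carrier_mat n n" using G.inv_closed[OF x] carrier_GL_iff by blast
  show "x * inv\<^bsub>GL n\<^esub> x = 1\<^sub>m n" using G.r_inv[OF x] unfolding s .
  show "inv\<^bsub>GL n\<^esub> x * x = 1\<^sub>m n" using G.l_inv[OF x] unfolding s .
qed

text \<open>Used with (0, 0) for the plus type and with (1, \<nu>) for the minus type; the passage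
  between membership in the stabilizer and the shape prescribed for \<open>L_plus\<close> and
  \<open>L_minus\<close> is the same for both.\<close>

lemma fixing_middle_iff:
  assumes "4 * \<alpha> * \<nu> \<noteq> 1" "l \<ge> 1"
  shows "(x \<in> carrier_mat (2 * l + 1) (2 * l + 1) \<and> det x = 1 \<and>
      (\<forall>v\<in>carrier_vec (2 * l + 1). mform \<alpha> \<nu> l (x *\<^sub>v v) = mform \<alpha> \<nu> l v) \<and> a \<noteq> 0 \<and>
      (\<forall>v\<in>carrier_vec (2 * l + 1). v $ l = a * (x *\<^sub>v v) $ l)) \<longleftrightarrow>
    (\<exists>g\<in>carrier (GL (2 * l)). (\<forall>w\<in>carrier_vec (2 * l). hform \<alpha> \<nu> l (g *\<^sub>v w) = hform \<alpha> \<nu> l w) \<and>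
      x = insert_middle l g (det g) \<and> a = det g)" (is "?L \<longleftrightarrow> ?R")
proof
  assume L: ?L
  then have x: "x \<in> carrier_mat (2 * l + 1) (2 * l + 1)" "det x = 1"
      "\<And>v. v \<in> carrier_vec (2 * l + 1) \<Longrightarrow> mform \<alpha> \<nu> l (x *\<^sub>v v) = mform \<alpha> \<nu> l v"
      "\<And>v. v \<in> carrier_vec (2 * l + 1) \<Longrightarrow> v $ l = a * (x *\<^sub>v v) $ l" by blast+
  show ?R
  proof (rule isometry_fixing_middle[OF assms x])
    fix g assume g: "g \<in> carrier_mat (2 * l) (2 * l)" "det g = a" "a \<noteq> 0" "x = insert_middle l g a"
      "\<And>w. w \<in> carrier_vec (2 * l) \<Longrightarrow> hform \<alpha> \<nu> l (g *\<^sub>v w) = hform \<alpha> \<nu> l w"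
    show ?R
    proof (intro bexI conjI ballI)
      show "g \<in> carrier (GL (2 * l))" unfolding carrier_GL_iff using g(1-3) by blast
    qed (use g in simp_all)
  qed
next
  assume ?R
  then obtain g where g': "g \<in> carrier (GL (2 * l))" "\<forall>w\<in>carrier_vec (2 * l). hform \<alpha> \<nu> l (g *\<^sub>v w) = hform \<alpha> \<nu> l w"
    and e: "x = insert_middle l g (det g)" "a = det g" by blast
  then have g: "g \<in> carrier_mat (2 * l) (2 * l)"
    "\<And>w. w \<in> carrier_vec (2 * l) \<Longrightarrow> hform \<alpha> \<nu> l (g *\<^sub>v w) = hform \<alpha> \<nu> l w" unfolding carrier_GL_iff by blast+
  show ?L unfolding e using insert_middle_isometry[OF assms g] insert_middle_carrier by blast
qed

text \<open>The radical of the polar form lies in the middle line, where the quadratic form is a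
  square and vanishes only at 0. This replaces nondegeneracy in characteristic 2.\<close>

lemma polar_radical:
  assumes z: "z \<in> carrier_vec (2 * l + 1)" and r: "\<And>u. u \<in> carrier_vec (2 * l + 1) \<Longrightarrow> polar_form l z u = 0" and Q: "Q_odd l z = 0"
  shows "z = 0\<^sub>v (2 * l + 1)"
proof (rule eq_vecI)
  have J: "Jv l z $ i = 0" if i: "i < 2 * l + 1" for i
    using r[of "unit_vec (2 * l + 1) i"] i unfolding polar_form_Jv[OF z unit_vec_carrier] by simp
  have off: "z $ i = 0" if i: "i < 2 * l + 1" "i \<noteq> l" for i
  proof -
    have "2 * l - i \<noteq> l" "2 * l - (2 * l - i) = i" "2 * l - i < 2 * l + 1" using i by auto
    then show ?thesis using J[of "2 * l - i"] by (simp add: Jv_def)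
  qed
  have "hyp l z = 0" unfolding hyp_def by (intro sum.neutral ballI) (auto simp: off)
  then have "z $ l = 0" using Q by (simp add: Q_odd_hyp)
  then show "z $ i = 0\<^sub>v (2 * l + 1) $ i" if "i < dim_vec (0\<^sub>v (2 * l + 1) :: 'a vec)" for i
    using off[of i] that by (cases "i = l") auto
qed (use z in simp)

lemma last_coordinate_polar:
  assumes v: "v \<in> carrier_vec (2 * Suc k + 1)"
  shows "v $ (2 * Suc k) = polar_form (Suc k) v (unit_vec (2 * Suc k + 1) 0)"
proof -
  obtain a w b where w: "w \<in> carrier_vec (2 * k + 1)" "v = brd a w b" using v by (rule brd_cases)
  show ?thesis unfolding w(2) brd_index(3)[OF w(1)] unit_vec_brd polar_form_brd[OF w(1) zero_carrier_vec] polar_form_zero[OF w(1)] by simp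
qed

text \<open>The last coordinate is the polar form with the first basis vector \<open>e\<close>.
  Scaling this functional therefore says that x e - a e is in the radical of the polar form; it is
  also singular, hence 0.\<close>

lemma fixing_last_iff:
  fixes x :: "'a::field mat"
  assumes x: "x \<in> SO_odd (Suc k)" and a: "a \<noteq> 0"
  defines "e \<equiv> unit_vec (2 * Suc k + 1) 0 :: 'a vec"
  shows "(\<forall>v\<in>carrier_vec (2 * Suc k + 1). v $ (2 * Suc k) = a * (x *\<^sub>v v) $ (2 * Suc k)) \<longleftrightarrow> x *\<^sub>v e = a \<cdot>\<^sub>v e" (is "?L \<longleftrightarrow> ?R")
proof -
  let ?V = "carrier_vec (2 * Suc k + 1) :: 'a vec set" and ?p = "polar_form (Suc k)"
  have e: "e \<in> ?V" by (simp add: e_def)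
  note xc = mult_mat_vec_carrier[OF SO_carrier[OF x]]
  have last: "v $ (2 * Suc k) = ?p v e" if "v \<in> ?V" for v unfolding e_def by (rule last_coordinate_polar[OF that])
  show ?thesis
  proof
    assume R: ?R
    show ?L
    proof
      fix v assume v: "v \<in> ?V"
      have "?p v e = ?p (x *\<^sub>v v) (a \<cdot>\<^sub>v e)" unfolding R[symmetric] by (rule SO_polar[OF x v e, symmetric])
      then show "v $ (2 * Suc k) = a * (x *\<^sub>v v) $ (2 * Suc k)"
        unfolding last[OF v] last[OF xc[OF v]] polar_form_smult(2)[OF xc[OF v] e] .
    qed
  next
    assume L: ?L
    define z where "z = x *\<^sub>v e + (- a) \<cdot>\<^sub>v e"
    have ae: "(- a) \<cdot>\<^sub>v e \<in> ?V" and xe: "x *\<^sub>v e \<in> ?V" using e xc by auto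
    have z: "z \<in> ?V" using ae xe by (simp add: z_def)
    obtain y where y: "y \<in> SO_odd (Suc k)" "x * y = 1\<^sub>m (2 * Suc k + 1)" using SO_inverse[OF x] by metis
    have rad: "?p z u = 0" if u: "u \<in> ?V" for u
    proof -
      let ?v = "y *\<^sub>v u"
      have v: "?v \<in> ?V" by (rule mult_mat_vec_carrier[OF SO_carrier[OF y(1)] u])
      have xv: "x *\<^sub>v ?v = u" using assoc_mult_mat_vec[OF SO_carrier[OF x] SO_carrier[OF y(1)] u] one_mult_mat_vec[OF u] unfolding y(2) by simp
      have "?p ?v e = a * ?p u e" using L v xv last[OF v] last[OF u] by metis
      moreover have "?p u (x *\<^sub>v e) = ?p ?v e" using SO_polar[OF x v e] unfolding xv .
      moreover have "?p u z = ?p u (x *\<^sub>v e) + ?p u ((- a) \<cdot>\<^sub>v e)"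
        unfolding z_def polar_form_Jv[OF u add_carrier_vec[OF xe ae]] polar_form_Jv[OF u xe] polar_form_Jv[OF u ae]
        by (rule scalar_prod_add_distrib[OF Jv_carrier xe ae])
      ultimately show ?thesis unfolding polar_form_commute[OF z u] polar_form_smult(2)[OF u e] by simp
    qed
    have xez: "x *\<^sub>v e = a \<cdot>\<^sub>v e + z"
      unfolding z_def using carrier_vecD[OF xe] carrier_vecD[OF e] by (intro eq_vecI) (simp_all del: index_mult_mat_vec dim_mult_mat_vec)
    have ae': "a \<cdot>\<^sub>v e \<in> ?V" using e by simp
    have "Q_odd (Suc k) e = 0" unfolding e_def unit_vec_brd Q_odd_brd[OF zero_carrier_vec] Q_odd_zero by simp
    moreover have "Q_odd (Suc k) (x *\<^sub>v e) = a\<^sup>2 * Q_odd (Suc k) e + Q_odd (Suc k) z + ?p z (a \<cdot>\<^sub>v e)"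
      unfolding xez Q_odd_add Q_odd_smult[OF e] polar_form_commute[OF z ae'] ..
    ultimately have "Q_odd (Suc k) z = 0" unfolding SO_Q[OF x e] rad[OF ae'] by simp
    then have "z = 0\<^sub>v (2 * Suc k + 1)" by (intro polar_radical[OF z rad]) auto
    then show ?R unfolding xez using e by (intro eq_vecI) auto
  qed
qed

lemma P_tilde_iff:
  "P_tilde (Suc l) = {s_mat x a | x a. x \<in> SO_odd l \<and> a \<noteq> 0 \<and> x *\<^sub>v unit_vec (2 * l + 1) 0 = a \<cdot>\<^sub>v unit_vec (2 * l + 1) 0}"
  unfolding P_tilde_def P_set_def diff_Suc_1 by (intro Collect_cong iff_exI) blast

section \<open>The inertia complements are the prescribed groups\<close>

context parabolic
begin

lemma Kc_zero: "Kc (0\<^sub>v (2 * l + 1)) = L_grp (Suc l)"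
proof -
  have "0\<^sub>v (2 * l + 1) \<bullet> v = a * (0\<^sub>v (2 * l + 1) \<bullet> (x *\<^sub>v v))" if "x \<in> SO_odd l" "v \<in> V" for x a v
    using that mult_mat_vec_carrier[OF SO_carrier[OF that(1)] that(2)] by simp
  then show ?thesis unfolding Kc_def L_grp_def diff_Suc_1 by blast
qed

lemma unit_scalar: "i < 2 * l + 1 \<Longrightarrow> v \<in> V \<Longrightarrow> unit_vec (2 * l + 1) i \<bullet> v = v $ i"
  by simp

lemma Kc_unit:
  assumes i: "i < 2 * l + 1"
  shows "Kc (unit_vec (2 * l + 1) i) = {s_mat x a | x a. x \<in> SO_odd l \<and> a \<noteq> 0 \<and> (\<forall>v\<in>V. v $ i = a * (x *\<^sub>v v) $ i)}"
proof -
  have "(\<forall>v\<in>V. unit_vec (2 * l + 1) i \<bullet> v = a * (unit_vec (2 * l + 1) i \<bullet> (x *\<^sub>v v))) \<longleftrightarrow> (\<forall>v\<in>V. v $ i = a * (x *\<^sub>v v) $ i)"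
    if "x \<in> SO_odd l" for x a
    using unit_scalar[OF i] mult_mat_vec_carrier[OF SO_carrier[OF that]] by (intro ball_cong refl) simp
  then show ?thesis unfolding Kc_def by blast
qed

lemma Kc_last:
  assumes l: "l \<ge> 1"
  shows "Kc (unit_vec (2 * l + 1) (2 * l)) = P_tilde (Suc l)"
proof -
  obtain k where k: "l = Suc k" using l by (cases l) auto
  have "2 * l < 2 * l + 1" by simp
  from Kc_unit[OF this] show ?thesis unfolding P_tilde_iff using fixing_last_iff[of _ k, folded k] by blast
qed

lemma Kc_center:
  assumes l: "l \<ge> 1"
  shows "Kc (unit_vec (2 * l + 1) l) = L_plus (Suc l)"
proof -
  have \<Delta>: "4 * 0 * 0 \<noteq> (1 :: 'a)" by simp
  have key: "x \<in> SO_odd l \<and> a \<noteq> 0 \<and> (\<forall>v\<in>V. v $ l = a * (x *\<^sub>v v) $ l) \<longleftrightarrow> (\<exists>g\<in>GO_plus l. x = insert_middle l g (det g) \<and> a = det g)" for x a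
    using fixing_middle_iff[OF \<Delta> l, of x a] unfolding SO_odd_iff GO_plus_def Q_plus_hform Q_odd_mform by blast
  have "l < 2 * l + 1" by simp
  then show ?thesis unfolding L_plus_def diff_Suc_1 by (simp only: Kc_unit key) blast
qed

text \<open>Conjugation by the similitude \<open>b_mat\<close> replaces \<open>Q_odd\<close> by
  \<open>Q_odd'\<close> and the functional, its middle row, by the middle coordinate. Then the
  statement about isometries fixing the middle applies with the anisotropic middle pair.\<close>

lemma Kc_minus:
  assumes l: "l \<ge> 1" and \<Delta>: "4 * \<nu> \<noteq> 1" and \<nu>': "\<nu>' \<noteq> 0" and B: "b_mat \<nu>' b3 l \<in> carrier (GL (2 * l + 1))"
    and b: "\<And>v. v \<in> V \<Longrightarrow> Q_odd' \<nu> l (b_mat \<nu>' b3 l *\<^sub>v v) = \<nu>' * Q_odd l v"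
  shows "Kc (row (b_mat \<nu>' b3 l) l) = L_minus \<nu> \<nu>' b3 (Suc l)"
proof -
  let ?B = "b_mat \<nu>' b3 l" and ?n = "2 * l + 1"
  define C where "C = inv\<^bsub>GL ?n\<^esub> ?B"
  have Bc: "?B \<in> carrier_mat ?n ?n" using B unfolding carrier_GL_iff by blast
  have C: "C \<in> carrier_mat ?n ?n" "?B * C = 1\<^sub>m ?n" "C * ?B = 1\<^sub>m ?n" unfolding C_def using inv_GL[OF B] by blast+
  have \<Delta>': "4 * 1 * \<nu> \<noteq> 1" using \<Delta> by simp
  have dBC: "det C * det ?B = 1" using det_mult[OF C(1) Bc] unfolding C(3) by simp
  have row: "row ?B l \<bullet> v = (?B *\<^sub>v v) $ l" for v using Bc by simp
  have BC: "?B *\<^sub>v (C *\<^sub>v v) = v" "C *\<^sub>v (?B *\<^sub>v v) = v" if "v \<in> V" for v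
    using assoc_mult_mat_vec[OF Bc C(1) that] assoc_mult_mat_vec[OF C(1) Bc that] one_mult_mat_vec[OF that] unfolding C(2,3) by auto
  have key: "x \<in> SO_odd l \<and> a \<noteq> 0 \<and> (\<forall>v\<in>V. row ?B l \<bullet> v = a * (row ?B l \<bullet> (x *\<^sub>v v))) \<longleftrightarrow>
      (\<exists>g\<in>GO_minus \<nu> l. x = C * insert_middle l g (det g) * ?B \<and> a = det g)" (is "?L \<longleftrightarrow> ?R") for x a
  proof
    assume L: ?L
    then have x: "x \<in> SO_odd l" by blast
    note xc = SO_carrier[OF x]
    define X where "X = ?B * x * C"
    have X: "X \<in> carrier_mat ?n ?n" using Bc xc C by (simp add: X_def)
    have Xv: "X *\<^sub>v v = ?B *\<^sub>v (x *\<^sub>v (C *\<^sub>v v))" if "v \<in> V" for v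
      unfolding X_def assoc_mult_mat_vec[OF mult_carrier_mat[OF Bc xc] C(1) that] assoc_mult_mat_vec[OF Bc xc mult_mat_vec_carrier[OF C(1) that]] ..
    have "det X = 1" unfolding X_def det_mult[OF mult_carrier_mat[OF Bc xc] C(1)] det_mult[OF Bc xc]
      using x dBC by (simp add: SO_odd_iff mult.commute)
    moreover have "mform 1 \<nu> l (X *\<^sub>v v) = mform 1 \<nu> l v" if v: "v \<in> V" for v
    proof -
      note Cv = mult_mat_vec_carrier[OF C(1) v]
      have "Q_odd' \<nu> l (X *\<^sub>v v) = Q_odd' \<nu> l (?B *\<^sub>v (C *\<^sub>v v))"
        unfolding Xv[OF v] b[OF Cv] b[OF mult_mat_vec_carrier[OF xc Cv]] SO_Q[OF x Cv] ..
      then show ?thesis unfolding BC(1)[OF v] Q_odd'_mform[OF l] .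
    qed
    moreover have "v $ l = a * (X *\<^sub>v v) $ l" if v: "v \<in> V" for v
      using L mult_mat_vec_carrier[OF C(1) v] unfolding row Xv[OF v] by (metis BC(1)[OF v])
    ultimately have "\<exists>g\<in>carrier (GL (2 * l)). (\<forall>w\<in>carrier_vec (2 * l). hform 1 \<nu> l (g *\<^sub>v w) = hform 1 \<nu> l w) \<and>
      X = insert_middle l g (det g) \<and> a = det g" using fixing_middle_iff[OF \<Delta>' l, of X a] X L by blast
    moreover have "x = C * X * ?B"
    proof (rule eq_mat_by_action[OF xc mult_carrier_mat[OF mult_carrier_mat[OF C(1) X] Bc]])
      fix v assume v: "v \<in> V"
      show "x *\<^sub>v v = C * X * ?B *\<^sub>v v"
        unfolding assoc_mult_mat_vec[OF mult_carrier_mat[OF C(1) X] Bc v] assoc_mult_mat_vec[OF C(1) X mult_mat_vec_carrier[OF Bc v]]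
          Xv[OF mult_mat_vec_carrier[OF Bc v]] BC(2)[OF v] BC(2)[OF mult_mat_vec_carrier[OF xc v]] ..
    qed
    ultimately show ?R unfolding GO_minus_def Q_minus_hform[OF l] by auto
  next
    assume ?R
    then obtain g where g: "g \<in> GO_minus \<nu> l" and xa: "x = C * insert_middle l g (det g) * ?B" "a = det g" by blast
    define X where "X = insert_middle l g (det g)"
    have "\<exists>g\<in>carrier (GL (2 * l)). (\<forall>w\<in>carrier_vec (2 * l). hform 1 \<nu> l (g *\<^sub>v w) = hform 1 \<nu> l w) \<and>
      X = insert_middle l g (det g) \<and> a = det g" using g unfolding GO_minus_def Q_minus_hform[OF l] X_def xa by blast
    then have X: "X \<in> carrier_mat ?n ?n" "det X = 1" "\<And>v. v \<in> V \<Longrightarrow> mform 1 \<nu> l (X *\<^sub>v v) = mform 1 \<nu> l v" "a \<noteq> 0"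
      "\<And>v. v \<in> V \<Longrightarrow> v $ l = a * (X *\<^sub>v v) $ l" using fixing_middle_iff[OF \<Delta>' l, of X a] by blast+
    have x: "x = C * X * ?B" using xa X_def by simp
    note CX = mult_carrier_mat[OF C(1) X(1)]
    have xc: "x \<in> carrier_mat ?n ?n" unfolding x by (rule mult_carrier_mat[OF CX Bc])
    have Bx: "?B *\<^sub>v (x *\<^sub>v v) = X *\<^sub>v (?B *\<^sub>v v)" if v: "v \<in> V" for v
      unfolding x assoc_mult_mat_vec[OF CX Bc v] assoc_mult_mat_vec[OF C(1) X(1) mult_mat_vec_carrier[OF Bc v]]
      by (rule BC(1)[OF mult_mat_vec_carrier[OF X(1) mult_mat_vec_carrier[OF Bc v]]])
    have "det x = 1" unfolding x det_mult[OF CX Bc] det_mult[OF C(1) X(1)] using X(2) dBC by simp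
    moreover have "Q_odd l (x *\<^sub>v v) = Q_odd l v" if v: "v \<in> V" for v
    proof -
      have "\<nu>' * Q_odd l (x *\<^sub>v v) = \<nu>' * Q_odd l v"
        unfolding b[OF v, symmetric] b[OF mult_mat_vec_carrier[OF xc v], symmetric] Bx[OF v] Q_odd'_mform[OF l]
        by (rule X(3)[OF mult_mat_vec_carrier[OF Bc v]])
      then show ?thesis using \<nu>' by simp
    qed
    ultimately have "x \<in> SO_odd l" unfolding SO_odd_iff using xc by blast
    moreover have "row ?B l \<bullet> v = a * (row ?B l \<bullet> (x *\<^sub>v v))" if v: "v \<in> V" for v
      unfolding row Bx[OF v] by (rule X(5)[OF mult_mat_vec_carrier[OF Bc v]])
    ultimately show ?L using X(4) by blast
  qed
  show ?thesis unfolding L_minus_def diff_Suc_1 C_def[symmetric] Kc_def by (simp only: key) blast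
qed

end

section \<open>The types of the functionals\<close>

lemma rts_last:
  assumes l: "l \<ge> 1"
  shows "nroots (unit_vec (2 * l + 1) (2 * l) $ l) (hyp l (unit_vec (2 * l + 1) (2 * l))) = 1"
proof -
  have "hyp l (unit_vec (2 * l + 1) (2 * l) :: 'a vec) = 0"
    unfolding hyp_def by (intro sum.neutral ballI) auto
  moreover have "(unit_vec (2 * l + 1) (2 * l) :: 'a vec) $ l = 0" using l by simp
  ultimately show ?thesis using nroots_eq(1)[of 0 0 0] by simp
qed

lemma rts_center: "nroots (unit_vec (2 * l + 1) l $ l) (hyp l (unit_vec (2 * l + 1) l)) = 2"
proof -
  have "hyp l (unit_vec (2 * l + 1) l :: 'a vec) = 0"
    unfolding hyp_def by (intro sum.neutral ballI) auto
  then show ?thesis using nroots_eq(1)[of 0 1 0] by simp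
qed

lemma irreducible_quadratic_no_root:
  assumes irr: "irreducible [:\<nu>, 1, 1 :: 'a::field:]"
  shows "t\<^sup>2 + t + \<nu> \<noteq> 0"
proof
  assume "t\<^sup>2 + t + \<nu> = 0"
  then have "poly [:\<nu>, 1, 1:] t = 0" by (simp add: power2_eq_square algebra_simps)
  then obtain r where r: "[:\<nu>, 1, 1:] = [:- t, 1:] * r" unfolding poly_eq_0_iff_dvd dvd_def by blast
  then have "[:- t, 1:] dvd 1 \<or> r dvd 1" using irreducibleD[OF irr] by blast
  then have d: "degree r = 0" unfolding is_unit_poly_iff by auto
  have "r \<noteq> 0" using r by auto
  then have "degree ([:- t, 1:] * r) = 1 + degree r" by (subst degree_mult_eq) auto
  moreover have "degree [:\<nu>, 1, 1 :: 'a:] = 2" by simp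
  ultimately show False using r d by simp
qed

lemma irreducible_quadratic_discriminant:
  assumes irr: "irreducible [:\<nu>, 1, 1 :: 'a::field:]"
  shows "4 * \<nu> \<noteq> 1"
proof
  assume d: "4 * \<nu> = 1"
  \<comment> \<open>With 4 \<nu> = 1 the element - 2 \<nu> is the double root - 1/2 of the
    polynomial.\<close>
  have "(- 2 * \<nu>)\<^sup>2 + (- 2 * \<nu>) + \<nu> = \<nu> * (4 * \<nu>) - \<nu>" by (simp add: power2_eq_square algebra_simps)
  then show False using irreducible_quadratic_no_root[OF irr, of "- 2 * \<nu>"] unfolding d by simp
qed

lemma irreducible_quadratic_anisotropic:
  assumes irr: "irreducible [:\<nu>, 1, 1 :: 'a::field:]" and z: "u\<^sup>2 + u * w + \<nu> * w\<^sup>2 = 0"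
  shows "u = 0 \<and> w = 0"
proof (cases "w = 0")
  case False
  have "(u / w)\<^sup>2 + u / w + \<nu> = (u\<^sup>2 + u * w + \<nu> * w\<^sup>2) / w\<^sup>2" using False by (simp add: field_simps power2_eq_square)
  then show ?thesis using irreducible_quadratic_no_root[OF irr, of "u / w"] z by simp
qed (use z in simp)

lemma b_mat_four_block:
  assumes "b3 \<in> carrier_mat 3 3"
  shows "b_mat \<nu>' b3 l = four_block_mat (\<nu>' \<cdot>\<^sub>m 1\<^sub>m (l - 1)) (0\<^sub>m (l - 1) (3 + (l - 1))) (0\<^sub>m (3 + (l - 1)) (l - 1))
     (four_block_mat b3 (0\<^sub>m 3 (l - 1)) (0\<^sub>m (l - 1) 3) (1\<^sub>m (l - 1)))"
proof -
  have "diag_block_mat [1\<^sub>m (l - 1) :: 'a mat] = 1\<^sub>m (l - 1)" by (auto simp: Let_def intro!: eq_matI)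
  then show ?thesis unfolding b_mat_def using assms by (simp add: Let_def)
qed

lemma b_mat_GL:
  assumes b3: "b3 \<in> carrier (GL 3)" and \<nu>': "\<nu>' \<noteq> 0" and l: "l \<ge> 1"
  shows "b_mat \<nu>' b3 l \<in> carrier (GL (2 * l + 1))"
proof -
  have c: "b3 \<in> carrier_mat 3 3" "det b3 \<noteq> 0" using b3 unfolding carrier_GL_iff by blast+
  let ?D = "four_block_mat b3 (0\<^sub>m 3 (l - 1)) (0\<^sub>m (l - 1) 3) (1\<^sub>m (l - 1))"
  have D: "?D \<in> carrier_mat (3 + (l - 1)) (3 + (l - 1))" using c by auto
  have "det ?D = det b3 * det (1\<^sub>m (l - 1))"
    using c by (intro det_four_block_mat_lower_left_zero[of _ 3 _ "l - 1"]) auto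
  moreover have "det (b_mat \<nu>' b3 l) = det (\<nu>' \<cdot>\<^sub>m 1\<^sub>m (l - 1)) * det ?D"
    unfolding b_mat_four_block[OF c(1)] using D by (intro det_four_block_mat_lower_left_zero[of _ "l - 1" _ "3 + (l - 1)"]) auto
  moreover have "l - 1 + (3 + (l - 1)) = 2 * l + 1" using l by simp
  then have "b_mat \<nu>' b3 l \<in> carrier_mat (2 * l + 1) (2 * l + 1)"
    unfolding b_mat_four_block[OF c(1)] using four_block_carrier_mat[OF _ D, of "\<nu>' \<cdot>\<^sub>m 1\<^sub>m (l - 1)" "l - 1" "l - 1"] by (metis one_carrier_mat smult_carrier_mat)
  ultimately show ?thesis unfolding carrier_GL_iff using c \<nu>' by simp
qed

lemma b_mat_middle_row:
  assumes b3: "b3 \<in> carrier_mat 3 3" and l: "l \<ge> 1" and i: "i < 2 * l + 1"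
  shows "b_mat \<nu>' b3 l $$ (l, i) = (if i < l - 1 then 0 else if i < l + 2 then b3 $$ (1, i - (l - 1)) else 0)"
proof -
  obtain k where k: "l = Suc k" using l by (cases l) auto
  let ?D = "four_block_mat b3 (0\<^sub>m 3 k) (0\<^sub>m k 3) (1\<^sub>m k)"
  have D: "?D $$ (1, j) = (if j < 3 then b3 $$ (1, j) else 0)" if "j < 3 + k" for j using b3 that by auto
  have "b_mat \<nu>' b3 l $$ (Suc k, i) = (if i < k then 0 else ?D $$ (1, i - k))"
    unfolding b_mat_four_block[OF b3] k diff_Suc_1 using b3 i unfolding k
    by (subst index_mat_four_block(1)) (auto simp del: index_mat_four_block(1))
  then show ?thesis using D[of "i - k"] i unfolding k by auto
qed

text \<open>The middle row of \<open>b_mat\<close> is supported on three coordinates and consists of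
  the middle row (\<alpha>, \<beta>, \<gamma>) of \<open>b3\<close>. A root of its quadratic would
  give a nonzero singular vector in dimension 3 whose image under \<open>b3\<close> has middle
  coordinate 0. That image would be a zero of the anisotropic form u^2 + u w + \<nu> w^2, hence 0,
  although \<open>b3\<close> is invertible.\<close>

lemma rts_minus:
  fixes b3 :: "'a::field mat"
  assumes irr: "irreducible [:\<nu>, 1, 1:]" and l: "l \<ge> 1" and b3: "b3 \<in> carrier (GL 3)" and \<nu>': "\<nu>' \<noteq> 0"
    and b: "\<And>v. v \<in> carrier_vec (2 * 1 + 1) \<Longrightarrow> Q_odd' \<nu> 1 (b_mat \<nu>' b3 1 *\<^sub>v v) = \<nu>' * Q_odd 1 v"
  shows "nroots (row (b_mat \<nu>' b3 l) l $ l) (hyp l (row (b_mat \<nu>' b3 l) l)) = 0"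
proof -
  have c3: "b3 \<in> carrier_mat 3 3" "det b3 \<noteq> 0" using b3 unfolding carrier_GL_iff by blast+
  have Bc: "b_mat \<nu>' b3 l \<in> carrier_mat (2 * l + 1) (2 * l + 1)" using b_mat_GL[OF b3 \<nu>' l] unfolding carrier_GL_iff by blast
  define \<alpha> \<beta> \<gamma> where "\<alpha> = b3 $$ (1, 0)" and "\<beta> = b3 $$ (1, 1)" and "\<gamma> = b3 $$ (1, 2)"
  define c where "c = row (b_mat \<nu>' b3 l) l"
  have ci: "c $ i = (if i < l - 1 then 0 else if i < l + 2 then b3 $$ (1, i - (l - 1)) else 0)" if "i < 2 * l + 1" for i
    using b_mat_middle_row[OF c3(1) l that, of \<nu>'] that Bc by (simp add: c_def)
  have "c $ l = \<beta>" using ci[of l] l by (auto simp: \<beta>_def)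
  moreover have "hyp l c = \<alpha> * \<gamma>"
  proof -
    have "hyp l c = c $ (l - 1) * c $ (l + 1) + (\<Sum>j=2..l. c $ (l - j) * c $ (l + j))" unfolding hyp_def by (rule sum_first[OF l])
    also have "(\<Sum>j=2..l. c $ (l - j) * c $ (l + j)) = 0" by (intro sum.neutral ballI) (auto simp: ci)
    also have "c $ (l - 1) = \<alpha>" using ci[of "l - 1"] l by (auto simp: \<alpha>_def)
    also have "c $ (l + 1) = \<gamma>"
    proof -
      have "l + 1 - (l - 1) = 2" using l by simp
      then show ?thesis using ci[of "l + 1"] l by (auto simp: \<gamma>_def)
    qed
    finally show ?thesis by simp
  qed
  moreover have "t\<^sup>2 + \<beta> * t \<noteq> \<alpha> * \<gamma>" for t
  proof
    assume t: "t\<^sup>2 + \<beta> * t = \<alpha> * \<gamma>"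
    \<comment> \<open>A root \<open>t\<close> gives the zero (t, \<alpha>) of the homogeneous form;
      if \<alpha> = 0, then (1, 0) is one.\<close>
    have "\<exists>p r. (p \<noteq> 0 \<or> r \<noteq> 0) \<and> \<alpha> * p\<^sup>2 + \<beta> * (p * r) = \<gamma> * r\<^sup>2"
    proof (cases "\<alpha> = 0")
      case True
      then show ?thesis by (intro exI[of _ 1] exI[of _ 0]) simp
    next
      case False
      have "\<alpha> * t\<^sup>2 + \<beta> * (t * \<alpha>) = \<alpha> * (t\<^sup>2 + \<beta> * t)" by (simp add: algebra_simps)
      then have "\<alpha> * t\<^sup>2 + \<beta> * (t * \<alpha>) = \<gamma> * \<alpha>\<^sup>2" unfolding t by (simp add: power2_eq_square)
      then show ?thesis using False by (intro exI[of _ t] exI[of _ \<alpha>]) simp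
    qed
    then obtain p r where pr: "p \<noteq> 0 \<or> r \<noteq> 0" "\<alpha> * p\<^sup>2 + \<beta> * (p * r) = \<gamma> * r\<^sup>2" by blast
    \<comment> \<open>The parametrization of the conic v_0^2 + v_1 v_1' = 0 by (p, r). The middle
      coordinate of the image is the binary form at (p, r), which vanishes.\<close>
    define v where "v = vec 3 (\<lambda>i. if i = 0 then p\<^sup>2 else if i = 1 then p * r else - (r\<^sup>2))"
    have v: "v \<in> carrier_vec 3" by (simp add: v_def)
    have b1: "b_mat \<nu>' b3 1 = b3" unfolding b_mat_four_block[OF c3(1)] using c3(1) by (intro eq_matI) auto
    define w where "w = b3 *\<^sub>v v"
    have w: "w \<in> carrier_vec 3" unfolding w_def by (rule mult_mat_vec_carrier[OF c3(1) v])
    have "w $ 1 = \<alpha> * p\<^sup>2 + \<beta> * (p * r) - \<gamma> * r\<^sup>2"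
    proof -
      have "w $ 1 = (\<Sum>k<3. b3 $$ (1, k) * v $ k)" unfolding w_def by (rule mult_vec_index[OF c3(1) v]) simp
      then show ?thesis by (simp add: numeral_3_eq_3 v_def \<alpha>_def \<beta>_def \<gamma>_def numeral_2_eq_2)
    qed
    then have w1: "w $ 1 = 0" using pr(2) by simp
    have "Q_odd 1 v = 0" by (simp add: Q_odd_def v_def power2_eq_square numeral_2_eq_2)
    then have "Q_odd' \<nu> 1 w = 0" using b[of v] v unfolding b1 w_def by simp
    then have "(w $ 0)\<^sup>2 + w $ 0 * w $ 2 + \<nu> * (w $ 2)\<^sup>2 = 0" unfolding Q_odd'_def using w1 by (simp add: numeral_2_eq_2)
    then have w02: "w $ 0 = 0" "w $ 2 = 0" using irreducible_quadratic_anisotropic[OF irr, of "w $ 0" "w $ 2"] by blast+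
    have "w = 0\<^sub>v 3"
    proof (rule eq_vecI)
      fix i assume "i < dim_vec (0\<^sub>v 3 :: 'a vec)"
      then have "i = 0 \<or> i = 1 \<or> i = 2" by auto
      then show "w $ i = 0\<^sub>v 3 $ i" using w1 w02 by auto
    qed (use w in simp)
    then have "v = 0\<^sub>v 3" using c3 v det_0_iff_vec_prod_zero_field[OF c3(1)] unfolding w_def by blast
    moreover have "v $ 0 = p\<^sup>2" "v $ 2 = - (r\<^sup>2)" by (simp_all add: v_def)
    ultimately show False using pr(1) by simp
  qed
  ultimately show ?thesis using nroots_eq(2)[of \<beta> "\<alpha> * \<gamma>"] unfolding c_def by simp
qed

section \<open>Additive characters\<close>

lemma additive_group_simps [simp]:
  "carrier additive_group = UNIV" "x \<otimes>\<^bsub>additive_group\<^esub> y = x + y" "\<one>\<^bsub>additive_group\<^esub> = 0"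
  by (simp_all add: additive_group_def)

text \<open>By Schur's lemma all matrices of an irreducible representation of an abelian group are
  scalar, so the degree is 1 and the character is multiplicative.\<close>

lemma Irr_additive_group:
  fixes \<xi> :: "'a::{field,finite} \<Rightarrow> complex"
  assumes \<xi>: "\<xi> \<in> Irr additive_group" "\<xi> \<noteq> (\<lambda>_. 1)"
  shows "add_char \<xi>"
proof -
  let ?G = "additive_group :: 'a monoid"
  have "\<exists>y. y + x = 0" for x :: 'a by (rule exI[of _ "- x"]) simp
  then have "group ?G" by (intro groupI) (auto simp: ac_simps)
  then interpret G: fin_group ?G by (intro fin_group.intro fin_group_axioms.intro) auto
  obtain d \<rho> where irr: "irreducible_rep ?G d \<rho>" and \<rho>: "\<xi> = afforded ?G \<rho>" using \<xi>(1) unfolding Irr_def by blast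
  then have rep: "representation ?G d \<rho>" and d: "d \<noteq> 0" by (auto simp: irreducible_rep_def)
  have \<rho>c: "\<rho> x \<in> carrier_mat d d" and \<rho>m: "\<rho> (x + y) = \<rho> x * \<rho> y" for x y
    using G.rep_carrier[OF rep, of x] G.rep_mult[OF rep, of x y] by auto
  have scalar: "\<exists>a. \<rho> x = a \<cdot>\<^sub>m 1\<^sub>m d" for x
  proof (rule G.schur_scalar[OF irr \<rho>c[of x]])
    show "\<rho> g * \<rho> x = \<rho> x * \<rho> g" for g using \<rho>m[of g x] \<rho>m[of x g] by (simp add: add.commute)
  qed blast
  \<comment> \<open>A diagonal matrix unit is an idempotent that commutes with all scalar matrices.
    Being 0 or 1, it must be 1, which leaves only degree 1.\<close>
  define E where "E = mat d d (\<lambda>(i, j). if i = 0 \<and> j = 0 then 1 else 0 :: complex)"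
  have E: "E \<in> carrier_mat d d" by (simp add: E_def)
  have "E * E = E"
  proof (rule eq_matI)
    fix i j assume "i < dim_row E" "j < dim_col E"
    then have ij: "i < d" "j < d" by (auto simp: E_def)
    have "(E * E) $$ (i, j) = (\<Sum>k<d. if k = 0 then if i = 0 \<and> j = 0 then 1 else 0 else 0)"
      unfolding mult_mat_index[OF E E ij] using ij by (intro sum.cong refl) (auto simp: E_def)
    then show "(E * E) $$ (i, j) = E $$ (i, j)" using d ij by (simp add: E_def)
  qed (auto simp: E_def)
  moreover have "\<rho> g * E = E * \<rho> g" for g
  proof -
    obtain a where "\<rho> g = a \<cdot>\<^sub>m 1\<^sub>m d" using scalar by blast
    then show ?thesis using E by (simp add: mult_smult_distrib[OF E one_carrier_mat] mult_smult_assoc_mat[OF one_carrier_mat E])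
  qed
  ultimately have "E = 0\<^sub>m d d \<or> E = 1\<^sub>m d" by (intro G.irreducible_idempotent[OF irr E])
  moreover have "E $$ (0, 0) = 1" using d by (simp add: E_def)
  ultimately have E1: "E = 1\<^sub>m d" using d by auto
  have "d = 1"
  proof (rule ccontr)
    assume "d \<noteq> 1"
    then have "1 < d" using d by simp
    then have "E $$ (1, 1) = 0" "(1\<^sub>m d :: complex mat) $$ (1, 1) = 1" by (auto simp: E_def)
    then show False unfolding E1 by simp
  qed
  note \<rho>c' = \<rho>c[unfolded this]
  have val: "\<xi> x = \<rho> x $$ (0, 0)" for x using \<rho>c'[of x] unfolding \<rho> by (simp add: afforded_def mat_trace_def)
  show ?thesis
  proof
    show "\<xi> (x + y) = \<xi> x * \<xi> y" for x y
      unfolding val \<rho>m using mult_mat_index[OF \<rho>c'[of x] \<rho>c'[of y], of 0 0] by simp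
    show "\<xi> \<noteq> (\<lambda>_. 1)" by (rule \<xi>(2))
    have inv: "inv\<^bsub>?G\<^esub> x = - x" for x by (rule G.inv_equality) auto
    show "\<xi> (- x) = cnj (\<xi> x)" for x using G.character_inv[OF G.Irr_is_character[OF \<xi>(1)], of x] by (simp add: inv)
    have "\<rho> 0 = 1\<^sub>m d" using G.rep_one[OF rep] by simp
    then show "\<xi> 0 = 1" unfolding val using d by simp
  qed
qed

section \<open>Characters covering a single orbit\<close>

context normal_with_chars
begin

text \<open>Multiplicities on \<open>U\<close> add up over the constituents, each of which covers
  the orbit of \<open>\<kappa>\<close> only.\<close>

lemma character_off_orbit:
  assumes \<chi>: "is_character G \<chi>" "\<And>\<psi>. \<psi> \<in> constituents G \<chi> \<Longrightarrow> char_inner U \<psi> \<kappa> \<noteq> 0" and \<kappa>: "\<kappa> \<in> Lam"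
    and \<mu>: "\<mu> \<in> Lam" "\<mu> \<notin> orbit \<kappa>"
  shows "char_inner U \<chi> \<mu> = 0"
proof -
  obtain \<psi>s where \<psi>s: "set \<psi>s \<subseteq> Irr G" "\<chi> = (\<lambda>g. \<Sum>\<psi>\<leftarrow>\<psi>s. \<psi> g)" using character_decomposition[OF \<chi>(1)] by metis
  have "char_inner U \<psi> \<mu> = 0" if \<psi>: "\<psi> \<in> set \<psi>s" for \<psi>
  proof -
    have "\<psi> \<in> constituents G \<chi>" unfolding \<psi>s(2) constituents_sum_list[OF \<psi>s(1)] by (rule \<psi>)
    then have "char_inner U \<psi> \<kappa> \<noteq> 0" by (rule \<chi>(2))
    then show ?thesis using Irr_covers_one_orbit[of \<psi> \<kappa> \<mu>] \<psi> \<psi>s(1) \<kappa> \<mu> by blast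
  qed
  then show ?thesis unfolding \<psi>s(2) char_inner_sum_list by (induction \<psi>s) auto
qed

lemma character_induced_from_inertia:
  assumes \<chi>: "is_character G \<chi>" "\<And>\<psi>. \<psi> \<in> constituents G \<chi> \<Longrightarrow> char_inner U \<psi> \<kappa> \<noteq> 0" and \<kappa>: "\<kappa> \<in> Lam"
    and K: "subgroup K G" "U \<inter> K = {\<one>}" and stab: "{x \<in> carrier G. cj x \<kappa> = \<kappa>} = U <#> K"
  shows "\<exists>\<theta>. is_character (G\<lparr>carrier := K\<rparr>) \<theta> \<and>
    \<chi> = induced G (U <#> K) (\<lambda>g. extended G U K \<kappa> g * inflated G U K \<theta> g)"
proof -
  obtain d \<rho> where \<rho>: "representation G d \<rho>" "\<chi> = afforded G \<rho>" using \<chi>(1) unfolding is_character_def by blast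
  have off: "char_inner U (afforded G \<rho>) \<mu> = 0" if "\<mu> \<in> Lam" "\<mu> \<notin> orbit \<kappa>" for \<mu>
    using character_off_orbit[OF \<chi> \<kappa> that] unfolding \<rho>(2) .
  show ?thesis unfolding \<rho>(2) by (rule clifford_induced[OF \<rho>(1) \<kappa> K stab off]) blast+
qed

lemma character_inflated_from_complement:
  assumes \<chi>: "is_character G \<chi>" "\<And>\<psi>. \<psi> \<in> constituents G \<chi> \<Longrightarrow> char_inner U \<psi> \<kappa> \<noteq> 0"
    and \<kappa>: "\<kappa> \<in> Lam" "\<And>u. u \<in> U \<Longrightarrow> \<kappa> u = 1" and orb: "orbit \<kappa> = {\<kappa>}"
    and K: "subgroup K G" "U \<inter> K = {\<one>}" "U <#> K = carrier G"
  shows "\<exists>\<theta>. is_character (G\<lparr>carrier := K\<rparr>) \<theta> \<and> \<chi> = inflated G U K \<theta>"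
proof -
  obtain d \<rho> where \<rho>: "representation G d \<rho>" "\<chi> = afforded G \<rho>" using \<chi>(1) unfolding is_character_def by blast
  have off: "char_inner U (afforded G \<rho>) \<mu> = 0" if "\<mu> \<in> Lam" "\<mu> \<noteq> \<kappa>" for \<mu>
    using character_off_orbit[OF \<chi> \<kappa>(1) that(1)] that(2) unfolding \<rho>(2) orb by blast
  show ?thesis unfolding \<rho>(2) by (rule inflated_from_complement[OF \<rho>(1) \<kappa> off K]) blast+
qed

end

section \<open>Orbits of functionals\<close>

lemma fequiv_zero:
  assumes "fequiv l c (0\<^sub>v (2 * l + 1))" and c: "c \<in> carrier_vec (2 * l + 1)"
  shows "c = 0\<^sub>v (2 * l + 1)"
proof -
  obtain x a where x: "x \<in> SO_odd l" "a \<noteq> 0" "\<And>v. v \<in> carrier_vec (2 * l + 1) \<Longrightarrow> 0\<^sub>v (2 * l + 1) \<bullet> v = a * (c \<bullet> (x *\<^sub>v v))"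
    using assms(1) unfolding fequiv_def by blast
  obtain y where y: "y \<in> SO_odd l" "x * y = 1\<^sub>m (2 * l + 1)" using SO_inverse[OF x(1)] by metis
  have "c \<bullet> u = 0" if u: "u \<in> carrier_vec (2 * l + 1)" for u
  proof -
    note yu = mult_mat_vec_carrier[OF SO_carrier[OF y(1)] u]
    have "x *\<^sub>v (y *\<^sub>v u) = u" using assoc_mult_mat_vec[OF SO_carrier[OF x(1)] SO_carrier[OF y(1)] u] one_mult_mat_vec[OF u] unfolding y(2) by simp
    then show ?thesis using x(3)[OF yu] x(2) yu by simp
  qed
  then have "c $ i = 0" if "i < 2 * l + 1" for i using scalar_prod_right_unit[OF that, of c] by simp
  then show ?thesis using c by (intro eq_vecI) auto
qed

lemma rts_zero: "nroots (0\<^sub>v (2 * l + 1) $ l) (hyp l (0\<^sub>v (2 * l + 1))) = 1"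
proof -
  have "hyp l (0\<^sub>v (2 * l + 1) :: 'a vec) = 0" unfolding hyp_def by (intro sum.neutral ballI) auto
  then show ?thesis using nroots_eq(1)[of 0 0 0] by simp
qed

context parabolic
begin

lemma lam_orbit_iff:
  assumes c: "c \<in> V" and c': "c' \<in> V"
  shows "lam c' \<in> N.orbit (lam c) \<longleftrightarrow> fequiv l c' c"
  unfolding orbit_lam[OF c] using lam_inject c' by auto

lemma lam_zero: "u \<in> U \<Longrightarrow> lam (0\<^sub>v (2 * l + 1)) u = 1"
  unfolding U_grp_eq by (auto simp: lam_um zero)

lemma orbit_lam_zero: "N.orbit (lam (0\<^sub>v (2 * l + 1))) = {lam (0\<^sub>v (2 * l + 1))}"
proof -
  have "{c' \<in> V. fequiv l c' (0\<^sub>v (2 * l + 1))} = {0\<^sub>v (2 * l + 1)}"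
  proof (intro subset_antisym subsetI)
    fix c' assume "c' \<in> {c' \<in> V. fequiv l c' (0\<^sub>v (2 * l + 1))}"
    then show "c' \<in> {0\<^sub>v (2 * l + 1)}" using fequiv_zero[of l c'] by blast
  next
    fix c' :: "'a vec" assume "c' \<in> {0\<^sub>v (2 * l + 1)}"
    then show "c' \<in> {c' \<in> V. fequiv l c' (0\<^sub>v (2 * l + 1))}" using fequiv_refl[OF zero_carrier_vec[of "2 * l + 1"]] by simp
  qed
  then show ?thesis unfolding orbit_lam[OF zero_carrier_vec] by (simp only: image_insert image_empty)
qed

text \<open>Among the functionals with a given number of roots the nonzero ones form one orbit. The
  zero functional also has one root; it contributes \<open>\<xi> 0 = 1\<close>, which is removed in
  that case.\<close>

lemma orbit_value:
  assumes l: "l \<ge> 1" and c: "c \<in> V" "c \<noteq> 0\<^sub>v (2 * l + 1)" and z: "z \<in> V"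
  shows "(\<Sum>\<mu>\<in>N.orbit (lam c). \<mu> (um l z)) = orbit_sum l (rts l c) z - (if rts l c = 1 then 1 else 0)"
proof -
  let ?o = "0\<^sub>v (2 * l + 1) :: 'a vec"
  define Ob where "Ob = {c' \<in> V. fequiv l c' c}"
  obtain k where k: "l = Suc k" using l by (cases l) auto
  have "c' \<in> Ob \<longleftrightarrow> c' \<noteq> ?o \<and> rts l c' = rts l c" if c': "c' \<in> V" for c'
  proof (cases "c' = ?o")
    case True
    have "\<not> fequiv l ?o c" using fequiv_zero[OF fequiv_sym c(1)] c(2) by blast
    then show ?thesis unfolding Ob_def using True by simp
  next
    case False
    then show ?thesis unfolding Ob_def using fequiv_iff_rts[of c' k c] c c' unfolding k by simp
  qed
  then have S: "{c' \<in> V. rts l c' = rts l c} = (if rts l c = 1 then insert ?o Ob else Ob)"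
    using rts_zero[of l, where ?'a='a] unfolding Ob_def by auto
  have fin: "finite Ob" unfolding Ob_def by simp
  have o: "?o \<notin> Ob" using fequiv_zero[OF fequiv_sym c(1)] c(2) unfolding Ob_def by blast
  have "(\<Sum>\<mu>\<in>N.orbit (lam c). \<mu> (um l z)) = (\<Sum>c'\<in>Ob. \<xi> (c' \<bullet> z))"
    unfolding orbit_lam[OF c(1)] Ob_def lam_um[OF z, symmetric]
    by (rule sum.reindex[unfolded o_def]) (auto simp: inj_on_def lam_inject)
  moreover have "\<xi> (?o \<bullet> z) = 1" using z by (simp add: zero)
  ultimately show ?thesis unfolding orbit_sum_def S using fin o by simp
qed

text \<open>The four representatives meet every orbit of functionals, and no two lie in the same
  orbit: zero is equivalent only to itself, and the other three have different numbers of roots.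
  Conjugate characters have equal multiplicities, and an irreducible character covers a single
  orbit.\<close>

lemma Irr_covers_exactly_one:
  fixes C :: "char_type \<Rightarrow> 'a vec"
  assumes l: "l \<ge> 1" and C: "\<And>t. C t \<in> V" "C Type1 = 0\<^sub>v (2 * l + 1)" "C Type0 \<noteq> 0\<^sub>v (2 * l + 1)"
    "rts l (C Type0) = 1" "rts l (C TypePlus) = 2" "rts l (C TypeMinus) = 0" and \<psi>: "\<psi> \<in> Irr P"
  shows "\<exists>!t. char_inner U \<psi> (lam (C t)) \<noteq> 0"
proof -
  let ?o = "0\<^sub>v (2 * l + 1) :: 'a vec"
  obtain k where k: "l = Suc k" using l by (cases l) auto
  have rz: "rts l ?o = 1" by (rule rts_zero)
  have nz: "C TypePlus \<noteq> ?o" "C TypeMinus \<noteq> ?o" using C(5,6) rz by auto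
  have sep: "t = t'" if "fequiv l (C t) (C t')" for t t'
  proof (cases "C t = ?o \<or> C t' = ?o")
    case True
    then have "C t = ?o" "C t' = ?o" using that fequiv_sym[OF that] fequiv_zero[of l] C(1) by metis+
    then have "t = Type1" "t' = Type1" using nz C(3) by (cases t; cases t'; auto)+
    then show ?thesis by simp
  next
    case False
    then have "rts l (C t) = rts l (C t')" using fequiv_iff_rts[of "C t" k "C t'"] C(1) that unfolding k by metis
    moreover have "t \<noteq> Type1" "t' \<noteq> Type1" using False C(2) by auto
    ultimately show ?thesis using C(4-6) by (cases t; cases t') auto
  qed
  obtain \<kappa> where \<kappa>: "\<kappa> \<in> lam ` V" "char_inner U \<psi> \<kappa> \<noteq> 0" using N.Irr_covers_some[OF \<psi>] by metis
  then obtain c where c: "c \<in> V" "\<kappa> = lam c" by blast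
  have "\<exists>t. fequiv l c (C t)"
  proof (cases "c = ?o")
    case True
    then show ?thesis using C(2) fequiv_refl[OF c(1)] by metis
  next
    case False
    have "\<exists>t. C t \<noteq> ?o \<and> rts l c = rts l (C t)"
      using C(3-6) nz by (cases rule: nroots_cases[of "c $ l" "hyp l c"]) metis+
    then show ?thesis using fequiv_iff_rts[of c k] C(1) c(1) False unfolding k by metis
  qed
  then obtain t where t: "fequiv l c (C t)" by blast
  then have "lam c \<in> N.orbit (lam (C t))" using lam_orbit_iff[OF C(1) c(1)] by blast
  then obtain p where p: "p \<in> carrier P" "lam c = conj_char P U p (lam (C t))" unfolding N.orbit_def by blast
  obtain d \<rho> where \<rho>: "representation P d \<rho>" "\<psi> = afforded P \<rho>" using \<psi> unfolding Irr_def irreducible_rep_def by blast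
  have "char_inner U \<psi> (lam (C t)) \<noteq> 0"
    using N.char_inner_cj[OF \<rho>(1) p(1), of "lam (C t)"] C(1) \<kappa>(2) unfolding c(2) \<rho>(2) p(2) by simp
  moreover have "t' = t" if "char_inner U \<psi> (lam (C t')) \<noteq> 0" "char_inner U \<psi> (lam (C t)) \<noteq> 0" for t'
  proof -
    have "lam (C t') \<in> N.orbit (lam (C t))" using N.Irr_covers_one_orbit[OF \<psi> _ that(2) _ that(1)] C(1) by blast
    then show ?thesis using lam_orbit_iff[OF C(1) C(1)] sep by blast
  qed
  ultimately show ?thesis by blast
qed

end

section \<open>The inertia complement of type 0\<close>

lemma mu_tilde_s_mat:
  assumes x: "x \<in> carrier_mat (2 * l + 1) (2 * l + 1)" and g: "s_mat x a \<in> P_tilde (Suc l)"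
  shows "mu_tilde (Suc l) \<mu> (s_mat x a) = \<mu> x"
proof -
  have "mat (2 * l + 1) (2 * l + 1) (\<lambda>(i, j). s_mat x a $$ (i + 1, j + 1)) = x"
    using x by (intro eq_matI) (auto simp: s_mat_index[OF x])
  then show ?thesis using g by (simp add: mu_tilde_def)
qed

lemma mu_tilde_one: "mu_tilde (Suc l) \<mu> (1\<^sub>m (2 * Suc l + 1)) = \<mu> (1\<^sub>m (2 * l + 1))"
proof -
  have "s_mat (1\<^sub>m (2 * l + 1)) 1 \<in> P_tilde (Suc l)"
    unfolding P_tilde_iff mem_Collect_eq
    by (intro exI conjI) (rule refl, rule SO_one, simp, simp)
  from mu_tilde_s_mat[OF one_carrier_mat this] show ?thesis unfolding s_one .
qed

text \<open>In \<open>P_tilde\<close> the scalar is determined by the middle block, as its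
  eigenvalue at the first basis vector. Hence the middle block identifies \<open>P_tilde\<close>
  with the parabolic group two dimensions lower, and representations are transported along the
  inverse map.\<close>

lemma P_tilde_character:
  fixes \<theta> :: "'a::field mat \<Rightarrow> complex"
  assumes \<theta>: "is_character (mat_group (2 * Suc l + 1) (P_tilde (Suc l))) \<theta>"
  shows "\<exists>\<mu>. is_character (P_grp l) \<mu> \<and> \<theta> = mu_tilde (Suc l) \<mu>"
proof -
  let ?K = "mat_group (2 * Suc l + 1) (P_tilde (Suc l) :: 'a mat set)" and ?e = "unit_vec (2 * l + 1) 0 :: 'a vec"
  obtain d \<rho> where \<rho>: "representation ?K d \<rho>" "\<theta> = afforded ?K \<rho>" using \<theta> unfolding is_character_def by blast
  \<comment> \<open>The eigenvalue is read off as a matrix entry; it is multiplicative and nonzero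
    on \<open>P_set l\<close>.\<close>
  define a where "a x = (x *\<^sub>v ?e) $ 0" for x
  have a_eq: "a x = c" if "x *\<^sub>v ?e = c \<cdot>\<^sub>v ?e" for x c unfolding a_def that by simp
  have act: "x *\<^sub>v ?e = a x \<cdot>\<^sub>v ?e" "x \<in> SO_odd l" if "x \<in> P_set l" for x
    using that a_eq[of x] unfolding P_set_def by auto
  have a0: "a x \<noteq> 0" if x: "x \<in> P_set l" for x
  proof
    assume z: "a x = 0"
    obtain y where y: "y \<in> SO_odd l" "y * x = 1\<^sub>m (2 * l + 1)" using SO_inverse[OF act(2)[OF x]] by metis
    have "?e = y *\<^sub>v (x *\<^sub>v ?e)"
      using assoc_mult_mat_vec[OF SO_carrier[OF y(1)] SO_carrier[OF act(2)[OF x]], of ?e] one_mult_mat_vec[of ?e "2 * l + 1"] unfolding y(2) by simp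
    also have "x *\<^sub>v ?e = 0\<^sub>v (2 * l + 1)" unfolding act(1)[OF x] z by (intro eq_vecI) auto
    also have "y *\<^sub>v 0\<^sub>v (2 * l + 1) = 0\<^sub>v (2 * l + 1)" using SO_carrier[OF y(1)] by (intro eq_vecI) auto
    finally have "?e $ 0 = 0\<^sub>v (2 * l + 1) $ 0" by simp
    then show False by simp
  qed
  have mem: "s_mat x (a x) \<in> P_tilde (Suc l)" if x: "x \<in> P_set l" for x
    unfolding P_tilde_iff using act[OF x] a0[OF x] by blast
  have a_mult: "a (x * y) = a x * a y" if x: "x \<in> P_set l" and y: "y \<in> P_set l" for x y
  proof (rule a_eq)
    have "x * y *\<^sub>v ?e = x *\<^sub>v (a y \<cdot>\<^sub>v ?e)"
      unfolding act(1)[OF y, symmetric] by (rule assoc_mult_mat_vec[OF SO_carrier[OF act(2)[OF x]] SO_carrier[OF act(2)[OF y]]]) simp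
    also have "\<dots> = a y \<cdot>\<^sub>v (x *\<^sub>v ?e)" by (rule mult_mat_vec[OF SO_carrier[OF act(2)[OF x]]]) simp
    finally show "x * y *\<^sub>v ?e = (a x * a y) \<cdot>\<^sub>v ?e" unfolding act(1)[OF x] by (simp add: smult_smult_assoc mult.commute)
  qed
  define \<sigma> where "\<sigma> x = \<rho> (s_mat x (a x))" for x
  have "representation (P_grp l) d \<sigma>"
    unfolding representation_def hom_def P_grp_def
  proof (intro CollectI conjI Pi_I ballI)
    fix x :: "'a mat" assume "x \<in> carrier (mat_group (2 * l + 1) (P_set l))"
    then have x: "x \<in> P_set l" by simp
    show "\<sigma> x \<in> carrier (GL d)" using \<rho>(1) mem[OF x] unfolding representation_def hom_def \<sigma>_def by auto
    fix y :: "'a mat" assume "y \<in> carrier (mat_group (2 * l + 1) (P_set l))"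
    then have y: "y \<in> P_set l" by simp
    have "s_mat (x * y) (a (x * y)) = s_mat x (a x) * s_mat y (a y)"
      unfolding a_mult[OF x y] by (rule s_mult[OF SO_carrier[OF act(2)[OF x]] SO_carrier[OF act(2)[OF y]], symmetric])
    then show "\<sigma> (x \<otimes>\<^bsub>mat_group (2 * l + 1) (P_set l)\<^esub> y) = \<sigma> x \<otimes>\<^bsub>GL d\<^esub> \<sigma> y"
      using \<rho>(1) mem[OF x] mem[OF y] unfolding representation_def hom_def \<sigma>_def by auto
  qed
  moreover have "\<theta> = mu_tilde (Suc l) (afforded (P_grp l) \<sigma>)"
  proof
    fix g
    show "\<theta> g = mu_tilde (Suc l) (afforded (P_grp l) \<sigma>) g"
    proof (cases "g \<in> P_tilde (Suc l)")
      case True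
      then obtain x c where x: "x \<in> SO_odd l" "x *\<^sub>v ?e = c \<cdot>\<^sub>v ?e" "g = s_mat x c" unfolding P_tilde_iff by blast
      have xP: "x \<in> P_set l" using x unfolding P_set_def by blast
      show ?thesis
        using True xP mu_tilde_s_mat[OF SO_carrier[OF x(1)], of c "afforded (P_grp l) \<sigma>"] a_eq[OF x(2)]
        unfolding x(3) \<rho>(2) by (simp add: afforded_def \<sigma>_def P_grp_def)
    qed (simp add: \<rho>(2) afforded_def mu_tilde_def)
  qed
  ultimately show ?thesis unfolding is_character_def by blast
qed

section \<open>The matrix of values\<close>

lemma det_mat_Suc:
  "det (mat (Suc n) (Suc n) f) = (\<Sum>j<Suc n. f (0, j) * ((- 1) ^ j * det (mat n n (\<lambda>(i, k). f (Suc i, insert_index j k) :: 'a::comm_ring_1))))"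
proof -
  have "det (mat (Suc n) (Suc n) f) = (\<Sum>j<Suc n. mat (Suc n) (Suc n) f $$ (0, j) * cofactor (mat (Suc n) (Suc n) f) 0 j)"
    by (rule laplace_expansion_row) auto
  also have "\<dots> = (\<Sum>j<Suc n. f (0, j) * ((- 1) ^ j * det (mat n n (\<lambda>(i, k). f (Suc i, insert_index j k)))))"
  proof (intro sum.cong refl)
    fix j assume j: "j \<in> {..<Suc n}"
    have "mat_delete (mat (Suc n) (Suc n) f) 0 j = mat n n (\<lambda>(i, k). f (Suc i, insert_index j k))"
      by (intro eq_matI) (auto simp: mat_delete_def insert_index_def)
    then show "mat (Suc n) (Suc n) f $$ (0, j) * cofactor (mat (Suc n) (Suc n) f) 0 j =
      f (0, j) * ((- 1) ^ j * det (mat n n (\<lambda>(i, k). f (Suc i, insert_index j k))))" using j by (simp add: cofactor_def)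
  qed
  finally show ?thesis .
qed

lemma det_rows_4:
  fixes a b c d :: "'a::comm_ring_1"
  shows "det (mat_of_rows_list 4 [[1, a, b, c], [1, a', b', c'], [1, a'', b'', c''], [1, a''', b''', c''']]) =
    (a' * b'' * c''' - a' * b''' * c'' - a'' * b' * c''' + a'' * b''' * c' + a''' * b' * c'' - a''' * b'' * c')
    - (a * b'' * c''' - a * b''' * c'' - a'' * b * c''' + a'' * b''' * c + a''' * b * c'' - a''' * b'' * c)
    + (a * b' * c''' - a * b''' * c' - a' * b * c''' + a' * b''' * c + a''' * b * c' - a''' * b' * c)
    - (a * b' * c'' - a * b'' * c' - a' * b * c'' + a' * b'' * c + a'' * b * c' - a'' * b' * c)"
proof -
  have "det (mat 0 0 f) = (1 :: 'a)" for f by (rule det_dim_zero) auto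
  then show ?thesis
    unfolding mat_of_rows_list_def
    by (simp add: det_mat_Suc numeral_eq_Suc insert_index_def algebra_simps)
qed

text \<open>With Q = q^(m-1) as a second variable both sides become polynomials in q and Q, the
  right one being Q^4 q^2; the even case has Q^5 q^2 / 2.\<close>

lemma det_M_odd:
  assumes m: "m \<ge> 1"
  shows "det (M_odd q m) = q ^ (4 * m - 2)"
proof -
  define Q where "Q = q ^ (m - 1)"
  have "2 * m - 2 = (m - 1) * 2" "4 * m - 2 = (m - 1) * 4 + 2" using m by auto
  then have e: "q ^ (2 * m - 2) = Q\<^sup>2" "q ^ (4 * m - 2) = Q ^ 4 * q\<^sup>2" by (simp_all only: Q_def power_add power_mult)
  show ?thesis unfolding M_odd_def e Q_def[symmetric] det_rows_4 by (simp add: field_simps power2_eq_square power4_eq_xxxx)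
qed

lemma det_M_even:
  assumes m: "m \<ge> 1"
  shows "det (M_even q m) = 1 / 2 * q ^ (5 * m - 3)"
proof -
  define Q where "Q = q ^ (m - 1)"
  have "2 * m - 2 = (m - 1) * 2" "5 * m - 3 = (m - 1) * 5 + 2" using m by auto
  then have e: "q ^ (2 * m - 2) = Q\<^sup>2" "q ^ (5 * m - 3) = Q ^ 5 * q\<^sup>2" by (simp_all only: Q_def power_add power_mult)
  have p: "Q ^ 5 = Q * Q * Q * Q * Q" by (simp add: numeral_eq_Suc)
  show ?thesis unfolding M_even_def e Q_def[symmetric] det_rows_4 p by (simp add: field_simps power2_eq_square)
qed

lemma rows_4_mult_vec:
  fixes x y z w :: "'a::comm_semiring_1"
  shows "mat_of_rows_list 4 [[a, b, c, d], [a', b', c', d'], [a'', b'', c'', d''], [a''', b''', c''', d''']] *\<^sub>v vec_of_list [x, y, z, w] =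
    vec_of_list [a * x + b * y + c * z + d * w, a' * x + b' * y + c' * z + d' * w,
      a'' * x + b'' * y + c'' * z + d'' * w, a''' * x + b''' * y + c''' * z + d''' * w]" (is "?A *\<^sub>v ?v = ?r")
proof (rule eq_vecI)
  have A: "?A \<in> carrier_mat 4 4" and v: "?v \<in> carrier_vec 4"
    by (auto simp: mat_of_rows_list_def intro: carrier_vecI)
  fix i assume "i < dim_vec ?r"
  then have i: "i < 4" by simp
  then have "i = 0 \<or> i = 1 \<or> i = 2 \<or> i = 3" by auto
  then show "(?A *\<^sub>v ?v) $ i = ?r $ i"
    unfolding mult_vec_index[OF A v i] using i
    by (elim disjE) (simp_all add: mat_of_rows_list_def numeral_eq_Suc ac_simps)
qed (simp add: mat_of_rows_list_def)

section \<open>The orbit sums as entries of the matrix\<close>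

context add_char
begin

lemma orbit_sums_from_weighted:
  "orbit_sum l 2 z = (weighted_sum l (\<lambda>x s. of_nat (nroots x s)) z - orbit_sum l 1 z) / 2"
  "orbit_sum l 0 z = weighted_sum l (\<lambda>_ _. 1) z - orbit_sum l 1 z - (weighted_sum l (\<lambda>x s. of_nat (nroots x s)) z - orbit_sum l 1 z) / 2"
  unfolding weighted_sum_one weighted_sum_nroots by (simp_all add: field_simps)

text \<open>Rows belong to the identity, \<open>z_zero\<close>, \<open>z_one\<close>,
  \<open>z_two\<close>, columns to the types 1, 0, +, -. The first column is constant because the
  orbit of the trivial character is a point. For odd q the nonsquare \<open>\<nu>''\<close> makes
  the last row differ from the second.\<close>

lemma value_matrix_orbit_sums:
  fixes \<nu>'' :: 'a and k :: nat
  assumes \<nu>'': "\<nu>'' \<noteq> 0" "odd CARD('a) \<longrightarrow> \<not> (\<exists>x. \<nu>'' = x\<^sup>2)"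
  defines "vals \<equiv> \<lambda>z. [1, orbit_sum (Suc k) 1 z - 1, orbit_sum (Suc k) 2 z, orbit_sum (Suc k) 0 z]"
  shows "value_matrix CARD('a) (Suc (Suc k)) = mat_of_rows_list 4 [vals (0\<^sub>v (2 * Suc k + 1)), vals (brd 1 (0\<^sub>v (2 * k + 1)) 0),
    vals (unit_vec (2 * Suc k + 1) (Suc k)), vals (brd 1 (0\<^sub>v (2 * k + 1)) \<nu>'')]"
proof -
  define q Q where "q = (of_nat CARD('a) :: complex)" and "Q = q ^ Suc k"
  \<comment> \<open>The zero vector and the middle unit vector are written as multiples of the
    latter, the form in which the sums were evaluated.\<close>
  define z0 z1 z2 z3 :: "'a vec" where "z0 = 0 \<cdot>\<^sub>v unit_vec (2 * Suc k + 1) (Suc k)" and "z1 = brd 1 (0\<^sub>v (2 * k + 1)) 0"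
    and "z2 = 1 \<cdot>\<^sub>v unit_vec (2 * Suc k + 1) (Suc k)" and "z3 = brd 1 (0\<^sub>v (2 * k + 1)) \<nu>''"
  note defs = z0_def z1_def z2_def z3_def Q_def q_def
  have z: "0\<^sub>v (2 * Suc k + 1) = z0" "unit_vec (2 * Suc k + 1) (Suc k) = z2"
    unfolding defs by (intro eq_vecI; simp)+
  have p: "q ^ (2 * Suc (Suc k) - 2) = Q\<^sup>2" "q ^ (Suc (Suc k) - 1) = Q"
    by (simp_all add: Q_def power_mult[symmetric] power2_eq_square mult_2 power_add[symmetric])
  let ?W = "weighted_sum (Suc k) (\<lambda>_ _. 1)" and ?N = "weighted_sum (Suc k) (\<lambda>x s. of_nat (nroots x s))"
  have W: "?W z0 = q * Q\<^sup>2" "?W z1 = 0" "?W z2 = 0" "?W z3 = 0"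
    unfolding defs by (rule weighted_values)+
  have "?N z3 = (if \<nu>'' = 0 then Q * (q - 1) else - Q)" "?N z1 = (if (0 :: 'a) = 0 then Q * (q - 1) else - Q)"
    unfolding defs by (rule weighted_values)+
  moreover have "?N z0 = q * Q\<^sup>2 + q * Q - Q" "?N z2 = - Q"
    unfolding defs by (rule weighted_values)+
  ultimately have N: "?N z0 = q * Q\<^sup>2 + q * Q - Q" "?N z1 = Q * (q - 1)" "?N z2 = - Q" "?N z3 = - Q" using \<nu>''(1) by simp_all
  show ?thesis
  proof (cases "(2 :: 'a) = 0")
    case True
    then have "\<not> odd CARD('a)" using even_card_field_iff by blast
    then have M: "value_matrix CARD('a) (Suc (Suc k)) = M_even q (Suc (Suc k))" unfolding value_matrix_def q_def by (rule if_not_P)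
    have "orbit_sum (Suc k) 1 z0 = Q\<^sup>2" "orbit_sum (Suc k) 1 z2 = Q\<^sup>2" "orbit_sum (Suc k) 1 z1 = 0" "orbit_sum (Suc k) 1 z3 = 0"
      unfolding defs by (rule one_root_values_even[OF True])+
    note o = this
    show ?thesis
      unfolding M M_even_def p vals_def z z1_def[symmetric] z3_def[symmetric] orbit_sums_from_weighted o W N
      by (intro arg_cong[of _ _ "mat_of_rows_list 4"]) (simp add: field_simps power2_eq_square)
  next
    case False
    then have od: "odd CARD('a)" using even_card_field_iff by blast
    then have M: "value_matrix CARD('a) (Suc (Suc k)) = M_odd q (Suc (Suc k))" unfolding value_matrix_def q_def by (rule if_P)
    have ns: "\<not> (\<exists>x. \<nu>'' = x\<^sup>2)" using \<nu>''(2) od by blast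
    have "orbit_sum (Suc k) 1 z0 = Q\<^sup>2" "orbit_sum (Suc k) 1 z2 = Q" "orbit_sum (Suc k) 1 z1 = 0" "orbit_sum (Suc k) 1 z3 = - Q"
      unfolding defs by (rule one_root_values_odd[OF False] one_root_values_odd(4)[OF False \<nu>''(1) ns])+
    note o = this
    show ?thesis
      unfolding M M_odd_def p vals_def z z1_def[symmetric] z3_def[symmetric] orbit_sums_from_weighted o W N
      by (intro arg_cong[of _ _ "mat_of_rows_list 4"]) (simp add: field_simps power2_eq_square)
  qed
qed

end

context parabolic
begin

section \<open>The four types of characters of \<open>P\<close>, their labels and their
  values\<close>

definition type_vec :: "'a mat \<Rightarrow> char_type \<Rightarrow> 'a vec" where
  "type_vec B t = (case t of Type1 \<Rightarrow> 0\<^sub>v (2 * l + 1) | Type0 \<Rightarrow> unit_vec (2 * l + 1) (2 * l)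
     | TypePlus \<Rightarrow> unit_vec (2 * l + 1) l | TypeMinus \<Rightarrow> row B l)"

lemma type_vec_simps [simp]:
  "type_vec B Type1 = 0\<^sub>v (2 * l + 1)" "type_vec B Type0 = unit_vec (2 * l + 1) (2 * l)"
  "type_vec B TypePlus = unit_vec (2 * l + 1) l" "type_vec B TypeMinus = row B l"
  by (simp_all add: type_vec_def)

context
  fixes \<nu> \<nu>' :: 'a and b3 :: "'a mat"
  assumes l: "l \<ge> 1" and irr: "irreducible [:\<nu>, 1, 1:]" and \<nu>': "\<nu>' \<noteq> 0" and b3: "b3 \<in> carrier (GL 3)"
    and b_similitude: "\<forall>l\<ge>1. \<forall>v\<in>carrier_vec (2 * l + 1). Q_odd' \<nu> l (b_mat \<nu>' b3 l *\<^sub>v v) = \<nu>' * Q_odd l v"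
begin

abbreviation (input) "tv \<equiv> type_vec (b_mat \<nu>' b3 l)"

lemma type_vec_carrier: "tv t \<in> V"
proof -
  have "b_mat \<nu>' b3 l \<in> carrier_mat (2 * l + 1) (2 * l + 1)" using b_mat_GL[OF b3 \<nu>' l] unfolding carrier_GL_iff by blast
  from row_carrier_vec[OF _ this, of l] show ?thesis by (cases t) (simp_all del: row_carrier_vec)
qed

lemma lambda_lam:
  "lambda_zero (Suc l) \<xi> = lam (tv Type0)" "lambda_plus (Suc l) \<xi> = lam (tv TypePlus)"
  "lambda_minus \<nu>' b3 (Suc l) \<xi> = lam (tv TypeMinus)"
proof -
  have B: "b_mat \<nu>' b3 l \<in> carrier_mat (2 * l + 1) (2 * l + 1)" using b_mat_GL[OF b3 \<nu>' l] unfolding carrier_GL_iff by blast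
  show "lambda_zero (Suc l) \<xi> = lam (tv Type0)" "lambda_plus (Suc l) \<xi> = lam (tv TypePlus)"
    unfolding lambda_zero_def lambda_plus_def lam_def diff_Suc_1 by (rule U_char_eqI; simp)+
  show "lambda_minus \<nu>' b3 (Suc l) \<xi> = lam (tv TypeMinus)"
    unfolding lambda_minus_def lam_def diff_Suc_1 by (rule U_char_eqI) (use B in simp)
qed

lemma type_set_covers: "type_set \<nu>' b3 (Suc l) \<xi> t = {\<psi> \<in> Irr P. char_inner U \<psi> (lam (tv t)) \<noteq> 0}"
proof (cases t)
  case Type1
  have "(\<forall>u\<in>U. \<psi> u = \<psi> \<one>\<^bsub>P\<^esub>) \<longleftrightarrow> char_inner U \<psi> (lam (0\<^sub>v (2 * l + 1))) \<noteq> 0" if "\<psi> \<in> Irr P" for \<psi>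
    by (rule N.Irr_trivial_on_U_iff[OF that imageI[OF zero_carrier_vec] lam_zero])
  then show ?thesis unfolding Type1 type_set.simps type_vec_simps by blast
qed (simp_all only: type_set.simps lambda_lam)

lemma type_vec_rts:
  "tv Type0 \<noteq> 0\<^sub>v (2 * l + 1)" "rts l (tv Type0) = 1" "rts l (tv TypePlus) = 2" "rts l (tv TypeMinus) = 0"
proof -
  have "tv Type0 $ (2 * l) = 1" by simp
  then show "tv Type0 \<noteq> 0\<^sub>v (2 * l + 1)" by auto
  show "rts l (tv Type0) = 1" unfolding type_vec_simps by (rule rts_last[OF l])
  show "rts l (tv TypePlus) = 2" unfolding type_vec_simps by (rule rts_center)
  show "rts l (tv TypeMinus) = 0" unfolding type_vec_simps by (rule rts_minus[OF irr l b3 \<nu>' b_similitude[rule_format, OF order_refl]])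
qed

lemma type_set_partition: "\<psi> \<in> Irr P \<Longrightarrow> \<exists>!t. \<psi> \<in> type_set \<nu>' b3 (Suc l) \<xi> t"
  using Irr_covers_exactly_one[OF l type_vec_carrier _ type_vec_rts] unfolding type_set_covers by simp

lemma inertia_complements:
  "Kc (tv Type1) = L_grp (Suc l)" "Kc (tv Type0) = P_tilde (Suc l)" "Kc (tv TypePlus) = L_plus (Suc l)"
  "Kc (tv TypeMinus) = L_minus \<nu> \<nu>' b3 (Suc l)"
  unfolding type_vec_simps
  using Kc_zero Kc_last[OF l] Kc_center[OF l]
    Kc_minus[OF l irreducible_quadratic_discriminant[OF irr] \<nu>' b_mat_GL[OF b3 \<nu>' l] b_similitude[rule_format, OF l]] by blast+

lemma P_carrier_update: "P\<lparr>carrier := K\<rparr> = mat_group (2 * Suc l + 1) K"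
  unfolding P_grp_def by simp

lemma U_mult_L: "U <#>\<^bsub>P\<^esub> L_grp (Suc l) = carrier P"
proof -
  have "conj_char P U p (lam (0\<^sub>v (2 * l + 1))) = lam (0\<^sub>v (2 * l + 1))" if "p \<in> carrier P" for p
    using orbit_lam_zero that unfolding N.orbit_def by blast
  then show ?thesis using stabilizer_lam[OF zero_carrier_vec] unfolding Kc_zero by blast
qed

text \<open>Clifford theory treats the four orbits alike and yields a label on the complement
  \<open>Kc\<close>. For the types + and - this is the prescribed group; type 1 is described by
  inflation instead, and the label of type 0 is transported to the smaller parabolic group.\<close>

lemma character_is_psi:
  assumes \<chi>: "is_character P \<chi>" "constituents P \<chi> \<subseteq> type_set \<nu>' b3 (Suc l) \<xi> t"
  shows "\<exists>\<theta>. is_character (label_grp \<nu> \<nu>' b3 (Suc l) t) \<theta> \<and> \<chi> = psi \<nu> \<nu>' b3 (Suc l) \<xi> t \<theta>"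
proof -
  have cov: "char_inner U \<psi> (lam (tv t)) \<noteq> 0" if "\<psi> \<in> constituents P \<chi>" for \<psi>
    using \<chi>(2) that unfolding type_set_covers by blast
  have Lam: "lam (tv t) \<in> lam ` V" using type_vec_carrier by blast
  have "\<exists>\<theta>. is_character (mat_group (2 * Suc l + 1) (Kc (tv t))) \<theta> \<and> \<chi> = induce_from (Suc l) (Kc (tv t)) (lam (tv t)) \<theta>"
    unfolding induce_from_def P_carrier_update[symmetric]
    by (rule N.character_induced_from_inertia[OF \<chi>(1) cov Lam Kc_subgroup U_inter_Kc stabilizer_lam[OF type_vec_carrier]])
  then obtain \<theta> where \<theta>: "is_character (mat_group (2 * Suc l + 1) (Kc (tv t))) \<theta>"
    "\<chi> = induce_from (Suc l) (Kc (tv t)) (lam (tv t)) \<theta>" by blast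
  show ?thesis
  proof (cases t)
    case Type1
    \<comment> \<open>For type 1 the required description is an inflation, so the label obtained
      from induction is discarded and a new one is produced from the complement
      \<open>L_grp\<close>.\<close>
    note K = Kc_subgroup[of "tv Type1", unfolded inertia_complements] U_inter_Kc[of "tv Type1", unfolded inertia_complements]
    have "\<exists>\<theta>. is_character (P\<lparr>carrier := L_grp (Suc l)\<rparr>) \<theta> \<and> \<chi> = inflated P U (L_grp (Suc l)) \<theta>"
      by (rule N.character_inflated_from_complement[OF \<chi>(1) cov[unfolded Type1 type_vec_simps] imageI[OF zero_carrier_vec] lam_zero
            orbit_lam_zero K U_mult_L])
    then show ?thesis unfolding Type1 label_grp.simps psi.simps P_carrier_update .
  next
    case Type0
    obtain \<mu> where "is_character (P_grp l) \<mu>" "\<theta> = mu_tilde (Suc l) \<mu>"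
      using P_tilde_character[of l \<theta>] \<theta>(1) unfolding Type0 inertia_complements by blast
    then show ?thesis using \<theta>(2) unfolding Type0 label_grp.simps psi.simps inertia_complements lambda_lam diff_Suc_1 by blast
  next
    case TypePlus
    then show ?thesis using \<theta> unfolding TypePlus label_grp.simps psi.simps inertia_complements lambda_lam by blast
  next
    case TypeMinus
    then show ?thesis using \<theta> unfolding TypeMinus label_grp.simps psi.simps inertia_complements lambda_lam by blast
  qed
qed

lemma induce_from_value:
  assumes z: "z \<in> V" and t: "t \<noteq> Type1"
  shows "induce_from (Suc l) (Kc (tv t)) (lam (tv t)) \<theta> (um l z) =
    (orbit_sum l (rts l (tv t)) z - (if rts l (tv t) = 1 then 1 else 0)) * \<theta> (1\<^sub>m (2 * Suc l + 1))"
proof -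
  have u: "um l z \<in> U" using z by (simp add: U_grp_eq)
  have nz: "tv t \<noteq> 0\<^sub>v (2 * l + 1)" using type_vec_rts rts_zero[of l, where ?'a='a] t by (cases t) auto
  have Lam: "lam (tv t) \<in> lam ` V" using type_vec_carrier by blast
  show ?thesis
    unfolding induce_from_def N.induced_value_on_U[OF Lam Kc_subgroup U_inter_Kc stabilizer_lam[OF type_vec_carrier] u]
      orbit_value[OF l type_vec_carrier nz z] P_simps ..
qed

text \<open>On \<open>U\<close> a label enters only through its value at the identity. The formulas
  hold for every function \<open>\<theta>\<close>, so they apply to whatever labels are chosen for
  the parts.\<close>

lemma psi_values:
  assumes z: "z \<in> V"
  shows "psi \<nu> \<nu>' b3 (Suc l) \<xi> Type1 \<theta> (um l z) = \<theta> \<one>\<^bsub>label_grp \<nu> \<nu>' b3 (Suc l) Type1\<^esub>"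
    "psi \<nu> \<nu>' b3 (Suc l) \<xi> Type0 \<theta> (um l z) = (orbit_sum l 1 z - 1) * \<theta> \<one>\<^bsub>label_grp \<nu> \<nu>' b3 (Suc l) Type0\<^esub>"
    "psi \<nu> \<nu>' b3 (Suc l) \<xi> TypePlus \<theta> (um l z) = orbit_sum l 2 z * \<theta> \<one>\<^bsub>label_grp \<nu> \<nu>' b3 (Suc l) TypePlus\<^esub>"
    "psi \<nu> \<nu>' b3 (Suc l) \<xi> TypeMinus \<theta> (um l z) = orbit_sum l 0 z * \<theta> \<one>\<^bsub>label_grp \<nu> \<nu>' b3 (Suc l) TypeMinus\<^esub>"
proof -
  have u: "um l z \<in> U" using z by (simp add: U_grp_eq)
  have K: "subgroup (L_grp (Suc l)) P" "U \<inter> L_grp (Suc l) = {\<one>\<^bsub>P\<^esub>}"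
    using Kc_subgroup[of "tv Type1"] U_inter_Kc[of "tv Type1"] unfolding inertia_complements .
  show "psi \<nu> \<nu>' b3 (Suc l) \<xi> Type1 \<theta> (um l z) = \<theta> \<one>\<^bsub>label_grp \<nu> \<nu>' b3 (Suc l) Type1\<^esub>"
    unfolding psi.simps label_grp.simps mat_group_simps N.inflated_value_on_U[OF K u] P_simps ..
  note val = induce_from_value[OF z]
  show "psi \<nu> \<nu>' b3 (Suc l) \<xi> Type0 \<theta> (um l z) = (orbit_sum l 1 z - 1) * \<theta> \<one>\<^bsub>label_grp \<nu> \<nu>' b3 (Suc l) Type0\<^esub>"
    unfolding psi.simps label_grp.simps lambda_lam inertia_complements(2)[symmetric] val[OF char_type.distinct(1)[symmetric]]
      type_vec_rts mu_tilde_one diff_Suc_1 P_grp_def mat_group_simps by simp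
  show "psi \<nu> \<nu>' b3 (Suc l) \<xi> TypePlus \<theta> (um l z) = orbit_sum l 2 z * \<theta> \<one>\<^bsub>label_grp \<nu> \<nu>' b3 (Suc l) TypePlus\<^esub>"
    unfolding psi.simps label_grp.simps lambda_lam inertia_complements(3)[symmetric] val[OF char_type.distinct(3)[symmetric]]
      type_vec_rts mat_group_simps by simp
  show "psi \<nu> \<nu>' b3 (Suc l) \<xi> TypeMinus \<theta> (um l z) = orbit_sum l 0 z * \<theta> \<one>\<^bsub>label_grp \<nu> \<nu>' b3 (Suc l) TypeMinus\<^esub>"
    unfolding psi.simps label_grp.simps lambda_lam inertia_complements(4)[symmetric] val[OF char_type.distinct(5)[symmetric]]
      type_vec_rts mat_group_simps by simp
qed

end

end

theorem mainTheorem4: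
  fixes \<xi> :: "'a::{field,finite} \<Rightarrow> complex" and \<nu> \<nu>' \<nu>'' :: 'a and b3 :: "'a mat" and m :: nat
  assumes m: "m \<ge> 2"
    and nu: "irreducible [:\<nu>, 1, 1:]"
    and xi: "\<xi> \<in> Irr additive_group" "\<xi> \<noteq> (\<lambda>_. 1)"
    and nu': "\<nu>' \<noteq> 0" "b3 \<in> carrier (GL 3)"
    and b: "\<forall>l\<ge>1. \<forall>v\<in>carrier_vec (2 * l + 1). Q_odd' \<nu> l (b_mat \<nu>' b3 l *\<^sub>v v) = \<nu>' * Q_odd l v"
    and nu'': "\<nu>'' \<noteq> 0" "odd CARD('a) \<longrightarrow> \<not> (\<exists>x. \<nu>'' = x\<^sup>2)" "even CARD('a) \<longrightarrow> \<nu>'' = 1"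
  shows
    "(odd CARD('a) \<longrightarrow> det (value_matrix CARD('a) m) = of_nat CARD('a) ^ (4 * m - 2)) \<and>
     (even CARD('a) \<longrightarrow> det (value_matrix CARD('a) m) = 1 / 2 * of_nat CARD('a) ^ (5 * m - 3)) \<and>
     det (value_matrix CARD('a) m) \<noteq> 0 \<and>
     (\<forall>\<chi>. is_character (P_grp m :: 'a mat monoid) \<chi> \<longrightarrow>
       (let P = P_grp m;
            T = type_set \<nu>' b3 m \<xi>;
            part = (\<lambda>t. constituent_sum P (T t) \<chi>)
        in
          (\<forall>t. is_character P (part t) \<and> constituents P (part t) \<subseteq> T t) \<and>
          \<chi> = (\<lambda>g. part Type1 g + part Type0 g + part TypePlus g + part TypeMinus g) \<and>
          (\<forall>\<phi>. (\<forall>t. is_character P (\<phi> t) \<and> constituents P (\<phi> t) \<subseteq> T t) \<and>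
               \<chi> = (\<lambda>g. \<phi> Type1 g + \<phi> Type0 g + \<phi> TypePlus g + \<phi> TypeMinus g)
               \<longrightarrow> \<phi> = part) \<and>
          (\<forall>t. \<exists>\<theta>. is_character (label_grp \<nu> \<nu>' b3 m t) \<theta> \<and> part t = psi \<nu> \<nu>' b3 m \<xi> t \<theta>) \<and>
          (\<forall>\<theta>. (\<forall>t. is_character (label_grp \<nu> \<nu>' b3 m t) (\<theta> t) \<and>
                    part t = psi \<nu> \<nu>' b3 m \<xi> t (\<theta> t)) \<longrightarrow>
               (\<exists>N. mat_inverse (value_matrix CARD('a) m) = Some N \<and>
                 vec_of_list [\<theta> Type1 \<one>\<^bsub>label_grp \<nu> \<nu>' b3 m Type1\<^esub>,
                              \<theta> Type0 \<one>\<^bsub>label_grp \<nu> \<nu>' b3 m Type0\<^esub>,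
                              \<theta> TypePlus \<one>\<^bsub>label_grp \<nu> \<nu>' b3 m TypePlus\<^esub>,
                              \<theta> TypeMinus \<one>\<^bsub>label_grp \<nu> \<nu>' b3 m TypeMinus\<^esub>]
                 = N *\<^sub>v vec_of_list [\<chi> \<one>\<^bsub>P\<^esub>, \<chi> (z_zero m), \<chi> (z_one m), \<chi> (z_two \<nu>'' m)]))))"
proof -
  let ?M = "value_matrix CARD('a) m"
  \<comment> \<open>From m at least 2 the Levi factor has rank \<open>Suc k\<close>, at least 1, as
    the reduction to normal forms requires.\<close>
  obtain k where m': "m = Suc (Suc k)" using that[of "m - 2"] m by simp
  have od: "odd CARD('a) \<longrightarrow> det ?M = of_nat CARD('a) ^ (4 * m - 2)"
    unfolding value_matrix_def using det_M_odd[of m] m by simp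
  have ev: "even CARD('a) \<longrightarrow> det ?M = 1 / 2 * of_nat CARD('a) ^ (5 * m - 3)"
    unfolding value_matrix_def using det_M_even[of m] m by simp
  have nz: "det ?M \<noteq> 0" 
  proof (cases "odd CARD('a)")
    case True
    then show ?thesis using od by simp
  next
    case False
    then have d: "det ?M = 1 / 2 * of_nat CARD('a) ^ (5 * m - 3)" using ev by blast
    show ?thesis unfolding d by simp
  qed
  interpret parabolic \<xi> "Suc k" by (intro parabolic.intro Irr_additive_group[OF xi])
  have l: "Suc k \<ge> 1" by simp
  note ctx = l nu nu' b
  let ?T = "type_set \<nu>' b3 m \<xi>"
  have T: "?T t \<subseteq> Irr P" for t unfolding m' by (cases t) auto
  have T1: "\<exists>!t. \<psi> \<in> ?T t" if "\<psi> \<in> Irr P" for \<psi> unfolding m' by (rule type_set_partition[OF ctx that])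
  \<comment> \<open>The vectors of the four test elements, the identity included, in the order of
    the rows of the matrix.\<close>
  define z where "z = [0\<^sub>v (2 * Suc k + 1), brd 1 (0\<^sub>v (2 * k + 1)) 0, unit_vec (2 * Suc k + 1) (Suc k), brd 1 (0\<^sub>v (2 * k + 1)) \<nu>'']"
  have zV: "0\<^sub>v (2 * Suc k + 1) \<in> V" "brd 1 (0\<^sub>v (2 * k + 1)) \<beta> \<in> V" "unit_vec (2 * Suc k + 1) (Suc k) \<in> V" for \<beta>
    by (rule zero_carrier_vec brd_carrier[OF zero_carrier_vec] unit_vec_carrier)+
  have e: "brd 1 (0\<^sub>v (2 * k + 1)) 0 + \<nu>'' \<cdot>\<^sub>v unit_vec (2 * Suc k + 1) (2 * Suc k) = brd 1 (0\<^sub>v (2 * k + 1)) \<nu>''"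
    by (intro eq_vecI) (auto simp: brd_def)
  have zs: "\<one>\<^bsub>P\<^esub> = um (Suc k) (0\<^sub>v (2 * Suc k + 1))" "z_zero m = um (Suc k) (brd 1 (0\<^sub>v (2 * k + 1)) 0)"
    "z_one m = um (Suc k) (unit_vec (2 * Suc k + 1) (Suc k))" "z_two \<nu>'' m = um (Suc k) (brd 1 (0\<^sub>v (2 * k + 1)) \<nu>'')"
    unfolding P_simps um_zero z_zero_def z_one_def z_two_def m' diff_Suc_1 unit_vec_brd e by (rule refl)+
  have "let P = P_grp m; T = ?T; part = (\<lambda>t. constituent_sum P (T t) \<chi>) in
          (\<forall>t. is_character P (part t) \<and> constituents P (part t) \<subseteq> T t) \<and>
          \<chi> = (\<lambda>g. part Type1 g + part Type0 g + part TypePlus g + part TypeMinus g) \<and>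
          (\<forall>\<phi>. (\<forall>t. is_character P (\<phi> t) \<and> constituents P (\<phi> t) \<subseteq> T t) \<and>
               \<chi> = (\<lambda>g. \<phi> Type1 g + \<phi> Type0 g + \<phi> TypePlus g + \<phi> TypeMinus g)
               \<longrightarrow> \<phi> = part) \<and>
          (\<forall>t. \<exists>\<theta>. is_character (label_grp \<nu> \<nu>' b3 m t) \<theta> \<and> part t = psi \<nu> \<nu>' b3 m \<xi> t \<theta>) \<and>
          (\<forall>\<theta>. (\<forall>t. is_character (label_grp \<nu> \<nu>' b3 m t) (\<theta> t) \<and>
                    part t = psi \<nu> \<nu>' b3 m \<xi> t (\<theta> t)) \<longrightarrow>
               (\<exists>N. mat_inverse ?M = Some N \<and>
                 vec_of_list [\<theta> Type1 \<one>\<^bsub>label_grp \<nu> \<nu>' b3 m Type1\<^esub>,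
                              \<theta> Type0 \<one>\<^bsub>label_grp \<nu> \<nu>' b3 m Type0\<^esub>,
                              \<theta> TypePlus \<one>\<^bsub>label_grp \<nu> \<nu>' b3 m TypePlus\<^esub>,
                              \<theta> TypeMinus \<one>\<^bsub>label_grp \<nu> \<nu>' b3 m TypeMinus\<^esub>]
                 = N *\<^sub>v vec_of_list [\<chi> \<one>\<^bsub>P\<^esub>, \<chi> (z_zero m), \<chi> (z_one m), \<chi> (z_two \<nu>'' m)]))"
    if \<chi>: "is_character (P_grp m) \<chi>" for \<chi>
    unfolding Let_def
  proof (intro conjI allI impI)
    let ?part = "\<lambda>t. constituent_sum P (?T t) \<chi>"
    have Pm: "P_grp m = P" unfolding m' ..
    note parts = N.character_parts[OF T T1 \<chi>[unfolded Pm]]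
    fix t
    show c: "is_character (P_grp m) (constituent_sum (P_grp m) (?T t) \<chi>)" unfolding Pm by (rule parts)
    show s: "constituents (P_grp m) (constituent_sum (P_grp m) (?T t) \<chi>) \<subseteq> ?T t" unfolding Pm by (rule parts)
    show "\<exists>\<theta>. is_character (label_grp \<nu> \<nu>' b3 m t) \<theta> \<and> constituent_sum (P_grp m) (?T t) \<chi> = psi \<nu> \<nu>' b3 m \<xi> t \<theta>"
      using character_is_psi[OF ctx] c s unfolding m' by blast
    show sum: "\<chi> = (\<lambda>g. constituent_sum (P_grp m) (?T Type1) \<chi> g + constituent_sum (P_grp m) (?T Type0) \<chi> g
        + constituent_sum (P_grp m) (?T TypePlus) \<chi> g + constituent_sum (P_grp m) (?T TypeMinus) \<chi> g)"
      unfolding Pm by (rule parts(3))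
    show "\<phi> = (\<lambda>t. constituent_sum (P_grp m) (?T t) \<chi>)"
      if "(\<forall>t. is_character (P_grp m) (\<phi> t) \<and> constituents (P_grp m) (\<phi> t) \<subseteq> ?T t) \<and>
        \<chi> = (\<lambda>g. \<phi> Type1 g + \<phi> Type0 g + \<phi> TypePlus g + \<phi> TypeMinus g)" for \<phi>
      using parts(4)[of \<phi>] that unfolding Pm by blast
    fix \<theta>
    assume \<theta>: "\<forall>t. is_character (label_grp \<nu> \<nu>' b3 m t) (\<theta> t) \<and> constituent_sum (P_grp m) (?T t) \<chi> = psi \<nu> \<nu>' b3 m \<xi> t (\<theta> t)"
    then have pt: "constituent_sum (P_grp m) (?T t) \<chi> = psi \<nu> \<nu>' b3 m \<xi> t (\<theta> t)" for t by blast
    \<comment> \<open>On \<open>U\<close> the character is a linear combination of the four degrees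
      whose coefficients, the orbit sums, do not depend on \<open>\<chi>\<close>.\<close>
    have val: "\<chi> (um (Suc k) v) = 1 * \<theta> Type1 \<one>\<^bsub>label_grp \<nu> \<nu>' b3 m Type1\<^esub> + (orbit_sum (Suc k) 1 v - 1) * \<theta> Type0 \<one>\<^bsub>label_grp \<nu> \<nu>' b3 m Type0\<^esub>
      + orbit_sum (Suc k) 2 v * \<theta> TypePlus \<one>\<^bsub>label_grp \<nu> \<nu>' b3 m TypePlus\<^esub>
      + orbit_sum (Suc k) 0 v * \<theta> TypeMinus \<one>\<^bsub>label_grp \<nu> \<nu>' b3 m TypeMinus\<^esub>" if v: "v \<in> V" for v
      using fun_cong[OF sum, of "um (Suc k) v"] unfolding pt unfolding m' psi_values[OF ctx v] by (simp only: mult_1)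
    let ?\<theta> = "vec_of_list [\<theta> Type1 \<one>\<^bsub>label_grp \<nu> \<nu>' b3 m Type1\<^esub>, \<theta> Type0 \<one>\<^bsub>label_grp \<nu> \<nu>' b3 m Type0\<^esub>,
      \<theta> TypePlus \<one>\<^bsub>label_grp \<nu> \<nu>' b3 m TypePlus\<^esub>, \<theta> TypeMinus \<one>\<^bsub>label_grp \<nu> \<nu>' b3 m TypeMinus\<^esub>]"
    have M: "?M = mat_of_rows_list 4 (map (\<lambda>z. [1, orbit_sum (Suc k) 1 z - 1, orbit_sum (Suc k) 2 z, orbit_sum (Suc k) 0 z]) z)"
      unfolding m' value_matrix_orbit_sums[OF nu''(1,2)] z_def list.map ..
    have Mc: "?M \<in> carrier_mat 4 4" unfolding M z_def by (rule carrier_matI) (simp_all add: mat_of_rows_list_def)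
    \<comment> \<open>Evaluating at the four test elements gives the linear system of which the
      claim is the solution.\<close>
    have "?M *\<^sub>v ?\<theta> = vec_of_list [\<chi> \<one>\<^bsub>P_grp m\<^esub>, \<chi> (z_zero m), \<chi> (z_one m), \<chi> (z_two \<nu>'' m)]"
      unfolding M z_def list.map rows_4_mult_vec Pm zs val[OF zV(1)] val[OF zV(2)] val[OF zV(3)] ..
    moreover have "mat_inverse ?M \<noteq> None"
      using mat_inverse(1)[OF Mc, where b = "()"] det_non_zero_imp_unit[OF Mc nz, where b = "()"] by blast
    then obtain N where N: "mat_inverse ?M = Some N" by blast
    moreover have "N *\<^sub>v (?M *\<^sub>v ?\<theta>) = ?\<theta>"
    proof -
      have N': "N * ?M = 1\<^sub>m 4" "N \<in> carrier_mat 4 4" using mat_inverse(2)[OF Mc N] by blast+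
      have \<theta>c: "?\<theta> \<in> carrier_vec 4" by (rule carrier_vecI) simp
      show ?thesis using assoc_mult_mat_vec[OF N'(2) Mc \<theta>c] one_mult_mat_vec[OF \<theta>c] unfolding N'(1) by simp
    qed
    ultimately show "\<exists>N. mat_inverse ?M = Some N \<and> ?\<theta> = N *\<^sub>v vec_of_list [\<chi> \<one>\<^bsub>P_grp m\<^esub>, \<chi> (z_zero m), \<chi> (z_one m), \<chi> (z_two \<nu>'' m)]"
      using N by metis
  qed
  then show ?thesis using od ev nz by blast
qed

end
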